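(* The category $\mathcal{C}$ of bounded below cochain complexes over $\mathcal{A}$, with morphism groups $Hom^r(C_\bullet,K_\bullet)$, $r\in\mathbb{R}$, the maps $i_{r,s}$, the functors $\Sigma^r$, the morphisms $id_{C_\bullet}^{r,s}$ and the translation functor $T$, is a triangulated persistence category.
   Context: Bounded symplectic correspondences. Manifolds are smooth without boundary. For symplectic manifolds $Y,X$ and $n\ge0$, $SCor_n(Y,X)$ is the set of global sections over $Y$ of the sheafification of the presheaf sending open $U\subset Y$ to unordered $n$-tuples $\{f_1,\dots,f_n\}$ of smooth maps $U\to X$ with $\sum_i f_i^*\omega_X=\omega_Y|_U$ (tuples identified if they agree pointwise as unordered tuples with multiplicity); $SCor_n^0(Y,X)$ (isotropic correspondences) is the same with $\sum_i f_i^*\omega_X=0$; $F+G$ is local concatenation. $SCor(Y,X)$ is the set of global sections over $Y$ of the sheafification of $U\mapsto(\coprod_{n\ge0}SCor_n(U,X))/\!\sim$, with $\sim$ the equivalence relation generated by $F\sim F+G$, $G$ isotropic. So near each $y$ an element is given by some number $n(y)$ of maps modulo isotropic correspondences. For $r\in\mathbb{R}$, $SCor_b(Y,X;r)$ is the set of elements that can be so represented with $n(y)\le e^r$ for all $y$; $SCor_b(Y,X)=\bigcup_rSCor_b(Y,X;r)$; $SC_b(Y,X;r)=\mathbb{Z}[SCor_b(Y,X;r)]$ and $SC_b(Y,X)=\mathbb{Z}[SCor_b(Y,X)]$ are free abelian groups. Composition: if $F|_U=\{f_i\}$ and $G|_{V_i}=\{g_{i,j}\}_j$ with $f_i(U)\subset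 V_i$, then $(G\circ F)|_U=\{g_{i,j}\circ f_i\}_{i,j}$, extended bilinearly; it maps $SC_b(Y,X;r)\times SC_b(Z,Y;s)$ to $SC_b(Z,X;r+s)$. The category $\mathcal{A}$. Objects: formal finite sums $\bigoplus_{i=1}^n(Z_i,r_i)$ with $Z_i$ connected symplectic manifolds, $r_i\in\mathbb{R}$, and the empty sum $\emptyset$ (zero object). Morphisms $\bigoplus_i(Z_i,r_i)\to\bigoplus_j(Z_j',r_j')$: matrices with entries $F_{i,j}\in SC_b(Z_i,Z_j')$, added entrywise, composed by matrix multiplication $(G\circ F)_{i,j}=\sum_\ell G_{\ell,j}\circ F_{i,\ell}$; morphisms to and from $\emptyset$ are $0$. Filtration: $SC_b(\bigoplus_i(Z_i,r_i),\bigoplus_j(Z_j',r_j');k)=\bigoplus_{i,j}SC_b(Z_i,Z_j';k+r_i-r_j')$. The functor $\Sigma^s:\mathcal{A}\to\mathcal{A}$ sends $\bigoplus(Y_i,r_i)$ to $\bigoplus(Y_i,r_i+s)$ and is the identity on morphisms. The category $\mathcal{C}$. Objects: bounded below cochain complexes $(C_\bullet,d_C)$ in $\mathcal{A}$. $Hom^r(C_\bullet,K_\bullet)$ = chain maps with components $F_n\in SC_b(C_n,K_n;r)$ modulo chain homotopies with components $H_n\in SC_b(C_n,K_{n-1};r)$. For $r\le s$, $i_{r,s}:Hom^r(C_\bullet,K_\bullet)\to Hom^s(C_\bullet,K_\bullet)$ is the natural map. $Mor_{\mathcal{C}}(C_\bullet,K_\bullet)=\coprod_rHom^r(C_\bullet,K_\bullet)$,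 with composition $Hom^r\times Hom^s\to Hom^{r+s}$. $\mathcal{C}_0$ has the same objects and morphisms $Hom^0$. $T(C_\bullet,d_C)=(C_{\bullet+1},-d_C)$, $T(F)_n=F_{n+1}$. $\Sigma^r$ acts on complexes degreewise and is the identity on morphisms. $id^{r,s}_{C_\bullet}:\Sigma^rC_\bullet\to\Sigma^sC_\bullet$ is the element of $Hom^{s-r}(\Sigma^rC_\bullet,\Sigma^sC_\bullet)$ given by the identities of the underlying objects. Triangles in $\mathcal{C}_0$: for a chain map $F:C_\bullet\to K_\bullet$, $Cone(F)=T(C_\bullet)\oplus K_\bullet$ with differential $\begin{pmatrix} -d_C & 0 \\ F & d_K \end{pmatrix}$; exact triangles are those isomorphic to the standard cone triangles $C_\bullet\to K_\bullet\to Cone(F)\to TC_\bullet$. Triangulated persistence category (Biran–Cornea–Zhang). A persistence category is a category whose morphisms form families $Hom^r(A,B)$, $r\in\mathbb{R}$, of abelian groups with homomorphisms $i_{r,s}:Hom^r\to Hom^s$ for $r\le s$ ($i_{r,r}=id$, $i_{s,t}i_{r,s}=i_{r,t}$), with bilinear associative composition $Hom^r(B,D)\times Hom^s(A,B)\to Hom^{r+s}(A,D)$ satisfying $i_{r,r'}(f)\circ i_{s,s'}(g)=i_{r+s,r'+s'}(f\circ g)$, and identities in $Hom^0$. A shift functor is a family of endofunctors $\Sigma^r$, $r\in\mathbb{R}$, preserving levels and commuting with all $i_{r,s}$, with $\Sigma^r\Sigma^s=\Sigma^{r+s}$, $\Sigma^0=id$, together with natural isomorphisms $\eta_{r,s}:\Sigma^r\to\Sigma^s$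 whose components lie in $Hom^{s-r}(\Sigma^rA,\Sigma^sA)$, with $\eta_{r',s}\eta_{r,r'}=\eta_{r,s}$, $\eta_{r,r}=id$ and $\Sigma^t\eta_{r,s}=\eta_{r+t,s+t}$. An object $K$ is $r$-acyclic ($r\ge0$) if $i_{0,r}(id_K)=0$ in $Hom^r(K,K)$. A triangulated persistence category is a persistence category with shift functor such that: (i) the category with the same objects and morphisms $Hom^0$ is triangulated, with translation functor $T$; (ii) each $\Sigma^r$ restricts to a triangulated endofunctor of it; (iii) for each $r\ge0$ and object $A$, the morphism $i_{-r,0}(\eta_{r,0}):\Sigma^rA\to A$ fits in an exact triangle $\Sigma^rA\to A\to K\to T\Sigma^rA$ with $K$ $r$-acyclic. Here $\eta_{r,s}=id^{r,s}$. *)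

theory Defs
  imports
    "HOL-Analysis.Analysis"
    "HOL-Algebra.Free_Abelian_Groups"
    "HOL-Library.Multiset"
begin

section \<open>Smooth functions of several real variables\<close>

text \<open>
  Points of \<open>\<real>\<^sup>n\<close> are the elements of \<^const>\<open>Euclidean_space\<close> \<open>n\<close>, that is, functions
  \<open>nat \<Rightarrow> real\<close> vanishing from \<open>n\<close> on, so that the dimension is an ordinary natural number.
\<close>

definition pderiv_at :: "nat \<Rightarrow> ((nat \<Rightarrow> real) \<Rightarrow> real) \<Rightarrow> (nat \<Rightarrow> real) \<Rightarrow> real" where
  "pderiv_at i f x = deriv (\<lambda>t. f (x(i := t))) (x i)"

primrec Ck_on :: "nat \<Rightarrow> nat \<Rightarrow> (nat \<Rightarrow> real) set \<Rightarrow> ((nat \<Rightarrow> real) \<Rightarrow> real) \<Rightarrow> bool" where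
  "Ck_on n 0 U f \<longleftrightarrow> continuous_map (subtopology (Euclidean_space n) U) euclideanreal f"
| "Ck_on n (Suc k) U f \<longleftrightarrow>
     continuous_map (subtopology (Euclidean_space n) U) euclideanreal f \<and>
     (\<forall>i<n. (\<forall>x\<in>U. (\<lambda>t. f (x(i := t))) field_differentiable at (x i)) \<and>
            Ck_on n k U (pderiv_at i f))"

definition smooth_on :: "nat \<Rightarrow> (nat \<Rightarrow> real) set \<Rightarrow> ((nat \<Rightarrow> real) \<Rightarrow> real) \<Rightarrow> bool" where
  "smooth_on n U f \<longleftrightarrow> (\<forall>k. Ck_on n k U f)"

definition smooth_vec_on ::
    "nat \<Rightarrow> nat \<Rightarrow> (nat \<Rightarrow> real) set \<Rightarrow> ((nat \<Rightarrow> real) \<Rightarrow> (nat \<Rightarrow> real)) \<Rightarrow> bool" where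
  "smooth_vec_on n m U f \<longleftrightarrow> (\<forall>j<m. smooth_on n U (\<lambda>x. f x j))"


section \<open>Symplectic manifolds\<close>

text \<open>A chart is a pair of its domain and its coordinate map.\<close>

type_synonym 'a chart = "'a set \<times> ('a \<Rightarrow> nat \<Rightarrow> real)"

text \<open>Tangent vectors are derivations of germs of smooth functions.\<close>

type_synonym 'a tvec = "('a \<Rightarrow> real) \<Rightarrow> real"

type_synonym 'a biform = "'a \<Rightarrow> 'a tvec \<Rightarrow> 'a tvec \<Rightarrow> real"

record 'a mfd =
  Mtop :: "'a topology"
  Mdim :: nat
  Matlas :: "'a chart set"
  Mform :: "'a biform"

abbreviation Mcarrier :: "'a mfd \<Rightarrow> 'a set" where
  "Mcarrier M \<equiv> topspace (Mtop M)"

abbreviation chart_inv :: "'a chart \<Rightarrow> (nat \<Rightarrow> real) \<Rightarrow> 'a" where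
  "chart_inv c \<equiv> inv_into (fst c) (snd c)"

definition is_chart :: "'a topology \<Rightarrow> nat \<Rightarrow> 'a chart \<Rightarrow> bool" where
  "is_chart X n c \<longleftrightarrow>
     openin X (fst c) \<and> snd c \<in> extensional (fst c) \<and>
     openin (Euclidean_space n) (snd c ` fst c) \<and>
     homeomorphic_map (subtopology X (fst c)) (subtopology (Euclidean_space n) (snd c ` fst c)) (snd c)"

definition smooth_transition :: "nat \<Rightarrow> 'a chart \<Rightarrow> 'a chart \<Rightarrow> bool" where
  "smooth_transition n c c' \<longleftrightarrow>
     smooth_vec_on n n (snd c ` (fst c \<inter> fst c')) (\<lambda>x. snd c' (chart_inv c x))"

definition compatible_charts :: "nat \<Rightarrow> 'a chart \<Rightarrow> 'a chart \<Rightarrow> bool" where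
  "compatible_charts n c c' \<longleftrightarrow> smooth_transition n c c' \<and> smooth_transition n c' c"

text \<open>The smooth structure is a maximal atlas.\<close>

definition smooth_manifold :: "'a mfd \<Rightarrow> bool" where
  "smooth_manifold M \<longleftrightarrow>
     Hausdorff_space (Mtop M) \<and> second_countable (Mtop M) \<and>
     (\<forall>c\<in>Matlas M. is_chart (Mtop M) (Mdim M) c) \<and>
     (\<Union>c\<in>Matlas M. fst c) = Mcarrier M \<and>
     (\<forall>c\<in>Matlas M. \<forall>c'\<in>Matlas M. compatible_charts (Mdim M) c c') \<and>
     (\<forall>c. is_chart (Mtop M) (Mdim M) c \<and> (\<forall>c'\<in>Matlas M. compatible_charts (Mdim M) c c')
          \<longrightarrow> c \<in> Matlas M)"

text \<open>Smoothness of a map defined on an open subset \<open>U\<close> of \<open>M\<close>; values outside \<open>U\<close> are irrelevant.\<close>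

definition smooth_map :: "'a mfd \<Rightarrow> 'b mfd \<Rightarrow> 'a set \<Rightarrow> ('a \<Rightarrow> 'b) \<Rightarrow> bool" where
  "smooth_map M N U f \<longleftrightarrow>
     openin (Mtop M) U \<and> f ` U \<subseteq> Mcarrier N \<and>
     (\<forall>p\<in>U. \<exists>c\<in>Matlas M. \<exists>c'\<in>Matlas N.
        p \<in> fst c \<and> fst c \<subseteq> U \<and> f ` fst c \<subseteq> fst c' \<and>
        smooth_vec_on (Mdim M) (Mdim N) (snd c ` fst c) (\<lambda>x. snd c' (f (chart_inv c x))))"

definition smooth_fun :: "'a mfd \<Rightarrow> 'a set \<Rightarrow> ('a \<Rightarrow> real) \<Rightarrow> bool" where
  "smooth_fun M U h \<longleftrightarrow>
     openin (Mtop M) U \<and>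
     (\<forall>p\<in>U. \<exists>c\<in>Matlas M. p \<in> fst c \<and> fst c \<subseteq> U \<and>
        smooth_on (Mdim M) (snd c ` fst c) (\<lambda>x. h (chart_inv c x)))"

definition smooth_near :: "'a mfd \<Rightarrow> 'a \<Rightarrow> ('a \<Rightarrow> real) \<Rightarrow> bool" where
  "smooth_near M p h \<longleftrightarrow> (\<exists>U. p \<in> U \<and> smooth_fun M U h)"

text \<open>
  Derivations at \<open>p\<close>: functionals depending only on germs at \<open>p\<close>, normalised to \<open>0\<close> on functions
  that are not smooth near \<open>p\<close>.
\<close>

definition tangent_space :: "'a mfd \<Rightarrow> 'a \<Rightarrow> 'a tvec set" where
  "tangent_space M p = {v.
     (\<forall>h. \<not> smooth_near M p h \<longrightarrow> v h = 0) \<and>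
     (\<forall>h h' U. smooth_near M p h \<and> openin (Mtop M) U \<and> p \<in> U \<and> (\<forall>q\<in>U. h q = h' q)
        \<longrightarrow> v h = v h') \<and>
     (\<forall>h h'. smooth_near M p h \<and> smooth_near M p h' \<longrightarrow>
        v (\<lambda>q. h q + h' q) = v h + v h' \<and>
        v (\<lambda>q. h q * h' q) = h p * v h' + h' p * v h) \<and>
     (\<forall>a h. smooth_near M p h \<longrightarrow> v (\<lambda>q. a * h q) = a * v h)}"

definition pushforward :: "'a mfd \<Rightarrow> 'b mfd \<Rightarrow> ('a \<Rightarrow> 'b) \<Rightarrow> 'a \<Rightarrow> 'a tvec \<Rightarrow> 'b tvec" where
  "pushforward M N f p v = (\<lambda>h. if smooth_near N (f p) h then v (h \<circ> f) else 0)"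

definition pullback :: "'a mfd \<Rightarrow> 'b mfd \<Rightarrow> ('a \<Rightarrow> 'b) \<Rightarrow> 'b biform \<Rightarrow> 'a biform" where
  "pullback M N f \<omega> = (\<lambda>p v w. \<omega> (f p) (pushforward M N f p v) (pushforward M N f p w))"

definition coord_vec :: "'a mfd \<Rightarrow> 'a chart \<Rightarrow> nat \<Rightarrow> 'a \<Rightarrow> 'a tvec" where
  "coord_vec M c i p =
     (\<lambda>h. if smooth_near M p h then pderiv_at i (\<lambda>x. h (chart_inv c x)) (snd c p) else 0)"

definition coord_form :: "'a mfd \<Rightarrow> 'a chart \<Rightarrow> 'a biform \<Rightarrow> nat \<Rightarrow> nat \<Rightarrow> (nat \<Rightarrow> real) \<Rightarrow> real" where
  "coord_form M c \<omega> i j =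
     (\<lambda>x. \<omega> (chart_inv c x) (coord_vec M c i (chart_inv c x)) (coord_vec M c j (chart_inv c x)))"

definition two_form :: "'a mfd \<Rightarrow> 'a biform \<Rightarrow> bool" where
  "two_form M \<omega> \<longleftrightarrow>
     (\<forall>p v w. \<not> (p \<in> Mcarrier M \<and> v \<in> tangent_space M p \<and> w \<in> tangent_space M p)
        \<longrightarrow> \<omega> p v w = 0) \<and>
     (\<forall>p\<in>Mcarrier M. \<forall>v\<in>tangent_space M p. \<omega> p v v = 0 \<and>
        (\<forall>w\<in>tangent_space M p. \<omega> p v w = - \<omega> p w v \<and>
           (\<forall>a. \<omega> p (\<lambda>h. a * v h) w = a * \<omega> p v w) \<and>
           (\<forall>v'\<in>tangent_space M p. \<omega> p (\<lambda>h. v h + v' h) w = \<omega> p v w + \<omega> p v' w))) \<and>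
     (\<forall>c\<in>Matlas M. \<forall>i<Mdim M. \<forall>j<Mdim M.
        smooth_on (Mdim M) (snd c ` fst c) (coord_form M c \<omega> i j))"

text \<open>The three-term sum is the coordinate expression of \<open>d\<omega>\<close>.\<close>

definition closed_form :: "'a mfd \<Rightarrow> 'a biform \<Rightarrow> bool" where
  "closed_form M \<omega> \<longleftrightarrow>
     (\<forall>c\<in>Matlas M. \<forall>x \<in> snd c ` fst c. \<forall>i<Mdim M. \<forall>j<Mdim M. \<forall>k<Mdim M.
        pderiv_at i (coord_form M c \<omega> j k) x + pderiv_at j (coord_form M c \<omega> k i) x
        + pderiv_at k (coord_form M c \<omega> i j) x = 0)"

definition nondegenerate :: "'a mfd \<Rightarrow> 'a biform \<Rightarrow> bool" where
  "nondegenerate M \<omega> \<longleftrightarrow>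
     (\<forall>p\<in>Mcarrier M. \<forall>v\<in>tangent_space M p.
        (\<forall>w\<in>tangent_space M p. \<omega> p v w = 0) \<longrightarrow> v = (\<lambda>_. 0))"

definition symplectic_manifold :: "'a mfd \<Rightarrow> bool" where
  "symplectic_manifold M \<longleftrightarrow>
     smooth_manifold M \<and> two_form M (Mform M) \<and> closed_form M (Mform M) \<and> nondegenerate M (Mform M)"

text \<open>Connected spaces are understood to be nonempty.\<close>

definition connected_symplectic :: "'a mfd \<Rightarrow> bool" where
  "connected_symplectic M \<longleftrightarrow>
     symplectic_manifold M \<and> connected_space (Mtop M) \<and> Mcarrier M \<noteq> {}"


section \<open>Sheafification of a presheaf of sets\<close>

record ('y, 's) presheaf =
  Sect :: "'y set \<Rightarrow> 's set"
  Restr :: "'y set \<Rightarrow> 'y set \<Rightarrow> 's \<Rightarrow> 's" \<comment> \<open>\<open>Restr P U V\<close> restricts sections from \<open>U\<close> to \<open>V \<subseteq> U\<close>\<close>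

definition germ :: "'y topology \<Rightarrow> ('y, 's) presheaf \<Rightarrow> 'y \<Rightarrow> 'y set \<Rightarrow> 's \<Rightarrow> ('y set \<times> 's) set" where
  "germ X P y U s =
     {(V, t). openin X V \<and> y \<in> V \<and> t \<in> Sect P V \<and>
        (\<exists>W. openin X W \<and> y \<in> W \<and> W \<subseteq> U \<inter> V \<and> Restr P U W s = Restr P V W t)}"

definition sheafify ::
    "'y topology \<Rightarrow> ('y, 's) presheaf \<Rightarrow> ('y, 'y \<Rightarrow> ('y set \<times> 's) set) presheaf" where
  "sheafify X P =
     \<lparr>Sect = (\<lambda>U. {\<sigma> \<in> extensional U.
        \<forall>y\<in>U. \<exists>V s. openin X V \<and> y \<in> V \<and> V \<subseteq> U \<and> s \<in> Sect P V \<and> (\<forall>z\<in>V. \<sigma> z = germ X P z V s)}),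
      Restr = (\<lambda>U V \<sigma>. restrict \<sigma> V)\<rparr>"


section \<open>Symplectic correspondences\<close>

text \<open>
  The unordered tuple \<open>{f\<^sub>1,\<dots>,f\<^sub>n}\<close> on \<open>U\<close>, with tuples identified when they agree pointwise as
  unordered tuples with multiplicity, is encoded as the multiset-valued function \<open>tuple_fun U fs\<close>.
\<close>

definition tuple_fun :: "'a set \<Rightarrow> ('a \<Rightarrow> 'a) list \<Rightarrow> 'a \<Rightarrow> 'a multiset" where
  "tuple_fun U fs = (\<lambda>y\<in>U. mset (map (\<lambda>f. f y) fs))"

definition local_tuple ::
    "'a mfd \<Rightarrow> 'a mfd \<Rightarrow> 'a biform \<Rightarrow> 'a set \<Rightarrow> ('a \<Rightarrow> 'a) list \<Rightarrow> bool" where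
  "local_tuple Y X \<alpha> U fs \<longleftrightarrow>
     openin (Mtop Y) U \<and> (\<forall>f\<in>set fs. smooth_map Y X U f) \<and>
     (\<forall>p\<in>U. \<forall>v\<in>tangent_space Y p. \<forall>w\<in>tangent_space Y p.
        (\<Sum>f\<leftarrow>fs. pullback Y X f (Mform X) p v w) = \<alpha> p v w)"

definition tuple_presheaf ::
    "'a mfd \<Rightarrow> 'a mfd \<Rightarrow> 'a biform \<Rightarrow> nat \<Rightarrow> ('a, 'a \<Rightarrow> 'a multiset) presheaf" where
  "tuple_presheaf Y X \<alpha> n =
     \<lparr>Sect = (\<lambda>U. {tuple_fun U fs | fs. length fs = n \<and> local_tuple Y X \<alpha> U fs}),
      Restr = (\<lambda>U V \<phi>. restrict \<phi> V)\<rparr>"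

type_synonym 'a cor_n = "'a \<Rightarrow> ('a set \<times> ('a \<Rightarrow> 'a multiset)) set"

text \<open>
  Sections over \<open>U \<subseteq> Y\<close>: for \<open>\<alpha> = \<omega>\<^sub>Y\<close> these are the symplectic correspondences with \<open>n\<close> branches,
  for \<open>\<alpha> = 0\<close> the isotropic ones.
\<close>

definition tuple_sections ::
    "'a mfd \<Rightarrow> 'a mfd \<Rightarrow> 'a biform \<Rightarrow> nat \<Rightarrow> 'a set \<Rightarrow> 'a cor_n set" where
  "tuple_sections Y X \<alpha> n U = Sect (sheafify (Mtop Y) (tuple_presheaf Y X \<alpha> n)) U"

definition SCor_n :: "'a mfd \<Rightarrow> 'a mfd \<Rightarrow> nat \<Rightarrow> 'a set \<Rightarrow> 'a cor_n set" where
  "SCor_n Y X n U = tuple_sections Y X (Mform Y) n U"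

definition SCor_n_iso :: "'a mfd \<Rightarrow> 'a mfd \<Rightarrow> nat \<Rightarrow> 'a set \<Rightarrow> 'a cor_n set" where
  "SCor_n_iso Y X n U = tuple_sections Y X (\<lambda>_ _ _. 0) n U"

definition tuple_section ::
    "'a mfd \<Rightarrow> 'a mfd \<Rightarrow> 'a biform \<Rightarrow> 'a set \<Rightarrow> ('a \<Rightarrow> 'a) list \<Rightarrow> 'a cor_n" where
  "tuple_section Y X \<alpha> U fs =
     (\<lambda>y\<in>U. germ (Mtop Y) (tuple_presheaf Y X \<alpha> (length fs)) y U (tuple_fun U fs))"

definition restricts_to_tuple ::
    "'a mfd \<Rightarrow> 'a mfd \<Rightarrow> 'a biform \<Rightarrow> 'a cor_n \<Rightarrow> 'a set \<Rightarrow> ('a \<Rightarrow> 'a) list \<Rightarrow> bool" where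
  "restricts_to_tuple Y X \<alpha> F U fs \<longleftrightarrow>
     local_tuple Y X \<alpha> U fs \<and> restrict F U = tuple_section Y X \<alpha> U fs"

text \<open>\<open>H = F + G\<close> over \<open>U\<close>, where \<open>G\<close> is isotropic.\<close>

definition is_concat :: "'a mfd \<Rightarrow> 'a mfd \<Rightarrow> 'a set \<Rightarrow> 'a cor_n \<Rightarrow> 'a cor_n \<Rightarrow> 'a cor_n \<Rightarrow> bool" where
  "is_concat Y X U F G H \<longleftrightarrow>
     (\<forall>y\<in>U. \<exists>W fs gs. y \<in> W \<and> W \<subseteq> U \<and>
        restricts_to_tuple Y X (Mform Y) F W fs \<and>
        restricts_to_tuple Y X (\<lambda>_ _ _. 0) G W gs \<and>
        restricts_to_tuple Y X (Mform Y) H W (fs @ gs))"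

definition cor_sum :: "'a mfd \<Rightarrow> 'a mfd \<Rightarrow> 'a set \<Rightarrow> (nat \<times> 'a cor_n) set" where
  "cor_sum Y X U = {(n, F). F \<in> SCor_n Y X n U}"

definition stab_step :: "'a mfd \<Rightarrow> 'a mfd \<Rightarrow> 'a set \<Rightarrow> (nat \<times> 'a cor_n) rel" where
  "stab_step Y X U =
     {((n, F), (n + m, H)) | n m F H. F \<in> SCor_n Y X n U \<and> H \<in> SCor_n Y X (n + m) U \<and>
        (\<exists>G\<in>SCor_n_iso Y X m U. is_concat Y X U F G H)}"

definition stab_equiv :: "'a mfd \<Rightarrow> 'a mfd \<Rightarrow> 'a set \<Rightarrow> (nat \<times> 'a cor_n) rel" where
  "stab_equiv Y X U = (stab_step Y X U \<union> (stab_step Y X U)\<inverse>)\<^sup>*"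

definition cor_presheaf :: "'a mfd \<Rightarrow> 'a mfd \<Rightarrow> ('a, (nat \<times> 'a cor_n) set) presheaf" where
  "cor_presheaf Y X =
     \<lparr>Sect = (\<lambda>U. cor_sum Y X U // stab_equiv Y X U),
      Restr = (\<lambda>U V c. stab_equiv Y X V `` ((\<lambda>(n, F). (n, restrict F V)) ` c))\<rparr>"

type_synonym 'a cor = "'a \<Rightarrow> ('a set \<times> (nat \<times> 'a cor_n) set) set"

definition SCor :: "'a mfd \<Rightarrow> 'a mfd \<Rightarrow> 'a cor set" where
  "SCor Y X = Sect (sheafify (Mtop Y) (cor_presheaf Y X)) (Mcarrier Y)"

definition cor_of_tuple :: "'a mfd \<Rightarrow> 'a mfd \<Rightarrow> 'a set \<Rightarrow> ('a \<Rightarrow> 'a) list \<Rightarrow> 'a cor" where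
  "cor_of_tuple Y X U fs =
     (\<lambda>y\<in>U. germ (Mtop Y) (cor_presheaf Y X) y U
        (stab_equiv Y X U `` {(length fs, tuple_section Y X (Mform Y) U fs)}))"

text \<open>\<open>F|\<^sub>U = {f\<^sub>1,\<dots>,f\<^sub>n}\<close> modulo isotropic correspondences.\<close>

definition represented_by :: "'a mfd \<Rightarrow> 'a mfd \<Rightarrow> 'a cor \<Rightarrow> 'a set \<Rightarrow> ('a \<Rightarrow> 'a) list \<Rightarrow> bool" where
  "represented_by Y X F U fs \<longleftrightarrow>
     local_tuple Y X (Mform Y) U fs \<and> restrict F U = cor_of_tuple Y X U fs"

definition SCor_b_level :: "'a mfd \<Rightarrow> 'a mfd \<Rightarrow> real \<Rightarrow> 'a cor set" where
  "SCor_b_level Y X r =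
     {F \<in> SCor Y X. \<forall>y\<in>Mcarrier Y. \<exists>U fs. y \<in> U \<and> represented_by Y X F U fs \<and>
        real (length fs) \<le> exp r}"

definition SCor_b :: "'a mfd \<Rightarrow> 'a mfd \<Rightarrow> 'a cor set" where
  "SCor_b Y X = (\<Union>r. SCor_b_level Y X r)"

type_synonym 'a sc = "'a cor \<Rightarrow>\<^sub>0 int"

definition SC_b_level :: "'a mfd \<Rightarrow> 'a mfd \<Rightarrow> real \<Rightarrow> 'a sc set" where
  "SC_b_level Y X r = carrier (free_Abelian_group (SCor_b_level Y X r))"

definition SC_b :: "'a mfd \<Rightarrow> 'a mfd \<Rightarrow> 'a sc set" where
  "SC_b Y X = carrier (free_Abelian_group (SCor_b Y X))"

definition cor_id :: "'a mfd \<Rightarrow> 'a cor" where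
  "cor_id Y = cor_of_tuple Y Y (Mcarrier Y) [\<lambda>y. y]"

text \<open>
  \<open>G \<circ> F\<close> for \<open>F \<in> SCor Z Y\<close> and \<open>G \<in> SCor Y X\<close> is the unique correspondence with
  \<open>(G \<circ> F)|\<^sub>U = {g\<^sub>i\<^sub>j \<circ> f\<^sub>i}\<close> whenever \<open>F|\<^sub>U = {f\<^sub>i}\<close>, \<open>G\<close> restricts to \<open>{g\<^sub>i\<^sub>j}\<close> on \<open>V\<^sub>i\<close>, and
  \<open>f\<^sub>i(U) \<subseteq> V\<^sub>i\<close>.
\<close>

definition cor_comp :: "'a mfd \<Rightarrow> 'a mfd \<Rightarrow> 'a mfd \<Rightarrow> 'a cor \<Rightarrow> 'a cor \<Rightarrow> 'a cor" where
  "cor_comp Z Y X G F =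
     (THE H. H \<in> SCor Z X \<and>
        (\<forall>U fs gss. represented_by Z Y F U fs \<and>
            list_all2 (\<lambda>f gs. \<exists>V. f ` U \<subseteq> V \<and> represented_by Y X G V gs) fs gss \<longrightarrow>
            represented_by Z X H U
              (concat (map (\<lambda>(f, gs). map (\<lambda>g. g \<circ> f) gs) (zip fs gss)))))"

definition sc_comp :: "'a mfd \<Rightarrow> 'a mfd \<Rightarrow> 'a mfd \<Rightarrow> 'a sc \<Rightarrow> 'a sc \<Rightarrow> 'a sc" where
  "sc_comp Z Y X b a =
     frag_extend (\<lambda>G. frag_extend (\<lambda>F. frag_of (cor_comp Z Y X G F)) a) b"


section \<open>The filtered additive category of formal sums\<close>

type_synonym 'a aobj = "('a mfd \<times> real) list"

text \<open>
  The entry \<open>F i j\<close> of a matrix goes from the \<open>i\<close>-th summand of the source to the \<open>j\<close>-th summand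
  of the target (both counted from \<open>0\<close>); entries outside the index range are \<open>0\<close>.
\<close>

type_synonym 'a amat = "nat \<Rightarrow> nat \<Rightarrow> 'a sc"

definition is_aobj :: "'a aobj \<Rightarrow> bool" where
  "is_aobj P \<longleftrightarrow> (\<forall>(Z, r) \<in> set P. connected_symplectic Z)"

definition amat_supp :: "'a aobj \<Rightarrow> 'a aobj \<Rightarrow> 'a amat \<Rightarrow> bool" where
  "amat_supp P Q F \<longleftrightarrow> (\<forall>i j. \<not> (i < length P \<and> j < length Q) \<longrightarrow> F i j = 0)"

definition ahom :: "'a aobj \<Rightarrow> 'a aobj \<Rightarrow> 'a amat set" where
  "ahom P Q = {F. amat_supp P Q F \<and>
     (\<forall>i<length P. \<forall>j<length Q. F i j \<in> SC_b (fst (P ! i)) (fst (Q ! j)))}"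

definition ahom_level :: "'a aobj \<Rightarrow> 'a aobj \<Rightarrow> real \<Rightarrow> 'a amat set" where
  "ahom_level P Q k = {F. amat_supp P Q F \<and>
     (\<forall>i<length P. \<forall>j<length Q.
        F i j \<in> SC_b_level (fst (P ! i)) (fst (Q ! j)) (k + snd (P ! i) - snd (Q ! j)))}"

definition azero :: "'a amat" where
  "azero = (\<lambda>i j. 0)"

definition aplus :: "'a amat \<Rightarrow> 'a amat \<Rightarrow> 'a amat" where
  "aplus F G = (\<lambda>i j. F i j + G i j)"

definition auminus :: "'a amat \<Rightarrow> 'a amat" where
  "auminus F = (\<lambda>i j. - F i j)"

definition aid :: "'a aobj \<Rightarrow> 'a amat" where
  "aid P = (\<lambda>i j. if i = j \<and> i < length P then frag_of (cor_id (fst (P ! i))) else 0)"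

definition acomp :: "'a aobj \<Rightarrow> 'a aobj \<Rightarrow> 'a aobj \<Rightarrow> 'a amat \<Rightarrow> 'a amat \<Rightarrow> 'a amat" where
  "acomp P Q R G F =
     (\<lambda>i j. if i < length P \<and> j < length R
        then \<Sum>l<length Q. sc_comp (fst (P ! i)) (fst (Q ! l)) (fst (R ! j)) (G l j) (F i l) else 0)"

definition ashift :: "real \<Rightarrow> 'a aobj \<Rightarrow> 'a aobj" where
  "ashift s P = map (\<lambda>(Z, r). (Z, r + s)) P"

text \<open>
  Block matrix from \<open>P\<^sub>1 @ P\<^sub>2\<close> to \<open>Q\<^sub>1 @ Q\<^sub>2\<close> with \<open>p = length P\<^sub>1\<close>, \<open>q = length Q\<^sub>1\<close>; the block \<open>Fab\<close>
  goes from \<open>P\<^sub>a\<close> to \<open>Q\<^sub>b\<close>.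
\<close>

definition ablock ::
    "nat \<Rightarrow> nat \<Rightarrow> 'a amat \<Rightarrow> 'a amat \<Rightarrow> 'a amat \<Rightarrow> 'a amat \<Rightarrow> 'a amat" where
  "ablock p q F11 F12 F21 F22 =
     (\<lambda>i j. if i < p then (if j < q then F11 i j else F12 i (j - q))
            else (if j < q then F21 (i - p) j else F22 (i - p) (j - q)))"


section \<open>Persistence, additive and triangulated categories\<close>

text \<open>
  Morphism groups are commutative groups in the sense of \<^theory>\<open>HOL-Algebra.Group\<close>, hence written
  multiplicatively: \<open>\<otimes>\<close> is addition, \<open>\<one>\<close> is the zero morphism, \<open>inv\<close> is negation.
  \<open>cmp X A B D g f\<close> is \<open>g \<circ> f\<close> for \<open>f : A \<rightarrow> B\<close> and \<open>g : B \<rightarrow> D\<close>.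
\<close>

record ('o, 'm) ab_cat =
  ob :: "'o set"
  mor :: "'o \<Rightarrow> 'o \<Rightarrow> 'm monoid"
  cmp :: "'o \<Rightarrow> 'o \<Rightarrow> 'o \<Rightarrow> 'm \<Rightarrow> 'm \<Rightarrow> 'm"
  idt :: "'o \<Rightarrow> 'm"

locale preadditive_category =
  fixes X :: "('o, 'm, 'z) ab_cat_scheme"
  assumes mor_group: "\<lbrakk>A \<in> ob X; B \<in> ob X\<rbrakk> \<Longrightarrow> comm_group (mor X A B)"
    and cmp_closed: "\<lbrakk>A \<in> ob X; B \<in> ob X; D \<in> ob X; f \<in> carrier (mor X A B); g \<in> carrier (mor X B D)\<rbrakk>
        \<Longrightarrow> cmp X A B D g f \<in> carrier (mor X A D)"
    and cmp_assoc: "\<lbrakk>A \<in> ob X; B \<in> ob X; D \<in> ob X; E \<in> ob X; f \<in> carrier (mor X A B);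
          g \<in> carrier (mor X B D); h \<in> carrier (mor X D E)\<rbrakk>
        \<Longrightarrow> cmp X A B E (cmp X B D E h g) f = cmp X A D E h (cmp X A B D g f)"
    and idt_closed: "A \<in> ob X \<Longrightarrow> idt X A \<in> carrier (mor X A A)"
    and idt_left: "\<lbrakk>A \<in> ob X; B \<in> ob X; f \<in> carrier (mor X A B)\<rbrakk> \<Longrightarrow> cmp X A B B (idt X B) f = f"
    and idt_right: "\<lbrakk>A \<in> ob X; B \<in> ob X; f \<in> carrier (mor X A B)\<rbrakk> \<Longrightarrow> cmp X A A B f (idt X A) = f"
    and cmp_add_left: "\<lbrakk>A \<in> ob X; B \<in> ob X; D \<in> ob X; f \<in> carrier (mor X A B);
          g \<in> carrier (mor X B D); g' \<in> carrier (mor X B D)\<rbrakk>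
        \<Longrightarrow> cmp X A B D (g \<otimes>\<^bsub>mor X B D\<^esub> g') f = cmp X A B D g f \<otimes>\<^bsub>mor X A D\<^esub> cmp X A B D g' f"
    and cmp_add_right: "\<lbrakk>A \<in> ob X; B \<in> ob X; D \<in> ob X; f \<in> carrier (mor X A B);
          f' \<in> carrier (mor X A B); g \<in> carrier (mor X B D)\<rbrakk>
        \<Longrightarrow> cmp X A B D g (f \<otimes>\<^bsub>mor X A B\<^esub> f') = cmp X A B D g f \<otimes>\<^bsub>mor X A D\<^esub> cmp X A B D g f'"

definition is_zero_object :: "('o, 'm, 'z) ab_cat_scheme \<Rightarrow> 'o \<Rightarrow> bool" where
  "is_zero_object X Z \<longleftrightarrow> Z \<in> ob X \<and>
     (\<forall>A\<in>ob X. carrier (mor X A Z) = {\<one>\<^bsub>mor X A Z\<^esub>} \<and> carrier (mor X Z A) = {\<one>\<^bsub>mor X Z A\<^esub>})"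

definition is_biproduct ::
    "('o, 'm, 'z) ab_cat_scheme \<Rightarrow> 'o \<Rightarrow> 'o \<Rightarrow> 'o \<Rightarrow> 'm \<Rightarrow> 'm \<Rightarrow> 'm \<Rightarrow> 'm \<Rightarrow> bool" where
  "is_biproduct X A B S i1 i2 p1 p2 \<longleftrightarrow> S \<in> ob X \<and>
     i1 \<in> carrier (mor X A S) \<and> i2 \<in> carrier (mor X B S) \<and>
     p1 \<in> carrier (mor X S A) \<and> p2 \<in> carrier (mor X S B) \<and>
     cmp X A S A p1 i1 = idt X A \<and> cmp X B S B p2 i2 = idt X B \<and>
     cmp X A S B p2 i1 = \<one>\<^bsub>mor X A B\<^esub> \<and> cmp X B S A p1 i2 = \<one>\<^bsub>mor X B A\<^esub> \<and>
     cmp X S A S i1 p1 \<otimes>\<^bsub>mor X S S\<^esub> cmp X S B S i2 p2 = idt X S"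

locale additive_category = preadditive_category +
  assumes zero_object_exists: "\<exists>Z. is_zero_object X Z"
    and biproduct_exists: "\<lbrakk>A \<in> ob X; B \<in> ob X\<rbrakk> \<Longrightarrow> \<exists>S i1 i2 p1 p2. is_biproduct X A B S i1 i2 p1 p2"

locale additive_endofunctor =
  fixes X :: "('o, 'm, 'z) ab_cat_scheme" and FO :: "'o \<Rightarrow> 'o" and FM :: "'o \<Rightarrow> 'o \<Rightarrow> 'm \<Rightarrow> 'm"
  assumes FO_closed: "A \<in> ob X \<Longrightarrow> FO A \<in> ob X"
    and FM_hom: "\<lbrakk>A \<in> ob X; B \<in> ob X\<rbrakk> \<Longrightarrow> FM A B \<in> hom (mor X A B) (mor X (FO A) (FO B))"
    and FM_idt: "A \<in> ob X \<Longrightarrow> FM A A (idt X A) = idt X (FO A)"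
    and FM_cmp: "\<lbrakk>A \<in> ob X; B \<in> ob X; D \<in> ob X; f \<in> carrier (mor X A B); g \<in> carrier (mor X B D)\<rbrakk>
        \<Longrightarrow> FM A D (cmp X A B D g f) = cmp X (FO A) (FO B) (FO D) (FM B D g) (FM A B f)"

definition is_iso :: "('o, 'm, 'z) ab_cat_scheme \<Rightarrow> 'o \<Rightarrow> 'o \<Rightarrow> 'm \<Rightarrow> bool" where
  "is_iso X A B f \<longleftrightarrow> f \<in> carrier (mor X A B) \<and>
     (\<exists>g\<in>carrier (mor X B A). cmp X A B A g f = idt X A \<and> cmp X B A B f g = idt X B)"

text \<open>\<open>(A, B, D, u, v, w)\<close> stands for \<open>A \<rightarrow> B \<rightarrow> D \<rightarrow> TA\<close> with arrows \<open>u\<close>, \<open>v\<close>, \<open>w\<close>.\<close>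

type_synonym ('o, 'm) triangle = "'o \<times> 'o \<times> 'o \<times> 'm \<times> 'm \<times> 'm"

definition is_triangle ::
    "('o, 'm, 'z) ab_cat_scheme \<Rightarrow> ('o \<Rightarrow> 'o) \<Rightarrow> ('o, 'm) triangle \<Rightarrow> bool" where
  "is_triangle X T = (\<lambda>(A, B, D, u, v, w).
     A \<in> ob X \<and> B \<in> ob X \<and> D \<in> ob X \<and>
     u \<in> carrier (mor X A B) \<and> v \<in> carrier (mor X B D) \<and> w \<in> carrier (mor X D (T A)))"

definition isomorphic_triangles ::
    "('o, 'm, 'z) ab_cat_scheme \<Rightarrow> ('o \<Rightarrow> 'o) \<Rightarrow> ('o \<Rightarrow> 'o \<Rightarrow> 'm \<Rightarrow> 'm) \<Rightarrow>
     ('o, 'm) triangle \<Rightarrow> ('o, 'm) triangle \<Rightarrow> bool" where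
  "isomorphic_triangles X T TM = (\<lambda>(A, B, D, u, v, w) (A', B', D', u', v', w').
     \<exists>a b d. is_iso X A A' a \<and> is_iso X B B' b \<and> is_iso X D D' d \<and>
       cmp X A B B' b u = cmp X A A' B' u' a \<and>
       cmp X B D D' d v = cmp X B B' D' v' b \<and>
       cmp X D (T A) (T A') (TM A A' a) w = cmp X D D' (T A') w' d)"

record ('o, 'm) tri_cat = "('o, 'm) ab_cat" +
  trO :: "'o \<Rightarrow> 'o"
  trM :: "'o \<Rightarrow> 'o \<Rightarrow> 'm \<Rightarrow> 'm"
  exact :: "('o, 'm) triangle set"

locale triangulated_category = additive_category X
  for X :: "('o, 'm, 'z) tri_cat_scheme" +
  assumes translation_functor: "additive_endofunctor X (trO X) (trM X)"
    and translation_ob_bij: "bij_betw (trO X) (ob X) (ob X)"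
    and translation_mor_bij: "\<lbrakk>A \<in> ob X; B \<in> ob X\<rbrakk>
        \<Longrightarrow> bij_betw (trM X A B) (carrier (mor X A B)) (carrier (mor X (trO X A) (trO X B)))"
    and exact_triangle: "t \<in> exact X \<Longrightarrow> is_triangle X (trO X) t"
    and TR1_iso: "\<lbrakk>t \<in> exact X; is_triangle X (trO X) t';
          isomorphic_triangles X (trO X) (trM X) t t'\<rbrakk> \<Longrightarrow> t' \<in> exact X"
    and TR1_id: "\<lbrakk>A \<in> ob X; is_zero_object X Z\<rbrakk>
        \<Longrightarrow> (A, A, Z, idt X A, \<one>\<^bsub>mor X A Z\<^esub>, \<one>\<^bsub>mor X Z (trO X A)\<^esub>) \<in> exact X"
    and TR1_cone: "\<lbrakk>A \<in> ob X; B \<in> ob X; u \<in> carrier (mor X A B)\<rbrakk>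
        \<Longrightarrow> \<exists>D v w. (A, B, D, u, v, w) \<in> exact X"
    and TR2: "is_triangle X (trO X) (A, B, D, u, v, w) \<Longrightarrow>
        (A, B, D, u, v, w) \<in> exact X \<longleftrightarrow>
        (B, D, trO X A, v, w, inv\<^bsub>mor X (trO X A) (trO X B)\<^esub> (trM X A B u)) \<in> exact X"
    and TR3: "\<lbrakk>(A, B, D, u, v, w) \<in> exact X; (A', B', D', u', v', w') \<in> exact X;
          f \<in> carrier (mor X A A'); g \<in> carrier (mor X B B');
          cmp X A B B' g u = cmp X A A' B' u' f\<rbrakk>
        \<Longrightarrow> \<exists>h\<in>carrier (mor X D D').
              cmp X B D D' h v = cmp X B B' D' v' g \<and>
              cmp X D (trO X A) (trO X A') (trM X A A' f) w = cmp X D D' (trO X A') w' h"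
    and TR4: "\<lbrakk>(A, B, D', u, j, k) \<in> exact X; (B, D, A', v, l, i) \<in> exact X;
          (A, D, B', cmp X A B D v u, m, n) \<in> exact X\<rbrakk>
        \<Longrightarrow> \<exists>f\<in>carrier (mor X D' B'). \<exists>g\<in>carrier (mor X B' A').
              (D', B', A', f, g, cmp X A' (trO X B) (trO X D') (trM X B D' j) i) \<in> exact X \<and>
              cmp X B D' B' f j = cmp X B D B' m v \<and>
              cmp X D' B' (trO X A) n f = k \<and>
              cmp X D B' A' g m = l \<and>
              cmp X B' A' (trO X B) i g = cmp X B' (trO X A) (trO X B) (trM X A B u) n"

locale triangulated_endofunctor = additive_endofunctor X FO FM
  for X :: "('o, 'm, 'z) tri_cat_scheme" and FO FM +
  assumes compatible_with_translation: "\<exists>\<theta>.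
      (\<forall>A\<in>ob X. is_iso X (FO (trO X A)) (trO X (FO A)) (\<theta> A)) \<and>
      (\<forall>A\<in>ob X. \<forall>B\<in>ob X. \<forall>f\<in>carrier (mor X A B).
         cmp X (FO (trO X A)) (FO (trO X B)) (trO X (FO B)) (\<theta> B) (FM (trO X A) (trO X B) (trM X A B f)) =
         cmp X (FO (trO X A)) (trO X (FO A)) (trO X (FO B)) (trM X (FO A) (FO B) (FM A B f)) (\<theta> A)) \<and>
      (\<forall>A B D u v w. (A, B, D, u, v, w) \<in> exact X \<longrightarrow>
         (FO A, FO B, FO D, FM A B u, FM B D v,
          cmp X (FO D) (FO (trO X A)) (trO X (FO A)) (\<theta> A) (FM D (trO X A) w)) \<in> exact X)"

text \<open>
  \<open>pmor P r A B\<close> is \<open>Hom\<^sup>r(A, B)\<close>, and \<open>pcmp P r s A B D g f\<close> is \<open>g \<circ> f\<close> for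
  \<open>g \<in> Hom\<^sup>r(B, D)\<close> and \<open>f \<in> Hom\<^sup>s(A, B)\<close>.
\<close>

record ('o, 'm) pers_cat =
  pob :: "'o set"
  pmor :: "real \<Rightarrow> 'o \<Rightarrow> 'o \<Rightarrow> 'm monoid"
  pcmp :: "real \<Rightarrow> real \<Rightarrow> 'o \<Rightarrow> 'o \<Rightarrow> 'o \<Rightarrow> 'm \<Rightarrow> 'm \<Rightarrow> 'm"
  pidt :: "'o \<Rightarrow> 'm"
  pinc :: "real \<Rightarrow> real \<Rightarrow> 'o \<Rightarrow> 'o \<Rightarrow> 'm \<Rightarrow> 'm" \<comment> \<open>\<open>i\<^sub>r\<^sub>,\<^sub>s : Hom\<^sup>r(A, B) \<rightarrow> Hom\<^sup>s(A, B)\<close>\<close>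

locale persistence_category =
  fixes P :: "('o, 'm, 'z) pers_cat_scheme"
  assumes pmor_group: "\<lbrakk>A \<in> pob P; B \<in> pob P\<rbrakk> \<Longrightarrow> comm_group (pmor P r A B)"
    and pinc_hom: "\<lbrakk>A \<in> pob P; B \<in> pob P; r \<le> s\<rbrakk> \<Longrightarrow> pinc P r s A B \<in> hom (pmor P r A B) (pmor P s A B)"
    and pinc_refl: "\<lbrakk>A \<in> pob P; B \<in> pob P; f \<in> carrier (pmor P r A B)\<rbrakk> \<Longrightarrow> pinc P r r A B f = f"
    and pinc_trans: "\<lbrakk>A \<in> pob P; B \<in> pob P; r \<le> s; s \<le> t; f \<in> carrier (pmor P r A B)\<rbrakk>
        \<Longrightarrow> pinc P s t A B (pinc P r s A B f) = pinc P r t A B f"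
    and pcmp_closed: "\<lbrakk>A \<in> pob P; B \<in> pob P; D \<in> pob P;
          f \<in> carrier (pmor P s A B); g \<in> carrier (pmor P r B D)\<rbrakk>
        \<Longrightarrow> pcmp P r s A B D g f \<in> carrier (pmor P (r + s) A D)"
    and pcmp_assoc: "\<lbrakk>A \<in> pob P; B \<in> pob P; D \<in> pob P; E \<in> pob P; f \<in> carrier (pmor P t A B);
          g \<in> carrier (pmor P s B D); h \<in> carrier (pmor P r D E)\<rbrakk>
        \<Longrightarrow> pcmp P (r + s) t A B E (pcmp P r s B D E h g) f =
            pcmp P r (s + t) A D E h (pcmp P s t A B D g f)"
    and pidt_closed: "A \<in> pob P \<Longrightarrow> pidt P A \<in> carrier (pmor P 0 A A)"
    and pidt_left: "\<lbrakk>A \<in> pob P; B \<in> pob P; f \<in> carrier (pmor P r A B)\<rbrakk>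
        \<Longrightarrow> pcmp P 0 r A B B (pidt P B) f = f"
    and pidt_right: "\<lbrakk>A \<in> pob P; B \<in> pob P; f \<in> carrier (pmor P r A B)\<rbrakk>
        \<Longrightarrow> pcmp P r 0 A A B f (pidt P A) = f"
    and pcmp_add_left: "\<lbrakk>A \<in> pob P; B \<in> pob P; D \<in> pob P; f \<in> carrier (pmor P s A B);
          g \<in> carrier (pmor P r B D); g' \<in> carrier (pmor P r B D)\<rbrakk>
        \<Longrightarrow> pcmp P r s A B D (g \<otimes>\<^bsub>pmor P r B D\<^esub> g') f =
            pcmp P r s A B D g f \<otimes>\<^bsub>pmor P (r + s) A D\<^esub> pcmp P r s A B D g' f"
    and pcmp_add_right: "\<lbrakk>A \<in> pob P; B \<in> pob P; D \<in> pob P; f \<in> carrier (pmor P s A B);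
          f' \<in> carrier (pmor P s A B); g \<in> carrier (pmor P r B D)\<rbrakk>
        \<Longrightarrow> pcmp P r s A B D g (f \<otimes>\<^bsub>pmor P s A B\<^esub> f') =
            pcmp P r s A B D g f \<otimes>\<^bsub>pmor P (r + s) A D\<^esub> pcmp P r s A B D g f'"
    and pcmp_pinc: "\<lbrakk>A \<in> pob P; B \<in> pob P; D \<in> pob P; r \<le> r'; s \<le> s';
          f \<in> carrier (pmor P r B D); g \<in> carrier (pmor P s A B)\<rbrakk>
        \<Longrightarrow> pcmp P r' s' A B D (pinc P r r' B D f) (pinc P s s' A B g) =
            pinc P (r + s) (r' + s') A D (pcmp P r s A B D f g)"

text \<open>
  \<open>shM r t A B\<close> is the action of \<open>\<Sigma>\<^sup>r\<close> on \<open>Hom\<^sup>t(A, B)\<close>, and \<open>eta r s A\<close> is the component at \<open>A\<close> of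
  \<open>\<eta>\<^sub>r\<^sub>,\<^sub>s : \<Sigma>\<^sup>r \<rightarrow> \<Sigma>\<^sup>s\<close>.
\<close>

record ('o, 'm) tpc = "('o, 'm) pers_cat" +
  shO :: "real \<Rightarrow> 'o \<Rightarrow> 'o"
  shM :: "real \<Rightarrow> real \<Rightarrow> 'o \<Rightarrow> 'o \<Rightarrow> 'm \<Rightarrow> 'm"
  eta :: "real \<Rightarrow> real \<Rightarrow> 'o \<Rightarrow> 'm"
  ptrO :: "'o \<Rightarrow> 'o"
  ptrM :: "'o \<Rightarrow> 'o \<Rightarrow> 'm \<Rightarrow> 'm" \<comment> \<open>the translation functor acts on level-zero morphisms\<close>
  pexact :: "('o, 'm) triangle set"

locale persistence_category_with_shift = persistence_category P
  for P :: "('o, 'm, 'z) tpc_scheme" +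
  assumes shO_closed: "A \<in> pob P \<Longrightarrow> shO P r A \<in> pob P"
    and shM_hom: "\<lbrakk>A \<in> pob P; B \<in> pob P\<rbrakk>
        \<Longrightarrow> shM P r t A B \<in> hom (pmor P t A B) (pmor P t (shO P r A) (shO P r B))"
    and shM_pidt: "A \<in> pob P \<Longrightarrow> shM P r 0 A A (pidt P A) = pidt P (shO P r A)"
    and shM_pcmp: "\<lbrakk>A \<in> pob P; B \<in> pob P; D \<in> pob P;
          f \<in> carrier (pmor P t A B); g \<in> carrier (pmor P s B D)\<rbrakk>
        \<Longrightarrow> shM P r (s + t) A D (pcmp P s t A B D g f) =
            pcmp P s t (shO P r A) (shO P r B) (shO P r D) (shM P r s B D g) (shM P r t A B f)"
    and shM_pinc: "\<lbrakk>A \<in> pob P; B \<in> pob P; s \<le> t; f \<in> carrier (pmor P s A B)\<rbrakk>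
        \<Longrightarrow> shM P r t A B (pinc P s t A B f) = pinc P s t (shO P r A) (shO P r B) (shM P r s A B f)"
    and shO_add: "A \<in> pob P \<Longrightarrow> shO P r (shO P s A) = shO P (r + s) A"
    and shO_zero: "A \<in> pob P \<Longrightarrow> shO P 0 A = A"
    and shM_add: "\<lbrakk>A \<in> pob P; B \<in> pob P; f \<in> carrier (pmor P t A B)\<rbrakk>
        \<Longrightarrow> shM P r t (shO P s A) (shO P s B) (shM P s t A B f) = shM P (r + s) t A B f"
    and shM_zero: "\<lbrakk>A \<in> pob P; B \<in> pob P; f \<in> carrier (pmor P t A B)\<rbrakk> \<Longrightarrow> shM P 0 t A B f = f"
    and eta_closed: "A \<in> pob P \<Longrightarrow> eta P r s A \<in> carrier (pmor P (s - r) (shO P r A) (shO P s A))"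
    and eta_natural: "\<lbrakk>A \<in> pob P; B \<in> pob P; f \<in> carrier (pmor P t A B)\<rbrakk>
        \<Longrightarrow> pcmp P (s - r) t (shO P r A) (shO P r B) (shO P s B) (eta P r s B) (shM P r t A B f) =
            pcmp P t (s - r) (shO P r A) (shO P s A) (shO P s B) (shM P s t A B f) (eta P r s A)"
    and eta_iso: "A \<in> pob P \<Longrightarrow> \<exists>\<theta>\<in>carrier (pmor P (r - s) (shO P s A) (shO P r A)).
          pcmp P (r - s) (s - r) (shO P r A) (shO P s A) (shO P r A) \<theta> (eta P r s A) = pidt P (shO P r A) \<and>
          pcmp P (s - r) (r - s) (shO P s A) (shO P r A) (shO P s A) (eta P r s A) \<theta> = pidt P (shO P s A)"
    and eta_cocycle: "A \<in> pob P
        \<Longrightarrow> pcmp P (s - r') (r' - r) (shO P r A) (shO P r' A) (shO P s A) (eta P r' s A) (eta P r r' A)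
            = eta P r s A"
    and eta_refl: "A \<in> pob P \<Longrightarrow> eta P r r A = pidt P (shO P r A)"
    and shM_eta: "A \<in> pob P
        \<Longrightarrow> shM P t (s - r) (shO P r A) (shO P s A) (eta P r s A) = eta P (r + t) (s + t) A"

definition acyclic_object :: "('o, 'm, 'z) pers_cat_scheme \<Rightarrow> real \<Rightarrow> 'o \<Rightarrow> bool" where
  "acyclic_object P r K \<longleftrightarrow> r \<ge> 0 \<and> K \<in> pob P \<and> pinc P 0 r K K (pidt P K) = \<one>\<^bsub>pmor P r K K\<^esub>"

definition level_zero_cat :: "('o, 'm, 'z) pers_cat_scheme \<Rightarrow> ('o, 'm) ab_cat" where
  "level_zero_cat P = \<lparr>ob = pob P, mor = pmor P 0, cmp = pcmp P 0 0, idt = pidt P\<rparr>"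

definition level_zero :: "('o, 'm, 'z) tpc_scheme \<Rightarrow> ('o, 'm) tri_cat" where
  "level_zero P = ab_cat.extend (level_zero_cat P)
     \<lparr>trO = ptrO P, trM = ptrM P, exact = pexact P\<rparr>"

locale triangulated_persistence_category = persistence_category_with_shift +
  assumes level_zero_triangulated: "triangulated_category (level_zero P)"
    and shift_triangulated: "triangulated_endofunctor (level_zero P) (shO P r) (shM P r 0)"
    and shift_cone_acyclic: "\<lbrakk>r \<ge> 0; A \<in> pob P\<rbrakk> \<Longrightarrow> \<exists>K v w.
        (shO P r A, A, K, pinc P (- r) 0 (shO P r A) A (eta P r 0 A), v, w) \<in> pexact P \<and>
        acyclic_object P r K"


section \<open>The category of bounded below complexes\<close>

record 'a cplx =
  cob :: "int \<Rightarrow> 'a aobj"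
  cdif :: "int \<Rightarrow> 'a amat"

definition is_cplx :: "'a cplx \<Rightarrow> bool" where
  "is_cplx C \<longleftrightarrow>
     (\<forall>n. is_aobj (cob C n)) \<and> (\<forall>n. cdif C n \<in> ahom (cob C n) (cob C (n + 1))) \<and>
     (\<forall>n. acomp (cob C n) (cob C (n + 1)) (cob C (n + 2)) (cdif C (n + 1)) (cdif C n) = azero) \<and>
     (\<exists>N. \<forall>n<N. cob C n = [])"

type_synonym 'a cmap = "int \<Rightarrow> 'a amat"

definition chain_maps :: "real \<Rightarrow> 'a cplx \<Rightarrow> 'a cplx \<Rightarrow> 'a cmap set" where
  "chain_maps r C K = {F.
     (\<forall>n. F n \<in> ahom_level (cob C n) (cob K n) r) \<and>
     (\<forall>n. acomp (cob C n) (cob K n) (cob K (n + 1)) (cdif K n) (F n) =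
          acomp (cob C n) (cob C (n + 1)) (cob K (n + 1)) (F (n + 1)) (cdif C n))}"

text \<open>
  The differentials carry no bound on their filtration level, so \<open>dH + Hd\<close> need not have level \<open>r\<close>
  when \<open>H\<close> does; membership in \<^const>\<open>chain_maps\<close> is therefore a separate requirement.
\<close>

definition null_homotopic :: "real \<Rightarrow> 'a cplx \<Rightarrow> 'a cplx \<Rightarrow> 'a cmap set" where
  "null_homotopic r C K = {F \<in> chain_maps r C K. \<exists>H.
     (\<forall>n. H n \<in> ahom_level (cob C n) (cob K (n - 1)) r) \<and>
     (\<forall>n. F n = aplus
        (acomp (cob C n) (cob K (n - 1)) (cob K n) (cdif K (n - 1)) (H n))
        (acomp (cob C n) (cob C (n + 1)) (cob K n) (H (n + 1)) (cdif C n)))}"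

definition chain_map_group :: "real \<Rightarrow> 'a cplx \<Rightarrow> 'a cplx \<Rightarrow> 'a cmap monoid" where
  "chain_map_group r C K =
     \<lparr>carrier = chain_maps r C K, monoid.mult = (\<lambda>F G n. aplus (F n) (G n)), one = (\<lambda>n. azero)\<rparr>"

type_synonym 'a cmor = "'a cmap set"

definition Hom_C :: "real \<Rightarrow> 'a cplx \<Rightarrow> 'a cplx \<Rightarrow> 'a cmor monoid" where
  "Hom_C r C K = chain_map_group r C K Mod null_homotopic r C K"

definition hclass :: "real \<Rightarrow> 'a cplx \<Rightarrow> 'a cplx \<Rightarrow> 'a cmap \<Rightarrow> 'a cmor" where
  "hclass r C K F = null_homotopic r C K #>\<^bsub>chain_map_group r C K\<^esub> F"

text \<open>
  Operations on classes are taken as unions over all representatives; they are again single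
  cosets because the class of the result does not depend on the representatives.
\<close>

definition comp_C :: "real \<Rightarrow> real \<Rightarrow> 'a cplx \<Rightarrow> 'a cplx \<Rightarrow> 'a cplx \<Rightarrow> 'a cmor \<Rightarrow> 'a cmor \<Rightarrow> 'a cmor" where
  "comp_C r s C K L b a =
     (\<Union>G\<in>b. \<Union>F\<in>a. hclass (r + s) C L (\<lambda>n. acomp (cob C n) (cob K n) (cob L n) (G n) (F n)))"

definition incl_C :: "real \<Rightarrow> real \<Rightarrow> 'a cplx \<Rightarrow> 'a cplx \<Rightarrow> 'a cmor \<Rightarrow> 'a cmor" where
  "incl_C r s C K a = (\<Union>F\<in>a. hclass s C K F)"

definition shift_cplx :: "real \<Rightarrow> 'a cplx \<Rightarrow> 'a cplx" where
  "shift_cplx r C = \<lparr>cob = (\<lambda>n. ashift r (cob C n)), cdif = cdif C\<rparr>"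

definition id_C :: "real \<Rightarrow> real \<Rightarrow> 'a cplx \<Rightarrow> 'a cmor" where
  "id_C r s C = hclass (s - r) (shift_cplx r C) (shift_cplx s C) (\<lambda>n. aid (cob C n))"

definition trans_cplx :: "'a cplx \<Rightarrow> 'a cplx" where
  "trans_cplx C = \<lparr>cob = (\<lambda>n. cob C (n + 1)), cdif = (\<lambda>n. auminus (cdif C (n + 1)))\<rparr>"

definition trans_mor :: "'a cmor \<Rightarrow> 'a cmor" where
  "trans_mor a = (\<lambda>F n. F (n + 1)) ` a"

definition cone :: "'a cplx \<Rightarrow> 'a cplx \<Rightarrow> 'a cmap \<Rightarrow> 'a cplx" where
  "cone C K F =
     \<lparr>cob = (\<lambda>n. cob C (n + 1) @ cob K n),
      cdif = (\<lambda>n. ablock (length (cob C (n + 1))) (length (cob C (n + 2)))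
                    (auminus (cdif C (n + 1))) (F (n + 1)) azero (cdif K n))\<rparr>"

definition cone_in :: "'a cplx \<Rightarrow> 'a cplx \<Rightarrow> 'a cmap" where
  "cone_in C K = (\<lambda>n. ablock 0 (length (cob C (n + 1))) azero azero azero (aid (cob K n)))"

definition cone_out :: "'a cplx \<Rightarrow> 'a cplx \<Rightarrow> 'a cmap" where
  "cone_out C K = (\<lambda>n. ablock (length (cob C (n + 1))) (length (cob C (n + 1)))
                    (aid (cob C (n + 1))) azero azero azero)"

definition standard_triangle :: "'a cplx \<Rightarrow> 'a cplx \<Rightarrow> 'a cmap \<Rightarrow> ('a cplx, 'a cmor) triangle" where
  "standard_triangle C K F =
     (C, K, cone C K F, hclass 0 C K F, hclass 0 K (cone C K F) (cone_in C K),
      hclass 0 (cone C K F) (trans_cplx C) (cone_out C K))"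

definition pers_C :: "('a cplx, 'a cmor) pers_cat" where
  "pers_C =
     \<lparr>pob = {C. is_cplx C}, pmor = Hom_C, pcmp = comp_C,
      pidt = (\<lambda>C. hclass 0 C C (\<lambda>n. aid (cob C n))), pinc = incl_C\<rparr>"

definition exact_C :: "('a cplx, 'a cmor) triangle set" where
  "exact_C = {t. is_triangle (level_zero_cat pers_C) trans_cplx t \<and>
     (\<exists>C K F. is_cplx C \<and> is_cplx K \<and> F \<in> chain_maps 0 C K \<and>
        isomorphic_triangles (level_zero_cat pers_C) trans_cplx (\<lambda>_ _. trans_mor)
          t (standard_triangle C K F))}"

definition tpc_C :: "('a cplx, 'a cmor) tpc" where
  "tpc_C = pers_cat.extend pers_C
     \<lparr>shO = shift_cplx, shM = (\<lambda>_ _ _ _ a. a), eta = id_C,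
      ptrO = trans_cplx, ptrM = (\<lambda>_ _. trans_mor), pexact = exact_C\<rparr>"

end

(* All graded morphisms between complexes over the category A live in one ring of row-finite matrices,
   indexed by the summands of all complexes.  There a complex is an element d with d * d = 0, a chain map
   commutes with the d's, and a null homotopic map has the form d * h + h * d; cones, translations and
   shifts are described by partial identity matrices.  The axioms of a triangulated persistence category
   become identities in an abstract ring with such a filtered dg structure; the octahedral axiom, for
   example, uses explicit maps between iterated cones.  A triangle Sigma^r A -> A -> K comes from the cone
   of the identity matrix Sigma^r A -> A, and K is r-acyclic because the inverse identity matrix,
   of level r, gives a contracting homotopy of level r.

   What is left is that the free abelian groups on bounded correspondences compose associatively
   and compatibly with the level.  Composition is well defined because both sheafifications can be undone
   locally: near a point only the multiset of values of the inner tuple matters, so the zigzags that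
   identify representatives may be treated one step at a time, and composing an isotropic tuple with any
   tuple on either side gives an isotropic tuple since forms pull back functorially. *)

theory Submission
  imports Defs
begin

section \<open>Matrix calculus of a filtered dg category\<close>

text \<open>The differentials lie in no fixed level. Hence the level-zero category is not the
  homotopy category of complexes over the level-zero part of the additive category, and
  \<open>d * h + h * d\<close> can fail to have the level of \<open>h\<close>. Homotopies and
  inverses are therefore given by formulas whose level is read off from the factors, and a boundary
  is a cocycle of level r that also has a primitive of level r. The translation maps are matrices of
  degree -1 that anticommute with the differentials; this accounts for the signs in cones and
  rotated triangles. The ring has no unit, as there are infinitely many objects: each complex has
  its own idempotent. Only rows are finite, since a complex may be unbounded above. On the geometric
  side the generated equivalence is replaced by one symmetric local condition: two tuples agree near
  a point after isotropic tuples have been added to both. Any zigzag collapses to a single step of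
  this kind.\<close>

lemma reassoc: "a * b = c \<Longrightarrow> a * (b * x) = c * (x :: 'r :: semigroup_mult)"
  by (simp add: mult.assoc[symmetric])

text \<open>\<open>L r k A B\<close> plays the role of the morphisms from A to B of degree k and
  level r, and \<open>e\<close> gives the local identities. No axiom places \<open>d A\<close> in a
  level. The first summand of a cone is translated, so \<open>i1\<close> and \<open>p1\<close> have
  degrees -1 and 1. The primed maps \<open>t'\<close> and \<open>\<sigma>'\<close> invert the
  identity matrices to translates and shifts.\<close>

locale filtered_dg =
  fixes Ob :: "'o set" and e d :: "'o \<Rightarrow> 'r :: ring"
    and L :: "real \<Rightarrow> int \<Rightarrow> 'o \<Rightarrow> 'o \<Rightarrow> 'r set"
    and Cn :: "'o \<Rightarrow> 'o \<Rightarrow> 'r \<Rightarrow> 'o" and i1 p1 i2 p2 :: "'o \<Rightarrow> 'o \<Rightarrow> 'r \<Rightarrow> 'r"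
    and T :: "'o \<Rightarrow> 'o" and t t' :: "'o \<Rightarrow> 'r"
    and S :: "real \<Rightarrow> 'o \<Rightarrow> 'o" and \<sigma> \<sigma>' :: "real \<Rightarrow> 'o \<Rightarrow> 'r"
    and O0 :: 'o
  assumes L_zero: "\<lbrakk>A \<in> Ob; B \<in> Ob\<rbrakk> \<Longrightarrow> 0 \<in> L r k A B"
    and L_add: "\<lbrakk>A \<in> Ob; B \<in> Ob; x \<in> L r k A B; y \<in> L r k A B\<rbrakk> \<Longrightarrow> x + y \<in> L r k A B"
    and L_minus: "\<lbrakk>A \<in> Ob; B \<in> Ob; x \<in> L r k A B\<rbrakk> \<Longrightarrow> - x \<in> L r k A B"
    and L_mult: "\<lbrakk>A \<in> Ob; B \<in> Ob; D \<in> Ob; y \<in> L r k B D; x \<in> L s l A B\<rbrakk>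
      \<Longrightarrow> y * x \<in> L (r + s) (k + l) A D"
    and L_mono: "\<lbrakk>A \<in> Ob; B \<in> Ob; r \<le> s; x \<in> L r k A B\<rbrakk> \<Longrightarrow> x \<in> L s k A B"
    and L_left: "\<lbrakk>A \<in> Ob; B \<in> Ob; x \<in> L r k A B\<rbrakk> \<Longrightarrow> e B * x = x"
    and L_right: "\<lbrakk>A \<in> Ob; B \<in> Ob; x \<in> L r k A B\<rbrakk> \<Longrightarrow> x * e A = x"
    and e_L: "A \<in> Ob \<Longrightarrow> e A \<in> L 0 0 A A"
    and d_d: "A \<in> Ob \<Longrightarrow> d A * d A = 0"
    and e_d: "A \<in> Ob \<Longrightarrow> e A * d A = d A"
    and d_e: "A \<in> Ob \<Longrightarrow> d A * e A = d A"
    and cone_Ob: "\<lbrakk>A \<in> Ob; B \<in> Ob; U \<in> L 0 0 A B; d B * U = U * d A\<rbrakk> \<Longrightarrow> Cn A B U \<in> Ob"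
    and i1_L: "\<lbrakk>A \<in> Ob; B \<in> Ob; U \<in> L 0 0 A B; d B * U = U * d A\<rbrakk> \<Longrightarrow> i1 A B U \<in> L 0 (-1) A (Cn A B U)"
    and p1_L: "\<lbrakk>A \<in> Ob; B \<in> Ob; U \<in> L 0 0 A B; d B * U = U * d A\<rbrakk> \<Longrightarrow> p1 A B U \<in> L 0 1 (Cn A B U) A"
    and i2_L: "\<lbrakk>A \<in> Ob; B \<in> Ob; U \<in> L 0 0 A B; d B * U = U * d A\<rbrakk> \<Longrightarrow> i2 A B U \<in> L 0 0 B (Cn A B U)"
    and p2_L: "\<lbrakk>A \<in> Ob; B \<in> Ob; U \<in> L 0 0 A B; d B * U = U * d A\<rbrakk> \<Longrightarrow> p2 A B U \<in> L 0 0 (Cn A B U) B"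
    and p1_i1: "\<lbrakk>A \<in> Ob; B \<in> Ob; U \<in> L 0 0 A B; d B * U = U * d A\<rbrakk> \<Longrightarrow> p1 A B U * i1 A B U = e A"
    and p2_i2: "\<lbrakk>A \<in> Ob; B \<in> Ob; U \<in> L 0 0 A B; d B * U = U * d A\<rbrakk> \<Longrightarrow> p2 A B U * i2 A B U = e B"
    and p1_i2: "\<lbrakk>A \<in> Ob; B \<in> Ob; U \<in> L 0 0 A B; d B * U = U * d A\<rbrakk> \<Longrightarrow> p1 A B U * i2 A B U = 0"
    and p2_i1: "\<lbrakk>A \<in> Ob; B \<in> Ob; U \<in> L 0 0 A B; d B * U = U * d A\<rbrakk> \<Longrightarrow> p2 A B U * i1 A B U = 0"
    and e_cone: "\<lbrakk>A \<in> Ob; B \<in> Ob; U \<in> L 0 0 A B; d B * U = U * d A\<rbrakk>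
      \<Longrightarrow> e (Cn A B U) = i1 A B U * p1 A B U + i2 A B U * p2 A B U"
    and d_cone: "\<lbrakk>A \<in> Ob; B \<in> Ob; U \<in> L 0 0 A B; d B * U = U * d A\<rbrakk>
      \<Longrightarrow> d (Cn A B U) = i2 A B U * U * p1 A B U + i2 A B U * d B * p2 A B U - i1 A B U * d A * p1 A B U"
    and T_bij: "bij_betw T Ob Ob"
    and t_L: "A \<in> Ob \<Longrightarrow> t A \<in> L 0 (-1) A (T A)"
    and t'_L: "A \<in> Ob \<Longrightarrow> t' A \<in> L 0 1 (T A) A"
    and t'_t: "A \<in> Ob \<Longrightarrow> t' A * t A = e A"
    and t_t': "A \<in> Ob \<Longrightarrow> t A * t' A = e (T A)"
    and d_T: "A \<in> Ob \<Longrightarrow> d (T A) = - (t A * d A * t' A)"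
    and S_Ob: "A \<in> Ob \<Longrightarrow> S r A \<in> Ob"
    and S_add: "A \<in> Ob \<Longrightarrow> S r (S s A) = S (r + s) A"
    and S_zero: "A \<in> Ob \<Longrightarrow> S 0 A = A"
    and \<sigma>_L: "A \<in> Ob \<Longrightarrow> \<sigma> r A \<in> L r 0 A (S r A)"
    and \<sigma>'_L: "A \<in> Ob \<Longrightarrow> \<sigma>' r A \<in> L (- r) 0 (S r A) A"
    and \<sigma>'_\<sigma>: "A \<in> Ob \<Longrightarrow> \<sigma>' r A * \<sigma> r A = e A"
    and \<sigma>_\<sigma>': "A \<in> Ob \<Longrightarrow> \<sigma> r A * \<sigma>' r A = e (S r A)"
    and d_\<sigma>: "A \<in> Ob \<Longrightarrow> d (S r A) * \<sigma> r A = \<sigma> r A * d A"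
    and \<sigma>_add: "A \<in> Ob \<Longrightarrow> \<sigma> r (S s A) * \<sigma> s A = \<sigma> (r + s) A"
    and \<sigma>_zero: "A \<in> Ob \<Longrightarrow> \<sigma> 0 A = e A"
    and O0_Ob: "O0 \<in> Ob" and e_O0: "e O0 = 0"
begin

definition Z :: "real \<Rightarrow> 'o \<Rightarrow> 'o \<Rightarrow> 'r set" where
  "Z r A B = {x \<in> L r 0 A B. d B * x = x * d A}"

definition Bd :: "real \<Rightarrow> 'o \<Rightarrow> 'o \<Rightarrow> 'r set" where
  "Bd r A B = {x \<in> Z r A B. \<exists>h \<in> L r (-1) A B. x = d B * h + h * d A}"

lemma ZI: "\<lbrakk>x \<in> L r 0 A B; d B * x = x * d A\<rbrakk> \<Longrightarrow> x \<in> Z r A B" by (simp add: Z_def)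
lemma Z_L: "x \<in> Z r A B \<Longrightarrow> x \<in> L r 0 A B" by (simp add: Z_def)
lemma Z_d: "x \<in> Z r A B \<Longrightarrow> d B * x = x * d A" by (simp add: Z_def)
lemma T_Ob: "A \<in> Ob \<Longrightarrow> T A \<in> Ob" using T_bij by (auto simp: bij_betw_def)
lemma T_surj: "A \<in> Ob \<Longrightarrow> \<exists>B\<in>Ob. T B = A" using T_bij by (metis bij_betw_imp_surj_on imageE)

lemma L_diff: "\<lbrakk>A \<in> Ob; B \<in> Ob; x \<in> L r k A B; y \<in> L r k A B\<rbrakk> \<Longrightarrow> x - y \<in> L r k A B"
  using L_add[of A B x r k "-y"] L_minus[of A B y r k] by simp

lemma L_mult': "\<lbrakk>y \<in> L r k B D; x \<in> L s l A B; A \<in> Ob; B \<in> Ob; D \<in> Ob; r + s = u; k + l = m\<rbrakk>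
      \<Longrightarrow> y * x \<in> L u m A D"
  using L_mult by blast

lemma L0_mult: "\<lbrakk>y \<in> L 0 k B D; x \<in> L 0 l A B; A \<in> Ob; B \<in> Ob; D \<in> Ob; k + l = m\<rbrakk>
      \<Longrightarrow> y * x \<in> L 0 m A D"
  using L_mult'[of y 0 k B D x 0 l A 0 m] by simp

lemma Z_zero: "\<lbrakk>A \<in> Ob; B \<in> Ob\<rbrakk> \<Longrightarrow> 0 \<in> Z r A B" by (simp add: Z_def L_zero)
lemma Z_add: "\<lbrakk>A \<in> Ob; B \<in> Ob; x \<in> Z r A B; y \<in> Z r A B\<rbrakk> \<Longrightarrow> x + y \<in> Z r A B"
  by (simp add: Z_def L_add algebra_simps)
lemma Z_minus: "\<lbrakk>A \<in> Ob; B \<in> Ob; x \<in> Z r A B\<rbrakk> \<Longrightarrow> - x \<in> Z r A B"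
  by (simp add: Z_def L_minus)
lemma Z_diff: "\<lbrakk>A \<in> Ob; B \<in> Ob; x \<in> Z r A B; y \<in> Z r A B\<rbrakk> \<Longrightarrow> x - y \<in> Z r A B"
  by (simp add: Z_def L_diff algebra_simps)
lemma Z_mult: "\<lbrakk>A \<in> Ob; B \<in> Ob; D \<in> Ob; y \<in> Z r B D; x \<in> Z s A B\<rbrakk> \<Longrightarrow> y * x \<in> Z (r + s) A D"
proof -
  assume a: "A \<in> Ob" "B \<in> Ob" "D \<in> Ob" "y \<in> Z r B D" "x \<in> Z s A B"
  have "d D * (y * x) = y * (d B * x)" using Z_d[OF a(4)] by (simp add: mult.assoc[symmetric])
  then show ?thesis using a L_mult'[of y r 0 B D x s 0 A "r+s" 0] by (simp add: Z_def mult.assoc)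
qed
lemma Z0_mult: "\<lbrakk>A \<in> Ob; B \<in> Ob; D \<in> Ob; y \<in> Z 0 B D; x \<in> Z 0 A B\<rbrakk> \<Longrightarrow> y * x \<in> Z 0 A D"
  using Z_mult[of A B D y 0 x 0] by simp
lemma Z_mono: "\<lbrakk>A \<in> Ob; B \<in> Ob; r \<le> s; x \<in> Z r A B\<rbrakk> \<Longrightarrow> x \<in> Z s A B"
  by (simp add: Z_def L_mono)
lemma e_Z: "A \<in> Ob \<Longrightarrow> e A \<in> Z 0 A A" by (simp add: Z_def e_L e_d d_e)
lemma Z_left: "\<lbrakk>A \<in> Ob; B \<in> Ob; x \<in> Z r A B\<rbrakk> \<Longrightarrow> e B * x = x" using L_left Z_L by blast
lemma Z_right: "\<lbrakk>A \<in> Ob; B \<in> Ob; x \<in> Z r A B\<rbrakk> \<Longrightarrow> x * e A = x" using L_right Z_L by blast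

lemma BdI: "\<lbrakk>x \<in> Z r A B; h \<in> L r (-1) A B; x = d B * h + h * d A\<rbrakk> \<Longrightarrow> x \<in> Bd r A B"
  by (auto simp: Bd_def)
lemma BdE: assumes "x \<in> Bd r A B"
  obtains h where "h \<in> L r (-1) A B" "x = d B * h + h * d A"
  using assms by (auto simp: Bd_def)
lemma Bd_Z: "x \<in> Bd r A B \<Longrightarrow> x \<in> Z r A B" by (simp add: Bd_def)
lemma Bd_zero: "\<lbrakk>A \<in> Ob; B \<in> Ob\<rbrakk> \<Longrightarrow> 0 \<in> Bd r A B"
  by (rule BdI[of _ _ _ _ 0]) (simp_all add: Z_zero L_zero)

text \<open>An inverse of a map that commutes with the differentials commutes with them too: insert
  \<open>\<sigma> * \<sigma>'\<close> on the right and move \<open>d\<close> across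
  \<open>\<sigma>\<close>.\<close>

lemma \<sigma>'_d: assumes A: "A \<in> Ob" shows "\<sigma>' r A * d (S r A) = d A * \<sigma>' r A"
proof -
  have "\<sigma>' r A * d (S r A) = \<sigma>' r A * d (S r A) * (\<sigma> r A * \<sigma>' r A)"
    using A by (simp add: \<sigma>_\<sigma>' mult.assoc d_e S_Ob)
  also have "\<dots> = \<sigma>' r A * \<sigma> r A * d A * \<sigma>' r A"
    using reassoc[OF d_\<sigma>[OF A, of r]] by (simp add: mult.assoc)
  finally show ?thesis using A by (simp add: \<sigma>'_\<sigma> e_d)
qed

lemma \<sigma>_Z: "A \<in> Ob \<Longrightarrow> \<sigma> r A \<in> Z r A (S r A)" by (simp add: Z_def \<sigma>_L d_\<sigma>)
lemma \<sigma>'_Z: "A \<in> Ob \<Longrightarrow> \<sigma>' r A \<in> Z (- r) (S r A) A" by (simp add: Z_def \<sigma>'_L \<sigma>'_d)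

text \<open>Both sides are inverse to \<open>\<sigma> (r + s) A\<close>, so additivity passes from
  \<open>\<sigma>\<close> to its inverses.\<close>

lemma \<sigma>'_add: assumes A: "A \<in> Ob" shows "\<sigma>' s A * \<sigma>' r (S s A) = \<sigma>' (r + s) A"
proof -
  have m: "\<sigma>' s A * \<sigma>' r (S s A) \<in> L (-(r + s)) 0 (S (r + s) A) A"
    by (rule L_mult'[OF \<sigma>'_L \<sigma>'_L[of "S s A" r, unfolded S_add[OF A]]]) (simp_all add: A S_Ob)
  have "\<sigma>' s A * \<sigma>' r (S s A) = \<sigma>' s A * \<sigma>' r (S s A) * (\<sigma> (r + s) A * \<sigma>' (r + s) A)"
    using A L_right[OF _ _ m] by (simp add: \<sigma>_\<sigma>' S_Ob)
  also have "\<dots> = \<sigma>' s A * ((\<sigma>' r (S s A) * \<sigma> r (S s A)) * (\<sigma> s A * \<sigma>' (r + s) A))"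
    using A by (simp add: \<sigma>_add[symmetric] mult.assoc)
  also have "\<dots> = \<sigma>' s A * (\<sigma> s A * \<sigma>' (r + s) A)"
    using A L_left[OF _ _ \<sigma>_L[OF A, of s]] by (simp add: \<sigma>'_\<sigma> S_Ob mult.assoc[symmetric])
  also have "\<dots> = \<sigma>' (r + s) A"
    using A L_left[OF _ _ \<sigma>'_L[OF A, of "r+s"]] by (simp add: \<sigma>'_\<sigma> S_Ob mult.assoc[symmetric])
  finally show ?thesis .
qed

lemma \<sigma>'_zero: assumes A: "A \<in> Ob" shows "\<sigma>' 0 A = e A"
  using \<sigma>'_\<sigma>[OF A, of 0] L_right[OF _ A \<sigma>'_L[OF A, of 0]] A by (simp add: \<sigma>_zero S_zero)

text \<open>\<open>t\<close> has degree -1 and anticommutes with the differentials. In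
  \<open>t B * x * t' A\<close> the two signs cancel for a cocycle x, while a conjugated homotopy
  changes sign.\<close>

lemma d_t: assumes A: "A \<in> Ob" shows "d (T A) * t A = - (t A * d A)"
  using A by (simp add: d_T t'_t mult.assoc d_e)

lemma t'_d: assumes A: "A \<in> Ob" shows "t' A * d (T A) = - (d A * t' A)"
  using A by (simp add: d_T t'_t mult.assoc[symmetric] e_d)

lemma cone_L:
  assumes "A \<in> Ob" "B \<in> Ob" "U \<in> Z 0 A B"
  shows "Cn A B U \<in> Ob" "i1 A B U \<in> L 0 (-1) A (Cn A B U)" "p1 A B U \<in> L 0 1 (Cn A B U) A"
    "i2 A B U \<in> L 0 0 B (Cn A B U)" "p2 A B U \<in> L 0 0 (Cn A B U) B"
  using assms by (simp_all add: Z_def cone_Ob i1_L p1_L i2_L p2_L)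

text \<open>Oriented as rewrite rules that move the structure maps of a cone together.\<close>

lemma cone_eq:
  assumes "A \<in> Ob" "B \<in> Ob" "U \<in> Z 0 A B"
  shows "p1 A B U * i1 A B U = e A" "p2 A B U * i2 A B U = e B"
    "p1 A B U * i2 A B U = 0" "p2 A B U * i1 A B U = 0"
    "p1 A B U * d (Cn A B U) = - (d A * p1 A B U)"
    "p2 A B U * d (Cn A B U) = U * p1 A B U + d B * p2 A B U"
    "d (Cn A B U) * i1 A B U = i2 A B U * U - i1 A B U * d A"
    "d (Cn A B U) * i2 A B U = i2 A B U * d B"
    "e A * p1 A B U = p1 A B U" "e B * p2 A B U = p2 A B U"
    "i1 A B U * e A = i1 A B U" "i2 A B U * e B = i2 A B U"
    "e (Cn A B U) * i1 A B U = i1 A B U" "e (Cn A B U) * i2 A B U = i2 A B U"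
    "p1 A B U * e (Cn A B U) = p1 A B U" "p2 A B U * e (Cn A B U) = p2 A B U"
    "d B * U = U * d A" "e B * U = U" "U * e A = U"
proof -
  note a = assms(1,2) Z_L[OF assms(3)] Z_d[OF assms(3)]
  show q: "p1 A B U * i1 A B U = e A" "p2 A B U * i2 A B U = e B"
    "p1 A B U * i2 A B U = 0" "p2 A B U * i1 A B U = 0"
    using a p1_i1 p2_i2 p1_i2 p2_i1 by auto
  note l = cone_L[OF assms]
  show f: "e A * p1 A B U = p1 A B U" "e B * p2 A B U = p2 A B U"
    "i1 A B U * e A = i1 A B U" "i2 A B U * e B = i2 A B U"
    "e (Cn A B U) * i1 A B U = i1 A B U" "e (Cn A B U) * i2 A B U = i2 A B U"
    "p1 A B U * e (Cn A B U) = p1 A B U" "p2 A B U * e (Cn A B U) = p2 A B U"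
    "e B * U = U" "U * e A = U"
    using L_left L_right l a by blast+
  show "d B * U = U * d A" by fact
  show "p1 A B U * d (Cn A B U) = - (d A * p1 A B U)"
    "p2 A B U * d (Cn A B U) = U * p1 A B U + d B * p2 A B U"
    "d (Cn A B U) * i1 A B U = i2 A B U * U - i1 A B U * d A"
    "d (Cn A B U) * i2 A B U = i2 A B U * d B"
    using a by (simp_all add: d_cone algebra_simps q q[THEN reassoc] f f[THEN reassoc] e_d[THEN reassoc] d_e)
qed

text \<open>Products are normalised to the right, where a rule for \<open>a * b\<close> no longer
  matches inside \<open>a * (b * x)\<close>; \<open>reassoc\<close> supplies the matching form of
  each rule. With both forms simplification settles most identities between maps of cones.\<close>

lemmas cone_eqs = cone_eq cone_eq[THEN reassoc]

lemma Bd_add: assumes "A \<in> Ob" "B \<in> Ob" "x \<in> Bd r A B" "y \<in> Bd r A B" shows "x + y \<in> Bd r A B"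
proof -
  obtain h k where h: "h \<in> L r (-1) A B" "x = d B * h + h * d A" and k: "k \<in> L r (-1) A B" "y = d B * k + k * d A"
    using assms(3,4) by (auto elim!: BdE)
  show ?thesis
    by (rule BdI[OF Z_add[OF assms(1,2) Bd_Z[OF assms(3)] Bd_Z[OF assms(4)]] L_add[OF assms(1,2) h(1) k(1)]])
      (simp add: h(2) k(2) algebra_simps)
qed

lemma Bd_minus: assumes "A \<in> Ob" "B \<in> Ob" "x \<in> Bd r A B" shows "- x \<in> Bd r A B"
proof -
  obtain h where h: "h \<in> L r (-1) A B" "x = d B * h + h * d A" using assms(3) by (rule BdE)
  show ?thesis
    by (rule BdI[OF Z_minus[OF assms(1,2) Bd_Z[OF assms(3)]] L_minus[OF assms(1,2) h(1)]]) (simp add: h(2))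
qed

lemma Bd_mono: assumes "A \<in> Ob" "B \<in> Ob" "r \<le> s" "x \<in> Bd r A B" shows "x \<in> Bd s A B"
proof -
  obtain h where h: "h \<in> L r (-1) A B" "x = d B * h + h * d A" using assms(4) by (rule BdE)
  show ?thesis by (rule BdI[OF Z_mono[OF assms(1,2,3) Bd_Z[OF assms(4)]] L_mono[OF assms(1,2,3) h(1)] h(2)])
qed

text \<open>For a cocycle x of degree 0 no sign appears:
  \<open>(d D * h + h * d B) * x = d D * (h * x) + (h * x) * d A\<close>.\<close>

lemma Bd_mult_right:
  assumes "A \<in> Ob" "B \<in> Ob" "D \<in> Ob" "y \<in> Bd r B D" "x \<in> Z s A B" shows "y * x \<in> Bd (r + s) A D"
proof -
  obtain h where h: "h \<in> L r (-1) B D" "y = d D * h + h * d B" using assms(4) by (rule BdE)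
  have "h * x \<in> L (r + s) (-1) A D" using L_mult[OF assms(1-3) h(1) Z_L[OF assms(5)]] by simp
  then show ?thesis
    by (rule BdI[OF Z_mult[OF assms(1-3) Bd_Z[OF assms(4)] assms(5)]])
      (simp add: h(2) Z_d[OF assms(5)] algebra_simps)
qed

lemma Bd_mult_left:
  assumes "A \<in> Ob" "B \<in> Ob" "D \<in> Ob" "y \<in> Z r B D" "x \<in> Bd s A B" shows "y * x \<in> Bd (r + s) A D"
proof -
  obtain h where h: "h \<in> L s (-1) A B" "x = d B * h + h * d A" using assms(5) by (rule BdE)
  have "y * h \<in> L (r + s) (-1) A D" using L_mult[OF assms(1-3) Z_L[OF assms(4)] h(1)] by simp
  then show ?thesis
    by (rule BdI[OF Z_mult[OF assms(1-3) assms(4) Bd_Z[OF assms(5)]]])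
      (simp add: h(2) Z_d[OF assms(4), THEN reassoc] algebra_simps)
qed

text \<open>The difference is \<open>(g - y) * f + y * (f - x)\<close>, and products of boundaries
  with cocycles are boundaries. This makes composition of classes independent of
  representatives.\<close>

lemma Bd_cmp:
  assumes o: "A \<in> Ob" "B \<in> Ob" "D \<in> Ob" and z: "y \<in> Z r B D" "g \<in> Z r B D" "x \<in> Z s A B" "f \<in> Z s A B"
    and b: "g - y \<in> Bd r B D" "f - x \<in> Bd s A B"
  shows "g * f - y * x \<in> Bd (r + s) A D"
proof -
  have "(g - y) * f + y * (f - x) \<in> Bd (r + s) A D"
    by (rule Bd_add[OF o(1,3) Bd_mult_right[OF o b(1) z(4)] Bd_mult_left[OF o z(1) b(2)]])
  then show ?thesis by (simp add: algebra_simps)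
qed

lemma t_conj_Z: assumes "A \<in> Ob" "B \<in> Ob" "x \<in> Z r A B" shows "t B * x * t' A \<in> Z r (T A) (T B)"
proof (rule ZI)
  show "t B * x * t' A \<in> L r 0 (T A) (T B)"
    using L_mult[OF T_Ob _ T_Ob L_mult[OF _ _ T_Ob t_L Z_L[OF assms(3)]] t'_L] assms by simp
  show "d (T B) * (t B * x * t' A) = t B * x * t' A * d (T A)"
    using assms by (simp add: mult.assoc d_t[THEN reassoc] t'_d Z_d[OF assms(3), THEN reassoc])
qed

text \<open>Translation of a class is defined as an image of the whole coset, so the boundaries have
  to match exactly. A primitive h corresponds to \<open>- (t B * h * t' A)\<close>, with a sign
  because \<open>t\<close> anticommutes with \<open>d\<close>; the level is unchanged since
  \<open>t\<close> and \<open>t'\<close> have level 0.\<close>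

lemma t_conj_Bd_iff:
  assumes o: "A \<in> Ob" "B \<in> Ob" and z: "y \<in> Z r (T A) (T B)"
  shows "y \<in> Bd r (T A) (T B) \<longleftrightarrow> (\<exists>x\<in>Bd r A B. y = t B * x * t' A)"
proof
  assume "y \<in> Bd r (T A) (T B)"
  then obtain h where h: "h \<in> L r (-1) (T A) (T B)" "y = d (T B) * h + h * d (T A)" by (rule BdE)
  let ?k = "- (t' B * h * t A)" and ?x = "t' B * y * t A"
  have k: "?k \<in> L r (-1) A B"
    using L_minus[OF o L_mult[OF o(1) T_Ob[OF o(1)] o(2) L_mult[OF T_Ob[OF o(1)] T_Ob[OF o(2)] o(2) t'_L[OF o(2)] h(1)] t_L[OF o(1)]]] by simp
  have xL: "?x \<in> L r 0 A B"
    using L_mult[OF o(1) T_Ob[OF o(1)] o(2) L_mult[OF T_Ob[OF o(1)] T_Ob[OF o(2)] o(2) t'_L[OF o(2)] Z_L[OF z]] t_L[OF o(1)]] by simp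
  have e: "?x = d B * ?k + ?k * d A"
    using o by (simp add: h(2) algebra_simps t'_d[THEN reassoc] d_t)
  have "d B * ?x = ?x * d A" unfolding e by (simp add: algebra_simps d_d[OF o(1)] d_d[OF o(2), THEN reassoc])
  then have "?x \<in> Bd r A B" using BdI[OF ZI[OF xL] k e] by blast
  moreover have "y = t B * ?x * t' A"
    using o Z_left[OF _ _ z] Z_right[OF _ _ z] by (simp add: mult.assoc t_t' t_t'[THEN reassoc] T_Ob)
  ultimately show "\<exists>x\<in>Bd r A B. y = t B * x * t' A" by blast
next
  assume "\<exists>x\<in>Bd r A B. y = t B * x * t' A"
  then obtain x where x: "x \<in> Bd r A B" "y = t B * x * t' A" by blast
  from x(1) obtain h where h: "h \<in> L r (-1) A B" "x = d B * h + h * d A" by (rule BdE)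
  show "y \<in> Bd r (T A) (T B)"
  proof (rule BdI[OF z, of "- (t B * h * t' A)"])
    show "- (t B * h * t' A) \<in> L r (-1) (T A) (T B)"
      using L_minus[OF T_Ob[OF o(1)] T_Ob[OF o(2)] L_mult[OF T_Ob[OF o(1)] o(1) T_Ob[OF o(2)] L_mult[OF o T_Ob[OF o(2)] t_L[OF o(2)] h(1)] t'_L[OF o(1)]]] by simp
    show "y = d (T B) * - (t B * h * t' A) + - (t B * h * t' A) * d (T A)"
      using o by (simp add: x(2) h(2) algebra_simps d_t[THEN reassoc] t'_d)
  qed
qed

end

text \<open>The interface between matrices and the category: \<open>cls\<close> turns cocycles into
  morphisms, exactly the boundaries become zero, and each operation of \<open>P\<close> is computed
  on representatives. The axioms for \<open>P\<close> thus become identities modulo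
  \<open>Bd\<close>, where at most an explicit homotopy has to be supplied.\<close>

locale homotopy_presentation = filtered_dg Ob e d L Cn i1 p1 i2 p2 T t t' S \<sigma> \<sigma>' O0
  for Ob :: "'o set" and e d :: "'o \<Rightarrow> 'r :: ring" and L Cn i1 p1 i2 p2 T t t' S \<sigma> \<sigma>' O0 +
  fixes P :: "('o, 'm) tpc" and cls :: "real \<Rightarrow> 'o \<Rightarrow> 'o \<Rightarrow> 'r \<Rightarrow> 'm"
  assumes pob_P: "pob P = Ob"
    and carrier_P: "\<lbrakk>A \<in> Ob; B \<in> Ob\<rbrakk> \<Longrightarrow> carrier (pmor P r A B) = cls r A B ` Z r A B"
    and cls_eq_iff: "\<lbrakk>A \<in> Ob; B \<in> Ob; x \<in> Z r A B; y \<in> Z r A B\<rbrakk>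
      \<Longrightarrow> cls r A B x = cls r A B y \<longleftrightarrow> x - y \<in> Bd r A B"
    and cls_add: "\<lbrakk>A \<in> Ob; B \<in> Ob; x \<in> Z r A B; y \<in> Z r A B\<rbrakk>
      \<Longrightarrow> cls r A B x \<otimes>\<^bsub>pmor P r A B\<^esub> cls r A B y = cls r A B (x + y)"
    and cls_one: "\<lbrakk>A \<in> Ob; B \<in> Ob\<rbrakk> \<Longrightarrow> \<one>\<^bsub>pmor P r A B\<^esub> = cls r A B 0"
    and cls_cmp: "\<lbrakk>A \<in> Ob; B \<in> Ob; D \<in> Ob; x \<in> Z s A B; y \<in> Z r B D\<rbrakk>
      \<Longrightarrow> pcmp P r s A B D (cls r B D y) (cls s A B x) = cls (r + s) A D (y * x)"
    and cls_idt: "A \<in> Ob \<Longrightarrow> pidt P A = cls 0 A A (e A)"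
    and cls_inc: "\<lbrakk>A \<in> Ob; B \<in> Ob; x \<in> Z r A B; r \<le> s\<rbrakk> \<Longrightarrow> pinc P r s A B (cls r A B x) = cls s A B x"
    and shO_P: "shO P = S"
    and cls_sh: "\<lbrakk>A \<in> Ob; B \<in> Ob; x \<in> Z s A B\<rbrakk>
      \<Longrightarrow> shM P r s A B (cls s A B x) = cls s (S r A) (S r B) (\<sigma> r B * x * \<sigma>' r A)"
    and cls_eta: "A \<in> Ob \<Longrightarrow> eta P r s A = cls (s - r) (S r A) (S s A) (\<sigma> s A * \<sigma>' r A)"
    and ptrO_P: "ptrO P = T"
    and cls_tr: "\<lbrakk>A \<in> Ob; B \<in> Ob; x \<in> Z 0 A B\<rbrakk>
      \<Longrightarrow> ptrM P A B (cls 0 A B x) = cls 0 (T A) (T B) (t B * x * t' A)"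
    and pexact_P: "pexact P = {tr. is_triangle (level_zero_cat P) (ptrO P) tr \<and>
      (\<exists>A B U. A \<in> Ob \<and> B \<in> Ob \<and> U \<in> Z 0 A B \<and>
        isomorphic_triangles (level_zero_cat P) (ptrO P) (ptrM P) tr
          (A, B, Cn A B U, cls 0 A B U, cls 0 B (Cn A B U) (i2 A B U),
           cls 0 (Cn A B U) (T A) (t A * p1 A B U)))}"
begin

section \<open>The persistence category of homotopy classes and its shifts\<close>

lemma pmor_comm_group: assumes A: "A \<in> Ob" and B: "B \<in> Ob" shows "comm_group (pmor P r A B)"
proof (rule comm_groupI)
  fix x y assume "x \<in> carrier (pmor P r A B)" "y \<in> carrier (pmor P r A B)"
  then show "x \<otimes>\<^bsub>pmor P r A B\<^esub> y \<in> carrier (pmor P r A B)"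
    by (auto simp: carrier_P A B cls_add Z_add)
next
  show "\<one>\<^bsub>pmor P r A B\<^esub> \<in> carrier (pmor P r A B)"
    using Z_zero[OF A B] by (auto simp: carrier_P A B cls_one)
next
  fix x y z assume "x \<in> carrier (pmor P r A B)" "y \<in> carrier (pmor P r A B)" "z \<in> carrier (pmor P r A B)"
  then show "x \<otimes>\<^bsub>pmor P r A B\<^esub> y \<otimes>\<^bsub>pmor P r A B\<^esub> z = x \<otimes>\<^bsub>pmor P r A B\<^esub> (y \<otimes>\<^bsub>pmor P r A B\<^esub> z)"
    by (auto simp: carrier_P A B cls_add Z_add add.assoc)
next
  fix x y assume "x \<in> carrier (pmor P r A B)" "y \<in> carrier (pmor P r A B)"
  then show "x \<otimes>\<^bsub>pmor P r A B\<^esub> y = y \<otimes>\<^bsub>pmor P r A B\<^esub> x"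
    by (auto simp: carrier_P A B cls_add add.commute)
next
  fix x assume "x \<in> carrier (pmor P r A B)"
  then show "\<one>\<^bsub>pmor P r A B\<^esub> \<otimes>\<^bsub>pmor P r A B\<^esub> x = x"
    by (auto simp: carrier_P A B cls_one cls_add Z_zero)
next
  fix x assume "x \<in> carrier (pmor P r A B)"
  then obtain a where a: "a \<in> Z r A B" "x = cls r A B a" by (auto simp: carrier_P A B)
  then show "\<exists>y\<in>carrier (pmor P r A B). y \<otimes>\<^bsub>pmor P r A B\<^esub> x = \<one>\<^bsub>pmor P r A B\<^esub>"
    using A B by (intro bexI[of _ "cls r A B (- a)"]) (auto simp: carrier_P cls_one cls_add Z_minus)
qed

lemma cls_minus:
  assumes "A \<in> Ob" "B \<in> Ob" "x \<in> Z r A B"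
  shows "inv\<^bsub>pmor P r A B\<^esub> (cls r A B x) = cls r A B (- x)"
proof -
  interpret G: comm_group "pmor P r A B" by (rule pmor_comm_group) fact+
  show ?thesis using assms
    by (intro G.inv_equality) (auto simp: carrier_P cls_add cls_one Z_minus)
qed

lemma persistence: "persistence_category P"
proof (rule persistence_category.intro)
  show "pinc P r s A B \<in> hom (pmor P r A B) (pmor P s A B)"
    if "A \<in> pob P" "B \<in> pob P" "r \<le> s" for A B r s
    using that by (auto simp: pob_P hom_def carrier_P cls_inc cls_add Z_mono[of A B r s] Z_add)
  show "pcmp P r' s' A B D (pinc P r r' B D f) (pinc P s s' A B g) =
            pinc P (r + s) (r' + s') A D (pcmp P r s A B D f g)"
    if "A \<in> pob P" "B \<in> pob P" "D \<in> pob P" "r \<le> r'" "s \<le> s'"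
          "f \<in> carrier (pmor P r B D)" "g \<in> carrier (pmor P s A B)" for A B D r r' s s' f g
    using that by (auto simp: pob_P carrier_P cls_inc cls_cmp Z_mono[of B D r r'] Z_mono[of A B s s'] Z_mult)
  show "pinc P s t A B (pinc P r s A B f) = pinc P r t A B f"
    if "A \<in> pob P" "B \<in> pob P" "r \<le> s" "s \<le> t" "f \<in> carrier (pmor P r A B)" for A B r s t f
    using that by (auto simp: pob_P carrier_P cls_inc Z_mono[of A B r s])
qed (auto simp: pob_P carrier_P cls_inc cls_cmp cls_idt cls_add Z_mult Z_add pmor_comm_group
      mult.assoc add.assoc distrib_left distrib_right e_Z Z_left Z_right)

lemma conj_Z: assumes "A \<in> Ob" "B \<in> Ob" "x \<in> Z s A B"
  shows "\<sigma> r B * x * \<sigma>' r A \<in> Z s (S r A) (S r B)"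
  using Z_mult[OF _ _ _ Z_mult[OF _ _ _ \<sigma>_Z assms(3)] \<sigma>'_Z, of r r] assms by (simp add: S_Ob)

lemma eta_Z: assumes "A \<in> Ob" shows "\<sigma> s A * \<sigma>' r A \<in> Z (s - r) (S r A) (S s A)"
  using Z_mult[OF _ _ _ \<sigma>_Z[of A s] \<sigma>'_Z[of A r]] assms by (simp add: S_Ob)

lemma \<sigma>_e: "A \<in> Ob \<Longrightarrow> \<sigma> r A * e A = \<sigma> r A" "A \<in> Ob \<Longrightarrow> e A * \<sigma>' r A = \<sigma>' r A"
  "A \<in> Ob \<Longrightarrow> e (S r A) * \<sigma> r A = \<sigma> r A" "A \<in> Ob \<Longrightarrow> \<sigma>' r A * e (S r A) = \<sigma>' r A"
  by (auto intro!: L_right[OF _ _ \<sigma>_L] L_left[OF _ _ \<sigma>'_L] L_left[OF _ _ \<sigma>_L] L_right[OF _ _ \<sigma>'_L] S_Ob)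

lemmas \<sigma>_eqs = \<sigma>_e \<sigma>_e[THEN reassoc] \<sigma>'_\<sigma> \<sigma>'_\<sigma>[THEN reassoc] \<sigma>_\<sigma>' \<sigma>_\<sigma>'[THEN reassoc]
  \<sigma>_add \<sigma>_add[THEN reassoc] \<sigma>'_add \<sigma>'_add[THEN reassoc] \<sigma>_zero \<sigma>'_zero S_zero S_add

lemma persistence_shift: "persistence_category_with_shift P"
proof -
  interpret persistence_category P by (rule persistence)
  show ?thesis
  proof (intro persistence_category_with_shift.intro persistence_category_with_shift_axioms.intro persistence)
    fix A r assume "A \<in> pob P" then show "shO P r A \<in> pob P" by (simp add: pob_P shO_P S_Ob)
  next
    fix A B r s assume "A \<in> pob P" "B \<in> pob P"
    then show "shM P r s A B \<in> hom (pmor P s A B) (pmor P s (shO P r A) (shO P r B))"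
      using conj_Z by (auto simp: pob_P hom_def carrier_P shO_P S_Ob cls_sh cls_add Z_add distrib_left distrib_right)
  next
    fix A r assume "A \<in> pob P"
    then show "shM P r 0 A A (pidt P A) = pidt P (shO P r A)"
      by (simp add: pob_P cls_idt cls_sh e_Z shO_P S_Ob \<sigma>_eqs)
  next
    fix A B D f g r s t assume a: "A \<in> pob P" "B \<in> pob P" "D \<in> pob P"
      "f \<in> carrier (pmor P t A B)" "g \<in> carrier (pmor P s B D)"
    then obtain x y where xy: "x \<in> Z t A B" "f = cls t A B x" "y \<in> Z s B D" "g = cls s B D y"
      by (auto simp: pob_P carrier_P)
    \<comment> \<open>Conjugating the two factors separately leaves
      \<open>\<sigma>' r B * \<sigma> r B\<close>, that is \<open>e B\<close>, in the middle; this
      absorbs it.\<close>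
    have "e B * (x * z) = x * z" for z
      using a xy Z_left[THEN reassoc, of A B x t] by (simp add: pob_P)
    then show "shM P r (s + t) A D (pcmp P s t A B D g f) =
            pcmp P s t (shO P r A) (shO P r B) (shO P r D) (shM P r s B D g) (shM P r t A B f)"
      using a by (simp add: xy pob_P cls_sh cls_cmp Z_mult[OF _ _ _ xy(3) xy(1)] conj_Z conj_Z[unfolded mult.assoc] S_Ob shO_P \<sigma>_eqs mult.assoc)
  next
    fix A B f r s t assume a: "A \<in> pob P" "B \<in> pob P" "s \<le> t" "f \<in> carrier (pmor P s A B)"
    then show "shM P r t A B (pinc P s t A B f) = pinc P s t (shO P r A) (shO P r B) (shM P r s A B f)"
      by (auto simp: pob_P carrier_P cls_inc cls_sh Z_mono[of A B s t] conj_Z conj_Z[unfolded mult.assoc] S_Ob shO_P)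
  next
    fix A r s assume "A \<in> pob P" then show "shO P r (shO P s A) = shO P (r + s) A"
      by (simp add: pob_P shO_P S_add)
  next
    fix A assume "A \<in> pob P" then show "shO P 0 A = A" by (simp add: pob_P shO_P S_zero)
  next
    fix A B f r s t assume a: "A \<in> pob P" "B \<in> pob P" "f \<in> carrier (pmor P t A B)"
    then show "shM P r t (shO P s A) (shO P s B) (shM P s t A B f) = shM P (r + s) t A B f"
      by (auto simp: pob_P carrier_P cls_sh conj_Z conj_Z[unfolded mult.assoc] S_Ob shO_P \<sigma>_eqs mult.assoc)
  next
    fix A B f t assume a: "A \<in> pob P" "B \<in> pob P" "f \<in> carrier (pmor P t A B)"
    then show "shM P 0 t A B f = f"
      by (auto simp: pob_P carrier_P cls_sh \<sigma>_eqs Z_left Z_right)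
  next
    fix A r s assume "A \<in> pob P"
    then show "eta P r s A \<in> carrier (pmor P (s - r) (shO P r A) (shO P s A))"
      by (simp add: pob_P carrier_P shO_P S_Ob cls_eta eta_Z)
  next
    fix A B f t r s assume a: "A \<in> pob P" "B \<in> pob P" "f \<in> carrier (pmor P t A B)"
    then obtain x where x: "x \<in> Z t A B" "f = cls t A B x" by (auto simp: pob_P carrier_P)
    have "e B * (x * z) = x * z" for z
      using a x Z_left[THEN reassoc, of A B x t] by (simp add: pob_P)
    then show "pcmp P (s - r) t (shO P r A) (shO P r B) (shO P s B) (eta P r s B) (shM P r t A B f) =
            pcmp P t (s - r) (shO P r A) (shO P s A) (shO P s B) (shM P s t A B f) (eta P r s A)"
      \<comment> \<open>The level is part of a class, so \<open>t + (s - r)\<close> has to be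
        rewritten to \<open>(s - r) + t\<close> before the two sides can agree.\<close>
      using a by (simp add: x pob_P cls_sh cls_eta cls_cmp eta_Z conj_Z conj_Z[unfolded mult.assoc] S_Ob shO_P \<sigma>_eqs mult.assoc
          add.commute[of t "s - r"])
  next
    fix A r s assume a: "A \<in> pob P"
    then show "\<exists>\<theta>\<in>carrier (pmor P (r - s) (shO P s A) (shO P r A)).
          pcmp P (r - s) (s - r) (shO P r A) (shO P s A) (shO P r A) \<theta> (eta P r s A) = pidt P (shO P r A) \<and>
          pcmp P (s - r) (r - s) (shO P s A) (shO P r A) (shO P s A) (eta P r s A) \<theta> = pidt P (shO P s A)"
      by (intro bexI[of _ "eta P s r A"])
         (simp_all add: pob_P carrier_P shO_P S_Ob cls_eta eta_Z cls_cmp cls_idt \<sigma>_eqs mult.assoc)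
  next
    fix A r r' s assume a: "A \<in> pob P"
    then show "pcmp P (s - r') (r' - r) (shO P r A) (shO P r' A) (shO P s A) (eta P r' s A) (eta P r r' A)
            = eta P r s A"
      by (simp add: pob_P carrier_P shO_P S_Ob cls_eta eta_Z cls_cmp cls_idt \<sigma>_eqs mult.assoc)
  next
    fix A r assume a: "A \<in> pob P"
    then show "eta P r r A = pidt P (shO P r A)"
      by (simp add: pob_P shO_P S_Ob cls_eta cls_idt \<sigma>_eqs)
  next
    fix A r s t assume a: "A \<in> pob P"
    then show "shM P t (s - r) (shO P r A) (shO P s A) (eta P r s A) = eta P (r + t) (s + t) A"
      by (simp add: pob_P shO_P S_Ob cls_eta cls_sh eta_Z \<sigma>_eqs mult.assoc add.commute[of t s] add.commute[of t r])
  qed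
qed

end

section \<open>Isomorphisms, commuting squares and isomorphic triangles\<close>

context preadditive_category
begin

lemma iso_mor: "is_iso X A B f \<Longrightarrow> f \<in> carrier (mor X A B)" by (simp add: is_iso_def)

lemma iso_inverse:
  assumes "is_iso X A B f"
  obtains g where "is_iso X B A g" "cmp X A B A g f = idt X A" "cmp X B A B f g = idt X B"
  using assms unfolding is_iso_def by blast

lemma iso_idt: "A \<in> ob X \<Longrightarrow> is_iso X A A (idt X A)"
  unfolding is_iso_def using idt_closed idt_left by blast

text \<open>A left inverse g and a right inverse h agree, as g = g f h = h.\<close>

lemma iso_left_right:
  assumes o: "A \<in> ob X" "B \<in> ob X" and f: "f \<in> carrier (mor X A B)"
    and g: "g \<in> carrier (mor X B A)" "cmp X A B A g f = idt X A"
    and h: "h \<in> carrier (mor X B A)" "cmp X B A B f h = idt X B"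
  shows "is_iso X A B f"
proof -
  have "g = cmp X B A A (cmp X A B A g f) h"
    using cmp_assoc[OF o(2,1,2,1) h(1) f g(1)] h(2) idt_right[OF o(2,1) g(1)] by simp
  then have "g = h" using g(2) idt_left[OF o(2,1) h(1)] by simp
  then show ?thesis using f g h unfolding is_iso_def by blast
qed

lemma iso_cmp:
  assumes o: "A \<in> ob X" "B \<in> ob X" "D \<in> ob X" and f: "is_iso X A B f" and g: "is_iso X B D g"
  shows "is_iso X A D (cmp X A B D g f)"
proof -
  obtain f' where f': "is_iso X B A f'" "cmp X A B A f' f = idt X A" "cmp X B A B f f' = idt X B"
    by (rule iso_inverse[OF f])
  obtain g' where g': "is_iso X D B g'" "cmp X B D B g' g = idt X B" "cmp X D B D g g' = idt X D"
    by (rule iso_inverse[OF g])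
  note m = iso_mor[OF f] iso_mor[OF g] iso_mor[OF f'(1)] iso_mor[OF g'(1)]
  have "cmp X A B A f' (cmp X A B B (cmp X B D B g' g) f) = idt X A"
    using m o f' g' by (simp add: idt_left)
  moreover have "cmp X D B D g (cmp X D B B (cmp X B A B f f') g') = idt X D"
    using m o f' g' by (simp add: idt_left)
  ultimately show ?thesis
    using m o unfolding is_iso_def
    by (intro conjI bexI[of _ "cmp X D B A f' g'"]) (simp_all add: cmp_assoc cmp_closed)
qed

text \<open>Correcting g by the inverses of the two composites yields a left and a right inverse of
  f. Maps of cones need this form, since their composites are known to be automorphisms but need not
  be identities.\<close>

lemma iso_of_cmps:
  assumes o: "A \<in> ob X" "B \<in> ob X" and f: "f \<in> carrier (mor X A B)"
    and g: "g \<in> carrier (mor X B A)" and l: "is_iso X A A (cmp X A B A g f)"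
    and r: "is_iso X B B (cmp X B A B f g)"
  shows "is_iso X A B f"
proof -
  obtain l' where l': "is_iso X A A l'" "cmp X A A A l' (cmp X A B A g f) = idt X A"
    by (rule iso_inverse[OF l])
  obtain r' where r': "is_iso X B B r'" "cmp X B B B (cmp X B A B f g) r' = idt X B"
    by (rule iso_inverse[OF r])
  show ?thesis
    using iso_mor[OF l'(1)] iso_mor[OF r'(1)] l'(2) r'(2) o f g
    by (intro iso_left_right[OF o f, of "cmp X B A A l' g" "cmp X B B A g r'"])
       (simp_all add: cmp_assoc cmp_closed)
qed

text \<open>Reverses the vertical arrows of a commuting square. One relation on each side suffices:
  a' is a right inverse of a, and b' is a left inverse of b.\<close>

lemma iso_swap:
  assumes o: "A \<in> ob X" "B \<in> ob X" "A' \<in> ob X" "B' \<in> ob X"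
    and u: "u \<in> carrier (mor X A B)" "u' \<in> carrier (mor X A' B')"
    and a: "a \<in> carrier (mor X A A')" "a' \<in> carrier (mor X A' A)" "cmp X A' A A' a a' = idt X A'"
    and b: "b \<in> carrier (mor X B B')" "b' \<in> carrier (mor X B' B)" "cmp X B B' B b' b = idt X B"
    and e: "cmp X A B B' b u = cmp X A A' B' u' a"
  shows "cmp X A' B' B b' u' = cmp X A' A B u a'"
proof -
  have "cmp X A' B' B b' u' = cmp X A' B' B b' (cmp X A' A' B' u' (cmp X A' A A' a a'))"
    using assms by (simp add: idt_right)
  also have "\<dots> = cmp X A' B' B b' (cmp X A' A B' (cmp X A B B' b u) a')"
    using assms by (simp add: cmp_assoc)
  also have "\<dots> = cmp X A' B B (cmp X B B' B b' b) (cmp X A' A B u a')"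
    using cmp_assoc[of A' B B' B "cmp X A' A B u a'" b b'] o u a b(1,2)
    by (simp add: cmp_assoc cmp_closed)
  also have "\<dots> = cmp X A' A B u a'" using assms by (simp add: cmp_closed idt_left)
  finally show ?thesis .
qed

lemma square_paste:
  assumes o: "A \<in> ob X" "B \<in> ob X" "A' \<in> ob X" "B' \<in> ob X" "A'' \<in> ob X" "B'' \<in> ob X"
    and u: "u \<in> carrier (mor X A B)" "u' \<in> carrier (mor X A' B')" "u'' \<in> carrier (mor X A'' B'')"
    and a: "a \<in> carrier (mor X A A')" "a' \<in> carrier (mor X A' A'')"
    and b: "b \<in> carrier (mor X B B')" "b' \<in> carrier (mor X B' B'')"
    and e: "cmp X A B B' b u = cmp X A A' B' u' a"
    and e': "cmp X A' B' B'' b' u' = cmp X A' A'' B'' u'' a'"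
  shows "cmp X A B B'' (cmp X B B' B'' b' b) u = cmp X A A'' B'' u'' (cmp X A A' A'' a' a)"
proof -
  have "cmp X A B B'' (cmp X B B' B'' b' b) u = cmp X A B' B'' b' (cmp X A A' B' u' a)"
    using o u a b e by (simp add: cmp_assoc)
  also have "\<dots> = cmp X A A' B'' (cmp X A' A'' B'' u'' a') a"
    using o u a b e'[symmetric] by (simp add: cmp_assoc)
  finally show ?thesis using o u a b by (simp add: cmp_assoc)
qed

end

text \<open>Serves twice: for the translation functor, and for the level-zero part of each
  shift.\<close>

locale translated_category = preadditive_category X + additive_endofunctor X F FM
  for X :: "('o, 'm, 'z) ab_cat_scheme" and F :: "'o \<Rightarrow> 'o" and FM
begin

lemma FM_closed: "\<lbrakk>A \<in> ob X; B \<in> ob X; f \<in> carrier (mor X A B)\<rbrakk> \<Longrightarrow> FM A B f \<in> carrier (mor X (F A) (F B))"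
  using FM_hom by (auto simp: hom_def)

lemma FM_iso: assumes o: "A \<in> ob X" "B \<in> ob X" and f: "is_iso X A B f"
  shows "is_iso X (F A) (F B) (FM A B f)"
proof -
  obtain g where g: "is_iso X B A g" "cmp X A B A g f = idt X A" "cmp X B A B f g = idt X B"
    by (rule iso_inverse[OF f])
  note m = iso_mor[OF f] iso_mor[OF g(1)]
  show ?thesis unfolding is_iso_def
    using o m FM_closed FM_cmp[OF o(1,2,1) m] FM_cmp[OF o(2,1,2) m(2,1)] g(2,3)
    by (intro conjI bexI[of _ "FM B A g"]) (simp_all add: FM_idt)
qed

lemma isomorphic_triangles_trans:
  assumes "isomorphic_triangles X F FM s t" "isomorphic_triangles X F FM t u"
    and "is_triangle X F s" "is_triangle X F t" "is_triangle X F u"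
  shows "isomorphic_triangles X F FM s u"
proof -
  obtain A B D u0 v0 w0 where s: "s = (A, B, D, u0, v0, w0)" by (metis prod_cases6)
  obtain A' B' D' u1 v1 w1 where t: "t = (A', B', D', u1, v1, w1)" by (metis prod_cases6)
  obtain A'' B'' D'' u2 v2 w2 where u: "u = (A'', B'', D'', u2, v2, w2)" by (metis prod_cases6)
  from assms(1) s t obtain a b d where 1: "is_iso X A A' a" "is_iso X B B' b" "is_iso X D D' d"
    "cmp X A B B' b u0 = cmp X A A' B' u1 a" "cmp X B D D' d v0 = cmp X B B' D' v1 b"
    "cmp X D (F A) (F A') (FM A A' a) w0 = cmp X D D' (F A') w1 d"
    by (auto simp: isomorphic_triangles_def)
  from assms(2) t u obtain a' b' d' where 2: "is_iso X A' A'' a'" "is_iso X B' B'' b'" "is_iso X D' D'' d'"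
    "cmp X A' B' B'' b' u1 = cmp X A' A'' B'' u2 a'" "cmp X B' D' D'' d' v1 = cmp X B' B'' D'' v2 b'"
    "cmp X D' (F A') (F A'') (FM A' A'' a') w1 = cmp X D' D'' (F A'') w2 d'"
    by (auto simp: isomorphic_triangles_def)
  note o = assms(3-5)[unfolded s t u is_triangle_def, simplified]
  note m = 1(1-3)[THEN iso_mor] 2(1-3)[THEN iso_mor]
  show ?thesis unfolding s u isomorphic_triangles_def prod.case
  proof (intro exI conjI)
    show "is_iso X A A'' (cmp X A A' A'' a' a)" "is_iso X B B'' (cmp X B B' B'' b' b)"
      "is_iso X D D'' (cmp X D D' D'' d' d)"
      using o 1 2 by (auto intro: iso_cmp)
    show "cmp X A B B'' (cmp X B B' B'' b' b) u0 = cmp X A A'' B'' u2 (cmp X A A' A'' a' a)"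
      using o m 1 2 by (intro square_paste[where u'=u1]) auto
    show "cmp X B D D'' (cmp X D D' D'' d' d) v0 = cmp X B B'' D'' v2 (cmp X B B' B'' b' b)"
      using o m 1 2 by (intro square_paste[where u'=v1]) auto
    have "cmp X D (F A) (F A'') (cmp X (F A) (F A') (F A'') (FM A' A'' a') (FM A A' a)) w0 =
      cmp X D D'' (F A'') w2 (cmp X D D' D'' d' d)"
      using o m 1 2 by (intro square_paste[where u'=w1]) (auto intro: FM_closed FO_closed)
    then show "cmp X D (F A) (F A'') (FM A A'' (cmp X A A' A'' a' a)) w0 =
      cmp X D D'' (F A'') w2 (cmp X D D' D'' d' d)"
      using o m by (simp add: FM_cmp)
  qed
qed

lemma isomorphic_triangles_sym:
  assumes "isomorphic_triangles X F FM s t" and "is_triangle X F s" "is_triangle X F t"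
  shows "isomorphic_triangles X F FM t s"
proof -
  obtain A B D u0 v0 w0 where s: "s = (A, B, D, u0, v0, w0)" by (metis prod_cases6)
  obtain A' B' D' u1 v1 w1 where t: "t = (A', B', D', u1, v1, w1)" by (metis prod_cases6)
  from assms(1) s t obtain a b d where 1: "is_iso X A A' a" "is_iso X B B' b" "is_iso X D D' d"
    "cmp X A B B' b u0 = cmp X A A' B' u1 a" "cmp X B D D' d v0 = cmp X B B' D' v1 b"
    "cmp X D (F A) (F A') (FM A A' a) w0 = cmp X D D' (F A') w1 d"
    by (auto simp: isomorphic_triangles_def)
  note o = assms(2,3)[unfolded s t is_triangle_def, simplified]
  obtain a' where a: "is_iso X A' A a'" "cmp X A A' A a' a = idt X A" "cmp X A' A A' a a' = idt X A'"
    by (rule iso_inverse[OF 1(1)])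
  obtain b' where b: "is_iso X B' B b'" "cmp X B B' B b' b = idt X B" "cmp X B' B B' b b' = idt X B'"
    by (rule iso_inverse[OF 1(2)])
  obtain d' where d: "is_iso X D' D d'" "cmp X D D' D d' d = idt X D" "cmp X D' D D' d d' = idt X D'"
    by (rule iso_inverse[OF 1(3)])
  note m = 1(1-3)[THEN iso_mor] a(1)[THEN iso_mor] b(1)[THEN iso_mor] d(1)[THEN iso_mor]
  \<comment> \<open>Reversing the third square needs an inverse for the image of a, and
    \<open>FM\<close> of a' is one.\<close>
  have Fa: "cmp X (F A) (F A') (F A) (FM A' A a') (FM A A' a) = idt X (F A)"
    using o m a FM_cmp[of A A' A a a'] by (simp add: FM_idt)
  show ?thesis unfolding s t isomorphic_triangles_def prod.case
  proof (intro exI conjI)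
    show "is_iso X A' A a'" "is_iso X B' B b'" "is_iso X D' D d'" by fact+
    show "cmp X A' B' B b' u1 = cmp X A' A B u0 a'"
      by (rule iso_swap[where a=a and b=b]) (use o m 1 a b in auto)
    show "cmp X B' D' D d' v1 = cmp X B' B D v0 b'"
      by (rule iso_swap[where a=b and b=d]) (use o m 1 b d in auto)
    show "cmp X D' (F A') (F A) (FM A' A a') w1 = cmp X D' D (F A) w0 d'"
      by (rule iso_swap[where a=d and b="FM A A' a"]) (use o m 1 d Fa in \<open>auto intro: FM_closed FO_closed\<close>)
  qed
qed

end

section \<open>The level-zero category, its translation and maps of cones\<close>

context homotopy_presentation
begin

abbreviation X where "X \<equiv> level_zero P"
abbreviation q where "q \<equiv> cls 0"

lemma X_simps [simp]: "ob X = Ob" "mor X = pmor P 0" "cmp X = pcmp P 0 0" "idt X = pidt P"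
  "trO X = T" "trM X = ptrM P" "exact X = pexact P"
  by (simp_all add: level_zero_def level_zero_cat_def ab_cat.defs pob_P ptrO_P)

text \<open>Exactness is phrased over the record \<open>level_zero_cat P\<close>, the triangulated
  axioms over its extension \<open>level_zero P\<close>. The predicates read only fields that both
  share.\<close>

lemma level_zero_cat_X:
  "is_triangle (level_zero_cat P) = is_triangle X"
  "isomorphic_triangles (level_zero_cat P) = isomorphic_triangles X"
  by (auto simp: fun_eq_iff is_triangle_def isomorphic_triangles_def is_iso_def level_zero_cat_def pob_P)

lemma q_carrier: "\<lbrakk>A \<in> Ob; B \<in> Ob; x \<in> Z 0 A B\<rbrakk> \<Longrightarrow> q A B x \<in> carrier (pmor P 0 A B)"
  by (simp add: carrier_P)

lemma q_cmp: "\<lbrakk>A \<in> Ob; B \<in> Ob; D \<in> Ob; x \<in> Z 0 A B; y \<in> Z 0 B D\<rbrakk>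
    \<Longrightarrow> pcmp P 0 0 A B D (q B D y) (q A B x) = q A D (y * x)"
  by (simp add: cls_cmp)

lemma q_eqI: "\<lbrakk>A \<in> Ob; B \<in> Ob; x \<in> Z 0 A B; y \<in> Z 0 A B; h \<in> L 0 (-1) A B; x - y = d B * h + h * d A\<rbrakk>
    \<Longrightarrow> q A B x = q A B y"
  using BdI[OF Z_diff] by (simp add: cls_eq_iff)

lemma q_eqE:
  assumes "A \<in> Ob" "B \<in> Ob" "x \<in> Z 0 A B" "y \<in> Z 0 A B" "q A B x = q A B y"
  obtains h where "h \<in> L 0 (-1) A B" "x - y = d B * h + h * d A"
  using assms by (auto simp: cls_eq_iff elim: BdE)

sublocale pre: preadditive_category X
proof -
  interpret persistence_category P by (rule persistence)
  show "preadditive_category X"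
  proof (rule preadditive_category.intro)
  qed (auto simp: pob_P carrier_P q_cmp cls_idt cls_add Z0_mult Z_add pmor_comm_group
      mult.assoc distrib_left distrib_right e_Z Z_left Z_right)
qed

lemma T_conj: assumes "A \<in> Ob" "B \<in> Ob" "x \<in> Z 0 A B" shows "t B * x * t' A \<in> Z 0 (T A) (T B)"
proof (rule ZI)
  have 1: "x * t' A \<in> L 0 1 (T A) B" by (rule L0_mult[OF Z_L t'_L]) (use assms T_Ob in auto)
  show "t B * x * t' A \<in> L 0 0 (T A) (T B)"
    unfolding mult.assoc by (rule L0_mult[OF t_L 1]) (use assms T_Ob in auto)
  show "d (T B) * (t B * x * t' A) = t B * x * t' A * d (T A)"
    using assms d_t[THEN reassoc, of B] t'_d[of A] Z_d[OF assms(3), THEN reassoc] by (simp add: mult.assoc)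
qed

lemma t_e: "A \<in> Ob \<Longrightarrow> t A * e A = t A" "A \<in> Ob \<Longrightarrow> e A * t' A = t' A"
  "A \<in> Ob \<Longrightarrow> e (T A) * t A = t A" "A \<in> Ob \<Longrightarrow> t' A * e (T A) = t' A"
  by (auto intro!: L_right[OF _ _ t_L] L_left[OF _ _ t'_L] L_left[OF _ _ t_L] L_right[OF _ _ t'_L] T_Ob)

lemmas t_eqs = t_e t_e[THEN reassoc] t'_t t'_t[THEN reassoc] t_t' t_t'[THEN reassoc]
  d_t d_t[THEN reassoc] t'_d t'_d[THEN reassoc]
lemmas d_eqs = d_d d_d[THEN reassoc] e_d e_d[THEN reassoc] d_e d_e[THEN reassoc]

lemmas ring_norm = distrib_left distrib_right mult.assoc right_diff_distrib left_diff_distrib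

sublocale tr: translated_category X T "ptrM P"
proof (intro translated_category.intro pre.preadditive_category_axioms additive_endofunctor.intro)
  fix A B assume o: "A \<in> ob X" "B \<in> ob X"
  show "ptrM P A B \<in> hom (mor X A B) (mor X (T A) (T B))"
    using o by (auto simp: hom_def carrier_P T_Ob cls_tr T_conj cls_add Z_add ring_norm
        T_conj[unfolded mult.assoc])
next
  fix A B D f g assume a: "A \<in> ob X" "B \<in> ob X" "D \<in> ob X" "f \<in> carrier (mor X A B)" "g \<in> carrier (mor X B D)"
  then obtain x y where xy: "x \<in> Z 0 A B" "f = q A B x" "y \<in> Z 0 B D" "g = q B D y"
    by (auto simp: carrier_P)
  then show "ptrM P A D (cmp X A B D g f) = cmp X (T A) (T B) (T D) (ptrM P B D g) (ptrM P A B f)"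
    using a Z_left[OF _ _ xy(1)]
    by (simp add: q_cmp T_Ob cls_tr T_conj Z0_mult[OF _ _ _ xy(3,1)] mult.assoc t_eqs
        T_conj[unfolded mult.assoc] Z_left[OF _ _ xy(1), THEN reassoc])
qed (auto simp: T_Ob cls_idt cls_tr e_Z t_eqs)

text \<open>A homotopy h between the translates comes back as \<open>- (t' B * (h * t A))\<close>, a
  homotopy of the same level.\<close>

lemma T_inj: assumes o: "A \<in> Ob" "B \<in> Ob" and x: "x \<in> Z 0 A B" and y: "y \<in> Z 0 A B"
    and eq: "ptrM P A B (q A B x) = ptrM P A B (q A B y)"
  shows "q A B x = q A B y"
proof -
  obtain h where h: "h \<in> L 0 (-1) (T A) (T B)"
      "t B * x * t' A - t B * y * t' A = d (T B) * h + h * d (T A)"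
    using q_eqE[OF T_Ob T_Ob T_conj T_conj] eq o x y by (metis cls_tr)
  have "t' B * (t B * x * t' A - t B * y * t' A) * t A = x - y"
    using o by (simp add: ring_norm t_eqs Z_left[OF _ _ x, THEN reassoc] Z_left[OF _ _ y, THEN reassoc]
        Z_right[OF _ _ x] Z_right[OF _ _ y] )
  then have eq: "x - y = t' B * (d (T B) * h + h * d (T A)) * t A" using h by simp
  have 1: "h * t A \<in> L 0 (-2) A (T B)" by (rule L0_mult[OF h(1) t_L]) (use o T_Ob in auto)
  have 2: "t' B * (h * t A) \<in> L 0 (-1) A B" by (rule L0_mult[OF t'_L 1]) (use o T_Ob in auto)
  show ?thesis
    by (rule q_eqI[OF o x y L_minus[OF o 2]]) (use o in \<open>simp add: eq ring_norm t_eqs\<close>)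
qed

text \<open>Translation is onto already for cocycles, before homotopies enter:
  \<open>t' B * (y * t A)\<close> is a preimage.\<close>

lemma T_surj_mor: assumes o: "A \<in> Ob" "B \<in> Ob" and y: "y \<in> Z 0 (T A) (T B)"
  obtains x where "x \<in> Z 0 A B" "t B * x * t' A = y"
proof
  have 1: "y * t A \<in> L 0 (-1) A (T B)" by (rule L0_mult[OF Z_L[OF y] t_L]) (use o T_Ob in auto)
  have "t' B * (y * t A) \<in> L 0 0 A B" by (rule L0_mult[OF t'_L 1]) (use o T_Ob in auto)
  then show "t' B * (y * t A) \<in> Z 0 A B"
  proof (rule ZI)
    have "d B * (t' B * (y * t A)) = - (t' B * (d (T B) * y) * t A)"
      using o by (simp add: mult.assoc t'_d[THEN reassoc])
    also have "\<dots> = t' B * (y * t A) * d A"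
      using o by (simp add: Z_d[OF y] d_t mult.assoc)
    finally show "d B * (t' B * (y * t A)) = t' B * (y * t A) * d A" .
  qed
  show "t B * (t' B * (y * t A)) * t' A = y"
    using o by (simp add: mult.assoc t_eqs T_Ob Z_left[OF _ _ y, THEN reassoc] Z_right[OF _ _ y])
qed

lemma T_mor_bij: assumes o: "A \<in> Ob" "B \<in> Ob"
  shows "bij_betw (ptrM P A B) (carrier (pmor P 0 A B)) (carrier (pmor P 0 (T A) (T B)))"
  unfolding bij_betw_def
proof
  show "inj_on (ptrM P A B) (carrier (pmor P 0 A B))"
    using o T_inj by (auto simp: inj_on_def carrier_P)
  have "q (T A) (T B) y \<in> ptrM P A B ` q A B ` Z 0 A B" if y: "y \<in> Z 0 (T A) (T B)" for y
  proof -
    obtain x where "x \<in> Z 0 A B" "t B * x * t' A = y" by (rule T_surj_mor[OF o y])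
    then show ?thesis using o by (auto simp: image_image cls_tr intro!: image_eqI[of _ _ x])
  qed
  then show "ptrM P A B ` carrier (pmor P 0 A B) = carrier (pmor P 0 (T A) (T B))"
    using o T_conj by (auto simp: carrier_P T_Ob cls_tr)
qed

lemma isoI:
  assumes "A \<in> Ob" "B \<in> Ob" "x \<in> Z 0 A B" "y \<in> Z 0 B A"
    "q A A (y * x) = q A A (e A)" "q B B (x * y) = q B B (e B)"
  shows "is_iso X A B (q A B x)"
  unfolding is_iso_def using assms
  by (auto simp: carrier_P q_cmp cls_idt intro!: bexI[of _ "q B A y"])

lemma cone_Ob': "\<lbrakk>A \<in> Ob; B \<in> Ob; U \<in> Z 0 A B\<rbrakk> \<Longrightarrow> Cn A B U \<in> Ob" by (rule cone_L)

lemma i2_Z: "\<lbrakk>A \<in> Ob; B \<in> Ob; U \<in> Z 0 A B\<rbrakk> \<Longrightarrow> i2 A B U \<in> Z 0 B (Cn A B U)"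
  by (rule ZI) (simp_all add: cone_L cone_eqs)

lemma tp1_Z: assumes "A \<in> Ob" "B \<in> Ob" "U \<in> Z 0 A B" shows "t A * p1 A B U \<in> Z 0 (Cn A B U) (T A)"
  by (rule ZI, rule L0_mult[OF t_L cone_L(3)])
     (use assms in \<open>auto simp: T_Ob cone_Ob' cone_eqs t_eqs mult.assoc\<close>)

text \<open>Up to homotopy \<open>\<phi>\<close> is the identity plus a map through \<open>B \<leftarrow> TA\<close>, whose square is 0.\<close>

lemma cone_endo_iso:
  assumes o: "A \<in> Ob" "B \<in> Ob" and U: "U \<in> Z 0 A B"
    and \<phi>: "\<phi> \<in> Z 0 (Cn A B U) (Cn A B U)"
    and x: "x \<in> Z 0 A A" "p1 A B U * \<phi> = x * p1 A B U" "q A A x = q A A (e A)"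
    and y: "y \<in> Z 0 B B" "\<phi> * i2 A B U = i2 A B U * y" "q B B y = q B B (e B)"
  shows "is_iso X (Cn A B U) (Cn A B U) (q (Cn A B U) (Cn A B U) \<phi>)"
proof -
  let ?C = "Cn A B U" and ?i1 = "i1 A B U" and ?i2 = "i2 A B U" and ?p1 = "p1 A B U" and ?p2 = "p2 A B U"
  note C = cone_Ob'[OF o U] and l = cone_L[OF o U]
  note eqs = cone_eqs[OF o U] o
  obtain \<alpha> where \<alpha>: "\<alpha> \<in> L 0 (-1) A A" "x - e A = d A * \<alpha> + \<alpha> * d A"
    using q_eqE[OF o(1) o(1) x(1) e_Z x(3)] o by blast
  obtain \<beta> where \<beta>: "\<beta> \<in> L 0 (-1) B B" "y - e B = d B * \<beta> + \<beta> * d B"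
    using q_eqE[OF o(2) o(2) y(1) e_Z y(3)] o by blast
  have xa: "x = e A + d A * \<alpha> + \<alpha> * d A" and yb: "y = e B + d B * \<beta> + \<beta> * d B"
    using \<alpha>(2) \<beta>(2) by (simp_all add: algebra_simps)
  have ab: "e A * \<alpha> = \<alpha>" "\<alpha> * e A = \<alpha>" "e B * \<beta> = \<beta>" "\<beta> * e B = \<beta>"
    using L_left L_right \<alpha> \<beta> o by blast+
  \<comment> \<open>Deforms the diagonal blocks x and y of \<open>\<phi>\<close> to the units; the
    block of A is translated, hence the minus sign. The term U in the differential of the cone
    leaves the defect \<open>\<beta> * U - U * \<alpha>\<close>, which n takes over together with
    the off-diagonal block f.\<close>
  define h where "h = ?i2 * \<beta> * ?p2 - ?i1 * \<alpha> * ?p1"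
  define f where "f = ?p2 * \<phi> * ?i1"
  define n where "n = f + U * \<alpha> - \<beta> * U"
  have "\<phi> * ?i1 \<in> L 0 (-1) A ?C" by (rule L0_mult[OF Z_L[OF \<phi>] l(2)]) (use o C in auto)
  then have f: "f \<in> L 0 (-1) A B" unfolding f_def mult.assoc
    by (rule L0_mult[OF l(5)]) (use o C in auto)
  have n: "n \<in> L 0 (-1) A B" unfolding n_def
    by (intro L_diff L_add f L0_mult[OF Z_L[OF U] \<alpha>(1)] L0_mult[OF \<beta>(1) Z_L[OF U]]) (use o in auto)
  have np: "n * ?p1 \<in> L 0 0 ?C B" by (rule L0_mult[OF n l(3)]) (use o C in auto)
  have N: "?i2 * (n * ?p1) \<in> L 0 0 ?C ?C" by (rule L0_mult[OF l(4) np]) (use o C in auto)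
  have "?i2 * (\<beta> * ?p2) \<in> L 0 (-1) ?C ?C"
    by (rule L0_mult[OF l(4) L0_mult[OF \<beta>(1) l(5)]]) (use o C in auto)
  moreover have "?i1 * (\<alpha> * ?p1) \<in> L 0 (-1) ?C ?C"
    by (rule L0_mult[OF l(2) L0_mult[OF \<alpha>(1) l(3)]]) (use o C in auto)
  ultimately have h: "h \<in> L 0 (-1) ?C ?C" unfolding h_def mult.assoc by (intro L_diff C)
  have e: "e ?C = ?i1 * ?p1 + ?i2 * ?p2" and dC: "d ?C = ?i2 * U * ?p1 + ?i2 * d B * ?p2 - ?i1 * d A * ?p1"
    using e_cone d_cone o U by (auto simp: Z_def)
  \<comment> \<open>Inserting the unit of the cone on both sides splits \<open>\<phi>\<close> into
    blocks; the relations with x and y make it triangular.\<close>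
  have "\<phi> = (?i1 * ?p1 + ?i2 * ?p2) * \<phi> * (?i1 * ?p1 + ?i2 * ?p2)"
    using Z_left[OF C C \<phi>] Z_right[OF C C \<phi>] e by simp
  also have "\<dots> = ?i1 * (?p1 * \<phi>) * (?i1 * ?p1 + ?i2 * ?p2) + ?i2 * f * ?p1 + ?i2 * ?p2 * (\<phi> * ?i2) * ?p2"
    by (simp add: f_def ring_norm)
  also have "\<dots> = ?i1 * x * ?p1 + ?i2 * f * ?p1 + ?i2 * y * ?p2"
    unfolding x(2) y(2) using Z_right[OF _ _ x(1)] Z_left[OF _ _ y(1)] o
    by (simp add: ring_norm eqs Z_left[OF _ _ y(1), THEN reassoc])
  finally have \<phi>_eq: "\<phi> = ?i1 * x * ?p1 + ?i2 * f * ?p1 + ?i2 * y * ?p2" .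
  have \<phi>N: "\<phi> - (e ?C + ?i2 * (n * ?p1)) = d ?C * h + h * d ?C"
    unfolding \<phi>_eq e xa yb n_def h_def dC by (simp add: algebra_simps eqs ab[THEN reassoc])
  \<comment> \<open>The remaining block commutes with the differential because
    \<open>\<phi>\<close>, the unit and every boundary do.\<close>
  then have "?i2 * (n * ?p1) = \<phi> - e ?C - (d ?C * h + h * d ?C)" by (simp add: algebra_simps)
  then have "d ?C * (?i2 * (n * ?p1)) = ?i2 * (n * ?p1) * d ?C"
    using Z_d[OF \<phi>] by (simp add: ring_norm d_d[OF C, THEN reassoc] d_d[OF C] C e_d d_e)
  with N have NZ: "?i2 * (n * ?p1) \<in> Z 0 ?C ?C" by (rule ZI)
  \<comment> \<open>The block passes through \<open>p1 * i2 = 0\<close>, so its square vanishes and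
    the unit minus the block inverts the unit plus the block.\<close>
  have NN: "(?i2 * (n * ?p1)) * (?i2 * (n * ?p1)) = 0" by (simp add: mult.assoc eqs)
  have "is_iso X ?C ?C (q ?C ?C (e ?C + ?i2 * (n * ?p1)))"
    by (rule isoI[of _ _ _ "e ?C - ?i2 * (n * ?p1)"])
       (use C NZ e_Z[OF C] NN Z_left[OF C C NZ] Z_right[OF C C NZ] Z_left[OF C C e_Z[OF C]] in
         \<open>auto simp: Z_add Z_diff ring_norm\<close>)
  moreover have "q ?C ?C \<phi> = q ?C ?C (e ?C + ?i2 * (n * ?p1))"
    by (rule q_eqI[OF C C \<phi> _ h \<phi>N]) (use C NZ e_Z in \<open>auto simp: Z_add\<close>)
  ultimately show ?thesis by simp
qed

text \<open>The homotopy that makes the square commute becomes the off-diagonal entry of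
  \<open>\<phi>\<close>. The relations with \<open>i2\<close> and \<open>p1\<close> hold on the nose
  and not only up to homotopy, as \<open>cone_endo_iso\<close> requires.\<close>

lemma cone_map:
  assumes o: "A \<in> Ob" "B \<in> Ob" "A' \<in> Ob" "B' \<in> Ob" and U: "U \<in> Z 0 A B" and U': "U' \<in> Z 0 A' B'"
    and a: "a \<in> Z 0 A A'" and b: "b \<in> Z 0 B B'" and eq: "q A B' (b * U) = q A B' (U' * a)"
  obtains \<phi> where "\<phi> \<in> Z 0 (Cn A B U) (Cn A' B' U')" "\<phi> * i2 A B U = i2 A' B' U' * b"
    "p1 A' B' U' * \<phi> = a * p1 A B U"
proof -
  note C = cone_Ob'[OF o(1,2) U] cone_Ob'[OF o(3,4) U'] and l = cone_L[OF o(1,2) U] cone_L[OF o(3,4) U']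
  note eqs = cone_eqs[OF o(1,2) U] cone_eqs[OF o(3,4) U'] o
  obtain s where s: "s \<in> L 0 (-1) A B'" "b * U - U' * a = d B' * s + s * d A"
    using q_eqE[OF o(1,4) Z0_mult Z0_mult eq] o U U' a b by metis
  have bU: "b * U = U' * a + d B' * s + s * d A" using s(2) by (simp add: algebra_simps)
  let ?\<phi> = "i1 A' B' U' * (a * p1 A B U) + i2 A' B' U' * (s * p1 A B U) + i2 A' B' U' * (b * p2 A B U)"
  note se = L_left[OF o(1,4) s(1)] L_right[OF o(1,4) s(1)] Z_left[OF o(1,3) a] Z_right[OF o(1,3) a]
    Z_left[OF o(2,4) b] Z_right[OF o(2,4) b] Z_d[OF a] Z_d[OF b]
  have "?\<phi> \<in> Z 0 (Cn A B U) (Cn A' B' U')"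
  proof (rule ZI)
    show "?\<phi> \<in> L 0 0 (Cn A B U) (Cn A' B' U')"
      by (intro L_add L0_mult[OF l(7) L0_mult[OF Z_L[OF a] l(3)]] L0_mult[OF l(9) L0_mult[OF s(1) l(3)]]
          L0_mult[OF l(9) L0_mult[OF Z_L[OF b] l(5)]]) (use o C in auto)
    show "d (Cn A' B' U') * ?\<phi> = ?\<phi> * d (Cn A B U)"
      by (simp add: algebra_simps eqs se se[THEN reassoc] bU[THEN reassoc])
  qed
  moreover have "?\<phi> * i2 A B U = i2 A' B' U' * b" "p1 A' B' U' * ?\<phi> = a * p1 A B U"
    by (simp_all add: algebra_simps eqs se se[THEN reassoc])
  ultimately show thesis by (rule that)
qed

end

section \<open>Exact triangles and their normal form\<close>

context homotopy_presentation
begin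

abbreviation c where "c \<equiv> pcmp P 0 0"
abbreviation Hm where "Hm A B \<equiv> carrier (pmor P 0 A B)"

lemmas c_assoc = pre.cmp_assoc[unfolded X_simps]
lemmas c_closed = pre.cmp_closed[unfolded X_simps]
lemmas c_left = pre.idt_left[unfolded X_simps]
lemmas c_right = pre.idt_right[unfolded X_simps]
lemmas iso_Hm = pre.iso_mor[unfolded X_simps]
lemmas TM_closed = tr.FM_closed[unfolded X_simps]
lemmas TM_cmp = tr.FM_cmp[unfolded X_simps]
lemmas TM_id = tr.FM_idt[unfolded X_simps]

lemma iso_inv_obtain:
  assumes "is_iso X A B f"
  obtains g where "is_iso X B A g" "c A B A g f = pidt P A" "c B A B f g = pidt P B" "g \<in> Hm B A"
  using pre.iso_inverse[OF assms] iso_Hm by (metis X_simps(3,4))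

lemma Hm_rep: assumes "A \<in> Ob" "B \<in> Ob" "f \<in> Hm A B" obtains x where "x \<in> Z 0 A B" "f = q A B x"
  using assms by (auto simp: carrier_P)

lemma cancel_left:
  assumes o: "A \<in> Ob" "B \<in> Ob" "D \<in> Ob" and g: "is_iso X B D g" and f: "f \<in> Hm A B" "f' \<in> Hm A B"
    and e: "c A B D g f = c A B D g f'"
  shows "f = f'"
proof -
  obtain h where h: "c B D B h g = pidt P B" "h \<in> Hm D B" by (rule iso_inv_obtain[OF g])
  have "c A B B (c B D B h g) f = c A B B (c B D B h g) f'"
    using c_assoc[OF o(1,2,3,2) f(1) iso_Hm[OF g] h(2)] c_assoc[OF o(1,2,3,2) f(2) iso_Hm[OF g] h(2)] e by simp
  then show ?thesis using h f o by (simp add: c_left)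
qed

text \<open>Inverses of a and b up to homotopy give a cone map \<open>\<psi>\<close> in the other
  direction. The homotopies filling the two squares are unrelated, so the composites are only
  triangular with diagonal blocks homotopic to units; \<open>cone_endo_iso\<close> makes them
  automorphisms, which is enough.\<close>

lemma cone_map_iso:
  assumes o: "A \<in> Ob" "B \<in> Ob" "A' \<in> Ob" "B' \<in> Ob" and U: "U \<in> Z 0 A B" and U': "U' \<in> Z 0 A' B'"
    and a: "a \<in> Z 0 A A'" "is_iso X A A' (q A A' a)" and b: "b \<in> Z 0 B B'" "is_iso X B B' (q B B' b)"
    and eq: "q A B' (b * U) = q A B' (U' * a)"
    and \<phi>: "\<phi> \<in> Z 0 (Cn A B U) (Cn A' B' U')" "\<phi> * i2 A B U = i2 A' B' U' * b"
    "p1 A' B' U' * \<phi> = a * p1 A B U"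
  shows "is_iso X (Cn A B U) (Cn A' B' U') (q (Cn A B U) (Cn A' B' U') \<phi>)"
proof -
  let ?C = "Cn A B U" and ?C' = "Cn A' B' U'"
  have C: "?C \<in> Ob" "?C' \<in> Ob" using o U U' by (auto intro: cone_Ob')
  obtain a1 where a1: "c A A' A a1 (q A A' a) = pidt P A" "c A' A A' (q A A' a) a1 = pidt P A'" "a1 \<in> Hm A' A"
    by (rule iso_inv_obtain[OF a(2)])
  then obtain a' where a': "a' \<in> Z 0 A' A" "q A A (a' * a) = q A A (e A)" "q A' A' (a * a') = q A' A' (e A')"
      "a1 = q A' A a'"
    using o a by (auto simp: carrier_P q_cmp cls_idt)
  obtain b1 where b1: "c B B' B b1 (q B B' b) = pidt P B" "c B' B B' (q B B' b) b1 = pidt P B'" "b1 \<in> Hm B' B"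
    by (rule iso_inv_obtain[OF b(2)])
  then obtain b' where b': "b' \<in> Z 0 B' B" "q B B (b' * b) = q B B (e B)" "q B' B' (b * b') = q B' B' (e B')"
      "b1 = q B' B b'"
    using o b by (auto simp: carrier_P q_cmp cls_idt)
  have "c A' B' B b1 (q A' B' U') = c A' A B (q A B U) a1"
    by (rule pre.iso_swap[where a="q A A' a" and b="q B B' b", unfolded X_simps])
       (use o U U' a b a1 b1 eq in \<open>auto simp: q_cmp q_carrier\<close>)
  then have eq': "q A' B (b' * U') = q A' B (U * a')"
    using o U U' a' b' by (simp add: q_cmp)
  obtain \<psi> where \<psi>: "\<psi> \<in> Z 0 ?C' ?C" "\<psi> * i2 A' B' U' = i2 A B U * b'" "p1 A B U * \<psi> = a' * p1 A' B' U'"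
    by (rule cone_map[OF o(3,4,1,2) U' U a'(1) b'(1) eq'])
  have 1: "is_iso X ?C ?C (q ?C ?C (\<psi> * \<phi>))"
    by (rule cone_endo_iso[OF o(1,2) U Z0_mult[OF _ _ _ \<psi>(1) \<phi>(1)] Z0_mult[OF _ _ _ a'(1) a(1)] _ a'(2)
          Z0_mult[OF _ _ _ b'(1) b(1)] _ b'(2)])
       (use o C \<phi> \<psi>(2) \<psi>(3)[THEN reassoc] \<psi>(2)[THEN reassoc] in \<open>auto simp: mult.assoc\<close>)
  have 2: "is_iso X ?C' ?C' (q ?C' ?C' (\<phi> * \<psi>))"
    by (rule cone_endo_iso[OF o(3,4) U' Z0_mult[OF _ _ _ \<phi>(1) \<psi>(1)] Z0_mult[OF _ _ _ a(1) a'(1)] _ a'(3)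
          Z0_mult[OF _ _ _ b(1) b'(1)] _ b'(3)])
       (use o C \<phi> \<psi> \<phi>(3)[THEN reassoc] \<phi>(2)[THEN reassoc] in \<open>auto simp: mult.assoc\<close>)
  show ?thesis
    by (rule pre.iso_of_cmps[where g="q ?C' ?C \<psi>"]) (use C \<phi> \<psi> 1 2 in \<open>auto simp: q_cmp q_carrier\<close>)
qed

lemma pexact_X: "pexact P = {tr. is_triangle X T tr \<and>
      (\<exists>A B U. A \<in> Ob \<and> B \<in> Ob \<and> U \<in> Z 0 A B \<and> isomorphic_triangles X T (ptrM P) tr
          (A, B, Cn A B U, q A B U, q B (Cn A B U) (i2 A B U), q (Cn A B U) (T A) (t A * p1 A B U)))}"
  by (simp add: pexact_P level_zero_cat_X ptrO_P)

lemma std_triangle: "\<lbrakk>A \<in> Ob; B \<in> Ob; U \<in> Z 0 A B\<rbrakk> \<Longrightarrow> is_triangle X T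
    (A, B, Cn A B U, q A B U, q B (Cn A B U) (i2 A B U), q (Cn A B U) (T A) (t A * p1 A B U))"
  by (simp add: is_triangle_def q_carrier cone_Ob' i2_Z tp1_Z T_Ob)

lemma exact_isoI:
  assumes "s \<in> pexact P" "isomorphic_triangles X T (ptrM P) s' s" "is_triangle X T s'"
  shows "s' \<in> pexact P"
  using assms std_triangle unfolding pexact_X by (blast intro: tr.isomorphic_triangles_trans)

lemma exactD: "(A, B, D, u, v, w) \<in> pexact P \<Longrightarrow>
    A \<in> Ob \<and> B \<in> Ob \<and> D \<in> Ob \<and> u \<in> Hm A B \<and> v \<in> Hm B D \<and> w \<in> Hm D (T A)"
  by (simp add: pexact_X is_triangle_def)

lemma exact_std:
  assumes "A \<in> Ob" "B \<in> Ob" "U \<in> Z 0 A B"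
  shows "(A, B, Cn A B U, q A B U, q B (Cn A B U) (i2 A B U), q (Cn A B U) (T A) (t A * p1 A B U)) \<in> pexact P"
proof -
  let ?s = "(A, B, Cn A B U, q A B U, q B (Cn A B U) (i2 A B U), q (Cn A B U) (T A) (t A * p1 A B U))"
  note C = cone_Ob'[OF assms]
  have "isomorphic_triangles X T (ptrM P) ?s ?s"
    unfolding isomorphic_triangles_def prod.case
    by (intro exI[of _ "pidt P A"] exI[of _ "pidt P B"] exI[of _ "pidt P (Cn A B U)"])
       (use assms C pre.iso_idt in \<open>auto simp: c_left c_right q_carrier i2_Z tp1_Z T_Ob TM_id\<close>)
  then show ?thesis using std_triangle[OF assms] assms by (auto simp: pexact_X)
qed

text \<open>With identities at A and B, comparing a triangle with a cone reduces to one isomorphism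
  at the third vertex. Most later exactness proofs go through this form.\<close>

lemma exactI:
  assumes o: "A \<in> Ob" "B \<in> Ob" "D \<in> Ob" and U: "U \<in> Z 0 A B"
    and \<delta>: "is_iso X D (Cn A B U) \<delta>" and v: "v \<in> Hm B D" "c B D (Cn A B U) \<delta> v = q B (Cn A B U) (i2 A B U)"
    and w: "w = c D (Cn A B U) (T A) (q (Cn A B U) (T A) (t A * p1 A B U)) \<delta>"
  shows "(A, B, D, q A B U, v, w) \<in> pexact P"
proof (rule exact_isoI[OF exact_std[OF o(1,2) U]])
  note C = cone_Ob'[OF o(1,2) U]
  have wH: "w \<in> Hm D (T A)"
    using w o C U iso_Hm[OF \<delta>] by (auto intro!: c_closed q_carrier tp1_Z T_Ob)
  show "is_triangle X T (A, B, D, q A B U, v, w)"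
    using o U v wH by (simp add: is_triangle_def q_carrier)
  show "isomorphic_triangles X T (ptrM P) (A, B, D, q A B U, v, w) (A, B, Cn A B U, q A B U,
      q B (Cn A B U) (i2 A B U), q (Cn A B U) (T A) (t A * p1 A B U))"
    unfolding isomorphic_triangles_def prod.case
    by (intro exI[of _ "pidt P A"] exI[of _ "pidt P B"] exI[of _ \<delta>])
       (use o U C pre.iso_idt[of A] pre.iso_idt[of B] \<delta> v w wH in
         \<open>auto simp: c_left c_right q_carrier i2_Z tp1_Z T_Ob TM_id\<close>)
qed

lemma T_comp_cone:
  assumes o: "A \<in> Ob" "B \<in> Ob" "A' \<in> Ob" "B' \<in> Ob" and U: "U \<in> Z 0 A B" and U': "U' \<in> Z 0 A' B'"
    and a: "a \<in> Z 0 A A'" and \<phi>: "\<phi> \<in> Z 0 (Cn A B U) (Cn A' B' U')" "p1 A' B' U' * \<phi> = a * p1 A B U"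
  shows "c (Cn A B U) (T A) (T A') (ptrM P A A' (q A A' a)) (q (Cn A B U) (T A) (t A * p1 A B U)) =
    c (Cn A B U) (Cn A' B' U') (T A') (q (Cn A' B' U') (T A') (t A' * p1 A' B' U')) (q (Cn A B U) (Cn A' B' U') \<phi>)"
  using o U U' a \<phi> Z_right[OF o(1,3) a, THEN reassoc]
  by (simp add: cls_tr q_cmp T_conj tp1_Z cone_Ob' T_Ob mult.assoc T_conj[unfolded mult.assoc] t_eqs cone_eqs)

text \<open>Exactness only provides the cone of some F between other objects. A cone map over the
  isomorphisms at the first two vertices is itself an isomorphism and replaces that cone by the cone
  of any chosen representative U of u, with identities at A and B.\<close>

lemma exact_normal:
  assumes ex: "(A, B, D, u, v, w) \<in> pexact P" and U: "U \<in> Z 0 A B" "u = q A B U"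
  obtains \<delta> where "is_iso X D (Cn A B U) \<delta>" "c B D (Cn A B U) \<delta> v = q B (Cn A B U) (i2 A B U)"
    "w = c D (Cn A B U) (T A) (q (Cn A B U) (T A) (t A * p1 A B U)) \<delta>"
proof -
  note o = exactD[OF ex, THEN conjunct1] exactD[OF ex, THEN conjunct2, THEN conjunct1]
    exactD[OF ex, THEN conjunct2, THEN conjunct2, THEN conjunct1]
  have vw: "v \<in> Hm B D" "w \<in> Hm D (T A)" using exactD[OF ex] by auto
  obtain A' B' F where o': "A' \<in> Ob" "B' \<in> Ob" and F: "F \<in> Z 0 A' B'" and
    it: "isomorphic_triangles X T (ptrM P) (A, B, D, u, v, w) (A', B', Cn A' B' F, q A' B' F,
      q B' (Cn A' B' F) (i2 A' B' F), q (Cn A' B' F) (T A') (t A' * p1 A' B' F))"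
    using ex by (auto simp: pexact_X)
  let ?C = "Cn A B U" and ?C' = "Cn A' B' F"
  have C: "?C \<in> Ob" "?C' \<in> Ob" using o o' U F by (auto intro: cone_Ob')
  obtain a b d where i: "is_iso X A A' a" "is_iso X B B' b" "is_iso X D ?C' d"
    "c A B B' b u = c A A' B' (q A' B' F) a" "c B D ?C' d v = c B B' ?C' (q B' ?C' (i2 A' B' F)) b"
    "c D (T A) (T A') (ptrM P A A' a) w = c D ?C' (T A') (q ?C' (T A') (t A' * p1 A' B' F)) d"
    using it by (auto simp: isomorphic_triangles_def)
  obtain \<alpha> where \<alpha>: "\<alpha> \<in> Z 0 A A'" "a = q A A' \<alpha>" by (rule Hm_rep[OF o(1) o'(1) iso_Hm[OF i(1)]])
  obtain \<beta> where \<beta>: "\<beta> \<in> Z 0 B B'" "b = q B B' \<beta>" by (rule Hm_rep[OF o(2) o'(2) iso_Hm[OF i(2)]])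
  have eq: "q A B' (\<beta> * U) = q A B' (F * \<alpha>)" using i(4) o o' U F \<alpha> \<beta> by (simp add: q_cmp)
  obtain \<phi> where \<phi>: "\<phi> \<in> Z 0 ?C ?C'" "\<phi> * i2 A B U = i2 A' B' F * \<beta>" "p1 A' B' F * \<phi> = \<alpha> * p1 A B U"
    by (rule cone_map[OF o(1,2) o' U(1) F \<alpha>(1) \<beta>(1) eq])
  have "is_iso X ?C ?C' (q ?C ?C' \<phi>)"
    using cone_map_iso[OF o(1,2) o' U(1) F \<alpha>(1) _ \<beta>(1) _ eq \<phi>] i(1,2) \<alpha> \<beta> by simp
  then obtain \<psi> where \<psi>: "is_iso X ?C' ?C \<psi>" "c ?C ?C' ?C \<psi> (q ?C ?C' \<phi>) = pidt P ?C"
    "c ?C' ?C ?C' (q ?C ?C' \<phi>) \<psi> = pidt P ?C'" "\<psi> \<in> Hm ?C' ?C" by (rule iso_inv_obtain)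
  note m = iso_Hm[OF i(1)] iso_Hm[OF i(2)] iso_Hm[OF i(3)] \<psi>(4) vw q_carrier[OF C \<phi>(1)]
    q_carrier[OF o(2) C(1) i2_Z[OF o(1,2) U(1)]] q_carrier[OF o'(2) C(2) i2_Z[OF o' F]]
    q_carrier[OF C(1) T_Ob tp1_Z[OF o(1,2) U(1)]] q_carrier[OF C(2) T_Ob tp1_Z[OF o' F]]
    TM_closed[OF o(1) o'(1)]
  \<comment> \<open>From D to the cone of F by the given isomorphism, then back along the inverse of
    the cone map.\<close>
  let ?\<delta> = "c D ?C' ?C \<psi> d"
  show thesis
  proof (rule that)
    show "is_iso X D ?C ?\<delta>" using pre.iso_cmp[OF _ _ _ i(3) \<psi>(1)] o C by simp
    have "c B D ?C ?\<delta> v = c B ?C' ?C \<psi> (c B B' ?C' (q B' ?C' (i2 A' B' F)) b)"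
      using i(5) m o C o' by (simp add: c_assoc)
    also have "\<dots> = c B ?C' ?C \<psi> (c B ?C ?C' (q ?C ?C' \<phi>) (q B ?C (i2 A B U)))"
      using \<phi> \<beta> o o' C U F by (simp add: q_cmp i2_Z)
    also have "\<dots> = c B ?C ?C (c ?C ?C' ?C \<psi> (q ?C ?C' \<phi>)) (q B ?C (i2 A B U))"
      using m o C o' by (subst c_assoc) auto
    finally show "c B D ?C ?\<delta> v = q B ?C (i2 A B U)" using m o C \<psi>(2) by (simp add: c_left)
    have "c D (T A) (T A') (ptrM P A A' a) w
        = c D ?C' (T A') (c ?C' ?C' (T A') (q ?C' (T A') (t A' * p1 A' B' F)) (c ?C' ?C ?C' (q ?C ?C' \<phi>) \<psi>)) d"
      using m o C o' \<psi>(3) i(6) by (simp add: c_right T_Ob)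
    also have "\<dots> = c D ?C' (T A') (c ?C' ?C (T A')
        (c ?C ?C' (T A') (q ?C' (T A') (t A' * p1 A' B' F)) (q ?C ?C' \<phi>)) \<psi>) d"
      using m o C o' by (simp add: c_assoc T_Ob)
    also have "\<dots> = c D ?C' (T A') (c ?C' ?C (T A')
        (c ?C (T A) (T A') (ptrM P A A' a) (q ?C (T A) (t A * p1 A B U))) \<psi>) d"
      using T_comp_cone[OF o(1,2) o' U(1) F \<alpha>(1) \<phi>(1,3)] \<alpha> by simp
    also have "\<dots> = c D (T A) (T A') (ptrM P A A' a) (c D ?C (T A) (q ?C (T A) (t A * p1 A B U)) ?\<delta>)"
      using m o C o' by (simp add: c_assoc c_closed T_Ob)
    \<comment> \<open>Translation sends the isomorphism a to an isomorphism, which can be cancelled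
      on the left.\<close>
    finally show "w = c D ?C (T A) (q ?C (T A) (t A * p1 A B U)) ?\<delta>"
      by (rule cancel_left[OF o(3) T_Ob[OF o(1)] T_Ob[OF o'(1)] tr.FM_iso[unfolded X_simps, OF o(1) o'(1) i(1)] vw(2), rotated])
         (use m o C o' in \<open>auto intro!: c_closed simp: T_Ob\<close>)
  qed
qed

end

section \<open>Contractible cones, identity triangles and rotation\<close>

context homotopy_presentation
begin

text \<open>The homotopy \<open>i1 * W * p2\<close> contracts the cone, and its level is that of W.
  With r = 0 this treats the cone of an identity, with general r the cone of the map from a
  shift.\<close>

lemma cone_contracted:
  assumes o: "A \<in> Ob" "B \<in> Ob" and V: "V \<in> Z 0 A B" and W: "W \<in> Z r B A"
    and inv: "W * V = e A" "V * W = e B" and r: "r \<ge> 0"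
  shows "cls r (Cn A B V) (Cn A B V) (e (Cn A B V)) = cls r (Cn A B V) (Cn A B V) 0"
proof -
  let ?C = "Cn A B V"
  note C = cone_Ob'[OF o V] and l = cone_L[OF o V] and eqs = cone_eqs[OF o V] o
  have "W * p2 A B V \<in> L r 0 ?C A" by (rule L_mult'[OF Z_L[OF W] l(5)]) (use o C in auto)
  from L_mult'[OF l(2) this] have h: "i1 A B V * (W * p2 A B V) \<in> L r (-1) ?C ?C" using o C by simp
  have "e ?C = d ?C * (i1 A B V * (W * p2 A B V)) + i1 A B V * (W * p2 A B V) * d ?C"
    using Z_d[OF W] Z_left[OF _ _ W] o e_cone[OF o Z_L[OF V] Z_d[OF V]]
    by (simp add: eqs algebra_simps inv inv[THEN reassoc] Z_d[OF W, THEN reassoc])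
  then have "e ?C \<in> Bd r ?C ?C"
    using Z_mono[OF C C r e_Z[OF C]] h by (blast intro: BdI)
  then show ?thesis using C r by (simp add: cls_eq_iff Z_mono[OF C C r e_Z[OF C]] Z_zero)
qed

text \<open>The cone of the identity is contractible at level 0. It is therefore isomorphic to the
  given zero object by the zero map, and the inclusion \<open>i2\<close> is zero up to
  homotopy.\<close>

lemma TR1_identity:
  assumes A: "A \<in> Ob" and N: "is_zero_object X N"
  shows "(A, A, N, pidt P A, \<one>\<^bsub>pmor P 0 A N\<^esub>, \<one>\<^bsub>pmor P 0 N (T A)\<^esub>) \<in> pexact P"
proof -
  let ?C = "Cn A A (e A)"
  note C = cone_Ob'[OF A A e_Z[OF A]]
  have No: "N \<in> Ob" and N0: "\<And>B. B \<in> Ob \<Longrightarrow> Hm B N = {q B N 0}"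
    using N by (auto simp: is_zero_object_def cls_one)
  have C0: "q ?C ?C (e ?C) = q ?C ?C 0"
    by (rule cone_contracted[OF A A e_Z[OF A] e_Z[OF A]])
       (use A Z_left[OF A A e_Z[OF A]] in auto)
  have z: "0 \<in> Z 0 B D" if "B \<in> Ob" "D \<in> Ob" for B D by (rule Z_zero[OF that])
  have N1: "q N N (e N) = q N N 0" using N0[OF No] q_carrier[OF No No e_Z[OF No]] by auto
  have "is_iso X N ?C (q N ?C 0)"
    by (rule isoI[OF No C z[OF No C] z[OF C No]]) (simp_all add: N1 C0)
  moreover have "q A ?C (i2 A A (e A)) = q A ?C 0"
  proof -
    have i: "i2 A A (e A) \<in> Z 0 A ?C" by (rule i2_Z[OF A A e_Z[OF A]])
    have "q A ?C (i2 A A (e A)) = c A ?C ?C (q ?C ?C (e ?C)) (q A ?C (i2 A A (e A)))"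
      using A C i e_Z[OF C] Z_left[OF A C i] by (simp add: q_cmp)
    also have "\<dots> = q A ?C 0" unfolding C0 using A C i z by (simp add: q_cmp)
    finally show ?thesis .
  qed
  ultimately show ?thesis
    using A No C z tp1_Z[OF A A e_Z[OF A]] unfolding cls_idt[OF A] cls_one[OF A No] cls_one[OF No T_Ob[OF A]]
    by (intro exactI[OF A A No e_Z[OF A]]) (auto simp: q_cmp q_carrier T_Ob)
qed

text \<open>The cone of the inclusion of B into C is equivalent to T A: its translated copy of B
  cancels against the copy of B inside C.\<close>

lemma rotate_std:
  assumes o: "A \<in> Ob" "B \<in> Ob" and U: "U \<in> Z 0 A B"
  shows "(B, Cn A B U, T A, q B (Cn A B U) (i2 A B U), q (Cn A B U) (T A) (t A * p1 A B U),
      q (T A) (T B) (- (t B * U * t' A))) \<in> pexact P"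
proof -
  let ?C = "Cn A B U"
  note C = cone_Ob'[OF o U]
  let ?i = "i2 A B U"
  have i: "?i \<in> Z 0 B ?C" by (rule i2_Z[OF o U])
  let ?K = "Cn B ?C ?i"
  note K = cone_Ob'[OF o(2) C i]
  let ?j1 = "i1 B ?C ?i" and ?j2 = "i2 B ?C ?i" and ?q1 = "p1 B ?C ?i" and ?q2 = "p2 B ?C ?i"
  note eqs = cone_eqs[OF o U] cone_eqs[OF o(2) C i] o C K t_eqs d_eqs
  note l = cone_L[OF o U] and k = cone_L[OF o(2) C i]
  \<comment> \<open>The first summand of C alone is not preserved by the differential. The
    correction by U in the translated copy of B repairs this, and its sign becomes the sign of the
    last map of the rotated triangle.\<close>
  let ?\<rho> = "?j2 * (i1 A B U * t' A) - ?j1 * (U * t' A)"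
  let ?\<rho>' = "t A * (p1 A B U * ?q2)"
  have 1: "i1 A B U * t' A \<in> L 0 0 (T A) ?C" by (rule L0_mult[OF l(2) t'_L]) (use o C T_Ob in auto)
  have 2: "U * t' A \<in> L 0 1 (T A) B" by (rule L0_mult[OF Z_L[OF U] t'_L]) (use o C T_Ob in auto)
  have \<rho>: "?\<rho> \<in> Z 0 (T A) ?K"
    by (rule ZI, intro L_diff L0_mult[OF k(4) 1] L0_mult[OF k(2) 2])
       (use o C K T_Ob in \<open>auto simp: algebra_simps eqs\<close>)
  have 3: "p1 A B U * ?q2 \<in> L 0 1 ?K A" by (rule L0_mult[OF l(3) k(5)]) (use o C K in auto)
  have \<rho>': "?\<rho>' \<in> Z 0 ?K (T A)"
    by (rule ZI, intro L0_mult[OF t_L 3])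
       (use o C K T_Ob in \<open>auto simp: algebra_simps eqs\<close>)
  have \<rho>'\<rho>: "?\<rho>' * ?\<rho> = e (T A)" using o by (simp add: algebra_simps eqs)
  have 4: "p2 A B U * ?q2 \<in> L 0 0 ?K B" by (rule L0_mult[OF l(5) k(5)]) (use o C K in auto)
  \<comment> \<open>Takes the copy of B in C to its translated copy, which cancels the two.\<close>
  have h: "?j1 * (p2 A B U * ?q2) \<in> L 0 (-1) ?K ?K" by (rule L0_mult[OF k(2) 4]) (use o C K in auto)
  have eK: "e ?K = ?j1 * ?q1 + ?j2 * ?q2" and eC: "e ?C = i1 A B U * p1 A B U + i2 A B U * p2 A B U"
    using e_cone o U C i by (auto simp: Z_def)
  have eq: "q ?K ?K (e ?K) = q ?K ?K (?\<rho> * ?\<rho>')"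
  proof (rule q_eqI[OF K K e_Z[OF K] Z0_mult[OF K T_Ob[OF o(1)] K \<rho> \<rho>'] h])
    have "?j2 * ?q2 = ?j2 * (e ?C * ?q2)" by (simp add: eqs)
    also have "\<dots> = ?j2 * (i1 A B U * (p1 A B U * ?q2)) + ?j2 * (i2 A B U * (p2 A B U * ?q2))"
      by (simp add: eC algebra_simps)
    finally show "e ?K - ?\<rho> * ?\<rho>' = d ?K * (?j1 * (p2 A B U * ?q2)) + ?j1 * (p2 A B U * ?q2) * d ?K"
      unfolding eK by (simp add: algebra_simps eqs)
  qed
  have iso: "is_iso X (T A) ?K (q (T A) ?K ?\<rho>)"
    by (rule isoI[OF T_Ob[OF o(1)] K \<rho> \<rho>']) (simp_all only: eq \<rho>'\<rho>)
  \<comment> \<open>The projection to T A is \<open>?\<rho>' * ?j2\<close>; since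
    \<open>?\<rho> * ?\<rho>'\<close> is homotopic to the unit, composing with
    \<open>?\<rho>\<close> gives back the class of \<open>?j2\<close>.\<close>
  have v: "c ?C (T A) ?K (q (T A) ?K ?\<rho>) (q ?C (T A) (t A * p1 A B U)) = q ?C ?K ?j2"
  proof -
    have "t A * p1 A B U = ?\<rho>' * ?j2" by (simp add: eqs mult.assoc)
    then have "c ?C (T A) ?K (q (T A) ?K ?\<rho>) (q ?C (T A) (t A * p1 A B U)) = q ?C ?K (?\<rho> * (?\<rho>' * ?j2))"
      using o C K \<rho> \<rho>' i tp1_Z[OF o U] by (simp add: q_cmp T_Ob del: ring_norm)
    also have "\<dots> = c ?C ?K ?K (q ?K ?K (?\<rho> * ?\<rho>')) (q ?C ?K ?j2)"
      using o C K \<rho> \<rho>' i Z0_mult[OF K T_Ob[OF o(1)] K \<rho> \<rho>'] i2_Z[OF o(2) C i] by (simp add: q_cmp mult.assoc)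
    also have "\<dots> = q ?C ?K (e ?K * ?j2)"
      using C K i2_Z[OF o(2) C i] e_Z[OF K] by (simp add: eq[symmetric] q_cmp)
    finally show ?thesis by (simp add: eqs)
  qed
  have w: "q (T A) (T B) (- (t B * U * t' A)) = c (T A) ?K (T B) (q ?K (T B) (t B * ?q1)) (q (T A) ?K ?\<rho>)"
    using o C K \<rho> tp1_Z[OF o(2) C i] by (simp add: q_cmp T_Ob algebra_simps eqs)
  show ?thesis
    by (rule exactI[OF o(2) C T_Ob[OF o(1)] i iso q_carrier[OF C T_Ob[OF o(1)] tp1_Z[OF o U]] v w])
qed

text \<open>T is bijective on objects, so the cone of V is T R for some R, and the standard triangle
  can be extended by one step to the left. This serves the converse direction of rotation. The cone
  of the map from R to A is equivalent to B, because the copy of A inside T R cancels.\<close>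

lemma inverse_rotate_std:
  assumes o: "A \<in> Ob" "B \<in> Ob" and V: "V \<in> Z 0 A B" and R: "R \<in> Ob" "T R = Cn A B V"
  shows "- (p1 A B V * t R) \<in> Z 0 R A"
    and "(R, A, B, q R A (- (p1 A B V * t R)), q A B V, q B (Cn A B V) (i2 A B V)) \<in> pexact P"
proof -
  let ?C = "Cn A B V"
  note C = cone_Ob'[OF o V]
  let ?p = "- (p1 A B V * t R)"
  note l = cone_L[OF o V]
  note tl = t_L[OF R(1), unfolded R(2)] t'_L[OF R(1), unfolded R(2)]
  note te = t_eqs[of R, unfolded R(2)]
  note eqs = cone_eqs[OF o V] o C te R(1) d_eqs
  have td: "t R * d R = - (d ?C * t R)" using d_t[OF R(1)] R(2) by simp
  then have "p1 A B V * (t R * d R) = d A * (p1 A B V * t R)"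
    using cone_eq(5)[OF o V, THEN reassoc, of "t R"] by (simp add: mult.assoc)
  then show p: "?p \<in> Z 0 R A"
    by (intro ZI L_minus L0_mult[OF l(3) tl(1)]) (use o C R(1) in \<open>auto simp: mult.assoc\<close>)
  let ?K = "Cn R A ?p"
  note K = cone_Ob'[OF R(1) o(1) p]
  let ?j1 = "i1 R A ?p" and ?j2 = "i2 R A ?p" and ?q1 = "p1 R A ?p" and ?q2 = "p2 R A ?p"
  note eqs = eqs cone_eqs[OF R(1) o(1) p] K
  note k = cone_L[OF R(1) o(1) p]
  have dR: "d R = - (t' R * (d ?C * t R))" by (simp add: eqs)
  let ?\<psi> = "p2 A B V * (t R * ?q1) + V * ?q2"
  let ?\<psi>' = "?j1 * (t' R * i2 A B V)"
  have 1: "t R * ?q1 \<in> L 0 0 ?K ?C" by (rule L0_mult[OF tl(1) k(3)]) (use o C K R in auto)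
  \<comment> \<open>The rules for cones speak of \<open>d ?C\<close>. These forms first trade
    \<open>d R\<close> for \<open>d ?C\<close> across \<open>t R\<close> and
    \<open>t' R\<close>.\<close>
  have p2t: "p2 A B V * (t R * (d R * x)) = - (V * (p1 A B V * (t R * x))) - d B * (p2 A B V * (t R * x))" for x
    using td[THEN reassoc, of x] cone_eq(6)[OF o V, THEN reassoc, of "t R * x"] by (simp add: algebra_simps)
  have "d R * t' R = - (t' R * d ?C)" using t'_d[OF R(1)] R(2) by simp
  then have dt': "d R * (t' R * x) = - (t' R * (d ?C * x))" for x
    using reassoc[of "d R" "t' R" "- (t' R * d ?C)" x] by (simp add: mult.assoc)
  have dti: "d R * (t' R * i2 A B V) = - (t' R * (i2 A B V * d B))"
    "d R * (t' R * (i1 A B V * x)) = t' R * (i1 A B V * (d A * x)) - t' R * (i2 A B V * (V * x))" for x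
    unfolding dt' by (simp_all add: algebra_simps cone_eqs[OF o V])
  have \<psi>: "?\<psi> \<in> Z 0 ?K B"
    by (rule ZI, intro L_add L0_mult[OF l(5) 1] L0_mult[OF Z_L[OF V] k(5)])
       (use o C K R in \<open>auto simp: algebra_simps eqs p2t\<close>)
  have 2: "t' R * i2 A B V \<in> L 0 1 B R" by (rule L0_mult[OF tl(2) l(4)]) (use o C K R in auto)
  have \<psi>': "?\<psi>' \<in> Z 0 B ?K"
    by (rule ZI, intro L0_mult[OF k(2) 2]) (use o C K R in \<open>auto simp: algebra_simps eqs dti\<close>)
  have \<psi>\<psi>': "?\<psi> * ?\<psi>' = e B" by (simp add: algebra_simps eqs)
  have 3: "i1 A B V * ?q2 \<in> L 0 (-1) ?K ?C" by (rule L0_mult[OF l(2) k(5)]) (use o C K R in auto)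
  have 4: "t' R * (i1 A B V * ?q2) \<in> L 0 0 ?K R" by (rule L0_mult[OF tl(2) 3]) (use o C K R in auto)
  \<comment> \<open>Takes the summand A of the new cone to the copy of A inside T R, which cancels
    the two.\<close>
  have h: "- (?j1 * (t' R * (i1 A B V * ?q2))) \<in> L 0 (-1) ?K ?K"
    by (intro L_minus L0_mult[OF k(2) 4]) (use o C K R in auto)
  have eK: "e ?K = ?j1 * ?q1 + ?j2 * ?q2" and eC: "e ?C = i1 A B V * p1 A B V + i2 A B V * p2 A B V"
    using e_cone o V C p R by (auto simp: Z_def)
  have eq: "q ?K ?K (e ?K) = q ?K ?K (?\<psi>' * ?\<psi>)"
  proof (rule q_eqI[OF K K e_Z[OF K] Z0_mult[OF K o(2) K \<psi>' \<psi>] h])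
    have "?j1 * ?q1 = ?j1 * (t' R * (e ?C * (t R * ?q1)))" by (simp add: eqs)
    also have "\<dots> = ?j1 * (t' R * (i1 A B V * (p1 A B V * (t R * ?q1)))) + ?j1 * (t' R * (i2 A B V * (p2 A B V * (t R * ?q1))))"
      by (simp add: eC algebra_simps)
    finally show "e ?K - ?\<psi>' * ?\<psi> = d ?K * - (?j1 * (t' R * (i1 A B V * ?q2))) + - (?j1 * (t' R * (i1 A B V * ?q2))) * d ?K"
      unfolding eK by (simp add: algebra_simps eqs dti)
  qed
  have iso: "is_iso X B ?K (q B ?K ?\<psi>')"
    by (rule isoI[OF o(2) K \<psi>' \<psi>]) (simp_all only: eq \<psi>\<psi>')
  have v: "c A B ?K (q B ?K ?\<psi>') (q A B V) = q A ?K ?j2"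
  proof -
    have V': "V = ?\<psi> * ?j2" by (simp add: eqs algebra_simps)
    have "c A B ?K (q B ?K ?\<psi>') (q A B V) = q A ?K (?\<psi>' * (?\<psi> * ?j2))"
      using o C K \<psi> \<psi>' V by (simp add: q_cmp V'[symmetric])
    also have "\<dots> = c A ?K ?K (q ?K ?K (?\<psi>' * ?\<psi>)) (q A ?K ?j2)"
      using o C K \<psi> \<psi>' Z0_mult[OF K o(2) K \<psi>' \<psi>] i2_Z[OF R(1) o(1) p] by (simp add: q_cmp mult.assoc)
    also have "\<dots> = q A ?K (e ?K * ?j2)"
      using o C K i2_Z[OF R(1) o(1) p] e_Z[OF K] by (simp add: eq[symmetric] q_cmp)
    finally show ?thesis by (simp add: eqs)
  qed
  have w: "q B ?C (i2 A B V) = c B ?K (T R) (q ?K (T R) (t R * ?q1)) (q B ?K ?\<psi>')"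
    using o C K \<psi>' tp1_Z[OF R(1) o(1) p] R by (simp add: q_cmp T_Ob algebra_simps eqs)
  show "(R, A, B, q R A ?p, q A B V, q B ?C (i2 A B V)) \<in> pexact P"
    by (rule exactI[OF R(1) o p iso q_carrier[OF o V] v w])
qed

text \<open>In one direction the normal form reduces to \<open>rotate_std\<close>. Conversely, the
  normal form of the rotated triangle gives an isomorphism from T A to a cone T R; as translation is
  fully faithful it comes from an isomorphism between A and R, and \<open>inverse_rotate_std\<close>
  applies.\<close>

lemma TR2_rotate:
  assumes tri: "is_triangle X T (A, B, D, u, v, w)"
  shows "(A, B, D, u, v, w) \<in> pexact P \<longleftrightarrow>
    (B, D, T A, v, w, inv\<^bsub>pmor P 0 (T A) (T B)\<^esub> (ptrM P A B u)) \<in> pexact P"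
proof
  have o: "A \<in> Ob" "B \<in> Ob" "D \<in> Ob" and m: "u \<in> Hm A B" "v \<in> Hm B D" "w \<in> Hm D (T A)"
    using tri by (auto simp: is_triangle_def)
  obtain U where U: "U \<in> Z 0 A B" "u = q A B U" by (rule Hm_rep[OF o(1,2) m(1)])
  have Tu: "inv\<^bsub>pmor P 0 (T A) (T B)\<^esub> (ptrM P A B u) = q (T A) (T B) (- (t B * U * t' A))"
    using o U by (simp add: cls_tr cls_minus T_Ob T_conj)
  have TuH: "q (T A) (T B) (- (t B * U * t' A)) \<in> Hm (T A) (T B)"
    using o U by (intro q_carrier Z_minus T_conj T_Ob)
  {
    assume ex: "(A, B, D, u, v, w) \<in> pexact P"
    let ?C = "Cn A B U"
    note C = cone_Ob'[OF o(1,2) U(1)]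
    obtain \<delta> where \<delta>: "is_iso X D ?C \<delta>" "c B D ?C \<delta> v = q B ?C (i2 A B U)"
      "w = c D ?C (T A) (q ?C (T A) (t A * p1 A B U)) \<delta>" by (rule exact_normal[OF ex U])
    show "(B, D, T A, v, w, inv\<^bsub>pmor P 0 (T A) (T B)\<^esub> (ptrM P A B u)) \<in> pexact P"
      unfolding Tu
    proof (rule exact_isoI[OF rotate_std[OF o(1,2) U(1)]])
      show "is_triangle X T (B, D, T A, v, w, q (T A) (T B) (- (t B * U * t' A)))"
        using o m TuH by (simp add: is_triangle_def T_Ob)
      show "isomorphic_triangles X T (ptrM P) (B, D, T A, v, w, q (T A) (T B) (- (t B * U * t' A)))
        (B, ?C, T A, q B ?C (i2 A B U), q ?C (T A) (t A * p1 A B U), q (T A) (T B) (- (t B * U * t' A)))"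
        unfolding isomorphic_triangles_def prod.case
        by (intro exI[of _ "pidt P B"] exI[of _ \<delta>] exI[of _ "pidt P (T A)"])
           (use o m C U \<delta> TuH pre.iso_idt[of B] pre.iso_idt[of "T A"] in
             \<open>auto simp: c_left c_right q_carrier i2_Z T_Ob TM_id\<close>)
    qed
  }
  {
    assume ex: "(B, D, T A, v, w, inv\<^bsub>pmor P 0 (T A) (T B)\<^esub> (ptrM P A B u)) \<in> pexact P"
    obtain V where V: "V \<in> Z 0 B D" "v = q B D V" by (rule Hm_rep[OF o(2,3) m(2)])
    let ?C = "Cn B D V"
    note C = cone_Ob'[OF o(2,3) V(1)]
    obtain \<delta> where \<delta>: "is_iso X (T A) ?C \<delta>" "c D (T A) ?C \<delta> w = q D ?C (i2 B D V)"
      "q (T A) (T B) (- (t B * U * t' A)) = c (T A) ?C (T B) (q ?C (T B) (t B * p1 B D V)) \<delta>"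
      using exact_normal[OF ex V] unfolding Tu by blast
    obtain R where R: "R \<in> Ob" "T R = ?C" using T_surj[OF C] by auto
    let ?p = "- (p1 B D V * t R)"
    note inv = inverse_rotate_std[OF o(2,3) V(1) R]
    obtain z where z: "z \<in> Z 0 (T A) (T R)" "\<delta> = q (T A) (T R) z"
      using Hm_rep[OF T_Ob[OF o(1)] C iso_Hm[OF \<delta>(1)]] R by metis
    obtain a where a: "a \<in> Z 0 A R" "t R * a * t' A = z" by (rule T_surj_mor[OF o(1) R(1) z(1)])
    obtain z' where z': "z' \<in> Z 0 (T R) (T A)" "c (T A) (T R) (T A) (q (T R) (T A) z') \<delta> = pidt P (T A)"
      "c (T R) (T A) (T R) \<delta> (q (T R) (T A) z') = pidt P (T R)"
      using iso_inv_obtain[OF \<delta>(1)] Hm_rep[OF C T_Ob[OF o(1)]] R(2) by metis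
    obtain a' where a': "a' \<in> Z 0 R A" "t A * a' * t' R = z'" by (rule T_surj_mor[OF R(1) o(1) z'(1)])
    have \<delta>T: "ptrM P A R (q A R a) = \<delta>" "ptrM P R A (q R A a') = q (T R) (T A) z'"
      using o R a a' z by (simp_all add: cls_tr)
    have e: "t A * e A * t' A = e (T A)" "t R * e R * t' R = e (T R)" using o R by (simp_all add: t_eqs)
    \<comment> \<open>Translation is faithful, so the two inverse relations may be checked after
      applying it.\<close>
    have aiso: "is_iso X A R (q A R a)"
    proof (rule isoI[OF o(1) R(1) a(1) a'(1)])
      have "ptrM P A A (q A A (a' * a)) = ptrM P A A (q A A (e A))"
        using TM_cmp[OF o(1) R(1) o(1) q_carrier[OF o(1) R(1) a(1)] q_carrier[OF R(1) o(1) a'(1)]] z' \<delta>T o R a a'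
        by (simp add: q_cmp T_Ob cls_tr e_Z e cls_idt)
      then show "q A A (a' * a) = q A A (e A)"
        by (rule T_inj[OF o(1) o(1) Z0_mult[OF o(1) R(1) o(1) a'(1) a(1)] e_Z[OF o(1)]])
      have "ptrM P R R (q R R (a * a')) = ptrM P R R (q R R (e R))"
        using TM_cmp[OF R(1) o(1) R(1) q_carrier[OF R(1) o(1) a'(1)] q_carrier[OF o(1) R(1) a(1)]] z' \<delta>T o R(1) a a'
        by (simp add: q_cmp T_Ob cls_tr e_Z e cls_idt)
      then show "q R R (a * a') = q R R (e R)"
        by (rule T_inj[OF R(1) R(1) Z0_mult[OF R(1) o(1) R(1) a(1) a'(1)] e_Z[OF R(1)]])
    qed
    \<comment> \<open>Again checked after translation. The sign of the rotated first map matches the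
      sign in \<open>?p\<close>.\<close>
    have pa: "q A B U = q A B (?p * a)"
    proof (rule T_inj[OF o(1,2) U(1) Z0_mult[OF o(1) R(1) o(2) inv(1) a(1)]])
      have Tp: "t B * (p1 B D V * t R * a) * t' A = t B * p1 B D V * z"
        by (simp add: a(2)[symmetric] mult.assoc)
      have pz: "t B * p1 B D V * z \<in> Z 0 (T A) (T B)"
        using Z0_mult[OF T_Ob[OF o(1)] C T_Ob[OF o(2)] tp1_Z[OF o(2,3) V(1)]] z(1) R(2) by simp
      have "q (T A) (T B) (- (t B * U * t' A)) = q (T A) (T B) (t B * p1 B D V * z)"
        using \<delta>(3) z R o C tp1_Z[OF o(2,3) V(1)] by (simp add: q_cmp T_Ob)
      then have "inv\<^bsub>pmor P 0 (T A) (T B)\<^esub> (q (T A) (T B) (- (t B * U * t' A)))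
          = inv\<^bsub>pmor P 0 (T A) (T B)\<^esub> (q (T A) (T B) (t B * p1 B D V * z))" by simp
      then have "q (T A) (T B) (t B * U * t' A) = q (T A) (T B) (- (t B * p1 B D V * z))"
        using o pz U T_conj[OF o(1,2) U(1)] by (simp add: cls_minus T_Ob Z_minus)
      then show "ptrM P A B (q A B U) = ptrM P A B (q A B (?p * a))"
        using o U Z0_mult[OF o(1) R(1) o(2) inv(1) a(1)] by (simp add: cls_tr Tp)
    qed
    show "(A, B, D, u, v, w) \<in> pexact P"
    proof (rule exact_isoI[OF inv(2) _ tri])
      show "isomorphic_triangles X T (ptrM P) (A, B, D, u, v, w) (R, B, D, q R B ?p, q B D V, q D ?C (i2 B D V))"
        unfolding isomorphic_triangles_def prod.case
        by (intro exI[of _ "q A R a"] exI[of _ "pidt P B"] exI[of _ "pidt P D"])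
           (use o m C U V R inv a \<delta> aiso pre.iso_idt[of B] pre.iso_idt[of D] pa in
             \<open>auto simp: c_left c_right q_carrier i2_Z \<delta>T q_cmp\<close>)
    qed
  }
qed

end

section \<open>Completion of squares and the octahedron\<close>

context homotopy_presentation
begin

lemma iso_cancel:
  assumes o: "A \<in> Ob" "B \<in> Ob" "D \<in> Ob" and f: "f \<in> Hm A B"
    and g: "g \<in> Hm B D" "h \<in> Hm D B" "c B D B h g = pidt P B"
  shows "c A D B h (c A B D g f) = f"
  using c_assoc[OF o(1,2,3,2) f g(1,2)] g(3) o f by (simp add: c_left)

text \<open>Between normal forms the filler is a cone map; in general it is conjugated by the
  isomorphisms to the cones.\<close>

lemma TR3_fill:
  assumes ex: "(A, B, D, u, v, w) \<in> pexact P" "(A', B', D', u', v', w') \<in> pexact P"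
    and fg: "f \<in> Hm A A'" "g \<in> Hm B B'" and sq: "c A B B' g u = c A A' B' u' f"
  shows "\<exists>h\<in>Hm D D'. c B D D' h v = c B B' D' v' g \<and>
    c D (T A) (T A') (ptrM P A A' f) w = c D D' (T A') w' h"
proof -
  note e1 = exactD[OF ex(1)] and e2 = exactD[OF ex(2)]
  then have o: "A \<in> Ob" "B \<in> Ob" "D \<in> Ob" "A' \<in> Ob" "B' \<in> Ob" "D' \<in> Ob" by auto
  obtain U where U: "U \<in> Z 0 A B" "u = q A B U" using Hm_rep e1 by metis
  obtain U' where U': "U' \<in> Z 0 A' B'" "u' = q A' B' U'" using Hm_rep e2 by metis
  obtain a where a: "a \<in> Z 0 A A'" "f = q A A' a" using Hm_rep o fg by metis
  obtain b where b: "b \<in> Z 0 B B'" "g = q B B' b" using Hm_rep o fg by metis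
  let ?C = "Cn A B U" and ?C' = "Cn A' B' U'"
  have C: "?C \<in> Ob" "?C' \<in> Ob" using o U U' by (auto intro: cone_Ob')
  have eq: "q A B' (b * U) = q A B' (U' * a)" using sq o U U' a b by (simp add: q_cmp)
  obtain \<phi> where \<phi>: "\<phi> \<in> Z 0 ?C ?C'" "\<phi> * i2 A B U = i2 A' B' U' * b" "p1 A' B' U' * \<phi> = a * p1 A B U"
    by (rule cone_map[OF o(1,2,4,5) U(1) U'(1) a(1) b(1) eq])
  obtain \<delta> where \<delta>: "is_iso X D ?C \<delta>" "c B D ?C \<delta> v = q B ?C (i2 A B U)"
    "w = c D ?C (T A) (q ?C (T A) (t A * p1 A B U)) \<delta>" by (rule exact_normal[OF ex(1) U])
  obtain \<delta>' where \<delta>': "is_iso X D' ?C' \<delta>'" "c B' D' ?C' \<delta>' v' = q B' ?C' (i2 A' B' U')"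
    "w' = c D' ?C' (T A') (q ?C' (T A') (t A' * p1 A' B' U')) \<delta>'" by (rule exact_normal[OF ex(2) U'])
  obtain \<epsilon> where \<epsilon>: "is_iso X ?C' D' \<epsilon>" "c D' ?C' D' \<epsilon> \<delta>' = pidt P D'" "c ?C' D' ?C' \<delta>' \<epsilon> = pidt P ?C'"
    "\<epsilon> \<in> Hm ?C' D'" by (rule iso_inv_obtain[OF \<delta>'(1)])
  note m = iso_Hm[OF \<delta>(1)] iso_Hm[OF \<delta>'(1)] \<epsilon>(4) q_carrier[OF C \<phi>(1)]
    q_carrier[OF o(2) C(1) i2_Z[OF o(1,2) U(1)]] q_carrier[OF o(5) C(2) i2_Z[OF o(4,5) U'(1)]]
    q_carrier[OF C(1) T_Ob tp1_Z[OF o(1,2) U(1)]] q_carrier[OF C(2) T_Ob tp1_Z[OF o(4,5) U'(1)]]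
    TM_closed[OF o(1,4)] fg e1 e2
  let ?h = "c D ?C' D' \<epsilon> (c D ?C ?C' (q ?C ?C' \<phi>) \<delta>)"
  show ?thesis
  proof (intro bexI[of _ ?h] conjI)
    show "?h \<in> Hm D D'" using m o C by (auto intro!: c_closed)
    have "c B D D' ?h v = c B ?C' D' \<epsilon> (c B ?C ?C' (q ?C ?C' \<phi>) (q B ?C (i2 A B U)))"
      using m o C \<delta>(2) by (simp add: c_assoc c_closed)
    also have "\<dots> = c B ?C' D' \<epsilon> (c B D' ?C' \<delta>' (c B B' D' v' g))"
      using \<phi> o C U U' a b c_assoc[OF o(2,5,6) C(2), of g v' \<delta>'] m \<delta>'(2) by (simp add: q_cmp i2_Z)
    also have "\<dots> = c B B' D' v' g"
      by (rule iso_cancel) (use m o C \<epsilon> in \<open>auto intro: c_closed\<close>)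
    finally show "c B D D' ?h v = c B B' D' v' g" .
    have "c D (T A) (T A') (ptrM P A A' f) w = c D ?C (T A') (c ?C (T A) (T A') (ptrM P A A' f) (q ?C (T A) (t A * p1 A B U))) \<delta>"
      using m o C \<delta>(3) by (simp add: c_assoc T_Ob)
    also have "\<dots> = c D ?C (T A') (c ?C ?C' (T A') (q ?C' (T A') (t A' * p1 A' B' U')) (q ?C ?C' \<phi>)) \<delta>"
      using T_comp_cone[OF o(1,2,4,5) U(1) U'(1) a(1) \<phi>(1,3)] a by simp
    also have "\<dots> = c D ?C' (T A') (q ?C' (T A') (t A' * p1 A' B' U')) (c D ?C ?C' (q ?C ?C' \<phi>) \<delta>)"
      using m o C by (simp add: c_assoc T_Ob)
    also have "c D ?C ?C' (q ?C ?C' \<phi>) \<delta> = c D D' ?C' \<delta>' ?h"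
      by (rule iso_cancel[symmetric]) (use m o C \<epsilon> in \<open>auto intro: c_closed\<close>)
    also have "c D ?C' (T A') (q ?C' (T A') (t A' * p1 A' B' U')) (c D D' ?C' \<delta>' ?h) = c D D' (T A') w' ?h"
      using m o C \<delta>'(3) by (simp add: c_assoc c_closed T_Ob)
    finally show "c D (T A) (T A') (ptrM P A A' f) w = c D D' (T A') w' ?h" .
  qed
qed

text \<open>Here f is the identity on the copy of A and V on B, while g is U on the copy of A and
  the identity on D. The cone of f contains A twice; cancelling the two copies leaves the cone of
  V.\<close>

lemma octahedral_std:
  assumes o: "A \<in> Ob" "B \<in> Ob" "D \<in> Ob" and U: "U \<in> Z 0 A B" and V: "V \<in> Z 0 B D"
  obtains f g where "f \<in> Z 0 (Cn A B U) (Cn A D (V * U))" "g \<in> Z 0 (Cn A D (V * U)) (Cn B D V)"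
    "f * i2 A B U = i2 A D (V * U) * V" "p1 A D (V * U) * f = p1 A B U"
    "g * i2 A D (V * U) = i2 B D V" "p1 B D V * g = U * p1 A D (V * U)"
    "(Cn A B U, Cn A D (V * U), Cn B D V, q (Cn A B U) (Cn A D (V * U)) f,
      q (Cn A D (V * U)) (Cn B D V) g,
      q (Cn B D V) (T (Cn A B U)) (t (Cn A B U) * (i2 A B U * p1 B D V))) \<in> pexact P"
proof -
  have W: "V * U \<in> Z 0 A D" using Z0_mult o U V by blast
  let ?F = "Cn A B U" and ?G = "Cn B D V" and ?H = "Cn A D (V * U)"
  have C: "?F \<in> Ob" "?G \<in> Ob" "?H \<in> Ob" using o U V W by (auto intro: cone_Ob')
  let ?i1 = "i1 A B U" and ?i2 = "i2 A B U" and ?p1 = "p1 A B U" and ?p2 = "p2 A B U"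
  let ?m1 = "i1 B D V" and ?m2 = "i2 B D V" and ?n1 = "p1 B D V" and ?n2 = "p2 B D V"
  let ?k1 = "i1 A D (V * U)" and ?k2 = "i2 A D (V * U)" and ?l1 = "p1 A D (V * U)" and ?l2 = "p2 A D (V * U)"
  note lU = cone_L[OF o(1,2) U] and lV = cone_L[OF o(2,3) V] and lW = cone_L[OF o(1,3) W]
  have de: "e D * (V * x) = V * x" "d D * (V * x) = V * (d B * x)" for x
    using Z_left[OF o(2,3) V, THEN reassoc] Z_d[OF V, THEN reassoc] by (simp_all add: mult.assoc)
  note eqs = cone_eqs[OF o(1,2) U] cone_eqs[OF o(2,3) V] cone_eqs[OF o(1,3) W] o C d_eqs
  let ?f = "?k1 * ?p1 + ?k2 * (V * ?p2)" and ?g = "?m1 * (U * ?l1) + ?m2 * ?l2"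
  have 1: "V * ?p2 \<in> L 0 0 ?F D" by (rule L0_mult[OF Z_L[OF V] lU(5)]) (use o C in auto)
  have f: "?f \<in> Z 0 ?F ?H"
    by (rule ZI, intro L_add L0_mult[OF lW(2) lU(3)] L0_mult[OF lW(4) 1])
       (use o C in \<open>auto simp: algebra_simps eqs\<close>)
  have 2: "U * ?l1 \<in> L 0 1 ?H B" by (rule L0_mult[OF Z_L[OF U] lW(3)]) (use o C in auto)
  have g: "?g \<in> Z 0 ?H ?G"
    by (rule ZI, intro L_add L0_mult[OF lV(2) 2] L0_mult[OF lV(4) lW(5)])
       (use o C in \<open>auto simp: algebra_simps eqs\<close>)
  have fg: "?f * ?i2 = ?k2 * V" "?l1 * ?f = ?p1" "?g * ?k2 = ?m2" "?n1 * ?g = U * ?l1"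
    by (simp_all add: algebra_simps eqs)
  let ?K = "Cn ?F ?H ?f"
  note K = cone_Ob'[OF C(1,3) f]
  let ?j1 = "i1 ?F ?H ?f" and ?j2 = "i2 ?F ?H ?f" and ?q1 = "p1 ?F ?H ?f" and ?q2 = "p2 ?F ?H ?f"
  note k = cone_L[OF C(1,3) f]
  \<comment> \<open>Since f is a sum, the rules for \<open>d ?K\<close> that mention it are restated
    in distributed form, to agree with the normal form reached by
    \<open>algebra_simps\<close>.\<close>
  have fx: "?f * x = ?k1 * (?p1 * x) + ?k2 * (V * (?p2 * x))" for x by (simp add: algebra_simps)
  have q2d: "?q2 * d ?K = ?k1 * (?p1 * ?q1) + ?k2 * (V * (?p2 * ?q1)) + d ?H * ?q2"
    "?q2 * (d ?K * x) = ?k1 * (?p1 * (?q1 * x)) + ?k2 * (V * (?p2 * (?q1 * x))) + d ?H * (?q2 * x)" for x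
    using cone_eq(6)[OF C(1,3) f] cone_eq(6)[OF C(1,3) f, THEN reassoc, of x] by (simp_all add: algebra_simps)
  have dj1: "d ?K * ?j1 = ?j2 * (?k1 * ?p1) + ?j2 * (?k2 * (V * ?p2)) - ?j1 * d ?F"
    "d ?K * (?j1 * x) = ?j2 * (?k1 * (?p1 * x)) + ?j2 * (?k2 * (V * (?p2 * x))) - ?j1 * (d ?F * x)" for x
    using cone_eq(7)[OF C(1,3) f] cone_eq(7)[OF C(1,3) f, THEN reassoc, of x] by (simp_all add: algebra_simps)
  note keq = cone_eq(1-5,8-16)[OF C(1,3) f] cone_eq(1-5,8-16)[OF C(1,3) f, THEN reassoc] q2d dj1 K
  let ?\<rho> = "?j1 * (?i2 * ?n1) + ?j2 * (?k2 * ?n2)"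
  \<comment> \<open>The term with U makes \<open>?\<rho>'\<close> restrict to g on the cone of
    \<open>V * U\<close>, as the triangle requires.\<close>
  let ?\<rho>' = "?m1 * (?p2 * ?q1) + ?m1 * (U * (?l1 * ?q2)) + ?m2 * (?l2 * ?q2)"
  have 3: "?i2 * ?n1 \<in> L 0 1 ?G ?F" by (rule L0_mult[OF lU(4) lV(3)]) (use o C in auto)
  have 4: "?k2 * ?n2 \<in> L 0 0 ?G ?H" by (rule L0_mult[OF lW(4) lV(5)]) (use o C in auto)
  have \<rho>: "?\<rho> \<in> Z 0 ?G ?K"
    by (rule ZI, intro L_add L0_mult[OF k(2) 3] L0_mult[OF k(4) 4])
       (use o C K in \<open>auto simp: algebra_simps eqs keq de\<close>)
  have 5: "?p2 * ?q1 \<in> L 0 1 ?K B" by (rule L0_mult[OF lU(5) k(3)]) (use o C K in auto)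
  have 6: "?l2 * ?q2 \<in> L 0 0 ?K D" by (rule L0_mult[OF lW(5) k(5)]) (use o C K in auto)
  have 7: "?l1 * ?q2 \<in> L 0 1 ?K A" by (rule L0_mult[OF lW(3) k(5)]) (use o C K in auto)
  have 8: "U * (?l1 * ?q2) \<in> L 0 1 ?K B" by (rule L0_mult[OF Z_L[OF U] 7]) (use o C K in auto)
  have \<rho>': "?\<rho>' \<in> Z 0 ?K ?G"
    by (rule ZI, intro L_add L0_mult[OF lV(2) 5] L0_mult[OF lV(2) 8] L0_mult[OF lV(4) 6])
       (use o C K in \<open>auto simp: algebra_simps eqs keq de\<close>)
  have eG: "e ?G = ?m1 * ?n1 + ?m2 * ?n2" and eF: "e ?F = ?i1 * ?p1 + ?i2 * ?p2"
    and eH: "e ?H = ?k1 * ?l1 + ?k2 * ?l2" and eK: "e ?K = ?j1 * ?q1 + ?j2 * ?q2"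
    using e_cone o U V W C f by (auto simp: Z_def)
  have \<rho>'\<rho>: "?\<rho>' * ?\<rho> = e ?G" unfolding eG by (simp add: algebra_simps eqs keq)
  have 9: "?i1 * (?l1 * ?q2) \<in> L 0 0 ?K ?F" by (rule L0_mult[OF lU(2) 7]) (use o C K in auto)
  \<comment> \<open>Takes the copy of A in the cone of \<open>V * U\<close> to the copy in the cone
    of U, which cancels both.\<close>
  have h: "?j1 * (?i1 * (?l1 * ?q2)) \<in> L 0 (-1) ?K ?K" by (rule L0_mult[OF k(2) 9]) (use o C K in auto)
  have eq: "q ?K ?K (e ?K) = q ?K ?K (?\<rho> * ?\<rho>')"
  proof (rule q_eqI[OF K K e_Z[OF K] Z0_mult[OF K C(2) K \<rho> \<rho>'] h])
    have "?j1 * ?q1 = ?j1 * (e ?F * ?q1)" "?j2 * ?q2 = ?j2 * (e ?H * ?q2)" by (simp_all add: keq)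
    then have a: "?j1 * ?q1 = ?j1 * (?i1 * (?p1 * ?q1)) + ?j1 * (?i2 * (?p2 * ?q1))"
      "?j2 * ?q2 = ?j2 * (?k1 * (?l1 * ?q2)) + ?j2 * (?k2 * (?l2 * ?q2))"
      unfolding eF eH by (simp_all add: algebra_simps)
    show "e ?K - ?\<rho> * ?\<rho>' = d ?K * (?j1 * (?i1 * (?l1 * ?q2))) + ?j1 * (?i1 * (?l1 * ?q2)) * d ?K"
      unfolding eK a by (simp add: algebra_simps eqs keq)
  qed
  have iso: "is_iso X ?G ?K (q ?G ?K ?\<rho>)"
    by (rule isoI[OF C(2) K \<rho> \<rho>']) (simp_all only: eq \<rho>'\<rho>)
  have v: "c ?H ?G ?K (q ?G ?K ?\<rho>) (q ?H ?G ?g) = q ?H ?K ?j2"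
  proof -
    have g': "?g = ?\<rho>' * ?j2" by (simp add: eqs keq algebra_simps)
    have "c ?H ?G ?K (q ?G ?K ?\<rho>) (q ?H ?G ?g) = q ?H ?K (?\<rho> * (?\<rho>' * ?j2))"
      unfolding g'[symmetric] by (rule q_cmp[OF C(3,2) K g \<rho>])
    also have "\<dots> = c ?H ?K ?K (q ?K ?K (?\<rho> * ?\<rho>')) (q ?H ?K ?j2)"
      using q_cmp[OF C(3) K K i2_Z[OF C(1,3) f] Z0_mult[OF K C(2) K \<rho> \<rho>']]
      by (simp only: mult.assoc)
    also have "\<dots> = q ?H ?K (e ?K * ?j2)"
      unfolding eq[symmetric] by (rule q_cmp[OF C(3) K K i2_Z[OF C(1,3) f] e_Z[OF K]])
    finally show ?thesis by (simp add: keq)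
  qed
  have w: "q ?G (T ?F) (t ?F * (?i2 * ?n1)) = c ?G ?K (T ?F) (q ?K (T ?F) (t ?F * ?q1)) (q ?G ?K ?\<rho>)"
    unfolding q_cmp[OF C(2) K T_Ob[OF C(1)] \<rho> tp1_Z[OF C(1,3) f]] by (simp add: algebra_simps eqs keq)
  have "(?F, ?H, ?G, q ?F ?H ?f, q ?H ?G ?g, q ?G (T ?F) (t ?F * (?i2 * ?n1))) \<in> pexact P"
    by (rule exactI[OF C(1,3,2) f iso q_carrier[OF C(3,2) g] v w])
  from that[OF f g fg this] show thesis .
qed

text \<open>The three triangles are brought to normal form with representatives U, V and exactly
  their product \<open>V * U\<close>; the standard octahedron is then conjugated by the three
  isomorphisms.\<close>

lemma TR4_octahedron:
  assumes e1: "(A, B, D', u, j, k) \<in> pexact P" and e2: "(B, D, A', v, l, i) \<in> pexact P"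
    and e3: "(A, D, B', c A B D v u, m, n) \<in> pexact P"
  shows "\<exists>f\<in>Hm D' B'. \<exists>g\<in>Hm B' A'.
    (D', B', A', f, g, c A' (T B) (T D') (ptrM P B D' j) i) \<in> pexact P \<and>
    c B D' B' f j = c B D B' m v \<and> c D' B' (T A) n f = k \<and> c D B' A' g m = l \<and>
    c B' A' (T B) i g = c B' (T A) (T B) (ptrM P A B u) n"
proof -
  have o: "A \<in> Ob" "B \<in> Ob" "D \<in> Ob" "D' \<in> Ob" "A' \<in> Ob" "B' \<in> Ob"
    and hm: "u \<in> Hm A B" "v \<in> Hm B D" "j \<in> Hm B D'" "k \<in> Hm D' (T A)" "l \<in> Hm D A'" "i \<in> Hm A' (T B)"
      "m \<in> Hm D B'" "n \<in> Hm B' (T A)"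
    using exactD[OF e1] exactD[OF e2] exactD[OF e3] by auto
  obtain U where U: "U \<in> Z 0 A B" "u = q A B U" by (rule Hm_rep[OF o(1,2) hm(1)])
  obtain V where V: "V \<in> Z 0 B D" "v = q B D V" by (rule Hm_rep[OF o(2,3) hm(2)])
  have W: "V * U \<in> Z 0 A D" "c A B D v u = q A D (V * U)"
    using Z0_mult o U V by (auto simp: q_cmp)
  let ?F = "Cn A B U" and ?G = "Cn B D V" and ?H = "Cn A D (V * U)"
  have C: "?F \<in> Ob" "?G \<in> Ob" "?H \<in> Ob" using o U V W by (auto intro: cone_Ob')
  obtain \<delta>1 where d1: "is_iso X D' ?F \<delta>1" "c B D' ?F \<delta>1 j = q B ?F (i2 A B U)"
    "k = c D' ?F (T A) (q ?F (T A) (t A * p1 A B U)) \<delta>1" by (rule exact_normal[OF e1 U])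
  obtain \<delta>2 where d2: "is_iso X A' ?G \<delta>2" "c D A' ?G \<delta>2 l = q D ?G (i2 B D V)"
    "i = c A' ?G (T B) (q ?G (T B) (t B * p1 B D V)) \<delta>2" by (rule exact_normal[OF e2 V])
  obtain \<delta>3 where d3: "is_iso X B' ?H \<delta>3" "c D B' ?H \<delta>3 m = q D ?H (i2 A D (V * U))"
    "n = c B' ?H (T A) (q ?H (T A) (t A * p1 A D (V * U))) \<delta>3" by (rule exact_normal[OF e3 W])
  obtain \<epsilon>2 where i2: "c A' ?G A' \<epsilon>2 \<delta>2 = pidt P A'" "c ?G A' ?G \<delta>2 \<epsilon>2 = pidt P ?G" "\<epsilon>2 \<in> Hm ?G A'"
    by (rule iso_inv_obtain[OF d2(1)])
  obtain \<epsilon>3 where i3: "c B' ?H B' \<epsilon>3 \<delta>3 = pidt P B'" "c ?H B' ?H \<delta>3 \<epsilon>3 = pidt P ?H" "\<epsilon>3 \<in> Hm ?H B'"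
    by (rule iso_inv_obtain[OF d3(1)])
  obtain f g where f: "f \<in> Z 0 ?F ?H" and g: "g \<in> Z 0 ?H ?G"
    and fg: "f * i2 A B U = i2 A D (V * U) * V" "p1 A D (V * U) * f = p1 A B U"
      "g * i2 A D (V * U) = i2 B D V" "p1 B D V * g = U * p1 A D (V * U)"
    and ex: "(?F, ?H, ?G, q ?F ?H f, q ?H ?G g, q ?G (T ?F) (t ?F * (i2 A B U * p1 B D V))) \<in> pexact P"
    by (rule octahedral_std[OF o(1-3) U(1) V(1)])
  have to: "T A \<in> Ob" "T B \<in> Ob" "T D' \<in> Ob" "T ?F \<in> Ob" using o C by (auto intro: T_Ob)
  have i2Z: "i2 A B U \<in> Z 0 B ?F" "i2 B D V \<in> Z 0 D ?G" "i2 A D (V * U) \<in> Z 0 D ?H"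
    using o U V W by (auto intro: i2_Z)
  have tpZ: "t A * p1 A B U \<in> Z 0 ?F (T A)" "t B * p1 B D V \<in> Z 0 ?G (T B)"
    "t A * p1 A D (V * U) \<in> Z 0 ?H (T A)"
    using o U V W by (auto intro: tp1_Z)
  have tiZ: "t ?F * i2 A B U * t' B \<in> Z 0 (T B) (T ?F)" using o C i2Z by (intro T_conj) auto
  note m1 = q_carrier[OF o(2) C(1) i2Z(1)] q_carrier[OF o(3) C(2) i2Z(2)] q_carrier[OF o(3) C(3) i2Z(3)]
    q_carrier[OF C(1) to(1) tpZ(1)] q_carrier[OF C(2) to(2) tpZ(2)] q_carrier[OF C(3) to(1) tpZ(3)]
    q_carrier[OF C(1,3) f] q_carrier[OF C(3,2) g] iso_Hm[OF d1(1)] iso_Hm[OF d2(1)] iso_Hm[OF d3(1)]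
    i2(3) i3(3) TM_closed[OF o(2,4) hm(3)] TM_closed[OF o(4) C(1) iso_Hm[OF d1(1)]]
  \<comment> \<open>Writing the unit of B as \<open>t' B * t B\<close> splits the third map into the
    translated inclusion after the connecting map of the cone of V.\<close>
  have wZ: "t ?F * (i2 A B U * p1 B D V) = t ?F * i2 A B U * t' B * (t B * p1 B D V)"
    using o cone_eqs[OF o(2,3) V(1)] by (simp add: mult.assoc t_eqs)
  have w_eq: "q ?G (T ?F) (t ?F * (i2 A B U * p1 B D V)) = c ?G (T B) (T ?F) (ptrM P B ?F (q B ?F (i2 A B U))) (q ?G (T B) (t B * p1 B D V))"
    using o C to i2Z(1) unfolding wZ by (simp add: cls_tr q_cmp tiZ tpZ)
  let ?f = "c D' ?H B' \<epsilon>3 (c D' ?F ?H (q ?F ?H f) \<delta>1)" and ?g = "c B' ?G A' \<epsilon>2 (c B' ?H ?G (q ?H ?G g) \<delta>3)"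
  have fH: "?f \<in> Hm D' B'" and gH: "?g \<in> Hm B' A'" using m1 o C by (auto intro!: c_closed)
  have sf: "c D' B' ?H \<delta>3 ?f = c D' ?F ?H (q ?F ?H f) \<delta>1"
    by (rule iso_cancel) (use o C m1 i3 in \<open>auto intro: c_closed\<close>)
  have sg: "c B' A' ?G \<delta>2 ?g = c B' ?H ?G (q ?H ?G g) \<delta>3"
    by (rule iso_cancel) (use o C m1 i2 in \<open>auto intro: c_closed\<close>)
  have wH: "c A' (T B) (T D') (ptrM P B D' j) i \<in> Hm A' (T D')" using o to hm m1 by (auto intro!: c_closed)
  have exact: "(D', B', A', ?f, ?g, c A' (T B) (T D') (ptrM P B D' j) i) \<in> pexact P"
  proof (rule exact_isoI[OF ex])
    show "is_triangle X T (D', B', A', ?f, ?g, c A' (T B) (T D') (ptrM P B D' j) i)"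
      using o fH gH wH by (simp add: is_triangle_def)
    have "c A' (T D') (T ?F) (ptrM P D' ?F \<delta>1) (c A' (T B) (T D') (ptrM P B D' j) i)
        = c A' (T B) (T ?F) (c (T B) (T D') (T ?F) (ptrM P D' ?F \<delta>1) (ptrM P B D' j)) i"
      using o C to hm m1 by (simp add: c_assoc)
    also have "\<dots> = c A' (T B) (T ?F) (ptrM P B ?F (q B ?F (i2 A B U))) (c A' ?G (T B) (q ?G (T B) (t B * p1 B D V)) \<delta>2)"
      using TM_cmp[OF o(2,4) C(1) hm(3) iso_Hm[OF d1(1)]] d1(2) d2(3) by simp
    also have "\<dots> = c A' ?G (T ?F) (q ?G (T ?F) (t ?F * (i2 A B U * p1 B D V))) \<delta>2"
      unfolding w_eq using o C to m1 TM_closed[OF o(2) C(1) m1(1)] by (simp add: c_assoc)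
    finally show "isomorphic_triangles X T (ptrM P) (D', B', A', ?f, ?g, c A' (T B) (T D') (ptrM P B D' j) i)
        (?F, ?H, ?G, q ?F ?H f, q ?H ?G g, q ?G (T ?F) (t ?F * (i2 A B U * p1 B D V)))"
      unfolding isomorphic_triangles_def prod.case
      by (intro exI[of _ \<delta>1] exI[of _ \<delta>3] exI[of _ \<delta>2]) (use d1 d2 d3 sf sg in auto)
  qed
  have 1: "c B D' B' ?f j = c B D B' m v"
  proof -
    have "c B D' B' ?f j = c B ?H B' \<epsilon>3 (c B ?F ?H (q ?F ?H f) (c B D' ?F \<delta>1 j))"
      using o C hm m1 by (simp add: c_assoc c_closed)
    also have "\<dots> = c B ?H B' \<epsilon>3 (c B D ?H (q D ?H (i2 A D (V * U))) v)"
      using o C i2Z f V fg by (simp add: d1(2) q_cmp)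
    also have "\<dots> = c B ?H B' \<epsilon>3 (c B B' ?H \<delta>3 (c B D B' m v))"
      using o C hm m1 by (simp add: c_assoc d3(2)[symmetric])
    also have "\<dots> = c B D B' m v" by (rule iso_cancel) (use o C m1 hm i3 in \<open>auto intro: c_closed\<close>)
    finally show ?thesis .
  qed
  have 2: "c D' B' (T A) n ?f = k"
  proof -
    have "c D' B' (T A) n ?f = c D' ?H (T A) (q ?H (T A) (t A * p1 A D (V * U))) (c D' B' ?H \<delta>3 ?f)"
      unfolding d3(3) using o C to hm m1 fH by (simp add: c_assoc)
    also have "\<dots> = c D' ?F (T A) (c ?F ?H (T A) (q ?H (T A) (t A * p1 A D (V * U))) (q ?F ?H f)) \<delta>1"
      unfolding sf using o C to hm m1 by (simp add: c_assoc)
    also have "\<dots> = k" unfolding d1(3) using o C to tpZ f fg by (simp add: q_cmp mult.assoc)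
    finally show ?thesis .
  qed
  have 3: "c D B' A' ?g m = l"
  proof -
    have "c D B' A' ?g m = c D ?G A' \<epsilon>2 (c D ?H ?G (q ?H ?G g) (c D B' ?H \<delta>3 m))"
      using o C hm m1 by (simp add: c_assoc c_closed)
    also have "\<dots> = c D ?G A' \<epsilon>2 (c D A' ?G \<delta>2 l)"
      using o C i2Z g fg by (simp add: d3(2) d2(2) q_cmp)
    also have "\<dots> = l" by (rule iso_cancel) (use o C m1 hm i2 in auto)
    finally show ?thesis .
  qed
  have 4: "c B' A' (T B) i ?g = c B' (T A) (T B) (ptrM P A B u) n"
  proof -
    have "c B' A' (T B) i ?g = c B' ?G (T B) (q ?G (T B) (t B * p1 B D V)) (c B' A' ?G \<delta>2 ?g)"
      unfolding d2(3) using o C to hm m1 gH by (simp add: c_assoc)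
    also have "\<dots> = c B' ?H (T B) (c ?H ?G (T B) (q ?G (T B) (t B * p1 B D V)) (q ?H ?G g)) \<delta>3"
      unfolding sg using o C to hm m1 by (simp add: c_assoc)
    also have "c ?H ?G (T B) (q ?G (T B) (t B * p1 B D V)) (q ?H ?G g) = q ?H (T B) (t B * (U * p1 A D (V * U)))"
      using o C to tpZ g fg by (simp add: q_cmp mult.assoc)
    also have "t B * (U * p1 A D (V * U)) = t B * U * t' A * (t A * p1 A D (V * U))"
      using o cone_eqs[OF o(1,3) W(1)] by (simp add: mult.assoc t_eqs)
    also have "q ?H (T B) \<dots> = c ?H (T A) (T B) (ptrM P A B u) (q ?H (T A) (t A * p1 A D (V * U)))"
      using o C to tpZ U T_conj[OF o(1,2) U(1)] by (simp add: cls_tr q_cmp)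
    also have "c B' ?H (T B) \<dots> \<delta>3 = c B' (T A) (T B) (ptrM P A B u) n"
      unfolding d3(3) using o C to m1 TM_closed[OF o(1,2) hm(1)] by (simp add: c_assoc)
    finally show ?thesis .
  qed
  show ?thesis using fH gH exact 1 2 3 4 by blast
qed

end

section \<open>The triangulated persistence category\<close>

context homotopy_presentation
begin

text \<open>A unit that is zero kills every cocycle into and out of the object.\<close>

lemma zero_object_O0: "is_zero_object X O0"
proof -
  have "Z 0 A O0 = {0}" "Z 0 O0 A = {0}" if A: "A \<in> Ob" for A
  proof -
    have "x = 0" if "x \<in> Z 0 A O0" for x
      using Z_left[OF A O0_Ob that] by (simp add: e_O0)
    then show "Z 0 A O0 = {0}" using Z_zero[OF A O0_Ob] by blast
    have "x = 0" if "x \<in> Z 0 O0 A" for x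
      using Z_right[OF O0_Ob A that] by (simp add: e_O0)
    then show "Z 0 O0 A = {0}" using Z_zero[OF O0_Ob A] by blast
  qed
  then show ?thesis by (simp add: is_zero_object_def O0_Ob carrier_P cls_one)
qed

text \<open>The direct sum of \<open>A\<close> and \<open>B\<close> is the cone of the zero map \<open>T\<^sup>-\<^sup>1A \<rightarrow> B\<close>.\<close>

lemma biproduct_exists:
  assumes o: "A \<in> Ob" "B \<in> Ob"
  shows "\<exists>S j1 j2 q1 q2. is_biproduct X A B S j1 j2 q1 q2"
proof -
  obtain R where R: "R \<in> Ob" "T R = A" using T_surj o by blast
  have z: "0 \<in> Z 0 R B" using Z_zero R o by blast
  let ?C = "Cn R B 0"
  note C = cone_Ob'[OF R(1) o(2) z] and l = cone_L[OF R(1) o(2) z] and eqs = cone_eqs[OF R(1) o(2) z]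
  note te = t_eqs[of R, unfolded R(2)] R(1)
  have j1: "i1 R B 0 * t' R \<in> Z 0 A ?C"
    by (intro ZI L0_mult[OF l(2) t'_L[OF R(1), unfolded R(2)]])
       (use o C R in \<open>auto simp: eqs te algebra_simps\<close>)
  have q1: "t R * p1 R B 0 \<in> Z 0 ?C A" using tp1_Z[OF R(1) o(2) z] R by simp
  have j2: "i2 R B 0 \<in> Z 0 B ?C" by (rule i2_Z[OF R(1) o(2) z])
  have q2: "p2 R B 0 \<in> Z 0 ?C B" by (intro ZI l) (simp add: eqs)
  have "is_biproduct X A B ?C (q A ?C (i1 R B 0 * t' R)) (q B ?C (i2 R B 0)) (q ?C A (t R * p1 R B 0)) (q ?C B (p2 R B 0))"
    using o C j1 j2 q1 q2 e_cone[OF R(1) o(2) Z_L[OF z] Z_d[OF z]]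
      Z0_mult[OF C o(1) C j1 q1] Z0_mult[OF C o(2) C j2 q2]
    by (simp add: is_biproduct_def q_carrier q_cmp cls_idt cls_one cls_add eqs te mult.assoc)
  then show ?thesis by blast
qed

lemma triangulated: "triangulated_category X"
proof (rule triangulated_category.intro)
  show "additive_category X"
    using zero_object_O0 biproduct_exists
    by (intro additive_category.intro pre.preadditive_category_axioms additive_category_axioms.intro) auto
  show "triangulated_category_axioms X"
  proof (intro triangulated_category_axioms.intro; (unfold X_simps)?)
    show "additive_endofunctor X T (ptrM P)" by (rule tr.additive_endofunctor_axioms)
    show "bij_betw T Ob Ob" by (rule T_bij)
  next
    fix A B assume "A \<in> Ob" "B \<in> Ob"
    then show "bij_betw (ptrM P A B) (Hm A B) (Hm (T A) (T B))" by (rule T_mor_bij)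
  next
    fix s assume "s \<in> pexact P" then show "is_triangle X T s" by (simp add: pexact_X)
  next
    fix s s' assume s: "s \<in> pexact P" "is_triangle X T s'" "isomorphic_triangles X T (ptrM P) s s'"
    have "is_triangle X T s" using s(1) by (simp add: pexact_X)
    then show "s' \<in> pexact P"
      by (rule exact_isoI[OF s(1) tr.isomorphic_triangles_sym[OF s(3) _ s(2)] s(2)])
  next
    fix A N assume "A \<in> Ob" "is_zero_object X N"
    then show "(A, A, N, pidt P A, \<one>\<^bsub>pmor P 0 A N\<^esub>, \<one>\<^bsub>pmor P 0 N (T A)\<^esub>) \<in> pexact P"
      by (rule TR1_identity)
  next
    fix A B u assume a: "A \<in> Ob" "B \<in> Ob" "u \<in> Hm A B"
    then obtain U where "U \<in> Z 0 A B" "u = q A B U" by (rule Hm_rep)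
    then show "\<exists>D v w. (A, B, D, u, v, w) \<in> pexact P" using exact_std a(1,2) by blast
  next
    fix A B D u v w assume "is_triangle X T (A, B, D, u, v, w)"
    then show "(A, B, D, u, v, w) \<in> pexact P \<longleftrightarrow>
      (B, D, T A, v, w, inv\<^bsub>pmor P 0 (T A) (T B)\<^esub> (ptrM P A B u)) \<in> pexact P" by (rule TR2_rotate)
  qed (rule TR3_fill TR4_octahedron; assumption)+
qed

lemma shM_closed: assumes "A \<in> Ob" "B \<in> Ob" "f \<in> Hm A B"
  shows "shM P r 0 A B f \<in> Hm (S r A) (S r B)"
  using assms conj_Z by (auto simp: carrier_P S_Ob cls_sh)

lemma shift_endofunctor: "additive_endofunctor X (S r) (shM P r 0)"
proof -
  interpret sh: persistence_category_with_shift P by (rule persistence_shift)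
  show ?thesis
  proof
    fix A B D f g assume a: "A \<in> ob X" "B \<in> ob X" "D \<in> ob X" "f \<in> carrier (mor X A B)" "g \<in> carrier (mor X B D)"
    then show "shM P r 0 A D (cmp X A B D g f) = cmp X (S r A) (S r B) (S r D) (shM P r 0 B D g) (shM P r 0 A B f)"
      using sh.shM_pcmp[of A B D f 0 g 0 r] by (simp add: pob_P shO_P)
  qed (use sh.shM_hom[of _ _ r 0] sh.shM_pidt in \<open>auto simp: pob_P shO_P S_Ob\<close>)
qed

text \<open>S and T are not assumed to commute on objects, so a comparison \<open>th\<close> is
  needed. It undoes shift and translation and redoes them in the other order; the levels r and -r
  cancel, so it has level 0.\<close>

lemma shift_triangulated_endofunctor: "triangulated_endofunctor X (S r) (shM P r 0)"
proof (intro triangulated_endofunctor.intro shift_endofunctor triangulated_endofunctor_axioms.intro)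
  interpret sh: translated_category X "S r" "shM P r 0"
    by (intro translated_category.intro pre.preadditive_category_axioms shift_endofunctor)
  let ?M = "shM P r 0"
  define th where "th A = t (S r A) * (\<sigma> r A * (t' A * \<sigma>' r (T A)))" for A
  define th' where "th' A = \<sigma> r (T A) * (t A * (\<sigma>' r A * t' (S r A)))" for A
  have Z: "th A \<in> Z 0 (S r (T A)) (T (S r A))" "th' A \<in> Z 0 (T (S r A)) (S r (T A))" if A: "A \<in> Ob" for A
  proof -
    have o: "T A \<in> Ob" "S r A \<in> Ob" "S r (T A) \<in> Ob" "T (S r A) \<in> Ob" using A T_Ob S_Ob by auto
    have 1: "t' A * \<sigma>' r (T A) \<in> L (-r) 1 (S r (T A)) A"
      by (rule L_mult'[OF t'_L \<sigma>'_L]) (use A o in auto)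
    have 2: "\<sigma> r A * (t' A * \<sigma>' r (T A)) \<in> L 0 1 (S r (T A)) (S r A)"
      by (rule L_mult'[OF \<sigma>_L 1]) (use A o in auto)
    show "th A \<in> Z 0 (S r (T A)) (T (S r A))" unfolding th_def
      by (intro ZI L0_mult[OF t_L 2])
         (use A o in \<open>auto simp: mult.assoc t_eqs d_t[THEN reassoc] d_\<sigma>[THEN reassoc] d_\<sigma> \<sigma>'_d \<sigma>'_d[THEN reassoc]\<close>)
    have 1: "\<sigma>' r A * t' (S r A) \<in> L (-r) 1 (T (S r A)) A"
      by (rule L_mult'[OF \<sigma>'_L t'_L]) (use A o in auto)
    have 2: "t A * (\<sigma>' r A * t' (S r A)) \<in> L (-r) 0 (T (S r A)) (T A)"
      by (rule L_mult'[OF t_L 1]) (use A o in auto)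
    show "th' A \<in> Z 0 (T (S r A)) (S r (T A))" unfolding th'_def
      by (intro ZI L_mult'[OF \<sigma>_L 2])
         (use A o in \<open>auto simp: mult.assoc t_eqs d_t[THEN reassoc] d_\<sigma>[THEN reassoc] d_\<sigma> \<sigma>'_d \<sigma>'_d[THEN reassoc]\<close>)
  qed
  let ?\<theta> = "\<lambda>A. q (S r (T A)) (T (S r A)) (th A)"
  have iso: "is_iso X (S r (T A)) (T (S r A)) (?\<theta> A)" if A: "A \<in> Ob" for A
    by (rule isoI[OF _ _ Z[OF A]]) (use A in \<open>simp_all add: T_Ob S_Ob th_def th'_def mult.assoc t_eqs \<sigma>_eqs\<close>)
  have sZ: "\<sigma> r B * (x * \<sigma>' r A) \<in> Z 0 (S r A) (S r B)" if "A \<in> Ob" "B \<in> Ob" "x \<in> Z 0 A B" for A B x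
    using conj_Z[OF that] by (simp add: mult.assoc)
  have tZ: "t B * (x * t' A) \<in> Z 0 (T A) (T B)" if "A \<in> Ob" "B \<in> Ob" "x \<in> Z 0 A B" for A B x
    using T_conj[OF that] by (simp add: mult.assoc)
  have nat: "c (S r (T A)) (S r (T B)) (T (S r B)) (?\<theta> B) (?M (T A) (T B) (ptrM P A B f)) =
      c (S r (T A)) (T (S r A)) (T (S r B)) (ptrM P (S r A) (S r B) (?M A B f)) (?\<theta> A)"
    if o: "A \<in> Ob" "B \<in> Ob" and f: "f \<in> Hm A B" for A B f
  proof -
    obtain x where x: "x \<in> Z 0 A B" "f = q A B x" by (rule Hm_rep[OF o f])
    show ?thesis
      using o x Z_left[OF o x(1), THEN reassoc] Z[OF o(1)] Z[OF o(2)] sZ[OF o x(1)] tZ[OF o x(1)]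
        tZ[OF S_Ob[OF o(1)] S_Ob[OF o(2)] sZ[OF o x(1)]] sZ[OF T_Ob[OF o(1)] T_Ob[OF o(2)] tZ[OF o x(1)]]
      by (simp add: x(2) cls_tr cls_sh q_cmp T_Ob S_Ob mult.assoc)
         (simp add: th_def mult.assoc t_eqs \<sigma>_eqs T_Ob S_Ob)
  qed
  have ex: "(S r A, S r B, S r D, ?M A B u, ?M B D v,
      c (S r D) (S r (T A)) (T (S r A)) (?\<theta> A) (?M D (T A) w)) \<in> pexact P"
    if ex: "(A, B, D, u, v, w) \<in> pexact P" for A B D u v w
  proof -
    have o: "A \<in> Ob" "B \<in> Ob" "D \<in> Ob" and hm: "u \<in> Hm A B" "v \<in> Hm B D" "w \<in> Hm D (T A)"
      using exactD[OF ex] by auto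
    obtain U where U: "U \<in> Z 0 A B" "u = q A B U" by (rule Hm_rep[OF o(1,2) hm(1)])
    let ?C = "Cn A B U"
    note C = cone_Ob'[OF o(1,2) U(1)]
    obtain \<delta> where d: "is_iso X D ?C \<delta>" "c B D ?C \<delta> v = q B ?C (i2 A B U)"
      "w = c D ?C (T A) (q ?C (T A) (t A * p1 A B U)) \<delta>" by (rule exact_normal[OF ex U])
    have so: "S r A \<in> Ob" "S r B \<in> Ob" "S r D \<in> Ob" "S r ?C \<in> Ob" "S r (T A) \<in> Ob" "T A \<in> Ob" "T (S r A) \<in> Ob"
      using o C by (auto intro: S_Ob T_Ob)
    let ?U = "\<sigma> r B * (U * \<sigma>' r A)"
    have U': "?U \<in> Z 0 (S r A) (S r B)" by (rule sZ[OF o(1,2) U(1)])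
    let ?C' = "Cn (S r A) (S r B) ?U"
    note C' = cone_Ob'[OF so(1,2) U']
    note l = cone_L[OF o(1,2) U(1)] and l' = cone_L[OF so(1,2) U']
    note eqs = cone_eqs[OF o(1,2) U(1)] cone_eqs[OF so(1,2) U'] o C C' so \<sigma>_eqs d_\<sigma> d_\<sigma>[THEN reassoc]
      \<sigma>'_d \<sigma>'_d[THEN reassoc] e_d e_d[THEN reassoc] d_e d_e[THEN reassoc]
    let ?i1 = "i1 A B U" and ?i2 = "i2 A B U" and ?p1 = "p1 A B U" and ?p2 = "p2 A B U"
    let ?j1 = "i1 (S r A) (S r B) ?U" and ?j2 = "i2 (S r A) (S r B) ?U"
      and ?q1 = "p1 (S r A) (S r B) ?U" and ?q2 = "p2 (S r A) (S r B) ?U"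
    \<comment> \<open>The shifted cone is not assumed equal to the cone of the shifted map. These
      block maps identify the two; each block contains one \<open>\<sigma>\<close> and one
      \<open>\<sigma>'\<close>, so the level is 0.\<close>
    let ?\<gamma> = "?j1 * (\<sigma> r A * (?p1 * \<sigma>' r ?C)) + ?j2 * (\<sigma> r B * (?p2 * \<sigma>' r ?C))"
    let ?\<gamma>' = "\<sigma> r ?C * (?i1 * (\<sigma>' r A * ?q1)) + \<sigma> r ?C * (?i2 * (\<sigma>' r B * ?q2))"
    have 1: "?p1 * \<sigma>' r ?C \<in> L (-r) 1 (S r ?C) A" "?p2 * \<sigma>' r ?C \<in> L (-r) 0 (S r ?C) B"
      by (rule L_mult'[OF l(3) \<sigma>'_L] L_mult'[OF l(5) \<sigma>'_L]; use o C so in simp)+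
    have 2: "\<sigma> r A * (?p1 * \<sigma>' r ?C) \<in> L 0 1 (S r ?C) (S r A)" "\<sigma> r B * (?p2 * \<sigma>' r ?C) \<in> L 0 0 (S r ?C) (S r B)"
      by (rule L_mult'[OF \<sigma>_L 1(1)] L_mult'[OF \<sigma>_L 1(2)]; use o C so in simp)+
    have \<gamma>: "?\<gamma> \<in> Z 0 (S r ?C) ?C'"
      by (rule ZI, intro L_add L0_mult[OF l'(2) 2(1)] L0_mult[OF l'(4) 2(2)])
         (use o C C' so in \<open>auto simp: algebra_simps eqs\<close>)
    have 1: "\<sigma>' r A * ?q1 \<in> L (-r) 1 ?C' A" "\<sigma>' r B * ?q2 \<in> L (-r) 0 ?C' B"
      by (rule L_mult'[OF \<sigma>'_L l'(3)] L_mult'[OF \<sigma>'_L l'(5)]; use o C C' so in simp)+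
    have 2: "?i1 * (\<sigma>' r A * ?q1) \<in> L (-r) 0 ?C' ?C" "?i2 * (\<sigma>' r B * ?q2) \<in> L (-r) 0 ?C' ?C"
      by (rule L_mult'[OF l(2) 1(1)] L_mult'[OF l(4) 1(2)]; use o C C' so in simp)+
    have \<gamma>': "?\<gamma>' \<in> Z 0 ?C' (S r ?C)"
      by (rule ZI, intro L_add L_mult'[OF \<sigma>_L 2(1)] L_mult'[OF \<sigma>_L 2(2)])
         (use o C C' so in \<open>auto simp: algebra_simps eqs\<close>)
    have eC: "e ?C = ?i1 * ?p1 + ?i2 * ?p2" and eC': "e ?C' = ?j1 * ?q1 + ?j2 * ?q2"
      using e_cone o U so U' by (auto simp: Z_def)
    have "?\<gamma> * ?\<gamma>' = e ?C'" unfolding eC' by (simp add: algebra_simps eqs)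
    moreover have "?\<gamma>' * ?\<gamma> = e (S r ?C)"
    proof -
      have "?\<gamma>' * ?\<gamma> = \<sigma> r ?C * ((?i1 * ?p1 + ?i2 * ?p2) * \<sigma>' r ?C)" by (simp add: algebra_simps eqs)
      then show ?thesis unfolding eC[symmetric] using C by (simp add: \<sigma>_eqs)
    qed
    ultimately have \<gamma>iso: "is_iso X (S r ?C) ?C' (q (S r ?C) ?C' ?\<gamma>)"
      by (intro isoI[OF so(4) C' \<gamma> \<gamma>']) simp_all
    let ?\<delta> = "c (S r D) (S r ?C) ?C' (q (S r ?C) ?C' ?\<gamma>) (?M D ?C \<delta>)"
    have i2Z: "i2 A B U \<in> Z 0 B ?C" and tpZ: "t A * p1 A B U \<in> Z 0 ?C (T A)"
      and tpZ': "t (S r A) * ?q1 \<in> Z 0 ?C' (T (S r A))"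
      using o U so U' by (auto intro: i2_Z tp1_Z)
    note m1 = q_carrier[OF so(4) C' \<gamma>] iso_Hm[OF d(1)] shM_closed[OF o(3) C iso_Hm[OF d(1)], where r=r] hm
      shM_closed[OF o(2,3) hm(2), where r=r] q_carrier[OF C so(6) tpZ] shM_closed[OF C so(6) q_carrier[OF C so(6) tpZ], where r=r]
      q_carrier[OF so(5) so(7) Z(1)[OF o(1)]] q_carrier[OF C' so(7) tpZ']
    have \<delta>iso: "is_iso X (S r D) ?C' ?\<delta>"
      using pre.iso_cmp[OF _ _ _ sh.FM_iso[OF _ _ d(1)] \<gamma>iso] o C C' so by simp
    have v: "c (S r B) (S r D) ?C' ?\<delta> (?M B D v) = q (S r B) ?C' ?j2"
    proof -
      have "c (S r B) (S r D) ?C' ?\<delta> (?M B D v)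
          = c (S r B) (S r ?C) ?C' (q (S r ?C) ?C' ?\<gamma>) (?M B ?C (c B D ?C \<delta> v))"
        using sh.FM_cmp[unfolded X_simps, OF o(2,3) C hm(2) iso_Hm[OF d(1)]] m1 o so C C' by (simp add: c_assoc)
      also have "\<dots> = q (S r B) ?C' (?\<gamma> * (\<sigma> r ?C * (?i2 * \<sigma>' r B)))"
        unfolding d(2) using o so C C' i2Z \<gamma> sZ[OF o(2) C i2Z] by (simp add: cls_sh q_cmp mult.assoc)
      also have "?\<gamma> * (\<sigma> r ?C * (?i2 * \<sigma>' r B)) = ?j2" by (simp add: algebra_simps eqs)
      finally show ?thesis .
    qed
    have w: "c (S r D) (S r (T A)) (T (S r A)) (?\<theta> A) (?M D (T A) w)
        = c (S r D) ?C' (T (S r A)) (q ?C' (T (S r A)) (t (S r A) * ?q1)) ?\<delta>"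
    proof -
      have "c (S r D) (S r (T A)) (T (S r A)) (?\<theta> A) (?M D (T A) w)
          = c (S r D) (S r ?C) (T (S r A)) (c (S r ?C) (S r (T A)) (T (S r A)) (?\<theta> A)
              (?M ?C (T A) (q ?C (T A) (t A * p1 A B U)))) (?M D ?C \<delta>)"
        unfolding d(3) using sh.FM_cmp[unfolded X_simps, OF o(3) C so(6) iso_Hm[OF d(1)] m1(8)] m1 o so C
        by (simp add: c_assoc)
      also have "c (S r ?C) (S r (T A)) (T (S r A)) (?\<theta> A) (?M ?C (T A) (q ?C (T A) (t A * p1 A B U)))
          = q (S r ?C) (T (S r A)) (th A * (\<sigma> r (T A) * (t A * p1 A B U * \<sigma>' r ?C)))"
        using o so C Z(1)[OF o(1)] tpZ sZ[OF C so(6) tpZ] by (simp add: cls_sh q_cmp mult.assoc)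
      also have "th A * (\<sigma> r (T A) * (t A * p1 A B U * \<sigma>' r ?C)) = t (S r A) * ?q1 * ?\<gamma>"
        by (simp add: th_def algebra_simps eqs t_eqs)
      also have "q (S r ?C) (T (S r A)) \<dots> = c (S r ?C) ?C' (T (S r A)) (q ?C' (T (S r A)) (t (S r A) * ?q1)) (q (S r ?C) ?C' ?\<gamma>)"
        using so C' \<gamma> tpZ' by (simp add: q_cmp)
      finally show ?thesis using m1 so C' by (simp add: c_assoc)
    qed
    have u: "?M A B u = q (S r A) (S r B) ?U" using o U by (simp add: cls_sh mult.assoc)
    show ?thesis unfolding u
      by (rule exactI[OF so(1-3) U' \<delta>iso m1(7) v w])
  qed
  show "\<exists>\<theta>. (\<forall>A\<in>ob X. is_iso X (S r (trO X A)) (trO X (S r A)) (\<theta> A)) \<and>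
      (\<forall>A\<in>ob X. \<forall>B\<in>ob X. \<forall>f\<in>carrier (mor X A B).
         cmp X (S r (trO X A)) (S r (trO X B)) (trO X (S r B)) (\<theta> B) (?M (trO X A) (trO X B) (trM X A B f)) =
         cmp X (S r (trO X A)) (trO X (S r A)) (trO X (S r B)) (trM X (S r A) (S r B) (?M A B f)) (\<theta> A)) \<and>
      (\<forall>A B D u v w. (A, B, D, u, v, w) \<in> exact X \<longrightarrow>
         (S r A, S r B, S r D, ?M A B u, ?M B D v,
          cmp X (S r D) (S r (trO X A)) (trO X (S r A)) (\<theta> A) (?M D (trO X A) w)) \<in> exact X)"
    unfolding X_simps using iso nat ex by (intro exI[of _ ?\<theta>]) blast
qed

theorem triangulated_persistence: "triangulated_persistence_category P"
proof (intro triangulated_persistence_category.intro triangulated_persistence_category_axioms.intro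
    persistence_shift triangulated)
  show "triangulated_endofunctor X (shO P r) (shM P r 0)" for r
    unfolding shO_P by (rule shift_triangulated_endofunctor)
  fix r :: real and A assume r: "r \<ge> 0" and "A \<in> pob P"
  then have A: "A \<in> Ob" and SA: "S r A \<in> Ob" by (auto simp: pob_P S_Ob)
  have s: "\<sigma>' r A \<in> Z 0 (S r A) A" by (rule Z_mono[OF SA A _ \<sigma>'_Z[OF A]]) (use r in simp)
  let ?C = "Cn (S r A) A (\<sigma>' r A)"
  note C = cone_Ob'[OF SA A s]
  have "eta P r 0 A = cls (- r) (S r A) A (\<sigma>' r A)"
    using A by (simp add: cls_eta \<sigma>_eqs)
  then have "pinc P (- r) 0 (S r A) A (eta P r 0 A) = q (S r A) A (\<sigma>' r A)"
    using A SA r by (simp add: cls_inc \<sigma>'_Z)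
  moreover have "acyclic_object P r ?C"
    using cone_contracted[OF SA A s \<sigma>_Z[OF A] \<sigma>_\<sigma>'[OF A] \<sigma>'_\<sigma>[OF A] r] r C
    by (simp add: acyclic_object_def pob_P cls_idt cls_inc e_Z cls_one)
  ultimately show "\<exists>K v w. (shO P r A, A, K, pinc P (- r) 0 (shO P r A) A (eta P r 0 A), v, w) \<in> pexact P \<and>
      acyclic_object P r K"
    using exact_std[OF SA A s] by (auto simp: shO_P)
qed

end

section \<open>Smooth maps and pullback of two-forms\<close>

lemma slice_continuous:
  assumes "x \<in> topspace (Euclidean_space n)" "i < n"
  shows "continuous_map euclideanreal (Euclidean_space n) (\<lambda>t. x(i := t))"
  using assms unfolding Euclidean_space_def
  by (auto simp: continuous_map_in_subtopology continuous_map_componentwise_UNIV topspace_subtopology)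

lemma openin_Euclidean_topspace: "\<lbrakk>openin (Euclidean_space n) U; x \<in> U\<rbrakk> \<Longrightarrow> x \<in> topspace (Euclidean_space n)"
  by (meson openin_subset subsetD)

text \<open>Functions are total, yet a partial derivative at a point of an open U may depend on
  values in U only: the coordinate line through the point stays in U for nearby parameters.\<close>

lemma slice_eventually:
  assumes U: "openin (Euclidean_space n) U" "x \<in> U" "i < n"
  shows "\<forall>\<^sub>F t in nhds (x i). x(i := t) \<in> U"
proof -
  have "openin euclideanreal {t \<in> topspace euclideanreal. x(i := t) \<in> U}"
    using openin_continuous_map_preimage[OF slice_continuous U(1)] openin_Euclidean_topspace[OF U(1,2)] U(3) by blast
  then have "open {t. x(i := t) \<in> U}" by simp
  then show ?thesis using U(2) by (auto simp: eventually_nhds intro!: exI[of _ "{t. x(i := t) \<in> U}"])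
qed

lemma pderiv_at_cong:
  assumes "openin (Euclidean_space n) U" "x \<in> U" "i < n" "\<And>z. z \<in> U \<Longrightarrow> f z = g z"
  shows "pderiv_at i f x = pderiv_at i g x"
  unfolding pderiv_at_def
  by (rule deriv_cong_ev[OF eventually_mono[OF slice_eventually[OF assms(1-3)]]]) (auto intro: assms(4))

lemma Ck_on_SucD:
  assumes "Ck_on n (Suc k) U f"
  shows "continuous_map (subtopology (Euclidean_space n) U) euclideanreal f"
    "\<lbrakk>i < n; x \<in> U\<rbrakk> \<Longrightarrow> (\<lambda>t. f (x(i := t))) field_differentiable at (x i)"
    "i < n \<Longrightarrow> Ck_on n k U (pderiv_at i f)"
  using assms unfolding Ck_on.simps by blast+

lemma Ck_on_SucI:
  assumes "continuous_map (subtopology (Euclidean_space n) U) euclideanreal f"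
    "\<And>i x. \<lbrakk>i < n; x \<in> U\<rbrakk> \<Longrightarrow> (\<lambda>t. f (x(i := t))) field_differentiable at (x i)"
    "\<And>i. i < n \<Longrightarrow> Ck_on n k U (pderiv_at i f)"
  shows "Ck_on n (Suc k) U f"
  using assms unfolding Ck_on.simps by blast

lemma Ck_on_cong:
  assumes U: "openin (Euclidean_space n) U"
  shows "Ck_on n k U f \<Longrightarrow> (\<And>z. z \<in> U \<Longrightarrow> f z = g z) \<Longrightarrow> Ck_on n k U g"
proof (induction k arbitrary: f g)
  case 0
  have "continuous_map (subtopology (Euclidean_space n) U) euclideanreal g"
    by (rule continuous_map_eq[of _ _ f]) (use 0 in \<open>simp_all add: topspace_subtopology\<close>)
  then show ?case by simp
next
  case (Suc k)
  note D = Ck_on_SucD[OF Suc.prems(1)]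
  show ?case
  proof (rule Ck_on_SucI)
    show "continuous_map (subtopology (Euclidean_space n) U) euclideanreal g"
      by (rule continuous_map_eq[OF D(1)]) (use Suc.prems(2) in \<open>simp add: topspace_subtopology\<close>)
    fix i assume i: "i < n"
    show "Ck_on n k U (pderiv_at i g)"
      by (rule Suc.IH[OF D(3)[OF i] pderiv_at_cong[OF U _ i Suc.prems(2)]])
    fix x assume x: "x \<in> U"
    obtain D' where D': "((\<lambda>t. f (x(i := t))) has_field_derivative D') (at (x i))"
      using D(2)[OF i x] unfolding field_differentiable_def by blast
    have "\<forall>\<^sub>F t in nhds (x i). f (x(i := t)) = g (x(i := t))"
      by (rule eventually_mono[OF slice_eventually[OF U x i]]) (rule Suc.prems(2))
    from D' DERIV_cong_ev[OF refl this refl, of D'] show "(\<lambda>t. g (x(i := t))) field_differentiable at (x i)"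
      unfolding field_differentiable_def by blast
  qed
qed

lemma Ck_on_subset: "Ck_on n k U f \<Longrightarrow> V \<subseteq> U \<Longrightarrow> Ck_on n k V f"
proof (induction k arbitrary: f)
  case 0 then show ?case by (simp add: continuous_map_from_subtopology_mono)
next
  case (Suc k)
  note D = Ck_on_SucD[OF Suc.prems(1)]
  show ?case
    by (rule Ck_on_SucI[OF continuous_map_from_subtopology_mono[OF D(1) Suc.prems(2)] D(2) Suc.IH[OF D(3) Suc.prems(2)]])
       (use Suc.prems(2) in auto)
qed

lemma Ck_on_continuous: "Ck_on n k U f \<Longrightarrow> continuous_map (subtopology (Euclidean_space n) U) euclideanreal f"
  by (cases k) auto

lemma Ck_on_Suc: "Ck_on n (Suc k) U f \<Longrightarrow> Ck_on n k U f"
proof (induction k arbitrary: f)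
  case 0 then show ?case by simp
next
  case (Suc k)
  note D = Ck_on_SucD[OF Suc.prems]
  show ?case by (intro Ck_on_SucI D Suc.IH)
qed

lemma pderiv_at_const: "pderiv_at i (\<lambda>_. a) = (\<lambda>_. 0)"
  by (simp add: pderiv_at_def fun_eq_iff)

lemma Ck_on_const: "Ck_on n k U (\<lambda>_. a)"
proof (induction k arbitrary: a)
  case (Suc k)
  show ?case by (rule Ck_on_SucI) (simp_all only: pderiv_at_const Suc.IH field_differentiable_const, simp)
qed simp

lemma Ck_on_coordinate: "Ck_on n k U (\<lambda>x. x j)"
proof -
  have c: "continuous_map (subtopology (Euclidean_space n) U) euclideanreal (\<lambda>x. x j)"
    unfolding Euclidean_space_def subtopology_subtopology
    by (rule continuous_map_from_subtopology[OF continuous_map_product_projection]) simp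
  show ?thesis
  proof (cases k)
    case 0 then show ?thesis using c by simp
  next
    case (Suc l)
    have "pderiv_at i (\<lambda>x. x j) = (\<lambda>_. if i = j then 1 else 0)" for i
      by (auto simp: pderiv_at_def fun_eq_iff)
    moreover have "(\<lambda>t. (x(i := t)) j) field_differentiable at (x i)" for i and x :: "nat \<Rightarrow> real"
      by (cases "i = j") (simp_all add: field_differentiable_const field_differentiable_ident)
    ultimately show ?thesis using Suc c by (simp only: Ck_on.simps) (simp add: Ck_on_const)
  qed
qed

lemma Ck_on_add:
  assumes U: "openin (Euclidean_space n) U"
  shows "Ck_on n k U f \<Longrightarrow> Ck_on n k U g \<Longrightarrow> Ck_on n k U (\<lambda>x. f x + g x)"
proof (induction k arbitrary: f g)
  case 0 then show ?case by (simp add: continuous_map_add)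
next
  case (Suc k)
  note D = Ck_on_SucD[OF Suc.prems(1)] Ck_on_SucD[OF Suc.prems(2)]
  have "pderiv_at i f x + pderiv_at i g x = pderiv_at i (\<lambda>x. f x + g x) x" if "i < n" "x \<in> U" for i x
    using deriv_add[OF D(2)[OF that] D(5)[OF that]] unfolding pderiv_at_def by (rule sym)
  then have pd: "Ck_on n k U (pderiv_at i (\<lambda>x. f x + g x))" if "i < n" for i
    by (rule Ck_on_cong[OF U Suc.IH[OF D(3)[OF that] D(6)[OF that]]]) (rule that)
  show ?case
    by (rule Ck_on_SucI[OF continuous_map_add[OF D(1,4)] field_differentiable_add[OF D(2) D(5)] pd])
qed

lemma Ck_on_sum:
  assumes U: "openin (Euclidean_space n) U" and "finite I"
  shows "(\<And>i. i \<in> I \<Longrightarrow> Ck_on n k U (f i)) \<Longrightarrow> Ck_on n k U (\<lambda>x. \<Sum>i\<in>I. f i x)"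
  using assms(2) by (induction I) (auto intro: Ck_on_const Ck_on_add[OF U])

lemma Ck_on_mult:
  assumes U: "openin (Euclidean_space n) U"
  shows "Ck_on n k U f \<Longrightarrow> Ck_on n k U g \<Longrightarrow> Ck_on n k U (\<lambda>x. f x * g x)"
proof (induction k arbitrary: f g)
  case 0 then show ?case by (simp add: continuous_map_real_mult)
next
  case (Suc k)
  note D = Ck_on_SucD[OF Suc.prems(1)] Ck_on_SucD[OF Suc.prems(2)]
  note lower = Suc.prems[THEN Ck_on_Suc]
  have "f x * pderiv_at i g x + pderiv_at i f x * g x = pderiv_at i (\<lambda>x. f x * g x) x" if "i < n" "x \<in> U" for i x
    using deriv_mult[OF D(2)[OF that] D(5)[OF that]] unfolding pderiv_at_def fun_upd_triv by (rule sym)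
  then have pd: "Ck_on n k U (pderiv_at i (\<lambda>x. f x * g x))" if "i < n" for i
    by (rule Ck_on_cong[OF U Ck_on_add[OF U Suc.IH[OF lower(1) D(6)[OF that]] Suc.IH[OF D(3)[OF that] lower(2)]]])
       (rule that)
  show ?case
    by (rule Ck_on_SucI[OF continuous_map_real_mult[OF D(1,4)] field_differentiable_mult[OF D(2) D(5)] pd])
qed

text \<open>A basic open set of the product topology contains an interval around each coordinate of
  y. Only the coordinates below m can vary, so one radius serves them all.\<close>

lemma Euclidean_box:
  assumes V: "openin (Euclidean_space m) V" "y \<in> V"
  obtains \<epsilon> where "\<epsilon> > 0" "\<And>x. \<lbrakk>\<forall>j\<ge>m. x j = 0; \<forall>j<m. \<bar>x j - y j\<bar> < \<epsilon>\<rbrakk> \<Longrightarrow> x \<in> V"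
proof -
  obtain S where S: "openin (powertop_real UNIV) S" "V = S \<inter> {x. \<forall>i\<ge>m. x i = 0}"
    using V(1) by (auto simp: Euclidean_space_def openin_subtopology)
  then obtain W where W: "finite {i. W i \<noteq> UNIV}" "\<And>i. open (W i)" "y \<in> Pi\<^sub>E UNIV W" "Pi\<^sub>E UNIV W \<subseteq> S"
    using V(2) by (auto simp: openin_product_topology_alt)
  have "\<exists>\<epsilon>>0. \<forall>t. \<bar>t - y j\<bar> < \<epsilon> \<longrightarrow> t \<in> W j" for j
    using W(2)[of j] W(3) by (force simp: open_real PiE_def)
  then obtain \<epsilon> where \<epsilon>: "\<And>j. \<epsilon> j > 0" "\<And>j t. \<bar>t - y j\<bar> < \<epsilon> j \<Longrightarrow> t \<in> W j" by metis
  have y0: "y j = 0" if "j \<ge> m" for j using V(2) S(2) that by simp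
  show thesis
  proof
    \<comment> \<open>The entry 1 keeps the set nonempty when m = 0.\<close>
    show "Min (insert 1 (\<epsilon> ` {..<m})) > 0" using \<epsilon>(1) by (subst Min_gr_iff) auto
    fix x assume x: "\<forall>j\<ge>m. x j = 0" "\<forall>j<m. \<bar>x j - y j\<bar> < Min (insert 1 (\<epsilon> ` {..<m}))"
    have "x j \<in> W j" for j
    proof (cases "j < m")
      case True
      then have "\<bar>x j - y j\<bar> < \<epsilon> j" using x(2) by auto
      then show ?thesis by (rule \<epsilon>(2))
    next
      case False
      then show ?thesis using x(1) y0 \<epsilon>(1)[of j] by (intro \<epsilon>(2)) auto
    qed
    then show "x \<in> V" using W(4) S(2) x(1) by (auto simp: PiE_def Pi_def)
  qed
qed

text \<open>The order of a and b stays open, and a = b is allowed, since a coordinate of a curve may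
  move either way or stand still.\<close>

lemma mvt_between:
  fixes f :: "real \<Rightarrow> real"
  assumes "\<And>\<tau>. \<bar>\<tau> - a\<bar> \<le> \<bar>b - a\<bar> \<Longrightarrow> (f has_field_derivative f' \<tau>) (at \<tau>)"
  shows "\<exists>\<xi>. \<bar>\<xi> - a\<bar> \<le> \<bar>b - a\<bar> \<and> f b - f a = f' \<xi> * (b - a)"
proof (cases a b rule: linorder_cases)
  case less
  then obtain z where "a < z" "z < b" "f b - f a = (b - a) * f' z"
    using MVT2[of a b f f'] assms by force
  then show ?thesis by (intro exI[of _ z]) auto
next
  case equal then show ?thesis by auto
next
  case greater
  then obtain z where "b < z" "z < a" "f a - f b = (a - b) * f' z"
    using MVT2[of b a f f'] assms by force
  then show ?thesis by (intro exI[of _ z]) (auto simp: algebra_simps)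
qed

text \<open>The coordinates of the curve are switched on one at a time; each step is controlled by the mean value theorem.\<close>

lemma curve_chain_rule:
  assumes V: "openin (Euclidean_space m) V"
    and diff: "\<And>j x. j < m \<Longrightarrow> x \<in> V \<Longrightarrow> (\<lambda>t. g (x(j := t))) field_differentiable at (x j)"
    and cont: "\<And>j. j < m \<Longrightarrow> continuous_map (subtopology (Euclidean_space m) V) euclideanreal (pderiv_at j g)"
    and y: "\<gamma> s \<in> V"
    and \<gamma>V: "\<forall>\<^sub>F t in nhds s. \<gamma> t \<in> V"
    and \<gamma>: "\<And>j. j < m \<Longrightarrow> ((\<lambda>t. \<gamma> t j) has_field_derivative \<gamma>' j) (at s)"
  shows "((\<lambda>t. g (\<gamma> t)) has_field_derivative (\<Sum>j<m. pderiv_at j g (\<gamma> s) * \<gamma>' j)) (at s)"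
proof -
  let ?y = "\<gamma> s"
  define z where "z k t = (\<lambda>j. if j < k then \<gamma> t j else ?y j)" for k t
  have y0: "?y j = 0" if "j \<ge> m" for j
    using openin_Euclidean_topspace[OF V y] that by (simp add: topspace_Euclidean_space)
  have lim: "((\<lambda>t. \<gamma> t j) \<longlongrightarrow> ?y j) (at s)" if "j < m" for j
    using DERIV_isCont[OF \<gamma>[OF that]] by (simp add: isCont_def)
  have near: "\<forall>\<^sub>F t in at s. \<forall>j<m. \<bar>\<gamma> t j - ?y j\<bar> < \<epsilon>" if "\<epsilon> > 0" for \<epsilon>
  proof -
    have "\<forall>\<^sub>F t in at s. \<forall>j\<in>{..<m}. \<bar>\<gamma> t j - ?y j\<bar> < \<epsilon>"
      using tendstoD[OF lim that] by (intro eventually_ball_finite) (auto simp: dist_real_def)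
    then show ?thesis by (auto elim: eventually_mono)
  qed
  have step: "((\<lambda>t. g (z k t)) has_field_derivative (\<Sum>j<k. pderiv_at j g ?y * \<gamma>' j)) (at s)" if "k \<le> m" for k
    using that
  proof (induction k)
    case 0 then show ?case by (simp add: z_def)
  next
    case (Suc k)
    then have k: "k < m" by simp
    let ?D = "\<lambda>t. g (z (Suc k) t) - g (z k t)"
    obtain \<epsilon> where \<epsilon>: "\<epsilon> > 0" "\<And>x. \<lbrakk>\<forall>j\<ge>m. x j = 0; \<forall>j<m. \<bar>x j - ?y j\<bar> < \<epsilon>\<rbrakk> \<Longrightarrow> x \<in> V"
      using Euclidean_box[OF V y] by metis
    let ?P = "\<lambda>t \<xi>. \<bar>\<xi> - ?y k\<bar> \<le> \<bar>\<gamma> t k - ?y k\<bar> \<and> ?D t = pderiv_at k g ((z k t)(k := \<xi>)) * (\<gamma> t k - ?y k)"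
    have "\<forall>\<^sub>F t in at s. \<exists>\<xi>. ?P t \<xi>"
      using near[OF \<epsilon>(1)]
    proof (rule eventually_mono)
      fix t assume t: "\<forall>j<m. \<bar>\<gamma> t j - ?y j\<bar> < \<epsilon>"
      have "((\<lambda>\<tau>. g ((z k t)(k := \<tau>))) has_field_derivative pderiv_at k g ((z k t)(k := \<tau>))) (at \<tau>)"
        if "\<bar>\<tau> - ?y k\<bar> \<le> \<bar>\<gamma> t k - ?y k\<bar>" for \<tau>
      proof -
        \<comment> \<open>No coordinate is further from that of \<open>\<gamma> s\<close> than the
          coordinate of \<open>\<gamma> t\<close>, so the point stays in the box.\<close>
        have "(z k t)(k := \<tau>) \<in> V"
          using t that k \<epsilon>(1) y0 by (intro \<epsilon>(2)) (auto simp: z_def)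
        from diff[OF k this] show ?thesis
          unfolding pderiv_at_def by (simp add: DERIV_deriv_iff_field_differentiable)
      qed
      from mvt_between[OF this] obtain \<xi> where "\<bar>\<xi> - ?y k\<bar> \<le> \<bar>\<gamma> t k - ?y k\<bar>"
        "g ((z k t)(k := \<gamma> t k)) - g ((z k t)(k := ?y k)) = pderiv_at k g ((z k t)(k := \<xi>)) * (\<gamma> t k - ?y k)"
        by blast
      moreover have "(z k t)(k := \<gamma> t k) = z (Suc k) t" "(z k t)(k := ?y k) = z k t"
        by (auto simp: z_def less_Suc_eq)
      ultimately show "\<exists>\<xi>. ?P t \<xi>" by auto
    qed
    then obtain \<xi> where \<xi>: "\<forall>\<^sub>F t in at s. ?P t (\<xi> t)" unfolding eventually_ex by blast
    \<comment> \<open>The coordinate \<open>\<xi> t\<close> is squeezed by that of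
      \<open>\<gamma> t\<close>, so the point of evaluation tends to \<open>\<gamma> s\<close> and
      continuity of the partial derivative applies.\<close>
    have "((\<lambda>t. pderiv_at k g ((z k t)(k := \<xi> t))) \<longlongrightarrow> pderiv_at k g ?y) (at s)"
    proof (rule topological_tendstoI)
      fix W :: "real set" assume W: "open W" "pderiv_at k g ?y \<in> W"
      have VW: "openin (Euclidean_space m) {x \<in> V. pderiv_at k g x \<in> W}"
      proof -
        have "{x \<in> topspace (subtopology (Euclidean_space m) V). pderiv_at k g x \<in> W} = {x \<in> V. pderiv_at k g x \<in> W}"
          using openin_subset[OF V] by (auto simp: topspace_subtopology)
        then show ?thesis
          using openin_continuous_map_preimage[OF cont[OF k], of W] W(1) V
          by (simp add: openin_open_subtopology)
      qed
      obtain \<epsilon> where \<epsilon>: "\<epsilon> > 0" "\<And>x. \<lbrakk>\<forall>j\<ge>m. x j = 0; \<forall>j<m. \<bar>x j - ?y j\<bar> < \<epsilon>\<rbrakk> \<Longrightarrow> x \<in> V \<and> pderiv_at k g x \<in> W"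
        using Euclidean_box[OF VW, of ?y] y W(2) by auto
      show "\<forall>\<^sub>F t in at s. pderiv_at k g ((z k t)(k := \<xi> t)) \<in> W"
        using \<xi> near[OF \<epsilon>(1)]
      proof eventually_elim
        case (elim t)
        then have "\<bar>\<xi> t - ?y k\<bar> < \<epsilon>" using k by fastforce
        then show ?case using elim k \<epsilon>(1) y0 by (intro \<epsilon>(2)[THEN conjunct2]) (auto simp: z_def)
      qed
    qed
    then have "((\<lambda>t. pderiv_at k g ((z k t)(k := \<xi> t)) * ((\<gamma> t k - ?y k) / (t - s))) \<longlongrightarrow> pderiv_at k g ?y * \<gamma>' k) (at s)"
      using \<gamma>[OF k] by (intro tendsto_mult) (simp_all add: has_field_derivative_iff)
    then have "((\<lambda>t. (?D t - ?D s) / (t - s)) \<longlongrightarrow> pderiv_at k g ?y * \<gamma>' k) (at s)"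
    proof (rule Lim_transform_eventually)
      have "z (Suc k) s = z k s" by (auto simp: z_def)
      then show "\<forall>\<^sub>F t in at s. pderiv_at k g ((z k t)(k := \<xi> t)) * ((\<gamma> t k - ?y k) / (t - s)) = (?D t - ?D s) / (t - s)"
        using \<xi> by (auto elim!: eventually_mono)
    qed
    then have "(?D has_field_derivative pderiv_at k g ?y * \<gamma>' k) (at s)"
      by (simp add: has_field_derivative_iff)
    from DERIV_add[OF this Suc.IH] show ?case using k by (simp add: add.commute)
  qed
  \<comment> \<open>After m steps the whole point has been replaced, because the coordinates from m
    on vanish on V.\<close>
  have "\<forall>\<^sub>F t in nhds s. g (z m t) = g (\<gamma> t)"
    using \<gamma>V
  proof (rule eventually_mono)
    fix t assume t: "\<gamma> t \<in> V"
    have "z m t = \<gamma> t"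
      using y0 openin_Euclidean_topspace[OF V t] by (auto simp: z_def fun_eq_iff topspace_Euclidean_space)
    then show "g (z m t) = g (\<gamma> t)" by simp
  qed
  then show ?thesis using step[of m] DERIV_cong_ev[of s s "\<lambda>t. g (z m t)" "\<lambda>t. g (\<gamma> t)"] by simp
qed

text \<open>F takes values in V, so its coordinates from m on vanish, and continuity in the product
  topology reduces to the first m.\<close>

lemma Euclidean_map_continuous:
  assumes "\<And>j. j < m \<Longrightarrow> continuous_map Y euclideanreal (\<lambda>x. F x j)"
    and "\<And>x. x \<in> topspace Y \<Longrightarrow> F x \<in> V" and "openin (Euclidean_space m) V"
  shows "continuous_map Y (subtopology (Euclidean_space m) V) F"
proof -
  have F0: "F x j = 0" if x: "x \<in> topspace Y" and j: "j \<ge> m" for x j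
    using openin_Euclidean_topspace[OF assms(3) assms(2)[OF x]] j by (simp add: topspace_Euclidean_space)
  have "continuous_map Y euclideanreal (\<lambda>x. F x j)" for j
  proof (cases "j < m")
    case False
    show ?thesis
      by (rule continuous_map_eq[of _ _ "\<lambda>_. 0"]) (use F0 False in \<open>simp_all\<close>)
  qed (rule assms(1))
  then have "continuous_map Y (powertop_real UNIV) F"
    by (simp add: continuous_map_componentwise_UNIV)
  moreover have "F ` topspace Y \<subseteq> {x. \<forall>i\<ge>m. x i = 0}" using F0 by blast
  ultimately have "continuous_map Y (Euclidean_space m) F"
    unfolding Euclidean_space_def by (auto simp: continuous_map_in_subtopology)
  then show ?thesis using assms(2) by (auto simp: continuous_map_in_subtopology)
qed

text \<open>By the chain rule each partial derivative of the composite is a sum of products of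
  functions one class lower; the induction hypothesis handles the derivatives of g after F, and
  closure under sums and products does the rest.\<close>

lemma Ck_on_compose:
  assumes U: "openin (Euclidean_space n) U" and V: "openin (Euclidean_space m) V"
    and FV: "\<And>x. x \<in> U \<Longrightarrow> F x \<in> V"
  shows "Ck_on m k V g \<Longrightarrow> (\<And>j. j < m \<Longrightarrow> Ck_on n k U (\<lambda>x. F x j)) \<Longrightarrow> Ck_on n k U (\<lambda>x. g (F x))"
proof (induction k arbitrary: g)
  have c: "continuous_map (subtopology (Euclidean_space n) U) euclideanreal (\<lambda>x. g (F x))"
    if g: "Ck_on m k V g" and F: "\<And>j. j < m \<Longrightarrow> Ck_on n k U (\<lambda>x. F x j)" for g k
  proof -
    have "continuous_map (subtopology (Euclidean_space n) U) (subtopology (Euclidean_space m) V) F"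
      by (rule Euclidean_map_continuous[OF Ck_on_continuous[OF F] FV V]) (simp_all add: topspace_subtopology)
    from continuous_map_compose[OF this Ck_on_continuous[OF g]] show ?thesis by (simp add: o_def)
  qed
  {
    case 0 then show ?case using c[of 0 g] by simp
  next
    case (Suc k)
    note D = Ck_on_SucD[OF Suc.prems(1)] and E = Ck_on_SucD[OF Suc.prems(2)]
    have der: "((\<lambda>t. g (F (x(i := t)))) has_field_derivative
        (\<Sum>j<m. pderiv_at j g (F x) * pderiv_at i (\<lambda>x. F x j) x)) (at (x i))" if i: "i < n" and x: "x \<in> U" for i x
    proof -
      have ev: "\<forall>\<^sub>F t in nhds (x i). F (x(i := t)) \<in> V"
        by (rule eventually_mono[OF slice_eventually[OF U x i]]) (rule FV)
      \<comment> \<open>The base point is written \<open>x(i := x i)\<close>, the form in which it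
        is the value of the curve at time \<open>x i\<close>.\<close>
      have "((\<lambda>t. g (F (x(i := t)))) has_field_derivative
        (\<Sum>j<m. pderiv_at j g (F (x(i := x i))) * pderiv_at i (\<lambda>x. F x j) x)) (at (x i))"
      proof (rule curve_chain_rule[OF V D(2) Ck_on_continuous[OF D(3)] _ ev])
        show "F (x(i := x i)) \<in> V" unfolding fun_upd_triv by (rule FV[OF x])
        show "((\<lambda>t. F (x(i := t)) j) has_field_derivative pderiv_at i (\<lambda>x. F x j) x) (at (x i))" if "j < m" for j
          using E(2)[OF that i x] unfolding pderiv_at_def DERIV_deriv_iff_field_differentiable .
      qed
      then show ?thesis unfolding fun_upd_triv .
    qed
    have pd: "(\<Sum>j<m. pderiv_at j g (F x) * pderiv_at i (\<lambda>x. F x j) x) = pderiv_at i (\<lambda>x. g (F x)) x"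
      if "i < n" "x \<in> U" for i x
      using DERIV_imp_deriv[OF der[OF that]] unfolding pderiv_at_def by (rule sym)
    show ?case
    proof (rule Ck_on_SucI[OF c[OF Suc.prems]])
      fix i assume i: "i < n"
      have "Ck_on n k U (\<lambda>x. \<Sum>j<m. pderiv_at j g (F x) * pderiv_at i (\<lambda>x. F x j) x)"
      proof (rule Ck_on_sum[OF U finite_lessThan], rule Ck_on_mult[OF U])
        fix j assume "j \<in> {..<m}"
        then have j: "j < m" by simp
        show "Ck_on n k U (\<lambda>x. pderiv_at j g (F x))"
          by (rule Suc.IH[OF D(3)[OF j] Ck_on_Suc[OF Suc.prems(2)]])
        show "Ck_on n k U (pderiv_at i (\<lambda>x. F x j))" by (rule E(3)[OF j i])
      qed
      then show "Ck_on n k U (pderiv_at i (\<lambda>x. g (F x)))"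
        by (rule Ck_on_cong[OF U]) (rule pd[OF i])
      fix x assume "x \<in> U"
      from der[OF i this] show "(\<lambda>t. g (F (x(i := t)))) field_differentiable at (x i)"
        unfolding field_differentiable_def by blast
    qed
  }
qed

lemma smooth_on_cong:
  assumes "openin (Euclidean_space n) U" "smooth_on n U f" "\<And>z. z \<in> U \<Longrightarrow> f z = g z"
  shows "smooth_on n U g"
  unfolding smooth_on_def
  by (rule allI, rule Ck_on_cong[OF assms(1) assms(2)[unfolded smooth_on_def, rule_format] assms(3)])

lemma smooth_on_subset: assumes "smooth_on n U f" "V \<subseteq> U" shows "smooth_on n V f"
  unfolding smooth_on_def
  by (rule allI, rule Ck_on_subset[OF assms(1)[unfolded smooth_on_def, rule_format] assms(2)])

lemma smooth_on_add:
  assumes "openin (Euclidean_space n) U" "smooth_on n U f" "smooth_on n U g"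
  shows "smooth_on n U (\<lambda>x. f x + g x)"
  unfolding smooth_on_def
  by (rule allI, rule Ck_on_add[OF assms(1) assms(2,3)[unfolded smooth_on_def, rule_format]])

lemma smooth_on_mult:
  assumes "openin (Euclidean_space n) U" "smooth_on n U f" "smooth_on n U g"
  shows "smooth_on n U (\<lambda>x. f x * g x)"
  unfolding smooth_on_def
  by (rule allI, rule Ck_on_mult[OF assms(1) assms(2,3)[unfolded smooth_on_def, rule_format]])

lemma smooth_on_const: "smooth_on n U (\<lambda>_. a)"
  by (simp add: smooth_on_def Ck_on_const)

lemma smooth_on_coordinate: "smooth_on n U (\<lambda>x. x j)"
  by (simp add: smooth_on_def Ck_on_coordinate)

lemma smooth_on_compose:
  assumes "openin (Euclidean_space n) U" "openin (Euclidean_space m) V" "\<And>x. x \<in> U \<Longrightarrow> F x \<in> V"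
    and "smooth_on m V g" "smooth_vec_on n m U F"
  shows "smooth_on n U (\<lambda>x. g (F x))"
  unfolding smooth_on_def
proof
  fix k show "Ck_on n k U (\<lambda>x. g (F x))"
    by (rule Ck_on_compose[OF assms(1-3)]) (use assms(4,5) in \<open>simp_all add: smooth_on_def smooth_vec_on_def\<close>)
qed

lemma smooth_vec_onD: "\<lbrakk>smooth_vec_on n m U f; j < m\<rbrakk> \<Longrightarrow> smooth_on n U (\<lambda>x. f x j)"
  by (simp add: smooth_vec_on_def)

lemma smooth_on_continuous: "smooth_on n U f \<Longrightarrow> continuous_map (subtopology (Euclidean_space n) U) euclideanreal f"
  unfolding smooth_on_def by (rule Ck_on_continuous) (erule allE)

lemma smooth_vec_on_subset:
  assumes "smooth_vec_on n m U f" "V \<subseteq> U"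
  shows "smooth_vec_on n m V f"
  using smooth_on_subset[OF smooth_vec_onD[OF assms(1)] assms(2)] by (simp add: smooth_vec_on_def)

section \<open>Charts and smooth maps\<close>

lemma atlas_chart: "\<lbrakk>smooth_manifold M; c \<in> Matlas M\<rbrakk> \<Longrightarrow> is_chart (Mtop M) (Mdim M) c"
  unfolding smooth_manifold_def by blast

lemma atlas_maximal:
  assumes "smooth_manifold M" "is_chart (Mtop M) (Mdim M) c"
    and "\<And>c'. c' \<in> Matlas M \<Longrightarrow> compatible_charts (Mdim M) c c'"
  shows "c \<in> Matlas M"
proof -
  have "\<forall>c. is_chart (Mtop M) (Mdim M) c \<and> (\<forall>c'\<in>Matlas M. compatible_charts (Mdim M) c c') \<longrightarrow> c \<in> Matlas M"
    using assms(1) unfolding smooth_manifold_def by (elim conjE)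
  then show ?thesis using assms(2,3) by blast
qed

lemma atlas_cover:
  assumes "smooth_manifold M" "p \<in> Mcarrier M"
  obtains c where "c \<in> Matlas M" "p \<in> fst c"
  using assms unfolding smooth_manifold_def by blast

lemma chart_open: "\<lbrakk>smooth_manifold M; c \<in> Matlas M\<rbrakk> \<Longrightarrow> openin (Mtop M) (fst c)"
  using atlas_chart unfolding is_chart_def by blast

lemma chart_homeo:
  assumes "smooth_manifold M" "c \<in> Matlas M"
  shows "homeomorphic_map (subtopology (Mtop M) (fst c)) (subtopology (Euclidean_space (Mdim M)) (snd c ` fst c)) (snd c)"
  using atlas_chart[OF assms] unfolding is_chart_def by blast

lemma chart_topspace: "\<lbrakk>smooth_manifold M; c \<in> Matlas M\<rbrakk> \<Longrightarrow> topspace (subtopology (Mtop M) (fst c)) = fst c"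
  by (simp add: topspace_subtopology Int_absorb1 openin_subset[OF chart_open])

lemma chart_inj: "\<lbrakk>smooth_manifold M; c \<in> Matlas M\<rbrakk> \<Longrightarrow> inj_on (snd c) (fst c)"
  using homeomorphic_imp_injective_map[OF chart_homeo] chart_topspace by metis

lemma chart_inv_chart: "\<lbrakk>smooth_manifold M; c \<in> Matlas M; p \<in> fst c\<rbrakk> \<Longrightarrow> chart_inv c (snd c p) = p"
  by (rule inv_into_f_f[OF chart_inj])

lemma chart_image_open:
  assumes M: "smooth_manifold M" "c \<in> Matlas M" and W: "openin (Mtop M) W" "W \<subseteq> fst c"
  shows "openin (Euclidean_space (Mdim M)) (snd c ` W)"
proof -
  have E: "openin (Euclidean_space (Mdim M)) (snd c ` fst c)"
    using atlas_chart[OF M] unfolding is_chart_def by blast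
  have "openin (subtopology (Mtop M) (fst c)) W"
    using W by (simp add: openin_open_subtopology chart_open[OF M])
  then have "openin (subtopology (Euclidean_space (Mdim M)) (snd c ` fst c)) (snd c ` W)"
    using homeomorphic_imp_open_map[OF chart_homeo[OF M]] unfolding open_map_def by blast
  then show ?thesis using E by (simp add: openin_open_subtopology)
qed

lemma chart_preimage_open:
  assumes M: "smooth_manifold M" "c \<in> Matlas M" and A: "openin (Euclidean_space (Mdim M)) A"
  shows "openin (Mtop M) {p \<in> fst c. snd c p \<in> A}"
proof -
  have "openin (subtopology (Euclidean_space (Mdim M)) (snd c ` fst c)) (snd c ` fst c \<inter> A)"
    using A by (auto simp: openin_subtopology)
  from openin_continuous_map_preimage[OF homeomorphic_imp_continuous_map[OF chart_homeo[OF M]] this]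
  have "openin (subtopology (Mtop M) (fst c)) {p \<in> fst c. snd c p \<in> snd c ` fst c \<inter> A}"
    unfolding chart_topspace[OF M] .
  moreover have "{p \<in> fst c. snd c p \<in> snd c ` fst c \<inter> A} = {p \<in> fst c. snd c p \<in> A}" by blast
  ultimately have "openin (subtopology (Mtop M) (fst c)) {p \<in> fst c. snd c p \<in> A}" by simp
  then show ?thesis by (simp add: openin_open_subtopology chart_open[OF M])
qed

lemma compatible: "\<lbrakk>smooth_manifold M; c \<in> Matlas M; c' \<in> Matlas M\<rbrakk>
    \<Longrightarrow> smooth_vec_on (Mdim M) (Mdim M) (snd c ` (fst c \<inter> fst c')) (\<lambda>x. snd c' (chart_inv c x))"
  unfolding smooth_manifold_def compatible_charts_def smooth_transition_def by blast

text \<open>The expression in c is the expression in c' after the transition map.\<close>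

lemma chart_change:
  assumes M: "smooth_manifold M" "c \<in> Matlas M" "c' \<in> Matlas M"
    and W: "openin (Mtop M) W" "W \<subseteq> fst c" "W \<subseteq> fst c'"
    and h: "smooth_on (Mdim M) (snd c' ` W) (\<lambda>x. h (chart_inv c' x))"
  shows "smooth_on (Mdim M) (snd c ` W) (\<lambda>x. h (chart_inv c x))"
proof (rule smooth_on_cong)
  show o: "openin (Euclidean_space (Mdim M)) (snd c ` W)" by (rule chart_image_open[OF M(1,2) W(1,2)])
  have sv: "smooth_vec_on (Mdim M) (Mdim M) (snd c ` W) (\<lambda>x. snd c' (chart_inv c x))"
    by (rule smooth_vec_on_subset[OF compatible[OF M]]) (use W(2,3) in auto)
  show "smooth_on (Mdim M) (snd c ` W) (\<lambda>x. h (chart_inv c' (snd c' (chart_inv c x))))"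
    by (rule smooth_on_compose[OF o chart_image_open[OF M(1,3) W(1,3)] _ h sv])
       (use W(2) chart_inv_chart[OF M(1,2)] in auto)
  fix z assume "z \<in> snd c ` W"
  then obtain p where "p \<in> W" "z = snd c p" by blast
  then show "h (chart_inv c' (snd c' (chart_inv c z))) = h (chart_inv c z)"
    using W chart_inv_chart[OF M(1,2)] chart_inv_chart[OF M(1,3)] by (simp add: subset_iff)
qed

text \<open>The map is cut down along with the domain, since \<open>is_chart\<close> asks for
  extensional coordinate maps.\<close>

definition restrict_chart :: "'a chart \<Rightarrow> 'a set \<Rightarrow> 'a chart" where
  "restrict_chart c W = (W, restrict (snd c) W)"

lemma restrict_chart_simps [simp]: "fst (restrict_chart c W) = W" "snd (restrict_chart c W) = restrict (snd c) W"
  by (simp_all add: restrict_chart_def)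

lemma restrict_chart_image: "V \<subseteq> W \<Longrightarrow> snd (restrict_chart c W) ` V = snd c ` V"
  by (rule image_cong) auto

lemma restrict_chart_inv:
  assumes "smooth_manifold M" "c \<in> Matlas M" "W \<subseteq> fst c" "p \<in> W"
  shows "chart_inv (restrict_chart c W) (snd c p) = p"
proof -
  have "inj_on (restrict (snd c) W) W"
    using inj_on_subset[OF chart_inj[OF assms(1,2)] assms(3)] by (simp add: inj_on_def)
  from inv_into_f_f[OF this assms(4)] show ?thesis using assms(4) by simp
qed

text \<open>By maximality of the atlas it suffices that the smaller chart is compatible with every
  chart, and its transition maps agree with restrictions of those of c.\<close>

lemma restrict_chart_atlas:
  assumes M: "smooth_manifold M" "c \<in> Matlas M" and W: "openin (Mtop M) W" "W \<subseteq> fst c"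
  shows "restrict_chart c W \<in> Matlas M"
proof -
  let ?n = "Mdim M"
  note ci = chart_inv_chart[OF M(1,2)] and ri = restrict_chart_inv[OF M W(2)]
  have "homeomorphic_map (subtopology (subtopology (Mtop M) (fst c)) W)
      (subtopology (subtopology (Euclidean_space ?n) (snd c ` fst c)) (snd c ` W)) (snd c)"
  proof (rule homeomorphic_map_subtopologies[OF chart_homeo[OF M]])
    have E: "snd c ` fst c \<subseteq> topspace (Euclidean_space ?n)"
      by (rule openin_subset[OF chart_image_open[OF M chart_open[OF M] subset_refl]])
    have "Mcarrier M \<inter> fst c \<inter> W = W" "snd c ` W \<subseteq> snd c ` fst c"
      using W(2) openin_subset[OF W(1)] by auto
    then show "snd c ` (topspace (subtopology (Mtop M) (fst c)) \<inter> W) =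
        topspace (subtopology (Euclidean_space ?n) (snd c ` fst c)) \<inter> snd c ` W"
      unfolding topspace_subtopology using E by (simp add: Int_absorb1 Int_absorb2)
  qed
  then have "homeomorphic_map (subtopology (Mtop M) W) (subtopology (Euclidean_space ?n) (snd c ` W)) (snd c)"
    unfolding subtopology_subtopology Int_absorb1[OF W(2)] Int_absorb1[OF image_mono[OF W(2)]] .
  then have h: "homeomorphic_map (subtopology (Mtop M) W) (subtopology (Euclidean_space ?n) (snd c ` W)) (restrict (snd c) W)"
    by (rule homeomorphic_map_eq) (simp add: topspace_subtopology)
  then have chart: "is_chart (Mtop M) ?n (restrict_chart c W)"
    unfolding is_chart_def restrict_chart_simps(1) restrict_chart_image[OF subset_refl]
    using W chart_image_open[OF M W] by simp
  have "compatible_charts ?n (restrict_chart c W) c'" if c': "c' \<in> Matlas M" for c'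
    unfolding compatible_charts_def smooth_transition_def
  proof
    have Wc: "openin (Mtop M) (W \<inter> fst c')" by (rule openin_Int[OF W(1) chart_open[OF M(1) c']])
    have "smooth_vec_on ?n ?n (snd c ` (W \<inter> fst c')) (\<lambda>x. snd c' (chart_inv (restrict_chart c W) x))"
      unfolding smooth_vec_on_def
    proof (intro allI impI)
      fix j assume j: "j < ?n"
      show "smooth_on ?n (snd c ` (W \<inter> fst c')) (\<lambda>x. snd c' (chart_inv (restrict_chart c W) x) j)"
      proof (rule smooth_on_cong)
        show "openin (Euclidean_space ?n) (snd c ` (W \<inter> fst c'))"
          by (rule chart_image_open[OF M Wc]) (use W(2) in auto)
        show "smooth_on ?n (snd c ` (W \<inter> fst c')) (\<lambda>x. snd c' (chart_inv c x) j)"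
          by (rule smooth_on_subset[OF smooth_vec_onD[OF compatible[OF M c'] j]]) (use W(2) in auto)
        show "snd c' (chart_inv c z) j = snd c' (chart_inv (restrict_chart c W) z) j"
          if z: "z \<in> snd c ` (W \<inter> fst c')" for z
        proof -
          obtain q where q: "q \<in> W" "z = snd c q" using z by blast
          then have "q \<in> fst c" using W(2) by blast
          then show ?thesis by (simp only: q(2) ci ri[OF q(1)])
        qed
      qed
    qed
    then show "smooth_vec_on ?n ?n (snd (restrict_chart c W) ` (fst (restrict_chart c W) \<inter> fst c'))
        (\<lambda>x. snd c' (chart_inv (restrict_chart c W) x))"
      unfolding restrict_chart_image[OF Int_lower1] restrict_chart_simps(1) .
    have Wc': "openin (Mtop M) (fst c' \<inter> W)" by (rule openin_Int[OF chart_open[OF M(1) c'] W(1)])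
    show "smooth_vec_on ?n ?n (snd c' ` (fst c' \<inter> fst (restrict_chart c W)))
        (\<lambda>x. snd (restrict_chart c W) (chart_inv c' x))"
      unfolding smooth_vec_on_def restrict_chart_simps
    proof (intro allI impI)
      fix j assume j: "j < ?n"
      show "smooth_on ?n (snd c' ` (fst c' \<inter> W)) (\<lambda>x. restrict (snd c) W (chart_inv c' x) j)"
      proof (rule smooth_on_cong)
        show "openin (Euclidean_space ?n) (snd c' ` (fst c' \<inter> W))"
          by (rule chart_image_open[OF M(1) c' Wc']) auto
        show "smooth_on ?n (snd c' ` (fst c' \<inter> W)) (\<lambda>x. snd c (chart_inv c' x) j)"
          by (rule smooth_on_subset[OF smooth_vec_onD[OF compatible[OF M(1) c' M(2)] j]]) (use W(2) in auto)
        show "snd c (chart_inv c' z) j = restrict (snd c) W (chart_inv c' z) j"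
          if z: "z \<in> snd c' ` (fst c' \<inter> W)" for z
        proof -
          obtain q where q: "q \<in> W" "q \<in> fst c'" "z = snd c' q" using z by blast
          then show ?thesis by (simp add: chart_inv_chart[OF M(1) c'])
        qed
      qed
    qed
  qed
  with chart show ?thesis by (rule atlas_maximal[OF M(1)])
qed

lemma smooth_on_restrict_chart:
  assumes M: "smooth_manifold M" "c \<in> Matlas M" and W: "openin (Mtop M) W" "W \<subseteq> fst c"
    and h: "smooth_on (Mdim M) (snd c ` W) (\<lambda>x. h (chart_inv c x))"
  shows "smooth_on (Mdim M) (snd (restrict_chart c W) ` fst (restrict_chart c W)) (\<lambda>x. h (chart_inv (restrict_chart c W) x))"
proof -
  have "smooth_on (Mdim M) (snd c ` W) (\<lambda>x. h (chart_inv (restrict_chart c W) x))"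
    by (rule smooth_on_cong[OF chart_image_open[OF M W] h])
       (use W(2) chart_inv_chart[OF M] restrict_chart_inv[OF M W(2)] in \<open>auto simp: subset_iff\<close>)
  then show ?thesis unfolding restrict_chart_simps(1) restrict_chart_image[OF subset_refl] .
qed

lemma smooth_map_open: "smooth_map M N U f \<Longrightarrow> openin (Mtop M) U" by (simp add: smooth_map_def)
lemma smooth_map_image: "\<lbrakk>smooth_map M N U f; p \<in> U\<rbrakk> \<Longrightarrow> f p \<in> Mcarrier N" unfolding smooth_map_def by blast

text \<open>\<open>smooth_map\<close> provides some pair of charts at p; transition maps on both
  sides pass to any prescribed pair. The neighbourhood is open because the coordinate expression of
  f is continuous, which follows from its smooth coordinates.\<close>

lemma smooth_map_in_charts:
  assumes M: "smooth_manifold M" and N: "smooth_manifold N" and f: "smooth_map M N U f" and p: "p \<in> U"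
    and c: "c \<in> Matlas M" "p \<in> fst c" and e: "e \<in> Matlas N" "f p \<in> fst e"
  obtains W where "openin (Mtop M) W" "p \<in> W" "W \<subseteq> fst c" "W \<subseteq> U" "f ` W \<subseteq> fst e"
    "smooth_vec_on (Mdim M) (Mdim N) (snd c ` W) (\<lambda>x. snd e (f (chart_inv c x)))"
proof -
  let ?m = "Mdim M" and ?n = "Mdim N"
  obtain c0 e0 where c0: "c0 \<in> Matlas M" "p \<in> fst c0" "fst c0 \<subseteq> U" and e0: "e0 \<in> Matlas N" "f ` fst c0 \<subseteq> fst e0"
    and s: "smooth_vec_on ?m ?n (snd c0 ` fst c0) (\<lambda>x. snd e0 (f (chart_inv c0 x)))"
    using f p unfolding smooth_map_def by blast
  let ?\<phi> = "\<lambda>x. snd e0 (f (chart_inv c0 x))"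
  note o0 = chart_image_open[OF M c0(1) chart_open[OF M c0(1)] subset_refl]
  note E0 = chart_image_open[OF N e0(1) chart_open[OF N e0(1)] subset_refl]
  have \<phi>: "?\<phi> x \<in> snd e0 ` fst e0" if "x \<in> snd c0 ` fst c0" for x
    using that e0(2) chart_inv_chart[OF M c0(1)] by auto
  have cont: "continuous_map (subtopology (Euclidean_space ?m) (snd c0 ` fst c0)) (subtopology (Euclidean_space ?n) (snd e0 ` fst e0)) ?\<phi>"
    by (rule Euclidean_map_continuous[OF smooth_on_continuous[OF smooth_vec_onD[OF s]] \<phi> E0])
       (simp_all add: topspace_subtopology)
  have ee: "openin (Mtop N) (fst e0 \<inter> fst e)" by (rule openin_Int[OF chart_open[OF N e0(1)] chart_open[OF N e(1)]])
  have B: "openin (Euclidean_space ?n) (snd e0 ` (fst e0 \<inter> fst e))"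
    by (rule chart_image_open[OF N e0(1) ee]) auto
  then have "openin (subtopology (Euclidean_space ?n) (snd e0 ` fst e0)) (snd e0 ` (fst e0 \<inter> fst e))"
    using E0 by (simp add: openin_open_subtopology image_mono)
  from openin_continuous_map_preimage[OF cont this]
  have A: "openin (Euclidean_space ?m) {x \<in> topspace (subtopology (Euclidean_space ?m) (snd c0 ` fst c0)). ?\<phi> x \<in> snd e0 ` (fst e0 \<inter> fst e)}"
    (is "openin _ ?A")
    using o0 by (simp add: openin_open_subtopology)
  have A_eq: "snd c0 q \<in> ?A \<longleftrightarrow> f q \<in> fst e" if q: "q \<in> fst c0" for q
  proof -
    have "snd c0 q \<in> topspace (Euclidean_space ?m)" using openin_subset[OF o0] q by blast
    moreover have "snd e0 (f q) \<in> snd e0 ` (fst e0 \<inter> fst e) \<longleftrightarrow> f q \<in> fst e0 \<inter> fst e"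
      using e0(2) q by (intro inj_on_image_mem_iff[OF chart_inj[OF N e0(1)]]) auto
    ultimately show ?thesis using q e0(2) chart_inv_chart[OF M c0(1) q] by (auto simp: topspace_subtopology)
  qed
  \<comment> \<open>The points of both source charts that f sends into e; open as a preimage under
    the coordinate expression.\<close>
  define W where "W = {q \<in> fst c0. snd c0 q \<in> ?A} \<inter> fst c"
  have W_eq: "W = {q \<in> fst c0. f q \<in> fst e} \<inter> fst c" using A_eq unfolding W_def by blast
  have Wo: "openin (Mtop M) W" unfolding W_def
    by (rule openin_Int[OF chart_preimage_open[OF M c0(1) A] chart_open[OF M c(1)]])
  have Ws: "W \<subseteq> fst c0" "W \<subseteq> fst c" "f ` W \<subseteq> fst e" using W_eq by auto
  show thesis
  proof (rule that[OF Wo])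
    show "p \<in> W" using W_eq c0(2) c(2) e(2) by blast
    show "W \<subseteq> fst c" "W \<subseteq> U" "f ` W \<subseteq> fst e" using Ws c0(3) by auto
    show "smooth_vec_on ?m ?n (snd c ` W) (\<lambda>x. snd e (f (chart_inv c x)))"
      unfolding smooth_vec_on_def
    proof (intro allI impI)
      fix j assume j: "j < ?n"
      note oW = chart_image_open[OF M c0(1) Wo Ws(1)]
      have im: "?\<phi> x \<in> snd e0 ` (fst e0 \<inter> fst e)" if x: "x \<in> snd c0 ` W" for x
      proof -
        obtain q where "q \<in> W" "x = snd c0 q" using x by blast
        moreover from this have "f q \<in> fst e0 \<inter> fst e" "q \<in> fst c0" using Ws e0(2) by blast+
        ultimately show ?thesis by (simp only: chart_inv_chart[OF M c0(1)] imageI)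
      qed
      have "smooth_on ?m (snd c0 ` W) (\<lambda>x. snd e (chart_inv e0 (?\<phi> x)) j)"
      proof (rule smooth_on_compose[OF oW B im smooth_vec_onD[OF compatible[OF N e0(1) e(1)] j]])
        show "smooth_vec_on ?m ?n (snd c0 ` W) ?\<phi>"
          by (rule smooth_vec_on_subset[OF s image_mono[OF Ws(1)]])
      qed
      then have "smooth_on ?m (snd c0 ` W) (\<lambda>x. snd e (f (chart_inv c0 x)) j)"
        by (rule smooth_on_cong[OF oW])
           (use Ws e0(2) chart_inv_chart[OF M c0(1)] chart_inv_chart[OF N e0(1)] in \<open>auto simp: subset_iff image_subset_iff\<close>)
      from chart_change[OF M c(1) c0(1) Wo Ws(2,1), of "\<lambda>q. snd e (f q) j", OF this]
      show "smooth_on ?m (snd c ` W) (\<lambda>x. snd e (f (chart_inv c x)) j)" .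
    qed
  qed
qed

text \<open>The definition asks for a whole chart inside U. A neighbourhood inside a chart suffices,
  as the chart can be restricted to it.\<close>

lemma smooth_mapI:
  assumes M: "smooth_manifold M" and U: "openin (Mtop M) U" "f ` U \<subseteq> Mcarrier N"
    and loc: "\<And>p. p \<in> U \<Longrightarrow> \<exists>c\<in>Matlas M. \<exists>e\<in>Matlas N. \<exists>W. openin (Mtop M) W \<and> p \<in> W \<and> W \<subseteq> fst c \<and> W \<subseteq> U \<and>
      f ` W \<subseteq> fst e \<and> smooth_vec_on (Mdim M) (Mdim N) (snd c ` W) (\<lambda>x. snd e (f (chart_inv c x)))"
  shows "smooth_map M N U f"
  unfolding smooth_map_def
proof (intro conjI ballI U)
  fix p assume "p \<in> U"
  from loc[OF this] obtain c e W where *: "c \<in> Matlas M" "e \<in> Matlas N" "openin (Mtop M) W" "p \<in> W" "W \<subseteq> fst c"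
    "W \<subseteq> U" "f ` W \<subseteq> fst e" "smooth_vec_on (Mdim M) (Mdim N) (snd c ` W) (\<lambda>x. snd e (f (chart_inv c x)))" by blast
  have "smooth_vec_on (Mdim M) (Mdim N) (snd (restrict_chart c W) ` fst (restrict_chart c W)) (\<lambda>x. snd e (f (chart_inv (restrict_chart c W) x)))"
    unfolding smooth_vec_on_def
  proof (intro allI impI)
    fix j assume "j < Mdim N"
    from smooth_vec_onD[OF *(8) this]
    show "smooth_on (Mdim M) (snd (restrict_chart c W) ` fst (restrict_chart c W)) (\<lambda>x. snd e (f (chart_inv (restrict_chart c W) x)) j)"
      by (rule smooth_on_restrict_chart[OF M *(1,3,5), of "\<lambda>q. snd e (f q) j"])
  qed
  then show "\<exists>c\<in>Matlas M. \<exists>c'\<in>Matlas N. p \<in> fst c \<and> fst c \<subseteq> U \<and> f ` fst c \<subseteq> fst c' \<and>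
        smooth_vec_on (Mdim M) (Mdim N) (snd c ` fst c) (\<lambda>x. snd c' (f (chart_inv c x)))"
    using * restrict_chart_atlas[OF M *(1,3,5)]
    by (intro bexI[of _ "restrict_chart c W"] bexI[of _ e]) auto
qed

lemma smooth_map_preimage:
  assumes M: "smooth_manifold M" and N: "smooth_manifold N" and f: "smooth_map M N U f" and V: "openin (Mtop N) V"
  shows "openin (Mtop M) {q \<in> U. f q \<in> V}"
proof (subst openin_subopen, intro ballI)
  fix p assume "p \<in> {q \<in> U. f q \<in> V}"
  then have p: "p \<in> U" "f p \<in> V" by auto
  obtain c where c: "c \<in> Matlas M" "p \<in> fst c"
    by (rule atlas_cover[OF M subsetD[OF openin_subset[OF smooth_map_open[OF f]]]]) (use p in blast)
  obtain e where e: "e \<in> Matlas N" "f p \<in> fst e" by (rule atlas_cover[OF N smooth_map_image[OF f p(1)]])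
  \<comment> \<open>A target chart contained in V makes the neighbourhood found by
    \<open>smooth_map_in_charts\<close> land in V.\<close>
  let ?e = "restrict_chart e (fst e \<inter> V)"
  have "openin (Mtop N) (fst e \<inter> V)" by (rule openin_Int[OF chart_open[OF N e(1)] V])
  then have "?e \<in> Matlas N" by (rule restrict_chart_atlas[OF N e(1)]) auto
  moreover have "f p \<in> fst ?e" using e p by simp
  ultimately obtain W where "openin (Mtop M) W" "p \<in> W" "W \<subseteq> fst c" "W \<subseteq> U" "f ` W \<subseteq> fst ?e"
    by (rule smooth_map_in_charts[OF M N f p(1) c]) blast
  then show "\<exists>W. openin (Mtop M) W \<and> p \<in> W \<and> W \<subseteq> {q \<in> U. f q \<in> V}"
    by (intro exI[of _ W]) auto
qed

lemma smooth_map_subset: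
  assumes M: "smooth_manifold M" and N: "smooth_manifold N" and f: "smooth_map M N U f" and V: "openin (Mtop M) V" "V \<subseteq> U"
  shows "smooth_map M N V f"
proof (rule smooth_mapI[OF M V(1)])
  show "f ` V \<subseteq> Mcarrier N" using smooth_map_image[OF f] V by blast
  fix p assume p: "p \<in> V"
  then have pU: "p \<in> U" using V by blast
  obtain c where c: "c \<in> Matlas M" "p \<in> fst c"
    by (rule atlas_cover[OF M subsetD[OF openin_subset[OF V(1)] p]])
  obtain e where e: "e \<in> Matlas N" "f p \<in> fst e" by (rule atlas_cover[OF N smooth_map_image[OF f pU]])
  obtain W where W: "openin (Mtop M) W" "p \<in> W" "W \<subseteq> fst c" "W \<subseteq> U" "f ` W \<subseteq> fst e"
    "smooth_vec_on (Mdim M) (Mdim N) (snd c ` W) (\<lambda>x. snd e (f (chart_inv c x)))"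
    by (rule smooth_map_in_charts[OF M N f pU c e])
  have "smooth_vec_on (Mdim M) (Mdim N) (snd c ` (W \<inter> V)) (\<lambda>x. snd e (f (chart_inv c x)))"
    by (rule smooth_vec_on_subset[OF W(6)]) auto
  then show "\<exists>c\<in>Matlas M. \<exists>e\<in>Matlas N. \<exists>W. openin (Mtop M) W \<and> p \<in> W \<and> W \<subseteq> fst c \<and> W \<subseteq> V \<and>
      f ` W \<subseteq> fst e \<and> smooth_vec_on (Mdim M) (Mdim N) (snd c ` W) (\<lambda>x. snd e (f (chart_inv c x)))"
    using c e W V p by (intro bexI[of _ c] bexI[of _ e] exI[of _ "W \<inter> V"]) auto
qed

lemma smooth_map_id:
  assumes M: "smooth_manifold M" and U: "openin (Mtop M) U"
  shows "smooth_map M M U (\<lambda>p. p)"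
proof (rule smooth_mapI[OF M U])
  show "(\<lambda>p. p) ` U \<subseteq> Mcarrier M" using openin_subset[OF U] by simp
  fix p assume p: "p \<in> U"
  obtain c where c: "c \<in> Matlas M" "p \<in> fst c"
    by (rule atlas_cover[OF M subsetD[OF openin_subset[OF U] p]])
  let ?W = "fst c \<inter> U"
  have W: "openin (Mtop M) ?W" by (rule openin_Int[OF chart_open[OF M c(1)] U])
  have "smooth_vec_on (Mdim M) (Mdim M) (snd c ` ?W) (\<lambda>x. snd c (chart_inv c x))"
    unfolding smooth_vec_on_def
  proof (intro allI impI)
    fix j
    show "smooth_on (Mdim M) (snd c ` ?W) (\<lambda>x. snd c (chart_inv c x) j)"
      by (rule smooth_on_cong[OF chart_image_open[OF M c(1) W Int_lower1] smooth_on_coordinate[of _ _ j]])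
         (use chart_inv_chart[OF M c(1)] in auto)
  qed
  then show "\<exists>c\<in>Matlas M. \<exists>e\<in>Matlas M. \<exists>W. openin (Mtop M) W \<and> p \<in> W \<and> W \<subseteq> fst c \<and> W \<subseteq> U \<and>
      (\<lambda>p. p) ` W \<subseteq> fst e \<and> smooth_vec_on (Mdim M) (Mdim M) (snd c ` W) (\<lambda>x. snd e (chart_inv c x))"
    using c W p by (intro bexI[of _ c] exI[of _ ?W]) auto
qed

lemma smooth_map_compose:
  assumes M: "smooth_manifold M" and N: "smooth_manifold N" and K: "smooth_manifold K"
    and f: "smooth_map M N U f" and g: "smooth_map N K V g" and fV: "f ` U \<subseteq> V"
  shows "smooth_map M K U (g \<circ> f)"
proof (rule smooth_mapI[OF M smooth_map_open[OF f]])
  show "(g \<circ> f) ` U \<subseteq> Mcarrier K" using smooth_map_image[OF g] fV by auto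
  fix p assume p: "p \<in> U"
  then have fp: "f p \<in> V" using fV by blast
  obtain c where c: "c \<in> Matlas M" "p \<in> fst c"
    by (rule atlas_cover[OF M subsetD[OF openin_subset[OF smooth_map_open[OF f]]]]) (use p in blast)
  obtain e where e: "e \<in> Matlas N" "f p \<in> fst e" by (rule atlas_cover[OF N smooth_map_image[OF f p]])
  obtain b where b: "b \<in> Matlas K" "g (f p) \<in> fst b" by (rule atlas_cover[OF K smooth_map_image[OF g fp]])
  obtain W' where W': "openin (Mtop N) W'" "f p \<in> W'" "W' \<subseteq> fst e" "W' \<subseteq> V" "g ` W' \<subseteq> fst b"
    "smooth_vec_on (Mdim N) (Mdim K) (snd e ` W') (\<lambda>x. snd b (g (chart_inv e x)))"
    by (rule smooth_map_in_charts[OF N K g fp e b])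
  obtain W0 where W0: "openin (Mtop M) W0" "p \<in> W0" "W0 \<subseteq> fst c" "W0 \<subseteq> U" "f ` W0 \<subseteq> fst e"
    "smooth_vec_on (Mdim M) (Mdim N) (snd c ` W0) (\<lambda>x. snd e (f (chart_inv c x)))"
    by (rule smooth_map_in_charts[OF M N f p c e])
  let ?W = "W0 \<inter> {q \<in> U. f q \<in> W'}"
  have W: "openin (Mtop M) ?W" by (rule openin_Int[OF W0(1) smooth_map_preimage[OF M N f W'(1)]])
  have Wc: "?W \<subseteq> fst c" using W0 by blast
  have s: "smooth_vec_on (Mdim M) (Mdim N) (snd c ` ?W) (\<lambda>x. snd e (f (chart_inv c x)))"
    by (rule smooth_vec_on_subset[OF W0(6)]) auto
  have im: "snd e (f (chart_inv c x)) \<in> snd e ` W'" if "x \<in> snd c ` ?W" for x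
    using that Wc chart_inv_chart[OF M c(1)] by auto
  have "smooth_vec_on (Mdim M) (Mdim K) (snd c ` ?W) (\<lambda>x. snd b ((g \<circ> f) (chart_inv c x)))"
    unfolding smooth_vec_on_def
  proof (intro allI impI)
    fix j assume j: "j < Mdim K"
    show "smooth_on (Mdim M) (snd c ` ?W) (\<lambda>x. snd b ((g \<circ> f) (chart_inv c x)) j)"
    proof (rule smooth_on_cong[OF chart_image_open[OF M c(1) W Wc]
          smooth_on_compose[OF chart_image_open[OF M c(1) W Wc] chart_image_open[OF N e(1) W'(1,3)] im
            smooth_vec_onD[OF W'(6) j] s]])
      fix z assume "z \<in> snd c ` ?W"
      then obtain q where q: "q \<in> ?W" "z = snd c q" by blast
      have "q \<in> fst c" "f q \<in> fst e" using q W0 by auto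
      then show "snd b (g (chart_inv e (snd e (f (chart_inv c z))))) j = snd b ((g \<circ> f) (chart_inv c z)) j"
        by (simp add: q(2) chart_inv_chart[OF M c(1)] chart_inv_chart[OF N e(1)])
    qed
  qed
  then show "\<exists>c\<in>Matlas M. \<exists>e\<in>Matlas K. \<exists>W. openin (Mtop M) W \<and> p \<in> W \<and> W \<subseteq> fst c \<and> W \<subseteq> U \<and>
      (g \<circ> f) ` W \<subseteq> fst e \<and> smooth_vec_on (Mdim M) (Mdim K) (snd c ` W) (\<lambda>x. snd e ((g \<circ> f) (chart_inv c x)))"
    using c b W W0 W' p by (intro bexI[of _ c] bexI[of _ b] exI[of _ ?W]) auto
qed

section \<open>Smooth germs, tangent vectors and pushforward\<close>

lemma smooth_near_carrier: "smooth_near M p h \<Longrightarrow> p \<in> Mcarrier M"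
  unfolding smooth_near_def smooth_fun_def by (meson openin_subset subsetD)

lemma smooth_nearI:
  assumes M: "smooth_manifold M" and c: "c \<in> Matlas M" and W: "openin (Mtop M) W" "p \<in> W" "W \<subseteq> fst c"
    and h: "smooth_on (Mdim M) (snd c ` W) (\<lambda>x. h (chart_inv c x))"
  shows "smooth_near M p h"
proof -
  have "smooth_fun M W h"
    unfolding smooth_fun_def
    using W(1) restrict_chart_atlas[OF M c W(1,3)] smooth_on_restrict_chart[OF M c W(1,3) h]
    by (intro conjI ballI bexI[of _ "restrict_chart c W"]) simp_all
  then show ?thesis using W(2) unfolding smooth_near_def by blast
qed

lemma smooth_near_in_chart:
  assumes M: "smooth_manifold M" and c: "c \<in> Matlas M" "p \<in> fst c" and h: "smooth_near M p h"
  obtains W where "openin (Mtop M) W" "p \<in> W" "W \<subseteq> fst c" "smooth_on (Mdim M) (snd c ` W) (\<lambda>x. h (chart_inv c x))"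
proof -
  obtain c0 where c0: "c0 \<in> Matlas M" "p \<in> fst c0" "smooth_on (Mdim M) (snd c0 ` fst c0) (\<lambda>x. h (chart_inv c0 x))"
    using h unfolding smooth_near_def smooth_fun_def by blast
  have W: "openin (Mtop M) (fst c \<inter> fst c0)"
    by (rule openin_Int[OF chart_open[OF M c(1)] chart_open[OF M c0(1)]])
  have "smooth_on (Mdim M) (snd c0 ` (fst c \<inter> fst c0)) (\<lambda>x. h (chart_inv c0 x))"
    by (rule smooth_on_subset[OF c0(3)]) auto
  from chart_change[OF M c(1) c0(1) W Int_lower1 Int_lower2 this] show thesis
    by (intro that[OF W]) (use c c0 in auto)
qed

lemma smooth_near_obtain_chart:
  assumes M: "smooth_manifold M" and h: "smooth_near M p h"
  obtains c where "c \<in> Matlas M" "p \<in> fst c"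
  using atlas_cover[OF M smooth_near_carrier[OF h]] by blast

lemma smooth_near_germ:
  assumes M: "smooth_manifold M" and h: "smooth_near M p h" and U: "openin (Mtop M) U" "p \<in> U" "\<And>q. q \<in> U \<Longrightarrow> h q = h' q"
  shows "smooth_near M p h'"
proof -
  obtain c where c: "c \<in> Matlas M" "p \<in> fst c" by (rule smooth_near_obtain_chart[OF M h])
  obtain W where W: "openin (Mtop M) W" "p \<in> W" "W \<subseteq> fst c" "smooth_on (Mdim M) (snd c ` W) (\<lambda>x. h (chart_inv c x))"
    by (rule smooth_near_in_chart[OF M c h])
  have o: "openin (Mtop M) (W \<inter> U)" by (rule openin_Int[OF W(1) U(1)])
  have WU: "W \<inter> U \<subseteq> fst c" using W by blast
  have "smooth_on (Mdim M) (snd c ` (W \<inter> U)) (\<lambda>x. h (chart_inv c x))"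
    by (rule smooth_on_subset[OF W(4)]) auto
  then have "smooth_on (Mdim M) (snd c ` (W \<inter> U)) (\<lambda>x. h' (chart_inv c x))"
  proof (rule smooth_on_cong[OF chart_image_open[OF M c(1) o WU]])
    fix z assume "z \<in> snd c ` (W \<inter> U)"
    then obtain q where "q \<in> W" "q \<in> U" "z = snd c q" by blast
    moreover from this have "q \<in> fst c" using W by blast
    ultimately show "h (chart_inv c z) = h' (chart_inv c z)" by (simp add: chart_inv_chart[OF M c(1)] U(3))
  qed
  then show ?thesis by (intro smooth_nearI[OF M c(1) o _ WU]) (use W U in auto)
qed

lemma smooth_near_binary:
  assumes M: "smooth_manifold M" and h: "smooth_near M p h" "smooth_near M p h'"
    and op: "\<And>n U f g. \<lbrakk>openin (Euclidean_space n) U; smooth_on n U f; smooth_on n U g\<rbrakk> \<Longrightarrow> smooth_on n U (\<lambda>x. F (f x) (g x))"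
  shows "smooth_near M p (\<lambda>q. F (h q) (h' q))"
proof -
  obtain c where c: "c \<in> Matlas M" "p \<in> fst c" by (rule smooth_near_obtain_chart[OF M h(1)])
  obtain W where W: "openin (Mtop M) W" "p \<in> W" "W \<subseteq> fst c" "smooth_on (Mdim M) (snd c ` W) (\<lambda>x. h (chart_inv c x))"
    by (rule smooth_near_in_chart[OF M c h(1)])
  obtain V where V: "openin (Mtop M) V" "p \<in> V" "V \<subseteq> fst c" "smooth_on (Mdim M) (snd c ` V) (\<lambda>x. h' (chart_inv c x))"
    by (rule smooth_near_in_chart[OF M c h(2)])
  have o: "openin (Mtop M) (W \<inter> V)" by (rule openin_Int[OF W(1) V(1)])
  have WU: "W \<inter> V \<subseteq> fst c" using W by blast
  have "smooth_on (Mdim M) (snd c ` (W \<inter> V)) (\<lambda>x. F (h (chart_inv c x)) (h' (chart_inv c x)))"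
    by (rule op[OF chart_image_open[OF M c(1) o WU] smooth_on_subset[OF W(4)] smooth_on_subset[OF V(4)]]) auto
  then show ?thesis by (intro smooth_nearI[OF M c(1) o _ WU]) (use W V in auto)
qed

lemma smooth_near_const:
  assumes M: "smooth_manifold M" and p: "p \<in> Mcarrier M"
  shows "smooth_near M p (\<lambda>_. a)"
proof -
  obtain c where c: "c \<in> Matlas M" "p \<in> fst c" by (rule atlas_cover[OF M p])
  show ?thesis by (rule smooth_nearI[OF M c(1) chart_open[OF M c(1)] c(2) subset_refl smooth_on_const])
qed

lemma smooth_near_add: "\<lbrakk>smooth_manifold M; smooth_near M p h; smooth_near M p h'\<rbrakk> \<Longrightarrow> smooth_near M p (\<lambda>q. h q + h' q)"
  by (rule smooth_near_binary[where F="(+)"]) (auto intro: smooth_on_add)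

lemma smooth_near_mult: "\<lbrakk>smooth_manifold M; smooth_near M p h; smooth_near M p h'\<rbrakk> \<Longrightarrow> smooth_near M p (\<lambda>q. h q * h' q)"
  by (rule smooth_near_binary[where F=times]) (auto intro: smooth_on_mult)

lemma smooth_near_compose:
  assumes M: "smooth_manifold M" and N: "smooth_manifold N" and f: "smooth_map M N U f" and p: "p \<in> U"
    and h: "smooth_near N (f p) h"
  shows "smooth_near M p (h \<circ> f)"
proof -
  obtain c where c: "c \<in> Matlas M" "p \<in> fst c"
    by (rule atlas_cover[OF M subsetD[OF openin_subset[OF smooth_map_open[OF f]] p]])
  obtain e where e: "e \<in> Matlas N" "f p \<in> fst e" by (rule smooth_near_obtain_chart[OF N h])
  obtain V where V: "openin (Mtop N) V" "f p \<in> V" "V \<subseteq> fst e" "smooth_on (Mdim N) (snd e ` V) (\<lambda>x. h (chart_inv e x))"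
    by (rule smooth_near_in_chart[OF N e h])
  obtain W where W: "openin (Mtop M) W" "p \<in> W" "W \<subseteq> fst c" "W \<subseteq> U" "f ` W \<subseteq> fst e"
    "smooth_vec_on (Mdim M) (Mdim N) (snd c ` W) (\<lambda>x. snd e (f (chart_inv c x)))"
    by (rule smooth_map_in_charts[OF M N f p c e])
  let ?W = "W \<inter> {q \<in> U. f q \<in> V}"
  have o: "openin (Mtop M) ?W" by (rule openin_Int[OF W(1) smooth_map_preimage[OF M N f V(1)]])
  have Wc: "?W \<subseteq> fst c" using W by blast
  have im: "snd e (f (chart_inv c x)) \<in> snd e ` V" if x: "x \<in> snd c ` ?W" for x
  proof -
    obtain q where "q \<in> ?W" "x = snd c q" using x by blast
    moreover from this have "q \<in> fst c" using W by blast
    ultimately show ?thesis by (simp add: chart_inv_chart[OF M c(1)])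
  qed
  have "smooth_on (Mdim M) (snd c ` ?W) (\<lambda>x. h (chart_inv e (snd e (f (chart_inv c x)))))"
    by (rule smooth_on_compose[OF chart_image_open[OF M c(1) o Wc] chart_image_open[OF N e(1) V(1,3)] im V(4)
          smooth_vec_on_subset[OF W(6)]]) auto
  then have "smooth_on (Mdim M) (snd c ` ?W) (\<lambda>x. (h \<circ> f) (chart_inv c x))"
  proof (rule smooth_on_cong[OF chart_image_open[OF M c(1) o Wc]])
    fix z assume "z \<in> snd c ` ?W"
    then obtain q where "q \<in> W" "f q \<in> V" "z = snd c q" by blast
    moreover from this have "q \<in> fst c" "f q \<in> fst e" using W V by auto
    ultimately show "h (chart_inv e (snd e (f (chart_inv c z)))) = (h \<circ> f) (chart_inv c z)"
      by (simp add: chart_inv_chart[OF M c(1)] chart_inv_chart[OF N e(1)])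
  qed
  then show ?thesis by (intro smooth_nearI[OF M c(1) o _ Wc]) (use W V p in auto)
qed

lemma tangent_spaceD:
  assumes "v \<in> tangent_space M p"
  shows "\<not> smooth_near M p h \<Longrightarrow> v h = 0"
    and "\<lbrakk>smooth_near M p h; openin (Mtop M) U; p \<in> U; \<And>q. q \<in> U \<Longrightarrow> h q = h' q\<rbrakk> \<Longrightarrow> v h = v h'"
    and "\<lbrakk>smooth_near M p h; smooth_near M p h'\<rbrakk> \<Longrightarrow> v (\<lambda>q. h q + h' q) = v h + v h'"
    and "\<lbrakk>smooth_near M p h; smooth_near M p h'\<rbrakk> \<Longrightarrow> v (\<lambda>q. h q * h' q) = h p * v h' + h' p * v h"
    and "smooth_near M p h \<Longrightarrow> v (\<lambda>q. a * h q) = a * v h"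
  using assms unfolding tangent_space_def mem_Collect_eq by blast+

text \<open>Each derivation law at \<open>f p\<close> is the law for v applied to functions
  precomposed with f, which are smooth near p. The value 0 elsewhere is the normalisation that
  \<open>tangent_space\<close> demands.\<close>

lemma pushforward_tangent:
  assumes M: "smooth_manifold M" and N: "smooth_manifold N" and f: "smooth_map M N U f" and p: "p \<in> U"
    and v: "v \<in> tangent_space M p"
  shows "pushforward M N f p v \<in> tangent_space N (f p)"
proof -
  note D = tangent_spaceD[OF v] and C = smooth_near_compose[OF M N f p]
  let ?w = "pushforward M N f p v"
  have w: "?w h = v (h \<circ> f)" if "smooth_near N (f p) h" for h using that by (simp add: pushforward_def)
  have 1: "?w h = 0" if "\<not> smooth_near N (f p) h" for h using that by (simp add: pushforward_def)
  have 2: "?w h = ?w h'" if h: "smooth_near N (f p) h" and V: "openin (Mtop N) V" "f p \<in> V" "\<forall>q\<in>V. h q = h' q" for h h' V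
  proof -
    have h': "smooth_near N (f p) h'" by (rule smooth_near_germ[OF N h V(1,2)]) (use V in blast)
    have "v (h \<circ> f) = v (h' \<circ> f)"
      by (rule D(2)[OF C[OF h] smooth_map_preimage[OF M N f V(1)]]) (use V p in auto)
    then show ?thesis by (simp add: w h h')
  qed
  have 3: "?w (\<lambda>q. h q + h' q) = ?w h + ?w h' \<and> ?w (\<lambda>q. h q * h' q) = h (f p) * ?w h' + h' (f p) * ?w h"
    if h: "smooth_near N (f p) h" "smooth_near N (f p) h'" for h h'
    using D(3)[OF C[OF h(1)] C[OF h(2)]] D(4)[OF C[OF h(1)] C[OF h(2)]]
    by (simp add: w h smooth_near_add[OF N h] smooth_near_mult[OF N h] o_def)
  have 4: "?w (\<lambda>q. a * h q) = a * ?w h" if h: "smooth_near N (f p) h" for a h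
    using D(5)[OF C[OF h], of a] smooth_near_mult[OF N smooth_near_const[OF N smooth_near_carrier[OF h]] h, of a]
    by (simp add: w h o_def)
  show ?thesis unfolding tangent_space_def mem_Collect_eq
  proof (intro conjI allI impI)
    fix h assume "\<not> smooth_near N (f p) h" then show "?w h = 0" by (rule 1)
  next
    fix h h' V assume "smooth_near N (f p) h \<and> openin (Mtop N) V \<and> f p \<in> V \<and> (\<forall>q\<in>V. h q = h' q)"
    then show "?w h = ?w h'" using 2[of h V h'] by simp
  next
    fix h h' assume "smooth_near N (f p) h \<and> smooth_near N (f p) h'"
    then show "?w (\<lambda>q. h q + h' q) = ?w h + ?w h'" using 3[of h h'] by simp
  next
    fix h h' assume "smooth_near N (f p) h \<and> smooth_near N (f p) h'"
    then show "?w (\<lambda>q. h q * h' q) = h (f p) * ?w h' + h' (f p) * ?w h" using 3[of h h'] by simp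
  next
    fix a h assume "smooth_near N (f p) h"
    then show "?w (\<lambda>q. a * h q) = a * ?w h" by (rule 4)
  qed
qed

text \<open>A function that is smooth near the final point stays smooth after precomposition with g,
  so the nested case distinction collapses and v may be arbitrary.\<close>

lemma pushforward_compose:
  assumes N: "smooth_manifold N" and K: "smooth_manifold K" and g: "smooth_map N K V g" "f p \<in> V"
  shows "pushforward M K (g \<circ> f) p v = pushforward N K g (f p) (pushforward M N f p v)"
  using smooth_near_compose[OF N K g] by (auto simp: pushforward_def fun_eq_iff o_assoc)

text \<open>Tangent vectors are normalised to 0 on functions that are not smooth near p; otherwise
  this would hold on smooth functions only.\<close>

lemma pushforward_id:
  assumes "v \<in> tangent_space M p"
  shows "pushforward M M (\<lambda>p. p) p v = v"
  using tangent_spaceD(1)[OF assms] by (auto simp: pushforward_def fun_eq_iff o_def)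

section \<open>Composition of correspondences\<close>

text \<open>A germ contains its defining pair, which gives one direction. For the other, two
  neighbourhoods of agreement are intersected, and transitivity of restriction compares the sections
  there.\<close>

lemma germ_eq_iff:
  assumes restr: "\<And>U V W s. \<lbrakk>openin X U; openin X V; openin X W; W \<subseteq> V; V \<subseteq> U; s \<in> Sect P U\<rbrakk>
      \<Longrightarrow> Restr P V W (Restr P U V s) = Restr P U W s"
    and s: "openin X U" "y \<in> U" "s \<in> Sect P U" and t: "openin X V" "y \<in> V" "t \<in> Sect P V"
  shows "germ X P y U s = germ X P y V t \<longleftrightarrow>
    (\<exists>W. openin X W \<and> y \<in> W \<and> W \<subseteq> U \<inter> V \<and> Restr P U W s = Restr P V W t)"
proof
  assume eq: "germ X P y U s = germ X P y V t"
  have "(V, t) \<in> germ X P y V t" using t by (auto simp: germ_def)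
  then have "(V, t) \<in> germ X P y U s" by (simp add: eq)
  then show "\<exists>W. openin X W \<and> y \<in> W \<and> W \<subseteq> U \<inter> V \<and> Restr P U W s = Restr P V W t"
    by (simp add: germ_def)
next
  have sub: "germ X P y U s \<subseteq> germ X P y V t"
    if s: "openin X U" "s \<in> Sect P U" and t: "openin X V" "t \<in> Sect P V"
      and W: "openin X W" "y \<in> W" "W \<subseteq> U \<inter> V" "Restr P U W s = Restr P V W t" for U V W s t
  proof
    fix a assume "a \<in> germ X P y U s"
    then obtain V' t' W' where a: "a = (V', t')" "openin X V'" "y \<in> V'" "t' \<in> Sect P V'"
      "openin X W'" "y \<in> W'" "W' \<subseteq> U \<inter> V'" "Restr P U W' s = Restr P V' W' t'"
      by (auto simp: germ_def)
    let ?I = "W \<inter> W'"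
    have I: "openin X ?I" using W a by (simp add: openin_Int)
    have "Restr P V ?I t = Restr P W ?I (Restr P V W t)" using s t W I by (intro restr[symmetric]) auto
    also have "\<dots> = Restr P U ?I s" unfolding W(4)[symmetric] using s t W I by (intro restr) auto
    also have "\<dots> = Restr P W' ?I (Restr P U W' s)" using s a I by (intro restr[symmetric]) auto
    also have "\<dots> = Restr P V' ?I t'" unfolding a(8) using a I by (intro restr) auto
    finally have "\<exists>W. openin X W \<and> y \<in> W \<and> W \<subseteq> V \<inter> V' \<and> Restr P V W t = Restr P V' W t'"
      using I W a by (intro exI[of _ ?I]) auto
    then show "a \<in> germ X P y V t" using a by (simp add: germ_def)
  qed
  assume "\<exists>W. openin X W \<and> y \<in> W \<and> W \<subseteq> U \<inter> V \<and> Restr P U W s = Restr P V W t"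
  then obtain W where W: "openin X W" "y \<in> W" "W \<subseteq> U \<inter> V" "Restr P U W s = Restr P V W t" by blast
  have "W \<subseteq> V \<inter> U" using W(3) by blast
  from sub[OF s(1,3) t(1,3) W] sub[OF t(1,3) s(1,3) W(1,2) this W(4)[symmetric]]
  show "germ X P y U s = germ X P y V t" by (rule subset_antisym)
qed

section \<open>Tuples, their germs and local sections\<close>

definition values_at :: "('a \<Rightarrow> 'a) list \<Rightarrow> 'a \<Rightarrow> 'a multiset" where
  "values_at fs y = mset (map (\<lambda>f. f y) fs)"

lemma values_at_append [simp]: "values_at (fs @ gs) y = values_at fs y + values_at gs y"
  by (simp add: values_at_def)

lemma values_at_Nil [simp]: "values_at [] y = {#}" by (simp add: values_at_def)

lemma size_values_at [simp]: "size (values_at fs y) = length fs" by (simp add: values_at_def)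

lemma tuple_fun_eq: "tuple_fun U fs = (\<lambda>y\<in>U. values_at fs y)"
  by (simp add: tuple_fun_def values_at_def)

abbreviation zero_form :: "'a biform" where "zero_form \<equiv> (\<lambda>_ _ _. 0)"

lemma local_tuple_open: "local_tuple Y X \<alpha> U fs \<Longrightarrow> openin (Mtop Y) U"
  by (simp add: local_tuple_def)

lemma local_tuple_subset:
  assumes "smooth_manifold Y" "smooth_manifold X" "local_tuple Y X \<alpha> U fs" "openin (Mtop Y) V" "V \<subseteq> U"
  shows "local_tuple Y X \<alpha> V fs"
  using assms smooth_map_subset[OF assms(1,2) _ assms(4,5)] unfolding local_tuple_def by blast

lemma local_tuple_Nil: "openin (Mtop Y) U \<Longrightarrow> local_tuple Y X zero_form U []"
  by (simp add: local_tuple_def)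

lemma local_tuple_append:
  assumes "local_tuple Y X \<alpha> U fs" "local_tuple Y X zero_form U gs"
  shows "local_tuple Y X \<alpha> U (fs @ gs)"
  using assms unfolding local_tuple_def by auto

lemma tuple_presheaf_simps:
  "Sect (tuple_presheaf Y X \<alpha> n) U = {tuple_fun U fs | fs. length fs = n \<and> local_tuple Y X \<alpha> U fs}"
  "Restr (tuple_presheaf Y X \<alpha> n) U V \<phi> = restrict \<phi> V"
  by (simp_all add: tuple_presheaf_def)

text \<open>The two presheaves differ when the lengths do, so \<open>germ_eq_iff\<close> applies
  only once the lengths are known to agree; the sizes of the value multisets at y show this.\<close>

lemma tuple_germ_eq_iff:
  assumes fs: "local_tuple Y X \<alpha> U fs" "y \<in> U" and gs: "local_tuple Y X \<alpha> V gs" "y \<in> V"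
  shows "germ (Mtop Y) (tuple_presheaf Y X \<alpha> (length fs)) y U (tuple_fun U fs) =
      germ (Mtop Y) (tuple_presheaf Y X \<alpha> (length gs)) y V (tuple_fun V gs) \<longleftrightarrow>
    (\<exists>W. openin (Mtop Y) W \<and> y \<in> W \<and> W \<subseteq> U \<inter> V \<and> (\<forall>z\<in>W. values_at fs z = values_at gs z))"
    (is "?l = ?r \<longleftrightarrow> ?W")
proof
  assume eq: "?l = ?r"
  \<comment> \<open>The defining pair of one germ lies in the other, which exposes a common
    neighbourhood before anything is known about the lengths.\<close>
  have "(V, tuple_fun V gs) \<in> ?r"
    using gs local_tuple_open[OF gs(1)] by (auto simp: germ_def tuple_presheaf_simps)
  then have "(V, tuple_fun V gs) \<in> ?l" using eq by simp
  then obtain W where W: "openin (Mtop Y) W" "y \<in> W" "W \<subseteq> U \<inter> V"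
    "restrict (tuple_fun U fs) W = restrict (tuple_fun V gs) W"
    by (auto simp: germ_def tuple_presheaf_simps)
  have "values_at fs z = values_at gs z" if z: "z \<in> W" for z
  proof -
    have "z \<in> U" "z \<in> V" using z W(3) by auto
    then show ?thesis using fun_cong[OF W(4), of z] z by (simp add: tuple_fun_eq)
  qed
  then show ?W using W by blast
next
  assume ?W
  then obtain W where W: "openin (Mtop Y) W" "y \<in> W" "W \<subseteq> U \<inter> V" "\<forall>z\<in>W. values_at fs z = values_at gs z" by blast
  then have len: "length gs = length fs" by (metis size_values_at)
  have "restrict (tuple_fun U fs) W = restrict (tuple_fun V gs) W"
    using W(3,4) by (auto simp: tuple_fun_eq restrict_def fun_eq_iff)
  then show "?l = ?r" unfolding len
    using fs gs W local_tuple_open[OF fs(1)] local_tuple_open[OF gs(1)] len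
    by (subst germ_eq_iff) (auto simp: tuple_presheaf_simps Int_absorb1)
qed

lemma restrict_tuple_section:
  assumes "smooth_manifold Y" "smooth_manifold X" "local_tuple Y X \<alpha> U fs" "openin (Mtop Y) V" "V \<subseteq> U"
  shows "restrict (tuple_section Y X \<alpha> U fs) V = tuple_section Y X \<alpha> V fs"
proof
  fix y
  show "restrict (tuple_section Y X \<alpha> U fs) V y = tuple_section Y X \<alpha> V fs y"
  proof (cases "y \<in> V")
    case True
    have "\<exists>W. openin (Mtop Y) W \<and> y \<in> W \<and> W \<subseteq> U \<inter> V \<and> (\<forall>z\<in>W. values_at fs z = values_at fs z)"
      using True assms(4,5) by (intro exI[of _ V]) auto
    then show ?thesis
      using True assms(5) tuple_germ_eq_iff[OF assms(3) _ local_tuple_subset[OF assms] True]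
      by (auto simp: tuple_section_def)
  qed (simp add: tuple_section_def)
qed

lemma restricts_to_tuple_subset:
  assumes YX: "smooth_manifold Y" "smooth_manifold X" and F: "restricts_to_tuple Y X \<alpha> F U fs"
    and V: "openin (Mtop Y) V" "V \<subseteq> U"
  shows "restricts_to_tuple Y X \<alpha> F V fs"
proof -
  have "restrict F V = restrict (restrict F U) V" using V(2) by (auto simp: restrict_def fun_eq_iff)
  also have "restrict F U = tuple_section Y X \<alpha> U fs" using F by (simp add: restricts_to_tuple_def)
  also have "restrict (tuple_section Y X \<alpha> U fs) V = tuple_section Y X \<alpha> V fs"
    by (rule restrict_tuple_section[OF YX _ V]) (use F in \<open>simp add: restricts_to_tuple_def\<close>)
  finally show ?thesis
    using F local_tuple_subset[OF YX _ V] unfolding restricts_to_tuple_def by blast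
qed

lemma restricts_to_tuple_germ:
  assumes "restricts_to_tuple Y X \<alpha> F U fs" "y \<in> U"
  shows "F y = germ (Mtop Y) (tuple_presheaf Y X \<alpha> (length fs)) y U (tuple_fun U fs)"
proof -
  have "restrict F U y = tuple_section Y X \<alpha> U fs y" using assms(1) by (simp add: restricts_to_tuple_def)
  then show ?thesis using assms(2) by (simp add: tuple_section_def)
qed

lemma restricts_to_tuple_restrict:
  assumes "restricts_to_tuple Y X \<alpha> F U fs" "U \<subseteq> V"
  shows "restricts_to_tuple Y X \<alpha> (restrict F V) U fs"
proof -
  have "restrict (restrict F V) U = restrict F U" using assms(2) by (auto simp: restrict_def fun_eq_iff)
  then show ?thesis using assms(1) by (simp add: restricts_to_tuple_def)
qed

text \<open>Undoes the inner sheafification: a section is the same as a function given by honest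
  tuples near each point.\<close>

lemma tuple_sections_iff:
  "F \<in> tuple_sections Y X \<alpha> n U \<longleftrightarrow> F \<in> extensional U \<and>
    (\<forall>y\<in>U. \<exists>V fs. y \<in> V \<and> V \<subseteq> U \<and> length fs = n \<and> restricts_to_tuple Y X \<alpha> F V fs)" (is "?l \<longleftrightarrow> ?r")
proof -
  have res: "restrict F V = tuple_section Y X \<alpha> V fs \<longleftrightarrow>
      (\<forall>z\<in>V. F z = germ (Mtop Y) (tuple_presheaf Y X \<alpha> (length fs)) z V (tuple_fun V fs))" for V fs
    by (auto simp: tuple_section_def fun_eq_iff restrict_def)
  have "(\<exists>V s. openin (Mtop Y) V \<and> y \<in> V \<and> V \<subseteq> U \<and> s \<in> Sect (tuple_presheaf Y X \<alpha> n) V \<and>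
      (\<forall>z\<in>V. F z = germ (Mtop Y) (tuple_presheaf Y X \<alpha> n) z V s)) \<longleftrightarrow>
    (\<exists>V fs. y \<in> V \<and> V \<subseteq> U \<and> length fs = n \<and> restricts_to_tuple Y X \<alpha> F V fs)"
    (is "?L \<longleftrightarrow> ?R") for y
  proof
    assume ?L
    then obtain V fs where "openin (Mtop Y) V" "y \<in> V" "V \<subseteq> U" "length fs = n" "local_tuple Y X \<alpha> V fs"
      "\<forall>z\<in>V. F z = germ (Mtop Y) (tuple_presheaf Y X \<alpha> n) z V (tuple_fun V fs)"
      unfolding tuple_presheaf_simps by auto
    then show ?R unfolding restricts_to_tuple_def res by (intro exI[of _ V] exI[of _ fs]) simp
  next
    assume ?R
    then obtain V fs where V: "y \<in> V" "V \<subseteq> U" "length fs = n" "local_tuple Y X \<alpha> V fs"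
      "\<forall>z\<in>V. F z = germ (Mtop Y) (tuple_presheaf Y X \<alpha> (length fs)) z V (tuple_fun V fs)"
      unfolding restricts_to_tuple_def res by blast
    then show ?L using local_tuple_open[OF V(4)] unfolding tuple_presheaf_simps
      by (intro exI[of _ V] exI[of _ "tuple_fun V fs"]) auto
  qed
  then show ?thesis by (simp add: tuple_sections_def sheafify_def)
qed

lemma restricts_to_tuple_section: "local_tuple Y X \<alpha> U fs \<Longrightarrow> restricts_to_tuple Y X \<alpha> (tuple_section Y X \<alpha> U fs) U fs"
  by (auto simp: restricts_to_tuple_def tuple_section_def)

lemma tuple_section_in: "local_tuple Y X \<alpha> U fs \<Longrightarrow> tuple_section Y X \<alpha> U fs \<in> tuple_sections Y X \<alpha> (length fs) U"
  unfolding tuple_sections_iff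
  by (intro conjI ballI exI[of _ U] exI[of _ fs] restricts_to_tuple_section) (simp_all add: tuple_section_def)

lemma restricts_to_tuple_values:
  assumes "restricts_to_tuple Y X \<alpha> F U fs" "restricts_to_tuple Y X \<alpha> F V gs" "y \<in> U" "y \<in> V"
  obtains W where "openin (Mtop Y) W" "y \<in> W" "W \<subseteq> U" "W \<subseteq> V" "\<forall>z\<in>W. values_at fs z = values_at gs z"
proof -
  have "local_tuple Y X \<alpha> U fs" "local_tuple Y X \<alpha> V gs"
    using assms by (simp_all add: restricts_to_tuple_def)
  from tuple_germ_eq_iff[OF this(1) assms(3) this(2) assms(4)]
  have "\<exists>W. openin (Mtop Y) W \<and> y \<in> W \<and> W \<subseteq> U \<inter> V \<and> (\<forall>z\<in>W. values_at fs z = values_at gs z)"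
    using restricts_to_tuple_germ[OF assms(1,3)] restricts_to_tuple_germ[OF assms(2,4)] by simp
  then show thesis using that by blast
qed

text \<open>The local form of the relation generated by adding isotropic correspondences. Allowing
  isotropic summands on both sides makes it an equivalence relation, so that no zigzags
  remain.\<close>

definition iso_equiv :: "'a mfd \<Rightarrow> 'a mfd \<Rightarrow> 'a \<Rightarrow> ('a \<Rightarrow> 'a) list \<Rightarrow> ('a \<Rightarrow> 'a) list \<Rightarrow> bool" where
  "iso_equiv Y X y fs gs \<longleftrightarrow> (\<exists>W as bs. y \<in> W \<and> local_tuple Y X zero_form W as \<and> local_tuple Y X zero_form W bs \<and>
     (\<forall>z\<in>W. values_at (fs @ as) z = values_at (gs @ bs) z))"

lemma iso_equiv_by:
  assumes "y \<in> W" "local_tuple Y X zero_form W as" "local_tuple Y X zero_form W bs"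
    "\<And>z. z \<in> W \<Longrightarrow> values_at (fs @ as) z = values_at (gs @ bs) z"
  shows "iso_equiv Y X y fs gs"
  unfolding iso_equiv_def using assms
  by (intro exI[of _ W] exI[of _ as] exI[of _ bs]) simp

lemma iso_equivI:
  assumes "y \<in> W" "openin (Mtop Y) W" "\<And>z. z \<in> W \<Longrightarrow> values_at fs z = values_at gs z"
  shows "iso_equiv Y X y fs gs"
  by (rule iso_equiv_by[OF assms(1) local_tuple_Nil[OF assms(2)] local_tuple_Nil[OF assms(2)]]) (simp add: assms(3))

lemma iso_equiv_sym: "iso_equiv Y X y fs gs \<Longrightarrow> iso_equiv Y X y gs fs"
proof -
  assume "iso_equiv Y X y fs gs"
  then obtain W as bs where "y \<in> W" "local_tuple Y X zero_form W as" "local_tuple Y X zero_form W bs"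
    "\<forall>z\<in>W. values_at (fs @ as) z = values_at (gs @ bs) z" unfolding iso_equiv_def by blast
  then show "iso_equiv Y X y gs fs" by (intro iso_equiv_by[of y W Y X bs as]) simp_all
qed

text \<open>Adding \<open>cs\<close> to the first relation and \<open>bs\<close> to the second gives
  fs + as + cs = gs + bs + cs = hs + ds + bs, and sums of isotropic tuples are isotropic.\<close>

lemma iso_equiv_trans:
  assumes YX: "smooth_manifold Y" "smooth_manifold X"
    and "iso_equiv Y X y fs gs" "iso_equiv Y X y gs hs"
  shows "iso_equiv Y X y fs hs"
proof -
  obtain W as bs where 1: "y \<in> W" "local_tuple Y X zero_form W as" "local_tuple Y X zero_form W bs"
    "\<forall>z\<in>W. values_at (fs @ as) z = values_at (gs @ bs) z" using assms(3) unfolding iso_equiv_def by blast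
  obtain V cs ds where 2: "y \<in> V" "local_tuple Y X zero_form V cs" "local_tuple Y X zero_form V ds"
    "\<forall>z\<in>V. values_at (gs @ cs) z = values_at (hs @ ds) z" using assms(4) unfolding iso_equiv_def by blast
  have o: "openin (Mtop Y) (W \<inter> V)" using local_tuple_open[OF 1(2)] local_tuple_open[OF 2(2)] by (rule openin_Int)
  note s = local_tuple_subset[OF YX 1(2) o Int_lower1] local_tuple_subset[OF YX 1(3) o Int_lower1]
    local_tuple_subset[OF YX 2(2) o Int_lower2] local_tuple_subset[OF YX 2(3) o Int_lower2]
  have "values_at (fs @ (as @ cs)) z = values_at (hs @ (bs @ ds)) z" if "z \<in> W \<inter> V" for z
  proof -
    have "values_at fs z + values_at as z = values_at gs z + values_at bs z"
      "values_at gs z + values_at cs z = values_at hs z + values_at ds z"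
      using 1(4) 2(4) that by auto
    note eqs = this
    have "values_at fs z + (values_at as z + values_at cs z) = (values_at fs z + values_at as z) + values_at cs z"
      by (simp only: add.assoc)
    also have "\<dots> = (values_at gs z + values_at cs z) + values_at bs z" unfolding eqs(1) by (simp only: ac_simps)
    also have "\<dots> = values_at hs z + (values_at bs z + values_at ds z)" unfolding eqs(2) by (simp only: ac_simps)
    finally show ?thesis unfolding values_at_append .
  qed
  then show ?thesis
    by (rule iso_equiv_by[OF IntI[OF 1(1) 2(1)] local_tuple_append[OF s(1,3)] local_tuple_append[OF s(2,4)]])
qed

lemma iso_equiv_append:
  assumes YX: "smooth_manifold Y" "smooth_manifold X"
    and "iso_equiv Y X y fs gs" "iso_equiv Y X y fs' gs'"
  shows "iso_equiv Y X y (fs @ fs') (gs @ gs')"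
proof -
  obtain W as bs where 1: "y \<in> W" "local_tuple Y X zero_form W as" "local_tuple Y X zero_form W bs"
    "\<forall>z\<in>W. values_at (fs @ as) z = values_at (gs @ bs) z" using assms(3) unfolding iso_equiv_def by blast
  obtain V cs ds where 2: "y \<in> V" "local_tuple Y X zero_form V cs" "local_tuple Y X zero_form V ds"
    "\<forall>z\<in>V. values_at (fs' @ cs) z = values_at (gs' @ ds) z" using assms(4) unfolding iso_equiv_def by blast
  have o: "openin (Mtop Y) (W \<inter> V)" using local_tuple_open[OF 1(2)] local_tuple_open[OF 2(2)] by (rule openin_Int)
  note s = local_tuple_subset[OF YX 1(2) o Int_lower1] local_tuple_subset[OF YX 1(3) o Int_lower1]
    local_tuple_subset[OF YX 2(2) o Int_lower2] local_tuple_subset[OF YX 2(3) o Int_lower2]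
  have "values_at ((fs @ fs') @ (as @ cs)) z = values_at ((gs @ gs') @ (bs @ ds)) z" if "z \<in> W \<inter> V" for z
  proof -
    have "values_at fs z + values_at as z = values_at gs z + values_at bs z"
      "values_at fs' z + values_at cs z = values_at gs' z + values_at ds z"
      using 1(4) 2(4) that by auto
    note eqs = this
    have "values_at fs z + values_at fs' z + (values_at as z + values_at cs z)
        = (values_at fs z + values_at as z) + (values_at fs' z + values_at cs z)"
      by (simp only: ac_simps)
    also have "\<dots> = values_at gs z + values_at gs' z + (values_at bs z + values_at ds z)"
      unfolding eqs by (simp only: ac_simps)
    finally show ?thesis unfolding values_at_append .
  qed
  then show ?thesis
    by (rule iso_equiv_by[OF IntI[OF 1(1) 2(1)] local_tuple_append[OF s(1,3)] local_tuple_append[OF s(2,4)]])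
qed

section \<open>Stabilisation zigzags and germs of correspondences\<close>

lemma stab_equiv_refl: "(a, a) \<in> stab_equiv Y X U" by (simp add: stab_equiv_def)
lemma stab_equiv_sym: "(a, b) \<in> stab_equiv Y X U \<Longrightarrow> (b, a) \<in> stab_equiv Y X U"
  unfolding stab_equiv_def using sym_rtrancl[of "stab_step Y X U \<union> (stab_step Y X U)\<inverse>"]
  by (meson symD sym_Un_converse)
lemma stab_equiv_trans: "(a, b) \<in> stab_equiv Y X U \<Longrightarrow> (b, c) \<in> stab_equiv Y X U \<Longrightarrow> (a, c) \<in> stab_equiv Y X U"
  unfolding stab_equiv_def by (rule rtrancl_trans)
lemma stab_equiv_step: "(a, b) \<in> stab_step Y X U \<Longrightarrow> (a, b) \<in> stab_equiv Y X U"
  unfolding stab_equiv_def by blast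
lemma stab_class_eq: "stab_equiv Y X U `` {a} = stab_equiv Y X U `` {b} \<longleftrightarrow> (a, b) \<in> stab_equiv Y X U"
proof
  assume eq: "stab_equiv Y X U `` {a} = stab_equiv Y X U `` {b}"
  have "b \<in> stab_equiv Y X U `` {b}" by (simp add: stab_equiv_refl)
  then have "b \<in> stab_equiv Y X U `` {a}" by (simp only: eq)
  then show "(a, b) \<in> stab_equiv Y X U" by simp
next
  assume ab: "(a, b) \<in> stab_equiv Y X U"
  have "(a, c) \<in> stab_equiv Y X U \<longleftrightarrow> (b, c) \<in> stab_equiv Y X U" for c
    using stab_equiv_trans[OF ab] stab_equiv_trans[OF stab_equiv_sym[OF ab]] by blast
  then show "stab_equiv Y X U `` {a} = stab_equiv Y X U `` {b}" by (simp add: set_eq_iff)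
qed

lemma is_concatD:
  "\<lbrakk>is_concat Y X U F G H; y \<in> U\<rbrakk> \<Longrightarrow> \<exists>W fs gs. y \<in> W \<and> W \<subseteq> U \<and>
    restricts_to_tuple Y X (Mform Y) F W fs \<and> restricts_to_tuple Y X zero_form G W gs \<and>
    restricts_to_tuple Y X (Mform Y) H W (fs @ gs)"
  unfolding is_concat_def by (rule bspec)

lemma stab_stepI:
  assumes "F \<in> SCor_n Y X n U" "H \<in> SCor_n Y X (n + m) U" "G \<in> SCor_n_iso Y X m U" "is_concat Y X U F G H"
  shows "((n, F), (n + m, H)) \<in> stab_step Y X U"
  unfolding stab_step_def using assms by blast

lemma stab_stepD:
  assumes "((n, F), (m, H)) \<in> stab_step Y X U"
  obtains k G where "m = n + k" "F \<in> SCor_n Y X n U" "H \<in> SCor_n Y X (n + k) U"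
    "G \<in> SCor_n_iso Y X k U" "is_concat Y X U F G H"
  using assms unfolding stab_step_def by auto

lemma restricts_to_tuple_open: "restricts_to_tuple Y X \<alpha> F U fs \<Longrightarrow> openin (Mtop Y) U"
  by (auto simp: restricts_to_tuple_def dest: local_tuple_open)

lemma tuple_sections_restrict:
  assumes YX: "smooth_manifold Y" "smooth_manifold X" and F: "F \<in> tuple_sections Y X \<alpha> n U"
    and V: "openin (Mtop Y) V" "V \<subseteq> U"
  shows "restrict F V \<in> tuple_sections Y X \<alpha> n V"
  unfolding tuple_sections_iff
proof (intro conjI ballI)
  fix y assume y: "y \<in> V"
  then obtain W fs where W: "y \<in> W" "W \<subseteq> U" "length fs = n" "restricts_to_tuple Y X \<alpha> F W fs"
    using F V(2) unfolding tuple_sections_iff by blast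
  have "openin (Mtop Y) W" using W(4) local_tuple_open by (auto simp: restricts_to_tuple_def)
  then have "openin (Mtop Y) (W \<inter> V)" using V(1) by (simp add: openin_Int)
  then have "restricts_to_tuple Y X \<alpha> (restrict F V) (W \<inter> V) fs"
    by (intro restricts_to_tuple_restrict restricts_to_tuple_subset[OF YX W(4)]) auto
  then show "\<exists>W fs. y \<in> W \<and> W \<subseteq> V \<and> length fs = n \<and> restricts_to_tuple Y X \<alpha> (restrict F V) W fs"
    using y W by (intro exI[of _ "W \<inter> V"] exI[of _ fs]) auto
qed simp

lemma stab_step_restrict:
  assumes YX: "smooth_manifold Y" "smooth_manifold X" and st: "((n, F), (m, H)) \<in> stab_step Y X U"
    and V: "openin (Mtop Y) V" "V \<subseteq> U"
  shows "((n, restrict F V), (m, restrict H V)) \<in> stab_step Y X V"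
proof -
  obtain k G where m: "m = n + k" and F: "F \<in> SCor_n Y X n U" "H \<in> SCor_n Y X (n + k) U"
    and G: "G \<in> SCor_n_iso Y X k U" "is_concat Y X U F G H"
    by (rule stab_stepD[OF st])
  have "is_concat Y X V (restrict F V) (restrict G V) (restrict H V)"
    unfolding is_concat_def
  proof
    fix y assume y: "y \<in> V"
    then obtain W fs gs where W: "y \<in> W" "W \<subseteq> U" "restricts_to_tuple Y X (Mform Y) F W fs"
      "restricts_to_tuple Y X zero_form G W gs" "restricts_to_tuple Y X (Mform Y) H W (fs @ gs)"
      using is_concatD[OF G(2) subsetD[OF V(2) y]] by (elim exE conjE)
    have "openin (Mtop Y) W" by (rule restricts_to_tuple_open[OF W(3)])
    then have WV: "openin (Mtop Y) (W \<inter> V)" using V(1) by (simp add: openin_Int)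
    show "\<exists>W fs gs. y \<in> W \<and> W \<subseteq> V \<and> restricts_to_tuple Y X (Mform Y) (restrict F V) W fs \<and>
        restricts_to_tuple Y X zero_form (restrict G V) W gs \<and>
        restricts_to_tuple Y X (Mform Y) (restrict H V) W (fs @ gs)"
      by (intro exI[of _ "W \<inter> V"] exI[of _ fs] exI[of _ gs] conjI IntI y W(1) Int_lower2
          restricts_to_tuple_restrict[OF restricts_to_tuple_subset[OF YX W(3) WV Int_lower1] Int_lower2]
          restricts_to_tuple_restrict[OF restricts_to_tuple_subset[OF YX W(4) WV Int_lower1] Int_lower2]
          restricts_to_tuple_restrict[OF restricts_to_tuple_subset[OF YX W(5) WV Int_lower1] Int_lower2])
  qed
  then show ?thesis unfolding m
    by (intro stab_stepI[of _ _ _ _ _ _ _ "restrict G V"])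
       (use tuple_sections_restrict[OF YX _ V] F G in \<open>simp_all add: SCor_n_def SCor_n_iso_def\<close>)
qed

text \<open>Makes restriction of classes well defined; it is proved step by step along the
  zigzag.\<close>

lemma stab_equiv_restrict:
  assumes YX: "smooth_manifold Y" "smooth_manifold X" and eq: "(a, b) \<in> stab_equiv Y X U"
    and V: "openin (Mtop Y) V" "V \<subseteq> U"
  shows "((fst a, restrict (snd a) V), (fst b, restrict (snd b) V)) \<in> stab_equiv Y X V"
  using eq unfolding stab_equiv_def[of Y X U]
proof (induction rule: rtrancl_induct)
  case base show ?case by (rule stab_equiv_refl)
next
  case (step b c)
  have "((fst b, restrict (snd b) V), (fst c, restrict (snd c) V)) \<in> stab_equiv Y X V"
    using step(2) stab_step_restrict[OF YX _ V, of "fst b" "snd b" "fst c" "snd c"]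
      stab_step_restrict[OF YX _ V, of "fst c" "snd c" "fst b" "snd b"]
    by (auto intro: stab_equiv_step stab_equiv_sym[OF stab_equiv_step])
  with step(3) show ?case by (rule stab_equiv_trans)
qed

text \<open>Each step of the zigzag is resolved near \<open>y\<close> into honest tuples.\<close>

lemma stab_equiv_local:
  assumes YX: "smooth_manifold Y" "smooth_manifold X" and eq: "(a, b) \<in> stab_equiv Y X U"
    and y: "y \<in> U" and fs: "restricts_to_tuple Y X (Mform Y) (snd a) V fs" "y \<in> V"
  shows "\<exists>W gs. y \<in> W \<and> restricts_to_tuple Y X (Mform Y) (snd b) W gs \<and> iso_equiv Y X y fs gs"
  using eq unfolding stab_equiv_def
proof (induction rule: rtrancl_induct)
  case base
  have "openin (Mtop Y) V" using fs(1) local_tuple_open by (auto simp: restricts_to_tuple_def)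
  then show ?case using fs by (intro exI[of _ V] exI[of _ fs]) (auto intro: iso_equivI)
next
  case (step b c)
  from step(3) obtain V' hs where hs: "y \<in> V'" "restricts_to_tuple Y X (Mform Y) (snd b) V' hs" "iso_equiv Y X y fs hs"
    by blast
  have add: "iso_equiv Y X y gs (gs @ ks)" if gk: "restricts_to_tuple Y X zero_form G W ks" "y \<in> W" for G W gs ks
  proof -
    have k: "local_tuple Y X zero_form W ks" using gk(1) by (simp add: restricts_to_tuple_def)
    show ?thesis by (rule iso_equiv_by[OF gk(2) k local_tuple_Nil[OF local_tuple_open[OF k]]]) simp
  qed
  have eqv: "iso_equiv Y X y gs ks"
    if gk: "restricts_to_tuple Y X (Mform Y) G W gs" "restricts_to_tuple Y X (Mform Y) G W' ks" "y \<in> W" "y \<in> W'" for G W W' gs ks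
  proof -
    obtain N where "openin (Mtop Y) N" "y \<in> N" "N \<subseteq> W" "N \<subseteq> W'" "\<forall>z\<in>N. values_at gs z = values_at ks z"
      by (rule restricts_to_tuple_values[OF gk])
    then show ?thesis by (intro iso_equivI[of y N]) simp_all
  qed
  note tr = iso_equiv_trans[OF YX]
  show ?case
  \<comment> \<open>A forward step adds an isotropic tuple, a backward step removes one;
    \<open>iso_equiv\<close> absorbs both.\<close>
  proof (cases "(b, c) \<in> stab_step Y X U")
    case True
    then obtain G where G: "is_concat Y X U (snd b) G (snd c)" by (cases b; cases c) (auto elim: stab_stepD)
    then obtain W gs ks where W: "y \<in> W" "restricts_to_tuple Y X (Mform Y) (snd b) W gs"
      "restricts_to_tuple Y X zero_form G W ks" "restricts_to_tuple Y X (Mform Y) (snd c) W (gs @ ks)"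
      using is_concatD[OF G y] by (elim exE conjE)
    have "iso_equiv Y X y fs (gs @ ks)"
      by (rule tr[OF hs(3) tr[OF eqv[OF hs(2) W(2) hs(1) W(1)] add[OF W(3,1)]]])
    then show ?thesis using W by blast
  next
    case False
    then have "(c, b) \<in> stab_step Y X U" using step(2) by blast
    then obtain G where G: "is_concat Y X U (snd c) G (snd b)" by (cases b; cases c) (auto elim: stab_stepD)
    then obtain W gs ks where W: "y \<in> W" "restricts_to_tuple Y X (Mform Y) (snd c) W gs"
      "restricts_to_tuple Y X zero_form G W ks" "restricts_to_tuple Y X (Mform Y) (snd b) W (gs @ ks)"
      using is_concatD[OF G y] by (elim exE conjE)
    have "iso_equiv Y X y fs gs"
      by (rule tr[OF hs(3) tr[OF eqv[OF hs(2) W(4) hs(1) W(1)] iso_equiv_sym[OF add[OF W(3,1)]]]])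
    then show ?thesis using W by blast
  qed
qed

lemma stab_step_append:
  assumes fs: "local_tuple Y X (Mform Y) U fs" and gs: "local_tuple Y X zero_form U gs"
  shows "((length fs, tuple_section Y X (Mform Y) U fs), (length (fs @ gs), tuple_section Y X (Mform Y) U (fs @ gs)))
    \<in> stab_step Y X U"
proof -
  note H = local_tuple_append[OF fs gs]
  have "is_concat Y X U (tuple_section Y X (Mform Y) U fs) (tuple_section Y X zero_form U gs) (tuple_section Y X (Mform Y) U (fs @ gs))"
    unfolding is_concat_def
    by (intro ballI exI[of _ U] exI[of _ fs] exI[of _ gs] conjI subset_refl restricts_to_tuple_section fs gs H)
  then show ?thesis unfolding length_append
    by (intro stab_stepI[of _ _ _ _ _ _ _ "tuple_section Y X zero_form U gs"])
       (use tuple_section_in[OF fs] tuple_section_in[OF gs] tuple_section_in[OF H] in \<open>simp_all add: SCor_n_def SCor_n_iso_def\<close>)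
qed

text \<open>For y in U this is the value of \<open>cor_of_tuple Y X U fs\<close> at y, in a form
  that allows germs from different domains to be compared.\<close>

definition cor_germ :: "'a mfd \<Rightarrow> 'a mfd \<Rightarrow> 'a \<Rightarrow> 'a set \<Rightarrow> ('a \<Rightarrow> 'a) list \<Rightarrow> ('a set \<times> (nat \<times> 'a cor_n) set) set" where
  "cor_germ Y X y U fs = germ (Mtop Y) (cor_presheaf Y X) y U
     (stab_equiv Y X U `` {(length fs, tuple_section Y X (Mform Y) U fs)})"

lemma cor_presheaf_Sect:
  "c \<in> Sect (cor_presheaf Y X) U \<longleftrightarrow> (\<exists>n F. F \<in> SCor_n Y X n U \<and> c = stab_equiv Y X U `` {(n, F)})"
  by (auto simp: cor_presheaf_def cor_sum_def quotient_def)

text \<open>Restriction is defined through all members of a class; by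
  \<open>stab_equiv_restrict\<close> their restrictions lie in one class.\<close>

lemma cor_presheaf_Restr:
  assumes YX: "smooth_manifold Y" "smooth_manifold X" and V: "openin (Mtop Y) V" "V \<subseteq> U"
  shows "Restr (cor_presheaf Y X) U V (stab_equiv Y X U `` {(n, F)}) = stab_equiv Y X V `` {(n, restrict F V)}"
    (is "?l = ?r")
proof (intro subset_antisym subsetI)
  fix c assume "c \<in> ?l"
  then obtain m H where mH: "((n, F), (m, H)) \<in> stab_equiv Y X U" "((m, restrict H V), c) \<in> stab_equiv Y X V"
    by (auto simp: cor_presheaf_def)
  from stab_equiv_restrict[OF YX mH(1) V] have "((n, restrict F V), (m, restrict H V)) \<in> stab_equiv Y X V" by simp
  from stab_equiv_trans[OF this mH(2)] show "c \<in> ?r" by simp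
next
  fix c assume "c \<in> ?r"
  then show "c \<in> ?l"
    using stab_equiv_refl[of "(n, F)" Y X U] by (force simp: cor_presheaf_def)
qed

lemma cor_presheaf_Restr_Restr:
  assumes YX: "smooth_manifold Y" "smooth_manifold X"
    and o: "openin (Mtop Y) V" "openin (Mtop Y) W" "W \<subseteq> V" "V \<subseteq> U" and s: "s \<in> Sect (cor_presheaf Y X) U"
  shows "Restr (cor_presheaf Y X) V W (Restr (cor_presheaf Y X) U V s) = Restr (cor_presheaf Y X) U W s"
proof -
  obtain n F where s: "s = stab_equiv Y X U `` {(n, F)}" using s unfolding cor_presheaf_Sect by blast
  have "restrict (restrict F V) W = restrict F W" using o(3) by (auto simp: restrict_def fun_eq_iff)
  moreover have "W \<subseteq> U" using o by blast
  ultimately show ?thesis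
    unfolding s cor_presheaf_Restr[OF YX o(1,4)] cor_presheaf_Restr[OF YX o(2,3)] cor_presheaf_Restr[OF YX o(2) \<open>W \<subseteq> U\<close>] by simp
qed

lemma tuple_class_Sect:
  "local_tuple Y X (Mform Y) U fs \<Longrightarrow>
    stab_equiv Y X U `` {(length fs, tuple_section Y X (Mform Y) U fs)} \<in> Sect (cor_presheaf Y X) U"
  unfolding cor_presheaf_Sect SCor_n_def by (blast intro: tuple_section_in)

text \<open>Undoes the quotient and the outer sheafification together. A zigzag over a neighbourhood
  is followed at y by \<open>stab_equiv_local\<close> from fs to a tuple with the same values as gs;
  conversely one stabilisation from fs and one from gs meet.\<close>

lemma cor_germ_eq_iff:
  assumes YX: "smooth_manifold Y" "smooth_manifold X"
    and fs: "local_tuple Y X (Mform Y) U fs" "y \<in> U" and gs: "local_tuple Y X (Mform Y) V gs" "y \<in> V"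
  shows "cor_germ Y X y U fs = cor_germ Y X y V gs \<longleftrightarrow> iso_equiv Y X y fs gs"
proof -
  have o: "openin (Mtop Y) U" "openin (Mtop Y) V" using local_tuple_open[OF fs(1)] local_tuple_open[OF gs(1)] by simp_all
  have *: "cor_germ Y X y U fs = cor_germ Y X y V gs \<longleftrightarrow> (\<exists>W. openin (Mtop Y) W \<and> y \<in> W \<and> W \<subseteq> U \<inter> V \<and>
    Restr (cor_presheaf Y X) U W (stab_equiv Y X U `` {(length fs, tuple_section Y X (Mform Y) U fs)}) =
    Restr (cor_presheaf Y X) V W (stab_equiv Y X V `` {(length gs, tuple_section Y X (Mform Y) V gs)}))"
    unfolding cor_germ_def
    by (rule germ_eq_iff[OF cor_presheaf_Restr_Restr[OF YX] o(1) fs(2) tuple_class_Sect[OF fs(1)]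
          o(2) gs(2) tuple_class_Sect[OF gs(1)]])
  have R: "Restr (cor_presheaf Y X) U W (stab_equiv Y X U `` {(length fs, tuple_section Y X (Mform Y) U fs)}) =
      Restr (cor_presheaf Y X) V W (stab_equiv Y X V `` {(length gs, tuple_section Y X (Mform Y) V gs)}) \<longleftrightarrow>
    ((length fs, tuple_section Y X (Mform Y) W fs), (length gs, tuple_section Y X (Mform Y) W gs)) \<in> stab_equiv Y X W"
    if W: "openin (Mtop Y) W" "W \<subseteq> U \<inter> V" for W
  proof -
    have WU: "W \<subseteq> U" "W \<subseteq> V" using W by auto
    show ?thesis
      unfolding cor_presheaf_Restr[OF YX W(1) WU(1)] cor_presheaf_Restr[OF YX W(1) WU(2)]
        restrict_tuple_section[OF YX fs(1) W(1) WU(1)] restrict_tuple_section[OF YX gs(1) W(1) WU(2)]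
      by (rule stab_class_eq)
  qed
  show ?thesis
  proof
    assume "cor_germ Y X y U fs = cor_germ Y X y V gs"
    then obtain W where W: "openin (Mtop Y) W" "y \<in> W" "W \<subseteq> U \<inter> V" and
      st: "((length fs, tuple_section Y X (Mform Y) W fs), (length gs, tuple_section Y X (Mform Y) W gs)) \<in> stab_equiv Y X W"
      using * R by blast
    have WU: "W \<subseteq> U" "W \<subseteq> V" using W by auto
    have f: "restricts_to_tuple Y X (Mform Y) (tuple_section Y X (Mform Y) W fs) W fs"
      "restricts_to_tuple Y X (Mform Y) (tuple_section Y X (Mform Y) W gs) W gs"
      by (rule restricts_to_tuple_section[OF local_tuple_subset[OF YX fs(1) W(1) WU(1)]]
          restricts_to_tuple_section[OF local_tuple_subset[OF YX gs(1) W(1) WU(2)]])+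
    obtain W' hs where hs: "y \<in> W'" "restricts_to_tuple Y X (Mform Y) (tuple_section Y X (Mform Y) W gs) W' hs"
      "iso_equiv Y X y fs hs"
      using stab_equiv_local[OF YX st W(2) _ W(2), of fs] f(1) by auto
    obtain N where N: "openin (Mtop Y) N" "y \<in> N" "N \<subseteq> W'" "N \<subseteq> W" "\<forall>z\<in>N. values_at hs z = values_at gs z"
      by (rule restricts_to_tuple_values[OF hs(2) f(2) hs(1) W(2)])
    have "iso_equiv Y X y hs gs" by (rule iso_equivI[OF N(2,1)]) (use N(5) in blast)
    with hs(3) show "iso_equiv Y X y fs gs" by (rule iso_equiv_trans[OF YX])
  next
    assume "iso_equiv Y X y fs gs"
    then obtain N as bs where N: "y \<in> N" "local_tuple Y X zero_form N as" "local_tuple Y X zero_form N bs"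
      "\<forall>z\<in>N. values_at (fs @ as) z = values_at (gs @ bs) z" unfolding iso_equiv_def by blast
    \<comment> \<open>Over this common domain fs with \<open>as\<close> and gs with
      \<open>bs\<close> define the same section, which is one stabilisation away from each of fs and
      gs.\<close>
    let ?W = "N \<inter> (U \<inter> V)"
    have W: "openin (Mtop Y) ?W" using local_tuple_open[OF N(2)] o by (intro openin_Int)
    have WU: "?W \<subseteq> U" "?W \<subseteq> V" by auto
    note l = local_tuple_subset[OF YX fs(1) W WU(1)] local_tuple_subset[OF YX gs(1) W WU(2)]
      local_tuple_subset[OF YX N(2) W Int_lower1] local_tuple_subset[OF YX N(3) W Int_lower1]
    have "length (fs @ as) = length (gs @ bs)" using N(1,4) by (metis size_values_at)
    moreover have "tuple_fun ?W (fs @ as) = tuple_fun ?W (gs @ bs)"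
      using N(4) unfolding tuple_fun_eq by (intro restrict_ext) blast
    moreover have "restrict (tuple_fun W' ks) W' = tuple_fun W' ks" for W' ks by (simp add: tuple_fun_def)
    ultimately have "tuple_section Y X (Mform Y) ?W (fs @ as) = tuple_section Y X (Mform Y) ?W (gs @ bs)"
      by (simp only: tuple_section_def)
    then have "((length fs, tuple_section Y X (Mform Y) ?W fs), (length gs, tuple_section Y X (Mform Y) ?W gs)) \<in> stab_equiv Y X ?W"
      using stab_equiv_step[OF stab_step_append[OF l(1,3)]] stab_equiv_step[OF stab_step_append[OF l(2,4)]]
        \<open>length (fs @ as) = length (gs @ bs)\<close> stab_equiv_trans stab_equiv_sym by metis
    then show "cor_germ Y X y U fs = cor_germ Y X y V gs"
      unfolding * using R[OF W] W N(1) fs(2) gs(2) by (intro exI[of _ ?W]) auto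
  qed
qed

lemma represented_by_iff:
  "represented_by Y X F U fs \<longleftrightarrow> local_tuple Y X (Mform Y) U fs \<and> (\<forall>z\<in>U. F z = cor_germ Y X z U fs)"
  unfolding represented_by_def cor_of_tuple_def cor_germ_def by (auto simp: restrict_def fun_eq_iff)

lemma represented_by_open: "represented_by Y X F U fs \<Longrightarrow> openin (Mtop Y) U"
  unfolding represented_by_iff using local_tuple_open by blast

lemma represented_by_local: "represented_by Y X F U fs \<Longrightarrow> local_tuple Y X (Mform Y) U fs"
  unfolding represented_by_iff by blast

lemma represented_by_smooth: "represented_by Y X F U fs \<Longrightarrow> f \<in> set fs \<Longrightarrow> smooth_map Y X U f"
  unfolding represented_by_iff local_tuple_def by blast

lemma represented_by_subset:
  assumes YX: "smooth_manifold Y" "smooth_manifold X" and F: "represented_by Y X F U fs"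
    and V: "openin (Mtop Y) V" "V \<subseteq> U"
  shows "represented_by Y X F V fs"
proof -
  have l: "local_tuple Y X (Mform Y) U fs" by (rule represented_by_local[OF F])
  note l' = local_tuple_subset[OF YX l V]
  have "cor_germ Y X z U fs = cor_germ Y X z V fs" if "z \<in> V" for z
    unfolding cor_germ_eq_iff[OF YX l subsetD[OF V(2) that] l' that]
    by (rule iso_equivI[OF that V(1) refl])
  then show ?thesis using F l' V(2) unfolding represented_by_iff by auto
qed

lemma represented_by_unique:
  assumes YX: "smooth_manifold Y" "smooth_manifold X"
    and F: "represented_by Y X F U fs" "y \<in> U" and G: "represented_by Y X F V gs" "y \<in> V"
  shows "iso_equiv Y X y fs gs"
proof -
  have "F y = cor_germ Y X y U fs" "F y = cor_germ Y X y V gs"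
    using F G unfolding represented_by_iff by blast+
  then show ?thesis
    using cor_germ_eq_iff[OF YX represented_by_local[OF F(1)] F(2) represented_by_local[OF G(1)] G(2)] by simp
qed

lemma represented_by_eqI:
  assumes YX: "smooth_manifold Y" "smooth_manifold X"
    and F: "represented_by Y X F U fs" "y \<in> U" and G: "represented_by Y X G V gs" "y \<in> V" and eq: "iso_equiv Y X y fs gs"
  shows "F y = G y"
proof -
  have "F y = cor_germ Y X y U fs" "G y = cor_germ Y X y V gs"
    using F G unfolding represented_by_iff by blast+
  then show ?thesis
    using cor_germ_eq_iff[OF YX represented_by_local[OF F(1)] F(2) represented_by_local[OF G(1)] G(2)] eq by simp
qed

text \<open>A section of the outer sheafification is locally the class of some section of the inner
  one, which is in turn locally an honest tuple; one smaller neighbourhood serves for both.\<close>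

lemma SCor_iff:
  assumes YX: "smooth_manifold Y" "smooth_manifold X"
  shows "F \<in> SCor Y X \<longleftrightarrow> F \<in> extensional (Mcarrier Y) \<and> (\<forall>y\<in>Mcarrier Y. \<exists>U fs. y \<in> U \<and> represented_by Y X F U fs)"
proof -
  have "(\<exists>V s. openin (Mtop Y) V \<and> y \<in> V \<and> V \<subseteq> Mcarrier Y \<and> s \<in> Sect (cor_presheaf Y X) V \<and>
        (\<forall>z\<in>V. F z = germ (Mtop Y) (cor_presheaf Y X) z V s)) \<longleftrightarrow> (\<exists>U fs. y \<in> U \<and> represented_by Y X F U fs)"
    (is "?L \<longleftrightarrow> ?R") for y
  proof
    assume ?L
    then obtain V s where V: "openin (Mtop Y) V" "y \<in> V" "s \<in> Sect (cor_presheaf Y X) V"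
      "\<forall>z\<in>V. F z = germ (Mtop Y) (cor_presheaf Y X) z V s" by blast
    obtain n G where G: "G \<in> SCor_n Y X n V" "s = stab_equiv Y X V `` {(n, G)}"
      using V(3) unfolding cor_presheaf_Sect by blast
    obtain W fs where W: "y \<in> W" "W \<subseteq> V" "length fs = n" "restricts_to_tuple Y X (Mform Y) G W fs"
      using G(1) V(2) unfolding SCor_n_def tuple_sections_iff by blast
    have l: "local_tuple Y X (Mform Y) W fs" "restrict G W = tuple_section Y X (Mform Y) W fs"
      using W(4) by (simp_all add: restricts_to_tuple_def)
    note oW = local_tuple_open[OF l(1)]
    have "F z = cor_germ Y X z W fs" if z: "z \<in> W" for z
    proof -
      have "germ (Mtop Y) (cor_presheaf Y X) z V s = cor_germ Y X z W fs"
        unfolding cor_germ_def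
      proof (subst germ_eq_iff[OF cor_presheaf_Restr_Restr[OF YX] V(1) _ V(3) oW z tuple_class_Sect[OF l(1)]])
        show "z \<in> V" using z W(2) by blast
        have "Restr (cor_presheaf Y X) V W s = stab_equiv Y X W `` {(length fs, tuple_section Y X (Mform Y) W fs)}"
          unfolding G(2) cor_presheaf_Restr[OF YX oW W(2)] l(2) W(3) ..
        moreover have "Restr (cor_presheaf Y X) W W (stab_equiv Y X W `` {(length fs, tuple_section Y X (Mform Y) W fs)})
          = stab_equiv Y X W `` {(length fs, tuple_section Y X (Mform Y) W fs)}"
          unfolding cor_presheaf_Restr[OF YX oW subset_refl] restrict_tuple_section[OF YX l(1) oW subset_refl] ..
        ultimately show "\<exists>N. openin (Mtop Y) N \<and> z \<in> N \<and> N \<subseteq> V \<inter> W \<and> Restr (cor_presheaf Y X) V N s =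
          Restr (cor_presheaf Y X) W N (stab_equiv Y X W `` {(length fs, tuple_section Y X (Mform Y) W fs)})"
          using oW z W(2) by (intro exI[of _ W]) simp
      qed auto
      then show ?thesis using V(4) z W(2) by auto
    qed
    then show ?R using W(1) l(1) unfolding represented_by_iff by blast
  next
    assume ?R
    then obtain U fs where U: "y \<in> U" "represented_by Y X F U fs" by blast
    have "\<forall>z\<in>U. F z = germ (Mtop Y) (cor_presheaf Y X) z U (stab_equiv Y X U `` {(length fs, tuple_section Y X (Mform Y) U fs)})"
      using U(2) unfolding represented_by_iff cor_germ_def by (rule conjunct2)
    then show ?L
      using U(1) represented_by_open[OF U(2)] openin_subset[OF represented_by_open[OF U(2)]]
        tuple_class_Sect[OF represented_by_local[OF U(2)]]
      by (intro exI[of _ U] exI[of _ "stab_equiv Y X U `` {(length fs, tuple_section Y X (Mform Y) U fs)}"] conjI)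
  qed
  then show ?thesis by (simp add: SCor_def sheafify_def)
qed

lemma SCor_eqI:
  assumes YX: "smooth_manifold Y" "smooth_manifold X" and F: "F \<in> SCor Y X" and G: "G \<in> SCor Y X"
    and eq: "\<And>y. y \<in> Mcarrier Y \<Longrightarrow> \<exists>U V fs. y \<in> U \<and> y \<in> V \<and> represented_by Y X F U fs \<and> represented_by Y X G V fs"
  shows "F = G"
proof (rule extensionalityI[of _ "Mcarrier Y"])
  fix y assume "y \<in> Mcarrier Y"
  from eq[OF this] obtain U V fs where *: "y \<in> U" "y \<in> V" "represented_by Y X F U fs" "represented_by Y X G V fs" by blast
  show "F y = G y"
    by (rule represented_by_eqI[OF YX *(3,1) *(4,2)])
       (rule iso_equivI[OF *(1) represented_by_open[OF *(3)] refl])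
qed (use F G in \<open>simp_all add: SCor_iff[OF YX]\<close>)

section \<open>Composites of tuples\<close>

definition comp_tuple :: "('a \<Rightarrow> 'a) list \<Rightarrow> ('a \<Rightarrow> 'a) list list \<Rightarrow> ('a \<Rightarrow> 'a) list" where
  "comp_tuple fs gss = concat (map (\<lambda>(f, gs). map (\<lambda>g. g \<circ> f) gs) (zip fs gss))"

lemma comp_tuple_simps [simp]:
  "comp_tuple [] gss = []"
  "comp_tuple (f # fs) (gs # gss) = map (\<lambda>g. g \<circ> f) gs @ comp_tuple fs gss"
  by (simp_all add: comp_tuple_def)

lemma values_at_map_comp: "values_at (map (\<lambda>g. g \<circ> f) gs) z = values_at gs (f z)"
  by (simp add: values_at_def o_def)

lemma comp_tuple_values: "values_at (comp_tuple fs (map \<gamma> fs)) z = (\<Sum>f\<leftarrow>fs. values_at (\<gamma> f) (f z))"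
  by (induction fs) (simp_all add: values_at_map_comp)

lemma comp_tuple_append: "comp_tuple (fs @ fs') (map \<gamma> (fs @ fs')) = comp_tuple fs (map \<gamma> fs) @ comp_tuple fs' (map \<gamma> fs')"
  by (simp add: comp_tuple_def)

text \<open>Forms pull back functorially, and pushed-forward tangent vectors are tangent, so the sum
  over gs can be evaluated at \<open>f p\<close>. The form \<open>\<alpha>\<close> is arbitrary to
  cover symplectic and isotropic outer tuples alike.\<close>

lemma pullback_sum_compose:
  assumes M: "smooth_manifold Z" "smooth_manifold Y" "smooth_manifold X"
    and f: "smooth_map Z Y U f" "f ` U \<subseteq> V" and gs: "local_tuple Y X \<alpha> V gs"
    and p: "p \<in> U" "v \<in> tangent_space Z p" "w \<in> tangent_space Z p"
  shows "(\<Sum>h\<leftarrow>map (\<lambda>g. g \<circ> f) gs. pullback Z X h (Mform X) p v w) =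
    \<alpha> (f p) (pushforward Z Y f p v) (pushforward Z Y f p w)"
proof -
  have fp: "f p \<in> V" using f(2) p(1) by blast
  have "pullback Z X (g \<circ> f) (Mform X) p v w =
      pullback Y X g (Mform X) (f p) (pushforward Z Y f p v) (pushforward Z Y f p w)" if "g \<in> set gs" for g
  proof -
    have g: "smooth_map Y X V g" using gs that unfolding local_tuple_def by blast
    show ?thesis by (simp add: pullback_def pushforward_compose[OF M(2,3) g, of f p, OF fp])
  qed
  then have "(\<Sum>h\<leftarrow>map (\<lambda>g. g \<circ> f) gs. pullback Z X h (Mform X) p v w) =
      (\<Sum>g\<leftarrow>gs. pullback Y X g (Mform X) (f p) (pushforward Z Y f p v) (pushforward Z Y f p w))"
    by (simp add: o_def cong: map_cong)
  also have "\<dots> = \<alpha> (f p) (pushforward Z Y f p v) (pushforward Z Y f p w)"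
    using gs fp pushforward_tangent[OF M(1,2) f(1) p(1,2)] pushforward_tangent[OF M(1,2) f(1) p(1,3)]
    unfolding local_tuple_def by blast
  finally show ?thesis .
qed

lemma smooth_map_map_comp:
  assumes M: "smooth_manifold Z" "smooth_manifold Y" "smooth_manifold X"
    and f: "smooth_map Z Y U f" "f ` U \<subseteq> V" and gs: "local_tuple Y X \<alpha> V gs"
  shows "\<forall>h\<in>set (map (\<lambda>g. g \<circ> f) gs). smooth_map Z X U h"
proof
  fix h assume "h \<in> set (map (\<lambda>g. g \<circ> f) gs)"
  then obtain g where g: "g \<in> set gs" "h = g \<circ> f" by auto
  have "smooth_map Y X V g" using gs g(1) unfolding local_tuple_def by blast
  then show "smooth_map Z X U h" unfolding g(2) by (rule smooth_map_compose[OF M f(1) _ f(2)])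
qed

lemma local_tuple_map_comp:
  assumes M: "smooth_manifold Z" "smooth_manifold Y" "smooth_manifold X"
    and f: "smooth_map Z Y U f" "f ` U \<subseteq> V" and gs: "local_tuple Y X zero_form V gs"
  shows "local_tuple Z X zero_form U (map (\<lambda>g. g \<circ> f) gs)"
  unfolding local_tuple_def
  using smooth_map_open[OF f(1)] smooth_map_map_comp[OF assms] pullback_sum_compose[OF assms] by blast

text \<open>Summing over the branches above one f yields the pullback of the form of Y by f; summing
  over f then yields \<open>\<beta>\<close>. With \<open>\<beta> = 0\<close> this shows that
  composing an isotropic inner tuple with symplectic ones stays isotropic.\<close>

lemma comp_tuple_local:
  assumes M: "smooth_manifold Z" "smooth_manifold Y" "smooth_manifold X"
    and fs: "local_tuple Z Y \<beta> U fs"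
    and gss: "list_all2 (\<lambda>f gs. \<exists>V. f ` U \<subseteq> V \<and> local_tuple Y X (Mform Y) V gs) fs gss"
  shows "local_tuple Z X \<beta> U (comp_tuple fs gss)"
proof -
  have "(\<forall>f\<in>set fs. smooth_map Z Y U f) \<longrightarrow> (\<forall>h\<in>set (comp_tuple fs gss). smooth_map Z X U h) \<and>
    (\<forall>p\<in>U. \<forall>v\<in>tangent_space Z p. \<forall>w\<in>tangent_space Z p.
      (\<Sum>h\<leftarrow>comp_tuple fs gss. pullback Z X h (Mform X) p v w) = (\<Sum>f\<leftarrow>fs. pullback Z Y f (Mform Y) p v w))"
    using gss
  proof (induction rule: list_all2_induct)
    case Nil show ?case by simp
  next
    case (Cons f fs gs gss)
    show ?case
    proof
      assume s: "\<forall>f\<in>set (f # fs). smooth_map Z Y U f"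
      then have f: "smooth_map Z Y U f" by simp
      obtain V where V: "f ` U \<subseteq> V" "local_tuple Y X (Mform Y) V gs" using Cons(1) by blast
      have IH: "\<forall>h\<in>set (comp_tuple fs gss). smooth_map Z X U h"
        "\<forall>p\<in>U. \<forall>v\<in>tangent_space Z p. \<forall>w\<in>tangent_space Z p.
        (\<Sum>h\<leftarrow>comp_tuple fs gss. pullback Z X h (Mform X) p v w) = (\<Sum>f\<leftarrow>fs. pullback Z Y f (Mform Y) p v w)"
        using Cons.IH s by auto
      have "(\<Sum>h\<leftarrow>comp_tuple (f # fs) (gs # gss). pullback Z X h (Mform X) p v w) = (\<Sum>f\<leftarrow>f # fs. pullback Z Y f (Mform Y) p v w)"
        if p: "p \<in> U" "v \<in> tangent_space Z p" "w \<in> tangent_space Z p" for p v w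
      proof -
        have "(\<Sum>h\<leftarrow>comp_tuple fs gss. pullback Z X h (Mform X) p v w) = (\<Sum>f\<leftarrow>fs. pullback Z Y f (Mform Y) p v w)"
          using IH(2) p by blast
        moreover have "pullback Z Y f (Mform Y) p v w = Mform Y (f p) (pushforward Z Y f p v) (pushforward Z Y f p w)"
          by (simp add: pullback_def)
        ultimately show ?thesis
          using pullback_sum_compose[OF M f V p] unfolding comp_tuple_simps map_append sum_list_append by simp
      qed
      moreover have "\<forall>h\<in>set (comp_tuple (f # fs) (gs # gss)). smooth_map Z X U h"
        using IH(1) smooth_map_map_comp[OF M f V] unfolding comp_tuple_simps set_append by blast
      ultimately show "(\<forall>h\<in>set (comp_tuple (f # fs) (gs # gss)). smooth_map Z X U h) \<and>
        (\<forall>p\<in>U. \<forall>v\<in>tangent_space Z p. \<forall>w\<in>tangent_space Z p.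
        (\<Sum>h\<leftarrow>comp_tuple (f # fs) (gs # gss). pullback Z X h (Mform X) p v w) = (\<Sum>f\<leftarrow>f # fs. pullback Z Y f (Mform Y) p v w))"
        by blast
    qed
  qed
  then show ?thesis using fs unfolding local_tuple_def by simp
qed

lemma openin_finite_ball:
  assumes "finite S" "openin T D" "\<And>f. f \<in> S \<Longrightarrow> openin T {z \<in> D. Q f z}"
  shows "openin T {z \<in> D. \<forall>f\<in>S. Q f z}"
  using assms(1,3)
proof (induction S)
  case empty then show ?case using assms(2) by simp
next
  case (insert f S)
  have "{z \<in> D. \<forall>f\<in>insert f S. Q f z} = {z \<in> D. Q f z} \<inter> {z \<in> D. \<forall>f\<in>S. Q f z}" by blast
  then show ?case using insert by (simp add: openin_Int)
qed

lemma Hausdorff_finite_separation: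
  assumes H: "Hausdorff_space T" and P: "finite P" "P \<subseteq> topspace T"
  shows "\<exists>N. (\<forall>x\<in>P. openin T (N x) \<and> x \<in> N x) \<and> (\<forall>x\<in>P. \<forall>y\<in>P. x \<noteq> y \<longrightarrow> N x \<inter> N y = {})"
  using P
proof (induction P)
  case empty show ?case by simp
next
  case (insert a P)
  then obtain N where N: "\<forall>x\<in>P. openin T (N x) \<and> x \<in> N x" "\<forall>x\<in>P. \<forall>y\<in>P. x \<noteq> y \<longrightarrow> N x \<inter> N y = {}" by auto
  have "\<forall>x\<in>P. \<exists>U V. openin T U \<and> openin T V \<and> a \<in> U \<and> x \<in> V \<and> disjnt U V"
  proof
    fix x assume x: "x \<in> P"
    then have "a \<in> topspace T" "x \<in> topspace T" "a \<noteq> x" using insert.prems insert.hyps(2) by auto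
    then show "\<exists>U V. openin T U \<and> openin T V \<and> a \<in> U \<and> x \<in> V \<and> disjnt U V"
      using H unfolding Hausdorff_space_def by blast
  qed
  then obtain A B where AB: "\<forall>x\<in>P. openin T (A x) \<and> openin T (B x) \<and> a \<in> A x \<and> x \<in> B x \<and> disjnt (A x) (B x)"
    by metis
  \<comment> \<open>Cutting down to the whole space makes the set open also when P is empty.\<close>
  let ?A = "{z \<in> topspace T. \<forall>x\<in>P. z \<in> A x}"
  have "openin T {z \<in> topspace T. z \<in> A x}" if "x \<in> P" for x
  proof -
    have "{z \<in> topspace T. z \<in> A x} = A x" using AB that openin_subset by fastforce
    then show ?thesis using AB that by simp
  qed
  then have oA: "openin T ?A" by (intro openin_finite_ball[OF insert.hyps(1) openin_topspace])
  define N' where "N' = (\<lambda>x. if x = a then ?A else N x \<inter> B x)"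
  have 1: "\<forall>x\<in>insert a P. openin T (N' x) \<and> x \<in> N' x"
    using oA AB N(1) insert.prems insert.hyps(2) by (auto simp: N'_def openin_Int)
  have a: "?A \<inter> B x = {}" if "x \<in> P" for x using AB that unfolding disjnt_def by blast
  have 2: "N' x \<inter> N' y = {}" if xy: "x \<in> insert a P" "y \<in> insert a P" "x \<noteq> y" for x y
  proof -
    consider "x = a" "y \<in> P" "y \<noteq> a" | "y = a" "x \<in> P" "x \<noteq> a" | "x \<in> P" "y \<in> P" "x \<noteq> a" "y \<noteq> a" using xy by blast
    then show ?thesis
    proof cases
      case 1 then show ?thesis using a[of y] by (auto simp: N'_def)
    next
      case 2 then show ?thesis using a[of x] by (auto simp: N'_def)
    next
      case 3 then show ?thesis using N(2) xy(3) unfolding N'_def by (simp only: if_False) blast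
    qed
  qed
  show ?case using 1 2 by blast
qed

text \<open>The isotropic summands that witness the relation at \<open>f y\<close> are precomposed
  with f and remain isotropic, over the part of U that f sends into their domain.\<close>

lemma iso_equiv_map_comp:
  assumes M: "smooth_manifold Z" "smooth_manifold Y" "smooth_manifold X"
    and f: "smooth_map Z Y U f" "y \<in> U" and eq: "iso_equiv Y X (f y) gs hs"
  shows "iso_equiv Z X y (map (\<lambda>g. g \<circ> f) gs) (map (\<lambda>g. g \<circ> f) hs)"
proof -
  obtain W as bs where W: "f y \<in> W" "local_tuple Y X zero_form W as" "local_tuple Y X zero_form W bs"
    "\<forall>z\<in>W. values_at (gs @ as) z = values_at (hs @ bs) z" using eq unfolding iso_equiv_def by blast
  let ?V = "{q \<in> U. f q \<in> W}"
  have V: "openin (Mtop Z) ?V" by (rule smooth_map_preimage[OF M(1,2) f(1) local_tuple_open[OF W(2)]])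
  have fV: "smooth_map Z Y ?V f" by (rule smooth_map_subset[OF M(1,2) f(1) V]) auto
  have im: "f ` ?V \<subseteq> W" by auto
  show ?thesis
  proof (rule iso_equiv_by[OF _ local_tuple_map_comp[OF M fV im W(2)] local_tuple_map_comp[OF M fV im W(3)]])
    show "y \<in> ?V" using f(2) W(1) by simp
    fix z assume "z \<in> ?V"
    then have "values_at (gs @ as) (f z) = values_at (hs @ bs) (f z)" using W(4) by blast
    then show "values_at (map (\<lambda>g. g \<circ> f) gs @ map (\<lambda>g. g \<circ> f) as) z = values_at (map (\<lambda>g. g \<circ> f) hs @ map (\<lambda>g. g \<circ> f) bs) z"
      by (simp add: values_at_map_comp)
  qed
qed

text \<open>Changes the representation of the outer correspondence branch by branch, to one that
  depends only on the value of the branch at y.\<close>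

lemma comp_tuple_iso_right:
  assumes M: "smooth_manifold Z" "smooth_manifold Y" "smooth_manifold X"
    and U: "openin (Mtop Z) U" "y \<in> U"
    and fs: "\<forall>f\<in>set fs. smooth_map Z Y U f"
    and gss: "list_all2 (\<lambda>f gs. iso_equiv Y X (f y) gs (\<kappa> (f y))) fs gss"
  shows "iso_equiv Z X y (comp_tuple fs gss) (comp_tuple fs (map (\<lambda>f. \<kappa> (f y)) fs))"
  using gss fs
proof (induction rule: list_all2_induct)
  case Nil show ?case using U by (auto intro: iso_equivI)
next
  case (Cons f fs gs gss)
  have f: "smooth_map Z Y U f" and fs: "\<forall>f\<in>set fs. smooth_map Z Y U f" using Cons.prems by auto
  show ?case unfolding comp_tuple_simps list.map
    by (rule iso_equiv_append[OF M(1,3) iso_equiv_map_comp[OF M f U(2) Cons(1)] Cons.IH[OF fs]])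
qed

text \<open>Near \<open>y\<close> the composite only depends on the multiset of values of the inner tuple: choose disjoint
  neighbourhoods of its finitely many values at \<open>y\<close> and one representation of the outer correspondence on each.\<close>

lemma comp_tuple_iso_left:
  assumes M: "smooth_manifold Z" "smooth_manifold Y" "smooth_manifold X"
    and fs: "local_tuple Z Y (Mform Z) U fs" "y \<in> U" and fs': "local_tuple Z Y (Mform Z) U' fs'" "y \<in> U'"
    and eq: "iso_equiv Z Y y fs fs'"
    and \<kappa>: "\<And>x. x \<in> Mcarrier Y \<Longrightarrow> x \<in> R x \<and> local_tuple Y X (Mform Y) (R x) (\<kappa> x)"
  shows "iso_equiv Z X y (comp_tuple fs (map (\<lambda>f. \<kappa> (f y)) fs)) (comp_tuple fs' (map (\<lambda>f. \<kappa> (f y)) fs'))"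
proof -
  obtain W as bs where W: "y \<in> W" "local_tuple Z Y zero_form W as" "local_tuple Z Y zero_form W bs"
    "\<forall>z\<in>W. values_at (fs @ as) z = values_at (fs' @ bs) z" using eq unfolding iso_equiv_def by blast
  \<comment> \<open>The corrections \<open>as\<close> and \<open>bs\<close> count among the
    branches, because they are composed with the outer correspondence as well.\<close>
  let ?D = "W \<inter> (U \<inter> U')" and ?A = "set (fs @ as) \<union> set (fs' @ bs)"
  have D: "openin (Mtop Z) ?D"
    by (intro openin_Int local_tuple_open[OF fs(1)] local_tuple_open[OF fs'(1)] local_tuple_open[OF W(2)])
  have sub: "?D \<subseteq> U" "?D \<subseteq> U'" "?D \<subseteq> W" by auto
  have sm: "smooth_map Z Y ?D f" if "f \<in> ?A" for f
    using that local_tuple_subset[OF M(1,2) fs(1) D sub(1)] local_tuple_subset[OF M(1,2) fs'(1) D sub(2)]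
      local_tuple_subset[OF M(1,2) W(2) D sub(3)] local_tuple_subset[OF M(1,2) W(3) D sub(3)]
    unfolding local_tuple_def by auto
  have yD: "y \<in> ?D" using W(1) fs(2) fs'(2) by blast
  let ?P = "(\<lambda>f. f y) ` ?A"
  have P: "finite ?P" "?P \<subseteq> topspace (Mtop Y)" using smooth_map_image[OF sm yD] by auto
  have "Hausdorff_space (Mtop Y)" using M(2) unfolding smooth_manifold_def by blast
  from Hausdorff_finite_separation[OF this P] obtain N where
    N: "\<And>x. x \<in> ?P \<Longrightarrow> openin (Mtop Y) (N x) \<and> x \<in> N x"
      "\<And>x x'. x \<in> ?P \<Longrightarrow> x' \<in> ?P \<Longrightarrow> x \<noteq> x' \<Longrightarrow> N x \<inter> N x' = {}" by metis
  define O' where "O' x = N x \<inter> R x" for x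
  have O': "openin (Mtop Y) (O' x)" "x \<in> O' x" if "x \<in> ?P" for x
  proof -
    note x = \<kappa>[OF subsetD[OF P(2) that]]
    have "openin (Mtop Y) (R x)" using local_tuple_open[OF conjunct2[OF x]] .
    then show "openin (Mtop Y) (O' x)" "x \<in> O' x"
      using N(1)[OF that] x unfolding O'_def by (auto intro: openin_Int)
  qed
  let ?V = "{z \<in> ?D. \<forall>f\<in>?A. f z \<in> O' (f y)}"
  have V: "openin (Mtop Z) ?V"
  proof (rule openin_finite_ball[OF _ D])
    show "finite ?A" by simp
    fix f assume f: "f \<in> ?A"
    then have "openin (Mtop Y) (O' (f y))" by (intro O'(1)) blast
    then show "openin (Mtop Z) {z \<in> ?D. f z \<in> O' (f y)}" by (rule smooth_map_preimage[OF M(1,2) sm[OF f]])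
  qed
  have yV: "y \<in> ?V" using yD O'(2) by blast
  \<comment> \<open>The composed corrections are the isotropic summands that will witness the
    relation between the composites.\<close>
  have iso: "local_tuple Z X zero_form ?V (comp_tuple cs (map (\<lambda>f. \<kappa> (f y)) cs))"
    if cs: "local_tuple Z Y zero_form W cs" "set cs \<subseteq> ?A" for cs
  proof (rule comp_tuple_local[OF M local_tuple_subset[OF M(1,2) cs(1) V]])
    show "?V \<subseteq> W" by blast
    have "\<exists>B. f ` ?V \<subseteq> B \<and> local_tuple Y X (Mform Y) B (\<kappa> (f y))" if "f \<in> set cs" for f
    proof (intro exI conjI)
      have f: "f \<in> ?A" using that cs(2) by blast
      then show "local_tuple Y X (Mform Y) (R (f y)) (\<kappa> (f y))" using \<kappa> P(2) by blast
      show "f ` ?V \<subseteq> R (f y)" using f unfolding O'_def by blast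
    qed
    then show "list_all2 (\<lambda>f gs. \<exists>B. f ` ?V \<subseteq> B \<and> local_tuple Y X (Mform Y) B gs) cs (map (\<lambda>f. \<kappa> (f y)) cs)"
      by (simp add: list_all2_conv_all_nth)
  qed
  \<comment> \<open>On \<open>?V\<close> the neighbourhoods are disjoint, so the point q alone
    determines which representation is used. This removes the dependence on the branch.\<close>
  define K where "K q = values_at (\<kappa> (THE x. x \<in> ?P \<and> q \<in> O' x)) q" for q
  have K: "values_at (\<kappa> (f y)) (f z) = K (f z)" if f: "f \<in> ?A" and z: "z \<in> ?V" for f z
  proof -
    have "(THE x. x \<in> ?P \<and> f z \<in> O' x) = f y"
    proof (rule the_equality)
      show *: "f y \<in> ?P \<and> f z \<in> O' (f y)" using f z by blast
      fix x assume "x \<in> ?P \<and> f z \<in> O' x"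
      then show "x = f y" using * N(2)[of x "f y"] unfolding O'_def by blast
    qed
    then show ?thesis by (simp add: K_def)
  qed
  \<comment> \<open>Now the composite depends on cs only through its multiset of values.\<close>
  have val: "values_at (comp_tuple cs (map (\<lambda>f. \<kappa> (f y)) cs)) z = sum_mset (image_mset K (values_at cs z))"
    if cs: "set cs \<subseteq> ?A" and z: "z \<in> ?V" for cs z
  proof -
    have "values_at (comp_tuple cs (map (\<lambda>f. \<kappa> (f y)) cs)) z = (\<Sum>f\<leftarrow>cs. K (f z))"
      unfolding comp_tuple_values using K[OF _ z] cs by (intro arg_cong[where f=sum_list] map_cong) auto
    also have "\<dots> = sum_mset (image_mset K (values_at cs z))"
      by (simp add: values_at_def image_mset.compositionality o_def sum_mset_sum_list[symmetric])
    finally show ?thesis .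
  qed
  have sA: "set as \<subseteq> ?A" "set bs \<subseteq> ?A" "set (fs @ as) \<subseteq> ?A" "set (fs' @ bs) \<subseteq> ?A" by auto
  show ?thesis
  proof (rule iso_equiv_by[OF yV iso[OF W(2) sA(1)] iso[OF W(3) sA(2)]])
    fix z assume z: "z \<in> ?V"
    then have "values_at (fs @ as) z = values_at (fs' @ bs) z" using W(4) by blast
    then show "values_at (comp_tuple fs (map (\<lambda>f. \<kappa> (f y)) fs) @ comp_tuple as (map (\<lambda>f. \<kappa> (f y)) as)) z =
      values_at (comp_tuple fs' (map (\<lambda>f. \<kappa> (f y)) fs') @ comp_tuple bs (map (\<lambda>f. \<kappa> (f y)) bs)) z"
      using val[OF sA(3) z] val[OF sA(4) z] unfolding comp_tuple_append by simp
  qed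
qed

section \<open>The composite of two correspondences\<close>

definition composable :: "'a mfd \<Rightarrow> 'a mfd \<Rightarrow> 'a mfd \<Rightarrow> 'a cor \<Rightarrow> 'a cor \<Rightarrow> 'a set \<Rightarrow> ('a \<Rightarrow> 'a) list \<Rightarrow> ('a \<Rightarrow> 'a) list list \<Rightarrow> bool" where
  "composable Z Y X G F U fs gss \<longleftrightarrow> represented_by Z Y F U fs \<and>
    list_all2 (\<lambda>f gs. \<exists>V. f ` U \<subseteq> V \<and> represented_by Y X G V gs) fs gss"

lemma composable_local:
  assumes M: "smooth_manifold Z" "smooth_manifold Y" "smooth_manifold X" and c: "composable Z Y X G F U fs gss"
  shows "local_tuple Z X (Mform Z) U (comp_tuple fs gss)"
proof (rule comp_tuple_local[OF M])
  show "local_tuple Z Y (Mform Z) U fs" using c represented_by_local unfolding composable_def by blast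
  show "list_all2 (\<lambda>f gs. \<exists>V. f ` U \<subseteq> V \<and> local_tuple Y X (Mform Y) V gs) fs gss"
    using c unfolding composable_def by (auto elim!: list_all2_mono dest: represented_by_local)
qed

lemma SCor_choice:
  assumes "smooth_manifold Y" "smooth_manifold X" "G \<in> SCor Y X"
  obtains R \<kappa> where "\<forall>x\<in>Mcarrier Y. x \<in> R x \<and> represented_by Y X G (R x) (\<kappa> x)"
proof -
  have "\<forall>x\<in>Mcarrier Y. \<exists>U fs. x \<in> U \<and> represented_by Y X G U fs" using assms SCor_iff by blast
  then obtain R \<kappa> where "\<forall>x\<in>Mcarrier Y. x \<in> R x \<and> represented_by Y X G (R x) (\<kappa> x)" by metis
  then show thesis using that by blast
qed

text \<open>Both composites are compared with those formed from one pointwise choice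
  \<open>\<kappa>\<close> of representations of G: \<open>comp_tuple_iso_right\<close> replaces the
  given outer tuples by it, and \<open>comp_tuple_iso_left\<close> then exchanges fs for
  fs'.\<close>

lemma composable_iso:
  assumes M: "smooth_manifold Z" "smooth_manifold Y" "smooth_manifold X" and G: "G \<in> SCor Y X"
    and c: "composable Z Y X G F U fs gss" "y \<in> U" and c': "composable Z Y X G F U' fs' gss'" "y \<in> U'"
  shows "iso_equiv Z X y (comp_tuple fs gss) (comp_tuple fs' gss')"
proof -
  obtain R \<kappa> where "\<forall>x\<in>Mcarrier Y. x \<in> R x \<and> represented_by Y X G (R x) (\<kappa> x)"
    by (rule SCor_choice[OF M(2,3) G])
  note \<kappa> = bspec[OF this]
  have r: "iso_equiv Z X y (comp_tuple fs gss) (comp_tuple fs (map (\<lambda>f. \<kappa> (f y)) fs))"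
    if c: "composable Z Y X G F U fs gss" "y \<in> U" for U fs gss
  proof -
    have F: "represented_by Z Y F U fs" and
      l: "list_all2 (\<lambda>f gs. \<exists>V. f ` U \<subseteq> V \<and> represented_by Y X G V gs) fs gss"
      using c(1) unfolding composable_def by auto
    have sm: "\<forall>f\<in>set fs. smooth_map Z Y U f" using represented_by_smooth[OF F] by blast
    have "list_all2 (\<lambda>f gs. iso_equiv Y X (f y) gs (\<kappa> (f y))) fs gss"
      unfolding list_all2_conv_all_nth
    proof (intro conjI allI impI)
      show "length fs = length gss" using l by (rule list_all2_lengthD)
      fix i assume i: "i < length fs"
      obtain V where V: "(fs ! i) ` U \<subseteq> V" "represented_by Y X G V (gss ! i)"
        using list_all2_nthD[OF l i] by blast
      have "fs ! i \<in> set fs" using i by simp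
      then have "(fs ! i) y \<in> Mcarrier Y" using smooth_map_image[of Z Y U "fs ! i" y] sm c(2) by blast
      note x = \<kappa>[OF this]
      show "iso_equiv Y X ((fs ! i) y) (gss ! i) (\<kappa> ((fs ! i) y))"
        by (rule represented_by_unique[OF M(2,3) V(2) _ conjunct2[OF x] conjunct1[OF x]]) (use V(1) c(2) in blast)
    qed
    from comp_tuple_iso_right[OF M represented_by_open[OF F] c(2) sm this] show ?thesis .
  qed
  have F: "represented_by Z Y F U fs" "represented_by Z Y F U' fs'" using c(1) c'(1) unfolding composable_def by auto
  have "iso_equiv Z X y (comp_tuple fs (map (\<lambda>f. \<kappa> (f y)) fs)) (comp_tuple fs' (map (\<lambda>f. \<kappa> (f y)) fs'))"
  proof (rule comp_tuple_iso_left[OF M represented_by_local[OF F(1)] c(2) represented_by_local[OF F(2)] c'(2)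
        represented_by_unique[OF M(1,2) F(1) c(2) F(2) c'(2)]])
    fix x assume "x \<in> Mcarrier Y"
    from \<kappa>[OF this] show "x \<in> R x \<and> local_tuple Y X (Mform Y) (R x) (\<kappa> x)" using represented_by_local by blast
  qed
  from iso_equiv_trans[OF M(1,3) r[OF c] iso_equiv_trans[OF M(1,3) this iso_equiv_sym[OF r[OF c']]]] show ?thesis .
qed

text \<open>The branches are finitely many and continuous, so U can be shrunk until each stays in
  the domain of its chosen outer representation.\<close>

lemma composable_exists:
  assumes M: "smooth_manifold Z" "smooth_manifold Y" "smooth_manifold X"
    and F: "represented_by Z Y F U fs" "y \<in> U"
    and \<kappa>: "\<And>f. f \<in> set fs \<Longrightarrow> f y \<in> R f \<and> represented_by Y X G (R f) (\<kappa> f)"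
  obtains V where "y \<in> V" "V \<subseteq> U" "composable Z Y X G F V fs (map \<kappa> fs)" "\<And>f. f \<in> set fs \<Longrightarrow> f ` V \<subseteq> R f"
proof -
  let ?V = "{z \<in> U. \<forall>f\<in>set fs. f z \<in> R f}"
  have V: "openin (Mtop Z) ?V"
  proof (rule openin_finite_ball[OF _ represented_by_open[OF F(1)]])
    show "openin (Mtop Z) {z \<in> U. f z \<in> R f}" if "f \<in> set fs" for f
      using \<kappa>[OF that] by (intro smooth_map_preimage[OF M(1,2) represented_by_smooth[OF F(1) that]] represented_by_open) blast
  qed simp
  have "list_all2 (\<lambda>f gs. \<exists>B. f ` ?V \<subseteq> B \<and> represented_by Y X G B gs) fs (map \<kappa> fs)"
    unfolding list_all2_conv_all_nth
  proof (intro conjI allI impI)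
    fix i assume i: "i < length fs"
    then have "fs ! i \<in> set fs" by simp
    with \<kappa>[OF this] show "\<exists>B. (fs ! i) ` ?V \<subseteq> B \<and> represented_by Y X G B (map \<kappa> fs ! i)"
      using i by (intro exI[of _ "R (fs ! i)"]) auto
  qed simp
  moreover have "represented_by Z Y F ?V fs" by (rule represented_by_subset[OF M(1,2) F(1) V]) blast
  ultimately have "composable Z Y X G F ?V fs (map \<kappa> fs)" unfolding composable_def by blast
  then show thesis by (intro that[of ?V]) (use F(2) \<kappa> in auto)
qed

text \<open>Justifies the definite description. Composable data exist near every point, which gives
  uniqueness; \<open>composable_iso\<close> shows that different data give the same germ, which
  gives existence.\<close>

lemma cor_comp_spec:
  assumes M: "smooth_manifold Z" "smooth_manifold Y" "smooth_manifold X" and F: "F \<in> SCor Z Y" and G: "G \<in> SCor Y X"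
  shows "cor_comp Z Y X G F \<in> SCor Z X"
    and "composable Z Y X G F U fs gss \<Longrightarrow> represented_by Z X (cor_comp Z Y X G F) U (comp_tuple fs gss)"
proof -
  let ?P = "\<lambda>H. H \<in> SCor Z X \<and> (\<forall>U fs gss. composable Z Y X G F U fs gss \<longrightarrow> represented_by Z X H U (comp_tuple fs gss))"
  obtain R \<kappa> where "\<forall>x\<in>Mcarrier Y. x \<in> R x \<and> represented_by Y X G (R x) (\<kappa> x)"
    by (rule SCor_choice[OF M(2,3) G])
  note \<kappa> = bspec[OF this]
  have ex: "\<exists>U fs gss. y \<in> U \<and> composable Z Y X G F U fs gss" if y: "y \<in> Mcarrier Z" for y
  proof -
    obtain U fs where U: "y \<in> U" "represented_by Z Y F U fs" using F y unfolding SCor_iff[OF M(1,2)] by blast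
    obtain V where "y \<in> V" "composable Z Y X G F V fs (map (\<lambda>f. \<kappa> (f y)) fs)"
    proof (rule composable_exists[OF M U(2,1), of "\<lambda>f. R (f y)" G "\<lambda>f. \<kappa> (f y)"])
      fix f assume "f \<in> set fs"
      then have "f y \<in> Mcarrier Y" using smooth_map_image[OF represented_by_smooth[OF U(2)] U(1)] by blast
      then show "f y \<in> R (f y) \<and> represented_by Y X G (R (f y)) (\<kappa> (f y))" by (rule \<kappa>)
    qed blast
    then show ?thesis by blast
  qed
  then obtain A fs0 gss0 where ch: "\<And>y. y \<in> Mcarrier Z \<Longrightarrow> y \<in> A y \<and> composable Z Y X G F (A y) (fs0 y) (gss0 y)"
    by metis
  \<comment> \<open>Assembled from one germ at each point; that H is represented by the composite
    tuple for all composable data is the claim \<open>rep\<close>.\<close>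
  define H where "H = (\<lambda>y\<in>Mcarrier Z. cor_germ Z X y (A y) (comp_tuple (fs0 y) (gss0 y)))"
  have rep: "represented_by Z X H U (comp_tuple fs gss)" if c: "composable Z Y X G F U fs gss" for U fs gss
    unfolding represented_by_iff
  proof (intro conjI ballI)
    show l: "local_tuple Z X (Mform Z) U (comp_tuple fs gss)" by (rule composable_local[OF M c])
    fix z assume z: "z \<in> U"
    then have zZ: "z \<in> Mcarrier Z" using openin_subset[OF local_tuple_open[OF l]] by blast
    note cz = ch[OF zZ]
    have "cor_germ Z X z (A z) (comp_tuple (fs0 z) (gss0 z)) = cor_germ Z X z U (comp_tuple fs gss)"
      unfolding cor_germ_eq_iff[OF M(1,3) composable_local[OF M conjunct2[OF cz]] conjunct1[OF cz] l z]
      by (rule composable_iso[OF M G conjunct2[OF cz] conjunct1[OF cz] c z])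
    then show "H z = cor_germ Z X z U (comp_tuple fs gss)" using zZ by (simp add: H_def)
  qed
  have "H \<in> SCor Z X"
    unfolding SCor_iff[OF M(1,3)]
  proof (intro conjI ballI)
    show "H \<in> extensional (Mcarrier Z)" by (simp add: H_def)
    fix y assume "y \<in> Mcarrier Z"
    from ch[OF this] rep show "\<exists>U fs. y \<in> U \<and> represented_by Z X H U fs" by blast
  qed
  then have PH: "?P H" using rep by blast
  have uniq: "H' = H" if H': "?P H'" for H'
  proof (rule SCor_eqI[OF M(1,3)])
    fix y assume y: "y \<in> Mcarrier Z"
    show "\<exists>U V fs. y \<in> U \<and> y \<in> V \<and> represented_by Z X H' U fs \<and> represented_by Z X H V fs"
      using ch[OF y] H' rep by blast
  qed (use H' PH in blast)+
  have "cor_comp Z Y X G F = (THE H. ?P H)"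
    by (simp only: cor_comp_def composable_def comp_tuple_def)
  also have "\<dots> = H" by (rule the_equality[of ?P, OF PH uniq])
  finally have eq: "cor_comp Z Y X G F = H" .
  show "cor_comp Z Y X G F \<in> SCor Z X" using PH unfolding eq by blast
  show "composable Z Y X G F U fs gss \<Longrightarrow> represented_by Z X (cor_comp Z Y X G F) U (comp_tuple fs gss)"
    unfolding eq by (rule rep)
qed

lemma comp_tuple_map: "comp_tuple fs (map \<gamma> fs) = concat (map (\<lambda>f. map (\<lambda>g. g \<circ> f) (\<gamma> f)) fs)"
  by (induction fs) (simp_all add: o_def)

lemma cor_id_represented:
  assumes M: "smooth_manifold Y"
  shows "represented_by Y Y (cor_id Y) (Mcarrier Y) [\<lambda>y. y]"
proof -
  have "local_tuple Y Y (Mform Y) (Mcarrier Y) [\<lambda>y. y]"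
    unfolding local_tuple_def
  proof (intro conjI ballI)
    show "smooth_map Y Y (Mcarrier Y) f" if "f \<in> set [\<lambda>y. y]" for f
      using that smooth_map_id[OF M openin_topspace] by simp
    fix p v w assume "v \<in> tangent_space Y p" "w \<in> tangent_space Y p"
    then show "(\<Sum>f\<leftarrow>[\<lambda>y. y]. pullback Y Y f (Mform Y) p v w) = Mform Y p v w"
      by (simp add: pullback_def pushforward_id)
  qed simp
  then show ?thesis by (simp add: represented_by_def cor_id_def cor_of_tuple_def)
qed

lemma cor_id_SCor: assumes M: "smooth_manifold Y" shows "cor_id Y \<in> SCor Y Y"
  unfolding SCor_iff[OF M M]
proof (intro conjI ballI)
  show "cor_id Y \<in> extensional (Mcarrier Y)" by (simp add: cor_id_def cor_of_tuple_def)
  fix y assume "y \<in> Mcarrier Y"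
  then show "\<exists>U fs. y \<in> U \<and> represented_by Y Y (cor_id Y) U fs" using cor_id_represented[OF M] by blast
qed

lemma cor_comp_id_right:
  assumes M: "smooth_manifold Z" "smooth_manifold Y" and F: "F \<in> SCor Z Y"
  shows "cor_comp Z Z Y F (cor_id Z) = F"
proof (rule SCor_eqI[OF M cor_comp_spec(1)[OF M(1,1,2) cor_id_SCor[OF M(1)] F] F])
  fix y assume "y \<in> Mcarrier Z"
  then obtain U gs where U: "y \<in> U" "represented_by Z Y F U gs" using F unfolding SCor_iff[OF M] by blast
  note oU = represented_by_open[OF U(2)]
  have "represented_by Z Z (cor_id Z) U [\<lambda>y. y]"
    by (rule represented_by_subset[OF M(1,1) cor_id_represented[OF M(1)] oU openin_subset[OF oU]])
  then have "composable Z Z Y F (cor_id Z) U [\<lambda>y. y] [gs]" using U(2) unfolding composable_def by auto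
  from cor_comp_spec(2)[OF M(1,1,2) cor_id_SCor[OF M(1)] F this]
  have "represented_by Z Y (cor_comp Z Z Y F (cor_id Z)) U gs" by (simp add: o_def)
  then show "\<exists>U V fs. y \<in> U \<and> y \<in> V \<and> represented_by Z Y (cor_comp Z Z Y F (cor_id Z)) U fs \<and> represented_by Z Y F V fs"
    using U by blast
qed

lemma cor_comp_id_left:
  assumes M: "smooth_manifold Z" "smooth_manifold Y" and F: "F \<in> SCor Z Y"
  shows "cor_comp Z Y Y (cor_id Y) F = F"
proof (rule SCor_eqI[OF M cor_comp_spec(1)[OF M(1,2,2) F cor_id_SCor[OF M(2)]] F])
  fix y assume "y \<in> Mcarrier Z"
  then obtain U fs where U: "y \<in> U" "represented_by Z Y F U fs" using F unfolding SCor_iff[OF M] by blast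
  have "\<exists>V. f ` U \<subseteq> V \<and> represented_by Y Y (cor_id Y) V [\<lambda>y. y]" if "f \<in> set fs" for f
    using cor_id_represented[OF M(2)] smooth_map_image[OF represented_by_smooth[OF U(2) that]] by blast
  then have "composable Z Y Y (cor_id Y) F U fs (map (\<lambda>_. [\<lambda>y. y]) fs)"
    using U(2) unfolding composable_def by (simp add: list_all2_conv_all_nth)
  from cor_comp_spec(2)[OF M(1,2,2) F cor_id_SCor[OF M(2)] this]
  have "represented_by Z Y (cor_comp Z Y Y (cor_id Y) F) U fs"
    unfolding comp_tuple_map by (simp add: o_def)
  then show "\<exists>U V fs. y \<in> U \<and> y \<in> V \<and> represented_by Z Y (cor_comp Z Y Y (cor_id Y) F) U fs \<and> represented_by Z Y F V fs"
    using U by blast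
qed

text \<open>With G and H represented by choices that depend only on points, both bracketings are
  represented near each y by the same list of branches.\<close>

lemma cor_comp_assoc:
  assumes M: "smooth_manifold W" "smooth_manifold Z" "smooth_manifold Y" "smooth_manifold X"
    and F: "F \<in> SCor W Z" and G: "G \<in> SCor Z Y" and H: "H \<in> SCor Y X"
  shows "cor_comp W Y X H (cor_comp W Z Y G F) = cor_comp W Z X (cor_comp Z Y X H G) F"
proof -
  note GF = cor_comp_spec[OF M(1-3) F G] and HG = cor_comp_spec[OF M(2-4) G H]
  note L = cor_comp_spec[OF M(1,3,4) GF(1) H] and R = cor_comp_spec[OF M(1,2,4) F HG(1)]
  obtain A \<kappa> where "\<forall>x\<in>Mcarrier Z. x \<in> A x \<and> represented_by Z Y G (A x) (\<kappa> x)" by (rule SCor_choice[OF M(2,3) G])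
  note \<kappa> = bspec[OF this]
  obtain B \<mu> where "\<forall>x\<in>Mcarrier Y. x \<in> B x \<and> represented_by Y X H (B x) (\<mu> x)" by (rule SCor_choice[OF M(3,4) H])
  note \<mu> = bspec[OF this]
  show ?thesis
  proof (rule SCor_eqI[OF M(1,4) L(1) R(1)])
    fix y assume "y \<in> Mcarrier W"
    then obtain U fs where U: "y \<in> U" "represented_by W Z F U fs" using F unfolding SCor_iff[OF M(1,2)] by blast
    have fy: "f y \<in> Mcarrier Z" if "f \<in> set fs" for f
      using smooth_map_image[OF represented_by_smooth[OF U(2) that] U(1)] .
    \<comment> \<open>The branches of H after G at \<open>f y\<close>, built from the same choices
      \<open>\<kappa>\<close> and \<open>\<mu>\<close> that the other bracketing uses.\<close>
    define \<rho> where "\<rho> f = comp_tuple (\<kappa> (f y)) (map (\<lambda>g. \<mu> (g (f y))) (\<kappa> (f y)))" for f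
    have "\<exists>V. f y \<in> V \<and> represented_by Z X (cor_comp Z Y X H G) V (\<rho> f)" if f: "f \<in> set fs" for f
    proof -
      note k = \<kappa>[OF fy[OF f]]
      obtain V where "f y \<in> V" "composable Z Y X H G V (\<kappa> (f y)) (map (\<lambda>g. \<mu> (g (f y))) (\<kappa> (f y)))"
      proof (rule composable_exists[OF M(2-4) conjunct2[OF k] conjunct1[OF k], of "\<lambda>g. B (g (f y))" H "\<lambda>g. \<mu> (g (f y))"])
        fix g assume "g \<in> set (\<kappa> (f y))"
        then have "g (f y) \<in> Mcarrier Y" using smooth_map_image[OF represented_by_smooth[OF conjunct2[OF k]] conjunct1[OF k]] by blast
        then show "g (f y) \<in> B (g (f y)) \<and> represented_by Y X H (B (g (f y))) (\<mu> (g (f y)))" by (rule \<mu>)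
      qed blast
      then show ?thesis unfolding \<rho>_def using HG(2) by blast
    qed
    then obtain C where C: "\<And>f. f \<in> set fs \<Longrightarrow> f y \<in> C f \<and> represented_by Z X (cor_comp Z Y X H G) (C f) (\<rho> f)" by metis
    obtain V1 where V1: "y \<in> V1" "composable W Z X (cor_comp Z Y X H G) F V1 fs (map \<rho> fs)"
      by (rule composable_exists[OF M(1,2,4) U(2,1), of C "cor_comp Z Y X H G" \<rho>]) (rule C, assumption, blast)
    let ?L = "comp_tuple fs (map (\<lambda>f. \<kappa> (f y)) fs)"
    obtain V2 where V2: "y \<in> V2" "composable W Z Y G F V2 fs (map (\<lambda>f. \<kappa> (f y)) fs)"
      by (rule composable_exists[OF M(1-3) U(2,1), of "\<lambda>f. A (f y)" G "\<lambda>f. \<kappa> (f y)"])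
         (rule \<kappa>[OF fy], assumption, blast)
    note rL = GF(2)[OF V2(2)]
    obtain V3 where V3: "y \<in> V3" "composable W Y X H (cor_comp W Z Y G F) V3 ?L (map (\<lambda>h. \<mu> (h y)) ?L)"
    proof (rule composable_exists[OF M(1,3,4) rL V2(1), of "\<lambda>h. B (h y)" H "\<lambda>h. \<mu> (h y)"])
      fix h assume "h \<in> set ?L"
      then have "h y \<in> Mcarrier Y" using smooth_map_image[OF represented_by_smooth[OF rL] V2(1)] by blast
      then show "h y \<in> B (h y) \<and> represented_by Y X H (B (h y)) (\<mu> (h y))" by (rule \<mu>)
    qed blast
    \<comment> \<open>Associativity of flattening nested lists; this is an equality of lists and not
      merely of germs.\<close>
    have "comp_tuple ?L (map (\<lambda>h. \<mu> (h y)) ?L) = comp_tuple fs (map \<rho> fs)"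
      unfolding \<rho>_def comp_tuple_map by (induction fs) (simp_all add: map_concat o_def)
    then show "\<exists>U V fs. y \<in> U \<and> y \<in> V \<and> represented_by W X (cor_comp W Y X H (cor_comp W Z Y G F)) U fs \<and>
      represented_by W X (cor_comp W Z X (cor_comp Z Y X H G) F) V fs"
      using L(2)[OF V3(2)] R(2)[OF V1(2)] V1(1) V3(1) by metis
  qed
qed

section \<open>Levels and free abelian groups\<close>

lemma SCor_b_level_SCor: "F \<in> SCor_b_level Y X r \<Longrightarrow> F \<in> SCor Y X"
  by (simp add: SCor_b_level_def)

lemma SCor_b_level_mono: assumes "r \<le> s" shows "SCor_b_level Y X r \<subseteq> SCor_b_level Y X s"
proof -
  have "real n \<le> exp s" if "real n \<le> exp r" for n using that assms by (meson exp_le_cancel_iff order_trans)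
  then show ?thesis unfolding SCor_b_level_def by blast
qed

lemma cor_id_level: assumes M: "smooth_manifold Y" shows "cor_id Y \<in> SCor_b_level Y Y 0"
  unfolding SCor_b_level_def mem_Collect_eq
proof (intro conjI ballI exI)
  show "represented_by Y Y (cor_id Y) (Mcarrier Y) [\<lambda>y. y]" by (rule cor_id_represented[OF M])
qed (use cor_id_SCor[OF M] in simp_all)

text \<open>Bounds on the numbers of branches multiply under composition, and the exponential turns
  this into addition of levels.\<close>

lemma cor_comp_level:
  assumes M: "smooth_manifold Z" "smooth_manifold Y" "smooth_manifold X"
    and F: "F \<in> SCor_b_level Z Y s" and G: "G \<in> SCor_b_level Y X r"
  shows "cor_comp Z Y X G F \<in> SCor_b_level Z X (r + s)"
  unfolding SCor_b_level_def mem_Collect_eq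
proof (intro conjI ballI)
  note spec = cor_comp_spec[OF M SCor_b_level_SCor[OF F] SCor_b_level_SCor[OF G]]
  show "cor_comp Z Y X G F \<in> SCor Z X" by (rule spec(1))
  fix y assume "y \<in> Mcarrier Z"
  then obtain U fs where U: "y \<in> U" "represented_by Z Y F U fs" "real (length fs) \<le> exp s"
    using F unfolding SCor_b_level_def by blast
  have "\<forall>x\<in>Mcarrier Y. \<exists>U fs. x \<in> U \<and> represented_by Y X G U fs \<and> real (length fs) \<le> exp r"
    using G unfolding SCor_b_level_def by blast
  then obtain A \<kappa> where \<kappa>: "\<forall>x\<in>Mcarrier Y. x \<in> A x \<and> represented_by Y X G (A x) (\<kappa> x) \<and> real (length (\<kappa> x)) \<le> exp r" by metis
  have fy: "f y \<in> Mcarrier Y" if "f \<in> set fs" for f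
    using smooth_map_image[OF represented_by_smooth[OF U(2) that] U(1)] .
  obtain V where V: "y \<in> V" "composable Z Y X G F V fs (map (\<lambda>f. \<kappa> (f y)) fs)"
  proof (rule composable_exists[OF M U(2,1), of "\<lambda>f. A (f y)" G "\<lambda>f. \<kappa> (f y)"])
    fix f assume "f \<in> set fs"
    from bspec[OF \<kappa> fy[OF this]] show "f y \<in> A (f y) \<and> represented_by Y X G (A (f y)) (\<kappa> (f y))" by blast
  qed blast
  have len: "real (length (comp_tuple gs (map (\<lambda>f. \<kappa> (f y)) gs))) \<le> real (length gs) * exp r"
    if "set gs \<subseteq> set fs" for gs
    using that
  proof (induction gs)
    case (Cons g gs)
    have "real (length (\<kappa> (g y))) \<le> exp r" using \<kappa> fy Cons.prems by simp
    then show ?case using Cons by (simp add: algebra_simps)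
  qed simp
  have "real (length fs) * exp r \<le> exp s * exp r" using U(3) by (intro mult_right_mono) simp_all
  from order_trans[OF len[OF subset_refl] this]
  have "real (length (comp_tuple fs (map (\<lambda>f. \<kappa> (f y)) fs))) \<le> exp (r + s)"
    by (simp only: exp_add mult.commute)
  then show "\<exists>U fs. y \<in> U \<and> represented_by Z X (cor_comp Z Y X G F) U fs \<and> real (length fs) \<le> exp (r + s)"
    using V(1) spec(2)[OF V(2)] by blast
qed

lemma SC_b_level_iff: "a \<in> SC_b_level Y X r \<longleftrightarrow> Poly_Mapping.keys a \<subseteq> SCor_b_level Y X r"
  by (simp add: SC_b_level_def)

lemma SC_b_iff: "a \<in> SC_b Y X \<longleftrightarrow> Poly_Mapping.keys a \<subseteq> SCor_b Y X"
  by (simp add: SC_b_def)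

lemma SC_b_level_SC_b: "SC_b_level Y X r \<subseteq> SC_b Y X"
  unfolding SC_b_level_iff SC_b_iff SCor_b_def subset_iff by blast

lemma SC_b_level_mono:
  assumes "r \<le> s" "a \<in> SC_b_level Y X r"
  shows "a \<in> SC_b_level Y X s"
  using assms(2) SCor_b_level_mono[OF assms(1)] unfolding SC_b_level_iff by (rule subset_trans)

lemma SC_b_level_add: "\<lbrakk>a \<in> SC_b_level Y X r; b \<in> SC_b_level Y X r\<rbrakk> \<Longrightarrow> a + b \<in> SC_b_level Y X r"
  unfolding SC_b_level_iff by (rule subset_trans[OF Poly_Mapping.keys_add Un_least])

lemma SC_b_add: "\<lbrakk>a \<in> SC_b Y X; b \<in> SC_b Y X\<rbrakk> \<Longrightarrow> a + b \<in> SC_b Y X"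
  unfolding SC_b_iff by (rule subset_trans[OF Poly_Mapping.keys_add Un_least])

lemma SC_b_level_zero: "0 \<in> SC_b_level Y X r" by (simp add: SC_b_level_iff)
lemma SC_b_zero: "0 \<in> SC_b Y X" by (simp add: SC_b_iff)
lemma SC_b_level_minus: "a \<in> SC_b_level Y X r \<Longrightarrow> - a \<in> SC_b_level Y X r" by (simp add: SC_b_level_iff)
lemma SC_b_minus: "a \<in> SC_b Y X \<Longrightarrow> - a \<in> SC_b Y X" by (simp add: SC_b_iff)

lemma sc_comp_add_left: "sc_comp Z Y X (b + b') a = sc_comp Z Y X b a + sc_comp Z Y X b' a"
  by (simp add: sc_comp_def frag_extend_add)

lemma frag_extend_fun_add: "frag_extend (\<lambda>x. f x + g x) a = frag_extend f a + frag_extend g a"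
  by (simp add: frag_extend_def frag_cmul_distrib2 sum.distrib)

lemma sc_comp_add_right: "sc_comp Z Y X b (a + a') = sc_comp Z Y X b a + sc_comp Z Y X b a'"
  by (simp add: sc_comp_def frag_extend_add frag_extend_fun_add)

lemma sc_comp_zero_left [simp]: "sc_comp Z Y X 0 a = 0"
  using sc_comp_add_left[of Z Y X 0 0 a] by simp
lemma sc_comp_zero_right [simp]: "sc_comp Z Y X b 0 = 0"
  using sc_comp_add_right[of Z Y X b 0 0] by simp
lemma sc_comp_minus_left: "sc_comp Z Y X (- b) a = - sc_comp Z Y X b a"
  by (rule minus_unique[symmetric]) (simp add: sc_comp_add_left[symmetric])
lemma sc_comp_minus_right: "sc_comp Z Y X b (- a) = - sc_comp Z Y X b a"
  by (rule minus_unique[symmetric]) (simp add: sc_comp_add_right[symmetric])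
lemma sc_comp_diff_left: "sc_comp Z Y X (b - b') a = sc_comp Z Y X b a - sc_comp Z Y X b' a"
  using sc_comp_add_left[of Z Y X b "- b'" a] by (simp add: sc_comp_minus_left)
lemma sc_comp_diff_right: "sc_comp Z Y X b (a - a') = sc_comp Z Y X b a - sc_comp Z Y X b a'"
  using sc_comp_add_right[of Z Y X b a "- a'"] by (simp add: sc_comp_minus_right)
lemma sc_comp_sum_left: "sc_comp Z Y X (\<Sum>i\<in>I. f i) a = (\<Sum>i\<in>I. sc_comp Z Y X (f i) a)"
  by (induction I rule: infinite_finite_induct) (simp_all add: sc_comp_add_left)
lemma sc_comp_sum_right: "sc_comp Z Y X b (\<Sum>i\<in>I. f i) = (\<Sum>i\<in>I. sc_comp Z Y X b (f i))"
  by (induction I rule: infinite_finite_induct) (simp_all add: sc_comp_add_right)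

lemma sc_comp_of: "sc_comp Z Y X (frag_of G) (frag_of F) = frag_of (cor_comp Z Y X G F)"
  by (simp add: sc_comp_def)

lemma frag_induct_in:
  assumes "Poly_Mapping.keys a \<subseteq> S" "P 0" "\<And>x. x \<in> S \<Longrightarrow> P (frag_of x)" "\<And>x y. P x \<Longrightarrow> P y \<Longrightarrow> P (x - y)"
  shows "P a"
  by (rule frag_induction[where P=P, OF assms])

text \<open>The sets of generators are arbitrary, so that one induction covers both a fixed level
  and mere boundedness.\<close>

lemma sc_comp_keys:
  assumes a: "Poly_Mapping.keys a \<subseteq> A" and b: "Poly_Mapping.keys b \<subseteq> B"
    and C: "\<And>F G. \<lbrakk>F \<in> A; G \<in> B\<rbrakk> \<Longrightarrow> cor_comp Z Y X G F \<in> C"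
  shows "Poly_Mapping.keys (sc_comp Z Y X b a) \<subseteq> C"
  using b
proof (rule frag_induct_in)
  fix G assume G: "G \<in> B"
  show "Poly_Mapping.keys (sc_comp Z Y X (frag_of G) a) \<subseteq> C"
    using a
  proof (rule frag_induct_in)
    fix F assume "F \<in> A" then show "Poly_Mapping.keys (sc_comp Z Y X (frag_of G) (frag_of F)) \<subseteq> C"
      using C[OF _ G] by (simp add: sc_comp_of)
  next
    fix x y assume "Poly_Mapping.keys (sc_comp Z Y X (frag_of G) x) \<subseteq> C" "Poly_Mapping.keys (sc_comp Z Y X (frag_of G) y) \<subseteq> C"
    then show "Poly_Mapping.keys (sc_comp Z Y X (frag_of G) (x - y)) \<subseteq> C"
      unfolding sc_comp_diff_right by (rule subset_trans[OF keys_diff Un_least])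
  qed simp
next
  fix x y assume "Poly_Mapping.keys (sc_comp Z Y X x a) \<subseteq> C" "Poly_Mapping.keys (sc_comp Z Y X y a) \<subseteq> C"
  then show "Poly_Mapping.keys (sc_comp Z Y X (x - y) a) \<subseteq> C"
    unfolding sc_comp_diff_left by (rule subset_trans[OF keys_diff Un_least])
qed simp

lemma sc_comp_level:
  assumes M: "smooth_manifold Z" "smooth_manifold Y" "smooth_manifold X"
    and "a \<in> SC_b_level Z Y s" "b \<in> SC_b_level Y X r"
  shows "sc_comp Z Y X b a \<in> SC_b_level Z X (r + s)"
  unfolding SC_b_level_iff
  by (rule sc_comp_keys[OF assms(4,5)[unfolded SC_b_level_iff] cor_comp_level[OF M]])

lemma sc_comp_SC_b:
  assumes M: "smooth_manifold Z" "smooth_manifold Y" "smooth_manifold X"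
    and "a \<in> SC_b Z Y" "b \<in> SC_b Y X"
  shows "sc_comp Z Y X b a \<in> SC_b Z X"
  unfolding SC_b_iff
proof (rule sc_comp_keys[OF assms(4,5)[unfolded SC_b_iff]])
  fix F G assume "F \<in> SCor_b Z Y" "G \<in> SCor_b Y X"
  then obtain r s where "F \<in> SCor_b_level Z Y s" "G \<in> SCor_b_level Y X r" unfolding SCor_b_def by blast
  from cor_comp_level[OF M this] show "cor_comp Z Y X G F \<in> SCor_b Z X" unfolding SCor_b_def by blast
qed

lemma SC_b_keys: assumes "a \<in> SC_b Y X" shows "Poly_Mapping.keys a \<subseteq> SCor Y X"
  using assms unfolding SC_b_iff SCor_b_def SCor_b_level_def by blast

text \<open>Both sides are additive in each argument, so it suffices to compare them on
  generators.\<close>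

lemma sc_comp_assoc:
  assumes M: "smooth_manifold W" "smooth_manifold Z" "smooth_manifold Y" "smooth_manifold X"
    and a: "a \<in> SC_b W Z" and b: "b \<in> SC_b Z Y" and c: "c \<in> SC_b Y X"
  shows "sc_comp W Y X c (sc_comp W Z Y b a) = sc_comp W Z X (sc_comp Z Y X c b) a"
  using SC_b_keys[OF c]
proof (rule frag_induct_in)
  fix H assume H: "H \<in> SCor Y X"
  show "sc_comp W Y X (frag_of H) (sc_comp W Z Y b a) = sc_comp W Z X (sc_comp Z Y X (frag_of H) b) a"
    using SC_b_keys[OF b]
  proof (rule frag_induct_in)
    fix G assume G: "G \<in> SCor Z Y"
    show "sc_comp W Y X (frag_of H) (sc_comp W Z Y (frag_of G) a) = sc_comp W Z X (sc_comp Z Y X (frag_of H) (frag_of G)) a"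
      using SC_b_keys[OF a]
    proof (rule frag_induct_in)
      fix F assume F: "F \<in> SCor W Z"
      show "sc_comp W Y X (frag_of H) (sc_comp W Z Y (frag_of G) (frag_of F)) = sc_comp W Z X (sc_comp Z Y X (frag_of H) (frag_of G)) (frag_of F)"
        by (simp add: sc_comp_of cor_comp_assoc[OF M F G H])
    qed (simp_all add: sc_comp_diff_right)
  qed (simp_all add: sc_comp_diff_left sc_comp_diff_right)
qed (simp_all add: sc_comp_diff_left)

lemma sc_comp_id_left:
  assumes M: "smooth_manifold Z" "smooth_manifold Y" and a: "a \<in> SC_b Z Y"
  shows "sc_comp Z Y Y (frag_of (cor_id Y)) a = a"
  using SC_b_keys[OF a]
  by (rule frag_induct_in) (simp_all add: sc_comp_of cor_comp_id_left[OF M] sc_comp_diff_right)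

lemma sc_comp_id_right:
  assumes M: "smooth_manifold Z" "smooth_manifold Y" and a: "a \<in> SC_b Z Y"
  shows "sc_comp Z Z Y a (frag_of (cor_id Z)) = a"
  using SC_b_keys[OF a]
  by (rule frag_induct_in) (simp_all add: sc_comp_of cor_comp_id_right[OF M] sc_comp_diff_left)

lemma sc_id_level: "smooth_manifold Y \<Longrightarrow> frag_of (cor_id Y) \<in> SC_b_level Y Y 0"
  by (simp add: SC_b_level_iff cor_id_level)

section \<open>The ring of row-finite matrices\<close>

text \<open>The whole complex is part of an index. Two complexes on the same graded object but with
  different differentials thus have disjoint sets of indices, and an entry of a matrix knows its
  source and target.\<close>

datatype 'a idx = Idx "'a cplx" int nat

definition graded :: "'a cplx \<Rightarrow> bool" where
  "graded C \<longleftrightarrow> (\<forall>n. is_aobj (cob C n))"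

primrec label :: "'a idx \<Rightarrow> 'a mfd" where
  "label (Idx C n i) = fst (cob C n ! i)"

primrec weight :: "'a idx \<Rightarrow> real" where
  "weight (Idx C n i) = snd (cob C n ! i)"

primrec valid :: "'a idx \<Rightarrow> bool" where
  "valid (Idx C n i) \<longleftrightarrow> graded C \<and> i < length (cob C n)"

lemma is_aobj_nth: "\<lbrakk>is_aobj P; i < length P\<rbrakk> \<Longrightarrow> connected_symplectic (fst (P ! i))"
  unfolding is_aobj_def using nth_mem by fastforce

lemma valid_smooth: assumes "valid x" shows "smooth_manifold (label x)"
proof -
  obtain C n i where x: "x = Idx C n i" by (cases x) auto
  have "connected_symplectic (label x)"
    using assms is_aobj_nth[of "cob C n" i] by (simp add: x graded_def)
  then show ?thesis by (simp add: connected_symplectic_def symplectic_manifold_def)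
qed

text \<open>Row-finite matrices whose rows and columns are the summands of all graded objects at once: they form
  a ring, in which a family of morphisms of some degree between two complexes is a single element.\<close>

definition is_rmat :: "('a idx \<Rightarrow> 'a idx \<Rightarrow> 'a sc) \<Rightarrow> bool" where
  "is_rmat \<phi> \<longleftrightarrow> (\<forall>x y. \<phi> x y \<noteq> 0 \<longrightarrow> valid x \<and> valid y \<and> \<phi> x y \<in> SC_b (label x) (label y)) \<and>
     (\<forall>x. finite {y. \<phi> x y \<noteq> 0})"

typedef 'a rmat = "{\<phi> :: 'a idx \<Rightarrow> 'a idx \<Rightarrow> 'a sc. is_rmat \<phi>}" morphisms entry Rmat
  by (rule exI[of _ "\<lambda>_ _. 0"]) (simp add: is_rmat_def)

lemma entry_Rmat: "is_rmat \<phi> \<Longrightarrow> entry (Rmat \<phi>) = \<phi>"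
  by (simp add: Rmat_inverse)

lemma is_rmat_entry: "is_rmat (entry a)" using entry[of a] by simp

lemma entry_valid: "entry a x y \<noteq> 0 \<Longrightarrow> valid x \<and> valid y"
  using is_rmat_entry[of a] unfolding is_rmat_def by blast

lemma entry_SC_b: "entry a x y \<in> SC_b (label x) (label y)"
proof (cases "entry a x y = 0")
  case True then show ?thesis by (simp add: SC_b_zero)
next
  case False then show ?thesis using is_rmat_entry[of a] unfolding is_rmat_def by blast
qed

lemma entry_finite: "finite {y. entry a x y \<noteq> 0}"
  using is_rmat_entry[of a] unfolding is_rmat_def by blast

lemma rmat_eqI: "(\<And>x y. entry a x y = entry b x y) \<Longrightarrow> a = b"
  by (simp add: entry_inject[symmetric] fun_eq_iff)

lemma SC_b_sum: "(\<And>i. i \<in> I \<Longrightarrow> f i \<in> SC_b Y X) \<Longrightarrow> (\<Sum>i\<in>I. f i) \<in> SC_b Y X"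
  by (induction I rule: infinite_finite_induct) (auto intro: SC_b_zero SC_b_add)

lemma SC_b_level_sum: "(\<And>i. i \<in> I \<Longrightarrow> f i \<in> SC_b_level Y X r) \<Longrightarrow> (\<Sum>i\<in>I. f i) \<in> SC_b_level Y X r"
  by (induction I rule: infinite_finite_induct) (auto intro: SC_b_level_zero SC_b_level_add)

definition entry_comp :: "'a rmat \<Rightarrow> 'a rmat \<Rightarrow> 'a idx \<Rightarrow> 'a idx \<Rightarrow> 'a idx \<Rightarrow> 'a sc" where
  "entry_comp a b x y z = sc_comp (label x) (label y) (label z) (entry a y z) (entry b x y)"

instantiation rmat :: (type) "{zero, plus, minus, uminus, times}"
begin

definition zero_rmat :: "'a rmat" where "zero_rmat = Rmat (\<lambda>_ _. 0)"
definition plus_rmat :: "'a rmat \<Rightarrow> 'a rmat \<Rightarrow> 'a rmat" where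
  "plus_rmat a b = Rmat (\<lambda>x y. entry a x y + entry b x y)"
definition uminus_rmat :: "'a rmat \<Rightarrow> 'a rmat" where
  "uminus_rmat a = Rmat (\<lambda>x y. - entry a x y)"
definition minus_rmat :: "'a rmat \<Rightarrow> 'a rmat \<Rightarrow> 'a rmat" where
  "minus_rmat a b = a + - b"
definition times_rmat :: "'a rmat \<Rightarrow> 'a rmat \<Rightarrow> 'a rmat" where
  "times_rmat a b = Rmat (\<lambda>x z. \<Sum>y | entry b x y \<noteq> 0. entry_comp a b x y z)"

instance ..

end

lemma entry_zero [simp]: "entry 0 x y = 0"
  unfolding zero_rmat_def by (subst entry_Rmat) (simp_all add: is_rmat_def)

lemma entry_plus [simp]: "entry (a + b) x y = entry a x y + entry b x y"
proof -
  have "finite {y. entry a x y + entry b x y \<noteq> 0}" for x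
    by (rule finite_subset[OF _ finite_UnI[OF entry_finite[of a x] entry_finite[of b x]]]) auto
  moreover have "valid x \<and> valid y" if "entry a x y + entry b x y \<noteq> 0" for x y
  proof (cases "entry a x y = 0")
    case True then show ?thesis using that entry_valid[of b x y] by simp
  qed (rule entry_valid)
  ultimately have "is_rmat (\<lambda>x y. entry a x y + entry b x y)"
    unfolding is_rmat_def using SC_b_add[OF entry_SC_b[of a] entry_SC_b[of b]] by blast
  then show ?thesis unfolding plus_rmat_def by (simp add: entry_Rmat)
qed

lemma entry_uminus [simp]: "entry (- a) x y = - entry a x y"
proof -
  have "is_rmat (\<lambda>x y. - entry a x y)"
    unfolding is_rmat_def using SC_b_minus[OF entry_SC_b[of a]] entry_valid[of a] entry_finite[of a] by simp
  then show ?thesis unfolding uminus_rmat_def by (simp add: entry_Rmat)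
qed

lemma entry_minus [simp]: "entry (a - b) x y = entry a x y - entry b x y"
  by (simp add: minus_rmat_def)

lemma entry_comp_zero: "entry a y z = 0 \<Longrightarrow> entry_comp a b x y z = 0" "entry b x y = 0 \<Longrightarrow> entry_comp a b x y z = 0"
  by (simp_all add: entry_comp_def)

lemma entry_comp_SC_b: "entry_comp a b x y z \<in> SC_b (label x) (label z)"
proof (cases "entry a y z = 0 \<or> entry b x y = 0")
  case True then show ?thesis using entry_comp_zero SC_b_zero by metis
next
  case False
  then have "valid x" "valid y" "valid z" using entry_valid by blast+
  then show ?thesis unfolding entry_comp_def by (intro sc_comp_SC_b valid_smooth entry_SC_b)
qed

text \<open>Rows index sources, and the product is a after b. Row finiteness of b makes the sum
  finite, and each row of the product is supported in a finite union of rows of a.\<close>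

lemma entry_times_def: "entry (a * b) x z = (\<Sum>y | entry b x y \<noteq> 0. entry_comp a b x y z)"
proof -
  let ?\<phi> = "\<lambda>x z. \<Sum>y | entry b x y \<noteq> 0. entry_comp a b x y z"
  have nz: "\<exists>y. entry b x y \<noteq> 0 \<and> entry a y z \<noteq> 0" if "?\<phi> x z \<noteq> 0" for x z
  proof (rule ccontr)
    assume "\<not> ?thesis"
    then have "?\<phi> x z = 0" by (intro sum.neutral) (auto intro: entry_comp_zero)
    with that show False by simp
  qed
  have "finite {z. ?\<phi> x z \<noteq> 0}" for x
    by (rule finite_subset[of _ "\<Union>y\<in>{y. entry b x y \<noteq> 0}. {z. entry a y z \<noteq> 0}"])
       (use nz entry_finite[of b] entry_finite[of a] in auto)
  moreover have "valid x \<and> valid z" if "?\<phi> x z \<noteq> 0" for x z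
    using nz[OF that] entry_valid by blast
  moreover have "?\<phi> x z \<in> SC_b (label x) (label z)" for x z by (intro SC_b_sum entry_comp_SC_b)
  ultimately have "is_rmat ?\<phi>" unfolding is_rmat_def by blast
  then show ?thesis unfolding times_rmat_def by (simp add: entry_Rmat)
qed

lemma entry_times_nonzero:
  assumes "entry (a * b) x z \<noteq> 0"
  shows "\<exists>y. entry b x y \<noteq> 0 \<and> entry a y z \<noteq> 0"
proof (rule ccontr)
  assume "\<not> ?thesis"
  then have "entry (a * b) x z = 0"
    unfolding entry_times_def by (intro sum.neutral) (auto intro: entry_comp_zero)
  with assms show False by simp
qed

text \<open>Lets the sum run over any finite set containing the contributing indices, for instance
  all summands in one degree.\<close>

lemma entry_times:
  assumes "finite S" "\<And>y. entry b x y \<noteq> 0 \<Longrightarrow> entry a y z \<noteq> 0 \<Longrightarrow> y \<in> S"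
  shows "entry (a * b) x z = (\<Sum>y\<in>S. entry_comp a b x y z)"
proof -
  have "entry (a * b) x z = (\<Sum>y\<in>{y. entry b x y \<noteq> 0} \<union> S. entry_comp a b x y z)"
    unfolding entry_times_def
    by (rule sum.mono_neutral_left) (use assms(1) entry_finite[of b] in \<open>auto intro: entry_comp_zero\<close>)
  also have "\<dots> = (\<Sum>y\<in>S. entry_comp a b x y z)"
  proof (rule sum.mono_neutral_right)
    show "\<forall>y\<in>({y. entry b x y \<noteq> 0} \<union> S) - S. entry_comp a b x y z = 0"
    proof
      fix y assume y: "y \<in> ({y. entry b x y \<noteq> 0} \<union> S) - S"
      show "entry_comp a b x y z = 0"
      proof (cases "entry a y z = 0")
        case False then show ?thesis using y assms(2)[of y] by auto
      qed (rule entry_comp_zero)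
    qed
  qed (use assms(1) entry_finite[of b] in auto)
  finally show ?thesis .
qed

instance rmat :: (type) ring
proof
  fix a b c :: "'a rmat"
  show "a + b + c = a + (b + c)" by (rule rmat_eqI) (simp add: add.assoc)
  show "a + b = b + a" by (rule rmat_eqI) (simp add: add.commute)
  show "0 + a = a" by (rule rmat_eqI) simp
  show "- a + a = 0" by (rule rmat_eqI) simp
  show "a - b = a + - b" by (simp add: minus_rmat_def)
  show "(a + b) * c = a * c + b * c"
    by (rule rmat_eqI) (simp add: entry_times_def entry_comp_def sc_comp_add_left sum.distrib)
  show "a * (b + c) = a * b + a * c"
  proof (rule rmat_eqI)
    fix x z
    let ?S = "{y. entry b x y \<noteq> 0} \<union> {y. entry c x y \<noteq> 0}"
    have S: "finite ?S" using entry_finite[of b] entry_finite[of c] by blast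
    have "entry (a * (b + c)) x z = (\<Sum>y\<in>?S. entry_comp a (b + c) x y z)" by (rule entry_times[OF S]) auto
    also have "\<dots> = (\<Sum>y\<in>?S. entry_comp a b x y z) + (\<Sum>y\<in>?S. entry_comp a c x y z)"
      by (simp add: entry_comp_def sc_comp_add_right sum.distrib)
    also have "(\<Sum>y\<in>?S. entry_comp a b x y z) = entry (a * b) x z" by (rule entry_times[OF S, symmetric]) auto
    also have "(\<Sum>y\<in>?S. entry_comp a c x y z) = entry (a * c) x z" by (rule entry_times[OF S, symmetric]) auto
    finally show "entry (a * (b + c)) x z = entry (a * b + a * c) x z" by simp
  qed
  show "a * b * c = a * (b * c)"
  proof (rule rmat_eqI)
    fix x w
    let ?S = "{y. entry c x y \<noteq> 0}"
    \<comment> \<open>The indices reached from x in two steps. The set is finite and does not depend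
      on the middle index, so the double sum can be exchanged.\<close>
    let ?T = "\<Union>y\<in>?S. {z. entry b y z \<noteq> 0}"
    have S: "finite ?S" by (rule entry_finite)
    then have T: "finite ?T" by (intro finite_UN_I entry_finite)
    have "entry (a * b * c) x w = (\<Sum>y\<in>?S. sc_comp (label x) (label y) (label w) (\<Sum>z\<in>?T. entry_comp a b y z w) (entry c x y))"
      unfolding entry_times_def[of "a * b" c] entry_comp_def[of "a * b" c]
      by (intro sum.cong refl arg_cong2[where f="sc_comp _ _ _"] entry_times[OF T]) auto
    also have "\<dots> = (\<Sum>y\<in>?S. \<Sum>z\<in>?T. sc_comp (label x) (label y) (label w) (entry_comp a b y z w) (entry c x y))"
      by (simp add: sc_comp_sum_left)
    also have "\<dots> = (\<Sum>z\<in>?T. \<Sum>y\<in>?S. sc_comp (label x) (label y) (label w) (entry_comp a b y z w) (entry c x y))"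
      by (rule sum.swap)
    also have "\<dots> = (\<Sum>z\<in>?T. \<Sum>y\<in>?S. sc_comp (label x) (label z) (label w) (entry a z w) (entry_comp b c x y z))"
    proof (intro sum.cong refl)
      fix y z
      show "sc_comp (label x) (label y) (label w) (entry_comp a b y z w) (entry c x y) =
        sc_comp (label x) (label z) (label w) (entry a z w) (entry_comp b c x y z)"
      \<comment> \<open>\<open>sc_comp_assoc\<close> asks for smooth manifolds, which is known for
        the labels of valid indices; every term with an invalid index vanishes.\<close>
      proof (cases "entry a z w = 0 \<or> entry b y z = 0 \<or> entry c x y = 0")
        case True then show ?thesis by (auto simp: entry_comp_def)
      next
        case False
        then have "valid x" "valid y" "valid z" "valid w" using entry_valid by blast+
        then show ?thesis unfolding entry_comp_def
          by (intro sc_comp_assoc[symmetric] valid_smooth entry_SC_b)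
      qed
    qed
    also have "\<dots> = (\<Sum>z\<in>?T. sc_comp (label x) (label z) (label w) (entry a z w) (entry (b * c) x z))"
      by (simp add: sc_comp_sum_right entry_times_def)
    also have "\<dots> = entry (a * (b * c)) x w"
    proof (rule entry_times[OF T, symmetric, unfolded entry_comp_def])
      fix z assume "entry (b * c) x z \<noteq> 0"
      from entry_times_nonzero[OF this] show "z \<in> ?T" by blast
    qed
    finally show "entry (a * b * c) x w = entry (a * (b * c)) x w" .
  qed
qed

text \<open>A label-preserving partial injection \<open>\<tau>\<close> of summands, with partial inverse \<open>\<tau>'\<close>, gives a matrix of identities.\<close>

definition matching :: "('a idx \<Rightarrow> 'a idx option) \<Rightarrow> ('a idx \<Rightarrow> 'a idx option) \<Rightarrow> bool" where
  "matching \<tau> \<tau>' \<longleftrightarrow> (\<forall>x y. \<tau> x = Some y \<longleftrightarrow> \<tau>' y = Some x) \<and>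
     (\<forall>x y. \<tau> x = Some y \<longrightarrow> valid x \<and> valid y \<and> label x = label y)"

definition delta :: "('a idx \<Rightarrow> 'a idx option) \<Rightarrow> 'a rmat" where
  "delta \<tau> = Rmat (\<lambda>x y. if \<tau> x = Some y then frag_of (cor_id (label x)) else 0)"

lemma matching_sym: "matching \<tau> \<tau>' \<Longrightarrow> matching \<tau>' \<tau>"
  unfolding matching_def by metis

lemma matchingD: "matching \<tau> \<tau>' \<Longrightarrow> \<tau> x = Some y \<Longrightarrow> valid x \<and> valid y \<and> label x = label y"
  unfolding matching_def by blast

lemma matching_iff: "matching \<tau> \<tau>' \<Longrightarrow> \<tau> x = Some y \<longleftrightarrow> \<tau>' y = Some x"
  unfolding matching_def by blast

lemma entry_delta:
  assumes m: "matching \<tau> \<tau>'"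
  shows "entry (delta \<tau>) x y = (if \<tau> x = Some y then frag_of (cor_id (label x)) else 0)"
proof -
  have "finite {y. (if \<tau> x = Some y then frag_of (cor_id (label x)) else 0) \<noteq> 0}" for x
    by (rule finite_subset[of _ "set_option (\<tau> x)"]) (auto split: if_splits)
  moreover have "frag_of (cor_id (label x)) \<in> SC_b (label x) (label y)" if xy: "\<tau> x = Some y" for x y
  proof -
    have v: "valid x" "label y = label x" using matchingD[OF m xy] by simp_all
    show ?thesis unfolding v(2) by (rule subsetD[OF SC_b_level_SC_b sc_id_level[OF valid_smooth[OF v(1)]]])
  qed
  ultimately have "is_rmat (\<lambda>x y. if \<tau> x = Some y then frag_of (cor_id (label x)) else 0)"
    unfolding is_rmat_def using matchingD[OF m] by auto
  then show ?thesis unfolding delta_def by (simp add: entry_Rmat)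
qed

text \<open>By the unit laws of composition, multiplying with such a matrix only relabels entries,
  so identities between structure maps become case distinctions on indices.\<close>

lemma entry_times_delta:
  assumes m: "matching \<tau> \<tau>'"
  shows "entry (a * delta \<tau>) x z = (case \<tau> x of None \<Rightarrow> 0 | Some y \<Rightarrow> entry a y z)"
proof (cases "\<tau> x")
  case None
  then have "entry (a * delta \<tau>) x z = (\<Sum>y\<in>{}. entry_comp a (delta \<tau>) x y z)"
    by (intro entry_times) (auto simp: entry_delta[OF m])
  then show ?thesis using None by simp
next
  case (Some y)
  have "entry (a * delta \<tau>) x z = (\<Sum>y\<in>{y}. entry_comp a (delta \<tau>) x y z)"
    by (rule entry_times) (use Some in \<open>auto simp: entry_delta[OF m] split: if_splits\<close>)
  also have "\<dots> = entry a y z"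
  proof (cases "entry a y z = 0")
    case False
    have l: "label y = label x" "valid x" using matchingD[OF m Some] by auto
    show ?thesis
      using sc_comp_id_right[OF valid_smooth[OF l(2)] valid_smooth entry_SC_b[of a y z, unfolded l(1)]] entry_valid[OF False] Some
      by (simp add: entry_comp_def entry_delta[OF m] l(1))
  qed (simp add: entry_comp_def)
  finally show ?thesis using Some by simp
qed

lemma entry_delta_times:
  assumes m: "matching \<tau> \<tau>'"
  shows "entry (delta \<tau> * b) x z = (case \<tau>' z of None \<Rightarrow> 0 | Some y \<Rightarrow> entry b x y)"
proof (cases "\<tau>' z")
  case None
  then have "entry (delta \<tau> * b) x z = (\<Sum>y\<in>{}. entry_comp (delta \<tau>) b x y z)"
    by (intro entry_times) (auto simp: entry_delta[OF m] matching_iff[OF m])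
  then show ?thesis using None by simp
next
  case (Some y)
  then have y: "\<tau> y = Some z" using matching_iff[OF m] by blast
  have "entry (delta \<tau> * b) x z = (\<Sum>y\<in>{y}. entry_comp (delta \<tau>) b x y z)"
    by (rule entry_times) (use Some in \<open>auto simp: entry_delta[OF m] matching_iff[OF m] split: if_splits\<close>)
  also have "\<dots> = entry b x y"
  proof (cases "entry b x y = 0")
    case False
    have l: "label z = label y" "valid y" using matchingD[OF m y] by auto
    show ?thesis
      using sc_comp_id_left[OF valid_smooth valid_smooth[OF l(2)] entry_SC_b[of b x y]] entry_valid[OF False] y
      by (simp add: entry_comp_def entry_delta[OF m] l(1))
  qed (simp add: entry_comp_def)
  finally show ?thesis using Some by simp
qed

section \<open>Matrices of fixed degree and level between two complexes\<close>

primrec cx :: "'a idx \<Rightarrow> 'a cplx" where "cx (Idx C n i) = C"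
primrec dg :: "'a idx \<Rightarrow> int" where "dg (Idx C n i) = n"
primrec ps :: "'a idx \<Rightarrow> nat" where "ps (Idx C n i) = i"

definition supported :: "int \<Rightarrow> 'a cplx \<Rightarrow> 'a cplx \<Rightarrow> 'a rmat set" where
  "supported k C K = {a. \<forall>x y. entry a x y \<noteq> 0 \<longrightarrow> cx x = C \<and> cx y = K \<and> dg y = dg x + k}"

definition lev :: "real \<Rightarrow> int \<Rightarrow> 'a cplx \<Rightarrow> 'a cplx \<Rightarrow> 'a rmat set" where
  "lev r k C K = {a \<in> supported k C K. \<forall>x y. entry a x y \<in> SC_b_level (label x) (label y) (r + weight x - weight y)}"

definition families :: "int \<Rightarrow> 'a cplx \<Rightarrow> 'a cplx \<Rightarrow> 'a cmap set" where
  "families k C K = {F. \<forall>n. F n \<in> ahom (cob C n) (cob K (n + k))}"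

definition fam :: "int \<Rightarrow> 'a cplx \<Rightarrow> 'a cplx \<Rightarrow> 'a rmat \<Rightarrow> 'a cmap" where
  "fam k C K a = (\<lambda>n i j. entry a (Idx C n i) (Idx K (n + k) j))"

definition mx :: "int \<Rightarrow> 'a cplx \<Rightarrow> 'a cplx \<Rightarrow> 'a cmap \<Rightarrow> 'a rmat" where
  "mx k C K F = Rmat (\<lambda>x y. if cx x = C \<and> cx y = K \<and> dg y = dg x + k then F (dg x) (ps x) (ps y) else 0)"

lemma supportedD: "\<lbrakk>a \<in> supported k C K; entry a x y \<noteq> 0\<rbrakk> \<Longrightarrow> cx x = C \<and> cx y = K \<and> dg y = dg x + k"
  unfolding supported_def by blast

lemma lev_supported: "a \<in> lev r k C K \<Longrightarrow> a \<in> supported k C K" by (simp add: lev_def)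

lemma lev_entry: "a \<in> lev r k C K \<Longrightarrow> entry a x y \<in> SC_b_level (label x) (label y) (r + weight x - weight y)"
  by (simp add: lev_def)

lemma supported_times:
  assumes "b \<in> supported l K N" "a \<in> supported k C K" shows "b * a \<in> supported (k + l) C N"
  unfolding supported_def mem_Collect_eq
proof (intro allI impI)
  fix x z assume "entry (b * a) x z \<noteq> 0"
  then obtain y where "entry a x y \<noteq> 0" "entry b y z \<noteq> 0" using entry_times_nonzero by blast
  with supportedD[OF assms(2) this(1)] supportedD[OF assms(1) this(2)]
  show "cx x = C \<and> cx z = N \<and> dg z = dg x + (k + l)" by simp
qed

lemma lev_zero: "0 \<in> lev r k C K" by (simp add: lev_def supported_def SC_b_level_zero)

lemma supported_add: "a \<in> supported k C K \<Longrightarrow> b \<in> supported k C K \<Longrightarrow> a + b \<in> supported k C K"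
  unfolding supported_def mem_Collect_eq
proof (intro allI impI)
  fix x y
  assume a: "\<forall>x y. entry a x y \<noteq> 0 \<longrightarrow> cx x = C \<and> cx y = K \<and> dg y = dg x + k"
    and b: "\<forall>x y. entry b x y \<noteq> 0 \<longrightarrow> cx x = C \<and> cx y = K \<and> dg y = dg x + k"
    and "entry (a + b) x y \<noteq> 0"
  then have "entry a x y \<noteq> 0 \<or> entry b x y \<noteq> 0" by auto
  then show "cx x = C \<and> cx y = K \<and> dg y = dg x + k" using a[rule_format, of x y] b[rule_format, of x y] by blast
qed

lemma supported_minus: "a \<in> supported k C K \<Longrightarrow> - a \<in> supported k C K"
  by (simp add: supported_def)

lemma lev_add: "a \<in> lev r k C K \<Longrightarrow> b \<in> lev r k C K \<Longrightarrow> a + b \<in> lev r k C K"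
  unfolding lev_def by (simp add: supported_add SC_b_level_add)

lemma lev_minus: "a \<in> lev r k C K \<Longrightarrow> - a \<in> lev r k C K"
  unfolding lev_def by (simp add: supported_minus SC_b_level_minus)

lemma lev_mono: "r \<le> s \<Longrightarrow> a \<in> lev r k C K \<Longrightarrow> a \<in> lev s k C K"
  unfolding lev_def mem_Collect_eq
proof (elim conjE, intro conjI allI)
  fix x y assume "r \<le> s" "\<forall>x y. entry a x y \<in> SC_b_level (label x) (label y) (r + weight x - weight y)"
  then show "entry a x y \<in> SC_b_level (label x) (label y) (s + weight x - weight y)"
    using SC_b_level_mono[of "r + weight x - weight y" "s + weight x - weight y" "entry a x y"] by simp
qed

text \<open>The weight of the middle index cancels when the bounds of the two factors are
  added.\<close>

lemma lev_times:
  assumes "b \<in> lev r k K N" "a \<in> lev s l C K" shows "b * a \<in> lev (r + s) (k + l) C N"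
proof -
  have "entry_comp b a x y z \<in> SC_b_level (label x) (label z) (r + s + weight x - weight z)" for x y z
  proof (cases "entry b y z = 0 \<or> entry a x y = 0")
    case True then show ?thesis using entry_comp_zero SC_b_level_zero by metis
  next
    case False
    then have v: "valid x" "valid y" "valid z" using entry_valid by blast+
    from sc_comp_level[OF valid_smooth[OF v(1)] valid_smooth[OF v(2)] valid_smooth[OF v(3)]
        lev_entry[OF assms(2)] lev_entry[OF assms(1)]]
    show ?thesis by (simp add: entry_comp_def algebra_simps)
  qed
  then have "entry (b * a) x z \<in> SC_b_level (label x) (label z) (r + s + weight x - weight z)" for x z
    unfolding entry_times_def by (intro SC_b_level_sum)
  then show ?thesis
    using supported_times[OF lev_supported[OF assms(1)] lev_supported[OF assms(2)]]
    by (simp add: lev_def add.commute)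
qed

lemma fam_families:
  assumes "graded C" "graded K" shows "fam k C K a \<in> families k C K"
  unfolding families_def ahom_def amat_supp_def mem_Collect_eq
proof (intro allI conjI impI)
  fix n i j
  show "fam k C K a n i j = 0" if "\<not> (i < length (cob C n) \<and> j < length (cob K (n + k)))"
    using entry_valid[of a "Idx C n i" "Idx K (n + k) j"] that by (auto simp: fam_def)
  show "fam k C K a n i j \<in> SC_b (fst (cob C n ! i)) (fst (cob K (n + k) ! j))"
    using entry_SC_b[of a "Idx C n i" "Idx K (n + k) j"] by (simp add: fam_def)
qed

lemma entry_mx:
  assumes g: "graded C" "graded K" and F: "F \<in> families k C K"
  shows "entry (mx k C K F) x y = (if cx x = C \<and> cx y = K \<and> dg y = dg x + k then F (dg x) (ps x) (ps y) else 0)"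
proof -
  let ?\<phi> = "\<lambda>x y. if cx x = C \<and> cx y = K \<and> dg y = dg x + k then F (dg x) (ps x) (ps y) else 0"
  have F: "amat_supp (cob C n) (cob K (n + k)) (F n)"
    "\<And>i j. \<lbrakk>i < length (cob C n); j < length (cob K (n + k))\<rbrakk> \<Longrightarrow> F n i j \<in> SC_b (fst (cob C n ! i)) (fst (cob K (n + k) ! j))" for n
    using F unfolding families_def ahom_def by auto
  \<comment> \<open>Outside the ranges of summands the family vanishes by \<open>amat_supp\<close>;
    this gives both validity of indices and finiteness of rows.\<close>
  have nz: "\<exists>n i j. x = Idx C n i \<and> y = Idx K (n + k) j \<and> i < length (cob C n) \<and> j < length (cob K (n + k))"
    if "?\<phi> x y \<noteq> 0" for x y
  proof -
    obtain A n i B m j where xy: "x = Idx A n i" "y = Idx B m j" by (cases x; cases y)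
    with that F(1)[of n] show ?thesis unfolding amat_supp_def by (auto split: if_splits)
  qed
  have fin: "finite {y. ?\<phi> x y \<noteq> 0}" for x
  proof (rule finite_subset)
    show "{y. ?\<phi> x y \<noteq> 0} \<subseteq> Idx K (dg x + k) ` {..<length (cob K (dg x + k))}" using nz by fastforce
  qed simp
  have "valid x \<and> valid y \<and> ?\<phi> x y \<in> SC_b (label x) (label y)" if xy: "?\<phi> x y \<noteq> 0" for x y
  proof -
    obtain n i j where "x = Idx C n i" "y = Idx K (n + k) j" "i < length (cob C n)" "j < length (cob K (n + k))"
      using nz[OF xy] by blast
    then show ?thesis using g F(2)[of i n j] by simp
  qed
  then have "is_rmat ?\<phi>" unfolding is_rmat_def using fin by blast
  then show ?thesis unfolding mx_def by (simp add: entry_Rmat)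
qed

lemma fam_mx: "\<lbrakk>graded C; graded K; F \<in> families k C K\<rbrakk> \<Longrightarrow> fam k C K (mx k C K F) = F"
  by (simp add: fam_def entry_mx fun_eq_iff)

lemma mx_supported: "\<lbrakk>graded C; graded K; F \<in> families k C K\<rbrakk> \<Longrightarrow> mx k C K F \<in> supported k C K"
  by (auto simp: supported_def entry_mx split: if_splits)

lemma fam_inj:
  assumes "a \<in> supported k C K" "b \<in> supported k C K" "fam k C K a = fam k C K b" shows "a = b"
proof (rule rmat_eqI)
  fix x y
  show "entry a x y = entry b x y"
  proof (cases "cx x = C \<and> cx y = K \<and> dg y = dg x + k")
    case True
    then obtain n i j where "x = Idx C n i" "y = Idx K (n + k) j" by (cases x; cases y) auto
    then show ?thesis using fun_cong[OF fun_cong[OF fun_cong[OF assms(3)]], of n i j] by (simp add: fam_def)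
  next
    case False
    then have "entry a x y = 0" "entry b x y = 0" using supportedD[OF assms(1)] supportedD[OF assms(2)] by blast+
    then show ?thesis by simp
  qed
qed

lemma fam_level_iff:
  assumes g: "graded C" "graded K" and a: "a \<in> supported k C K"
  shows "a \<in> lev r k C K \<longleftrightarrow> (\<forall>n. fam k C K a n \<in> ahom_level (cob C n) (cob K (n + k)) r)"
proof
  assume "a \<in> lev r k C K"
  then have e: "entry a x y \<in> SC_b_level (label x) (label y) (r + weight x - weight y)" for x y by (rule lev_entry)
  show "\<forall>n. fam k C K a n \<in> ahom_level (cob C n) (cob K (n + k)) r"
  proof
    fix n
    have "fam k C K a n \<in> ahom (cob C n) (cob K (n + k))" using fam_families[OF g, of k a] unfolding families_def by blast
    then show "fam k C K a n \<in> ahom_level (cob C n) (cob K (n + k)) r"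
      using e[of "Idx C n _" "Idx K (n + k) _"] unfolding ahom_def ahom_level_def by (simp add: fam_def)
  qed
next
  assume f: "\<forall>n. fam k C K a n \<in> ahom_level (cob C n) (cob K (n + k)) r"
  have "entry a x y \<in> SC_b_level (label x) (label y) (r + weight x - weight y)" for x y
  proof (cases "entry a x y = 0")
    case False
    from supportedD[OF a this] obtain n i j where xy: "x = Idx C n i" "y = Idx K (n + k) j" by (cases x; cases y) auto
    with entry_valid[OF False] have "i < length (cob C n)" "j < length (cob K (n + k))" by auto
    then show ?thesis using f[rule_format, of n] unfolding ahom_level_def xy by (simp add: fam_def)
  qed (simp add: SC_b_level_zero)
  then show "a \<in> lev r k C K" using a by (simp add: lev_def)
qed

text \<open>From a summand of C in degree n the matrix a reaches only summands of K in degree n + k,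
  so the product in the ring restricts to the matrix product of \<open>acomp\<close>.\<close>

lemma fam_times:
  assumes a: "a \<in> supported k C K" and g: "graded K"
  shows "fam (k + l) C N (b * a) n =
    acomp (cob C n) (cob K (n + k)) (cob N (n + k + l)) (fam l K N b (n + k)) (fam k C K a n)"
proof (intro ext)
  fix i j
  let ?x = "Idx C n i" and ?z = "Idx N (n + k + l) j"
  let ?R = "acomp (cob C n) (cob K (n + k)) (cob N (n + k + l)) (fam l K N b (n + k)) (fam k C K a n) i j"
  have l: "fam (k + l) C N (b * a) n i j = entry (b * a) ?x ?z" by (simp add: fam_def add.assoc)
  show "fam (k + l) C N (b * a) n i j = ?R"
  proof (cases "i < length (cob C n) \<and> j < length (cob N (n + k + l))")
    case False
    then have "entry (b * a) ?x ?z = 0" using entry_valid[of "b * a" ?x ?z] by auto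
    then show ?thesis using False l by (auto simp: acomp_def)
  next
    case True
    have "entry (b * a) ?x ?z = (\<Sum>y\<in>Idx K (n + k) ` {..<length (cob K (n + k))}. entry_comp b a ?x y ?z)"
    proof (rule entry_times)
      fix y assume y: "entry a ?x y \<noteq> 0"
      obtain B m q where "y = Idx B m q" by (cases y)
      with supportedD[OF a y] entry_valid[OF y] show "y \<in> Idx K (n + k) ` {..<length (cob K (n + k))}" by auto
    qed simp
    also have "\<dots> = (\<Sum>q<length (cob K (n + k)). entry_comp b a ?x (Idx K (n + k) q) ?z)"
      by (subst sum.reindex) (auto simp: inj_on_def)
    also have "\<dots> = ?R" using True by (simp add: acomp_def entry_comp_def fam_def add.assoc)
    finally show ?thesis using l by simp
  qed
qed

text \<open>One family covers units, shifts, translations and both inclusions into a cone; a nonzero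
  \<open>off\<close> occurs only for the second summand of a cone.\<close>

definition emb :: "'a cplx \<Rightarrow> int \<Rightarrow> (int \<Rightarrow> nat) \<Rightarrow> 'a cplx \<Rightarrow> 'a idx \<Rightarrow> 'a idx option" where
  "emb C k off K x = (if cx x = C \<and> valid x \<and> graded K then Some (Idx K (dg x + k) (ps x + off (dg x))) else None)"

definition emb' :: "'a cplx \<Rightarrow> int \<Rightarrow> (int \<Rightarrow> nat) \<Rightarrow> 'a cplx \<Rightarrow> 'a idx \<Rightarrow> 'a idx option" where
  "emb' C k off K y = (let m = dg y - k in if cx y = K \<and> graded C \<and> graded K \<and> off m \<le> ps y \<and> ps y - off m < length (cob C m)
     then Some (Idx C m (ps y - off m)) else None)"

text \<open>The number r is the common change of weight, and hence the level of the
  embedding.\<close>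

definition embeds :: "'a cplx \<Rightarrow> int \<Rightarrow> (int \<Rightarrow> nat) \<Rightarrow> 'a cplx \<Rightarrow> real \<Rightarrow> bool" where
  "embeds C k off K r \<longleftrightarrow> (\<forall>n i. i < length (cob C n) \<longrightarrow> i + off n < length (cob K (n + k)) \<and>
     fst (cob K (n + k) ! (i + off n)) = fst (cob C n ! i) \<and> snd (cob K (n + k) ! (i + off n)) = snd (cob C n ! i) + r)"

lemma emb_iff: "emb C k off K x = Some y \<longleftrightarrow> emb' C k off K y = Some x"
  by (cases x; cases y) (auto simp: emb_def emb'_def Let_def)

lemma emb_matching:
  assumes "embeds C k off K r" shows "matching (emb C k off K) (emb' C k off K)"
  unfolding matching_def
proof (intro conjI allI impI)
  fix x y
  show "(emb C k off K x = Some y) = (emb' C k off K y = Some x)" by (rule emb_iff)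
  assume "emb C k off K x = Some y"
  then have "valid x \<and> valid y \<and> label x = label y"
    using assms by (cases x) (auto simp: emb_def embeds_def split: if_splits)
  then show "valid x" "valid y" "label x = label y" by auto
qed

lemma emb_weight: "\<lbrakk>embeds C k off K r; emb C k off K x = Some y\<rbrakk> \<Longrightarrow> weight y = weight x + r"
  by (cases x) (auto simp: emb_def embeds_def split: if_splits)

lemma delta_lev:
  assumes m: "matching \<tau> \<tau>'" and t: "\<And>x y. \<tau> x = Some y \<Longrightarrow> cx x = C \<and> cx y = K \<and> dg y = dg x + k \<and> weight y = weight x + r"
  shows "delta \<tau> \<in> lev r k C K"
proof -
  have "entry (delta \<tau>) x y \<in> SC_b_level (label x) (label y) (r + weight x - weight y)" for x y
  proof (cases "\<tau> x = Some y")
    case True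
    then have "valid x" "label y = label x" using matchingD[OF m] by auto
    then show ?thesis using True t[OF True] sc_id_level[OF valid_smooth, of x] by (simp add: entry_delta[OF m])
  qed (simp add: entry_delta[OF m] SC_b_level_zero)
  moreover have "delta \<tau> \<in> supported k C K"
    using t by (auto simp: supported_def entry_delta[OF m] split: if_splits)
  ultimately show ?thesis by (simp add: lev_def)
qed

lemma emb_lev:
  assumes e: "embeds C k off K r"
  shows "delta (emb C k off K) \<in> lev r k C K" "delta (emb' C k off K) \<in> lev (- r) (- k) K C"
proof -
  have *: "cx x = C \<and> cx y = K \<and> dg y = dg x + k \<and> weight y = weight x + r" if "emb C k off K x = Some y" for x y
    using that emb_weight[OF e that] by (auto simp: emb_def split: if_splits)
  show "delta (emb C k off K) \<in> lev r k C K" by (rule delta_lev[OF emb_matching[OF e] *])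
  show "delta (emb' C k off K) \<in> lev (- r) (- k) K C"
  proof (rule delta_lev[OF matching_sym[OF emb_matching[OF e]]])
    fix x y assume "emb' C k off K x = Some y"
    then have "emb C k off K y = Some x" using emb_iff by metis
    from *[OF this] show "cx x = K \<and> cx y = C \<and> dg y = dg x + - k \<and> weight y = weight x + - r" by simp
  qed
qed

lemma entry_emb_simps:
  assumes e: "embeds C k off K r"
  shows "entry (a * delta (emb C k off K)) x z = (case emb C k off K x of None \<Rightarrow> 0 | Some y \<Rightarrow> entry a y z)"
    "entry (a * delta (emb' C k off K)) x z = (case emb' C k off K x of None \<Rightarrow> 0 | Some y \<Rightarrow> entry a y z)"
    "entry (delta (emb C k off K) * a) x z = (case emb' C k off K z of None \<Rightarrow> 0 | Some y \<Rightarrow> entry a x y)"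
    "entry (delta (emb' C k off K) * a) x z = (case emb C k off K z of None \<Rightarrow> 0 | Some y \<Rightarrow> entry a x y)"
    "entry (delta (emb C k off K)) x z = (if emb C k off K x = Some z then frag_of (cor_id (label x)) else 0)"
    "entry (delta (emb' C k off K)) x z = (if emb' C k off K x = Some z then frag_of (cor_id (label x)) else 0)"
  using entry_times_delta[OF emb_matching[OF e]] entry_times_delta[OF matching_sym[OF emb_matching[OF e]]]
    entry_delta_times[OF emb_matching[OF e]] entry_delta_times[OF matching_sym[OF emb_matching[OF e]]]
    entry_delta[OF emb_matching[OF e]] entry_delta[OF matching_sym[OF emb_matching[OF e]]] by blast+

definition unit_el :: "'a cplx \<Rightarrow> 'a rmat" where "unit_el C = delta (emb C 0 (\<lambda>_. 0) C)"

lemma embeds_self: "embeds C 0 (\<lambda>_. 0) C 0" by (simp add: embeds_def)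

lemma emb_self: "emb C 0 (\<lambda>_. 0) C x = (if cx x = C \<and> valid x then Some x else None)"
  by (cases x) (auto simp: emb_def)

lemma emb'_self: "emb' C 0 (\<lambda>_. 0) C x = (if cx x = C \<and> valid x then Some x else None)"
  by (cases x) (auto simp: emb'_def Let_def)

lemma entry_unit_el: "entry (unit_el C) x y = (if cx x = C \<and> valid x \<and> x = y then frag_of (cor_id (label x)) else 0)"
  by (auto simp: unit_el_def entry_emb_simps[OF embeds_self] emb_self)

lemma unit_el_left: assumes a: "a \<in> supported k C K" shows "unit_el K * a = a"
proof (rule rmat_eqI)
  fix x y
  show "entry (unit_el K * a) x y = entry a x y"
    using supportedD[OF a, of x y] entry_valid[of a x y] by (auto simp: unit_el_def entry_emb_simps[OF embeds_self] emb'_self)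
qed

lemma unit_el_right: assumes a: "a \<in> supported k C K" shows "a * unit_el C = a"
proof (rule rmat_eqI)
  fix x y
  show "entry (a * unit_el C) x y = entry a x y"
    using supportedD[OF a, of x y] entry_valid[of a x y] by (auto simp: unit_el_def entry_emb_simps[OF embeds_self] emb_self)
qed

lemma emb_retract:
  assumes e: "embeds C k off K r" and g: "graded K"
  shows "delta (emb' C k off K) * delta (emb C k off K) = unit_el C"
proof (rule rmat_eqI)
  fix x y
  show "entry (delta (emb' C k off K) * delta (emb C k off K)) x y = entry (unit_el C) x y"
  proof (cases "cx x = C \<and> valid x")
    case True
    then obtain z where z: "emb C k off K x = Some z" using g by (simp add: emb_def)
    then have "emb' C k off K z = Some x" "label z = label x"
      using emb_iff matchingD[OF emb_matching[OF e] z] by metis+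
    then show ?thesis using True z by (simp add: entry_emb_simps[OF e] entry_unit_el)
  next
    case False
    then have "emb C k off K x = None" by (auto simp: emb_def)
    then show ?thesis using False by (auto simp: entry_emb_simps(1)[OF e] entry_unit_el)
  qed
qed

lemma entry_emb_range:
  assumes e: "embeds C k off K r"
  shows "entry (delta (emb C k off K) * delta (emb' C k off K)) x y =
    (if x = y \<and> emb' C k off K x \<noteq> None then frag_of (cor_id (label x)) else 0)"
proof (cases "emb' C k off K x")
  case None then show ?thesis by (simp add: entry_emb_simps(2)[OF e])
next
  case (Some z)
  then have "emb C k off K z = Some x" using emb_iff by metis
  moreover from this have "label z = label x" using matchingD[OF emb_matching[OF e]] by blast
  ultimately show ?thesis using Some by (auto simp: entry_emb_simps(2,5)[OF e])
qed

lemma emb_onto: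
  assumes e: "embeds C k (\<lambda>_. 0) K r" and g: "graded C" "graded K" and len: "\<And>n. length (cob K (n + k)) = length (cob C n)"
  shows "delta (emb C k (\<lambda>_. 0) K) * delta (emb' C k (\<lambda>_. 0) K) = unit_el K"
proof (rule rmat_eqI)
  fix x y
  have "emb' C k (\<lambda>_. 0) K x \<noteq> None \<longleftrightarrow> cx x = K \<and> valid x"
    using g len[of "dg x - k"] by (cases x) (auto simp: emb'_def Let_def)
  then show "entry (delta (emb C k (\<lambda>_. 0) K) * delta (emb' C k (\<lambda>_. 0) K)) x y = entry (unit_el K) x y"
    unfolding entry_emb_range[OF e] entry_unit_el by auto
qed

section \<open>Differentials as matrices\<close>

definition dR :: "'a cplx \<Rightarrow> 'a rmat" where "dR C = mx 1 C C (cdif C)"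

text \<open>Nothing is asked of the square of the differential, so that cones and translates have
  matrices before they are known to be complexes.\<close>

definition precomplex :: "'a cplx \<Rightarrow> bool" where
  "precomplex C \<longleftrightarrow> graded C \<and> cdif C \<in> families 1 C C"

lemma precomplex_graded: "precomplex C \<Longrightarrow> graded C" by (simp add: precomplex_def)

lemma entry_dR: "precomplex C \<Longrightarrow>
    entry (dR C) x y = (if cx x = C \<and> cx y = C \<and> dg y = dg x + 1 then cdif C (dg x) (ps x) (ps y) else 0)"
  unfolding dR_def precomplex_def by (simp add: entry_mx)

lemma dR_supported: "precomplex C \<Longrightarrow> dR C \<in> supported 1 C C"
  unfolding dR_def precomplex_def by (simp add: mx_supported)

lemma fam_dR: "precomplex C \<Longrightarrow> fam 1 C C (dR C) = cdif C"
  unfolding dR_def precomplex_def by (simp add: fam_mx)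

lemma cdif_supp: "precomplex C \<Longrightarrow> \<not> (i < length (cob C n) \<and> j < length (cob C (n + 1))) \<Longrightarrow> cdif C n i j = 0"
  unfolding precomplex_def families_def ahom_def amat_supp_def by blast

lemma is_cplx_iff: "is_cplx C \<longleftrightarrow> precomplex C \<and> dR C * dR C = 0 \<and> (\<exists>N. \<forall>n<N. cob C n = [])"
proof -
  have "(dR C * dR C = 0) \<longleftrightarrow> (\<forall>n. acomp (cob C n) (cob C (n + 1)) (cob C (n + 2)) (cdif C (n + 1)) (cdif C n) = azero)"
    if p: "precomplex C"
  proof -
    have f: "fam (1 + 1) C C (dR C * dR C) n = acomp (cob C n) (cob C (n + 1)) (cob C (n + 2)) (cdif C (n + 1)) (cdif C n)" for n
      using fam_times[OF dR_supported[OF p] precomplex_graded[OF p], of 1 C "dR C" n] by (simp add: fam_dR[OF p] add.assoc)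
    have "dR C * dR C = 0 \<longleftrightarrow> fam (1 + 1) C C (dR C * dR C) = fam (1 + 1) C C 0"
      using fam_inj[OF supported_times[OF dR_supported[OF p] dR_supported[OF p]] lev_supported[OF lev_zero]] by metis
    also have "\<dots> \<longleftrightarrow> (\<forall>n. fam (1 + 1) C C (dR C * dR C) n = azero)"
      unfolding fun_eq_iff[of "fam (1 + 1) C C (dR C * dR C)"] by (simp add: fam_def azero_def)
    finally show ?thesis unfolding f .
  qed
  then show ?thesis unfolding is_cplx_def precomplex_def graded_def families_def by auto
qed

lemma is_cplx_precomplex: "is_cplx C \<Longrightarrow> precomplex C" by (simp add: is_cplx_iff)
lemma is_cplx_graded: "is_cplx C \<Longrightarrow> graded C" by (simp add: is_cplx_iff precomplex_graded)

section \<open>Complexes as matrices\<close>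

lemma length_ashift [simp]: "length (ashift r P) = length P" by (simp add: ashift_def)

lemma nth_ashift: "i < length P \<Longrightarrow> ashift r P ! i = (fst (P ! i), snd (P ! i) + r)"
  by (simp add: ashift_def case_prod_beta)

lemma ashift_ashift: "ashift r (ashift s P) = ashift (r + s) P"
  by (simp add: ashift_def case_prod_beta comp_def add_ac)

lemma ashift_zero: "ashift 0 P = P" by (simp add: ashift_def)

lemma is_aobj_ashift: "is_aobj P \<Longrightarrow> is_aobj (ashift r P)"
  by (auto simp: is_aobj_def ashift_def)

lemma ahom_ashift: "ahom (ashift r P) (ashift s Q) = ahom P Q"
  by (simp add: ahom_def amat_supp_def nth_ashift)

lemma ahom_ablock:
  assumes "F \<in> ahom P Q" "G \<in> ahom P Q'" "H \<in> ahom P' Q" "J \<in> ahom P' Q'"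
  shows "ablock (length P) (length Q) F G H J \<in> ahom (P @ P') (Q @ Q')"
  using assms unfolding ahom_def amat_supp_def ablock_def by (simp add: nth_append) (metis add_diff_inverse_nat nat_add_left_cancel_less)

lemma ahom_auminus: "F \<in> ahom P Q \<Longrightarrow> auminus F \<in> ahom P Q"
  by (simp add: ahom_def amat_supp_def auminus_def SC_b_minus)

lemma ahom_azero: "azero \<in> ahom P Q"
  by (simp add: ahom_def amat_supp_def azero_def SC_b_zero)

lemma embeds_shift: "embeds C 0 (\<lambda>_. 0) (shift_cplx r C) r"
  by (simp add: embeds_def shift_cplx_def nth_ashift)

lemma embeds_trans: "embeds C (-1) (\<lambda>_. 0) (trans_cplx C) 0"
  by (simp add: embeds_def trans_cplx_def)

lemma embeds_cone1: "embeds C (-1) (\<lambda>_. 0) (cone C K F) 0"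
  by (simp add: embeds_def cone_def nth_append)

lemma embeds_cone2: "embeds K 0 (\<lambda>n. length (cob C (n + 1))) (cone C K F) 0"
  by (simp add: embeds_def cone_def nth_append)

lemma precomplex_shift: "precomplex C \<Longrightarrow> precomplex (shift_cplx r C)"
  by (simp add: precomplex_def graded_def families_def shift_cplx_def is_aobj_ashift ahom_ashift)

lemma cdif_succ: assumes "precomplex C" shows "cdif C (n + 1) \<in> ahom (cob C (n + 1)) (cob C (n + 2))"
proof -
  have "cdif C (n + 1) \<in> ahom (cob C (n + 1)) (cob C (n + 1 + 1))"
    using assms unfolding precomplex_def families_def by blast
  moreover have "n + 1 + 1 = n + 2" by simp
  ultimately show ?thesis by (simp only:)
qed

lemma precomplex_trans: assumes "precomplex C" shows "precomplex (trans_cplx C)"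
proof -
  have "\<forall>n. auminus (cdif C (n + 1)) \<in> ahom (cob C (n + 1)) (cob C (n + 1 + 1))"
    using assms ahom_auminus unfolding precomplex_def families_def by blast
  then show ?thesis
    using assms unfolding precomplex_def graded_def families_def trans_cplx_def by simp
qed

lemma precomplex_cone:
  assumes C: "precomplex C" and K: "precomplex K" and F: "F \<in> families 0 C K"
  shows "precomplex (cone C K F)"
proof -
  have "cdif C (n + 1) \<in> ahom (cob C (n + 1)) (cob C (n + 2))" for n
    by (rule cdif_succ[OF C])
  then have *: "cdif (cone C K F) n \<in> ahom (cob C (n + 1) @ cob K n) (cob C (n + 2) @ cob K (n + 1))" for n
    using K F unfolding cone_def precomplex_def families_def
    by (auto intro!: ahom_ablock ahom_auminus ahom_azero)
  have "cdif (cone C K F) n \<in> ahom (cob (cone C K F) n) (cob (cone C K F) (n + 1))" for n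
    using *[of n] by (simp add: cone_def add.commute)
  moreover have "graded (cone C K F)"
    using C K by (auto simp: precomplex_def graded_def cone_def is_aobj_def)
  ultimately show ?thesis by (simp add: precomplex_def families_def)
qed

text \<open>Conjugation by embeddings places a as a block. Beyond the upper end of the block the
  index into a is invalid and the entry vanishes, so only the offsets appear in the
  condition.\<close>

lemma entry_conj:
  assumes e: "embeds A k off A' r" "embeds B l off' B' s"
    and g: "graded A" "graded A'" "graded B" "graded B'"
  shows "entry (delta (emb B l off' B') * a * delta (emb' A k off A')) (Idx A' n i) (Idx B' m j) =
    (if off (n - k) \<le> i \<and> off' (m - l) \<le> j then entry a (Idx A (n - k) (i - off (n - k))) (Idx B (m - l) (j - off' (m - l))) else 0)"
    (is "?l = (if ?c then entry a ?x ?y else 0)")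
proof -
  have "?l = (if ?c \<and> i - off (n - k) < length (cob A (n - k)) \<and> j - off' (m - l) < length (cob B (m - l)) then entry a ?x ?y else 0)"
    using g by (auto simp: entry_emb_simps[OF e(1)] entry_emb_simps[OF e(2)] emb'_def Let_def)
  then show ?thesis using entry_valid[of a ?x ?y] by auto
qed

lemma conj_supported:
  assumes e: "embeds A k off A' r" "embeds B l off' B' s" and a: "a \<in> supported m A B"
  shows "delta (emb B l off' B') * a * delta (emb' A k off A') \<in> supported (l + m - k) A' B'"
  using supported_times[OF supported_times[OF lev_supported[OF emb_lev(1)[OF e(2)]] a] lev_supported[OF emb_lev(2)[OF e(1)]]] 
  by (simp add: supported_times algebra_simps)

definition sh_el :: "real \<Rightarrow> 'a cplx \<Rightarrow> 'a rmat" where "sh_el r C = delta (emb C 0 (\<lambda>_. 0) (shift_cplx r C))"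
definition sh_el' :: "real \<Rightarrow> 'a cplx \<Rightarrow> 'a rmat" where "sh_el' r C = delta (emb' C 0 (\<lambda>_. 0) (shift_cplx r C))"
definition tr_el :: "'a cplx \<Rightarrow> 'a rmat" where "tr_el C = delta (emb C (-1) (\<lambda>_. 0) (trans_cplx C))"
definition tr_el' :: "'a cplx \<Rightarrow> 'a rmat" where "tr_el' C = delta (emb' C (-1) (\<lambda>_. 0) (trans_cplx C))"
definition cone_el :: "'a cplx \<Rightarrow> 'a cplx \<Rightarrow> 'a rmat \<Rightarrow> 'a cplx" where "cone_el C K U = cone C K (fam 0 C K U)"
definition in1 :: "'a cplx \<Rightarrow> 'a cplx \<Rightarrow> 'a rmat \<Rightarrow> 'a rmat" where
  "in1 C K U = delta (emb C (-1) (\<lambda>_. 0) (cone_el C K U))"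
definition out1 :: "'a cplx \<Rightarrow> 'a cplx \<Rightarrow> 'a rmat \<Rightarrow> 'a rmat" where
  "out1 C K U = delta (emb' C (-1) (\<lambda>_. 0) (cone_el C K U))"
definition in2 :: "'a cplx \<Rightarrow> 'a cplx \<Rightarrow> 'a rmat \<Rightarrow> 'a rmat" where
  "in2 C K U = delta (emb K 0 (\<lambda>n. length (cob C (n + 1))) (cone_el C K U))"
definition out2 :: "'a cplx \<Rightarrow> 'a cplx \<Rightarrow> 'a rmat \<Rightarrow> 'a rmat" where
  "out2 C K U = delta (emb' K 0 (\<lambda>n. length (cob C (n + 1))) (cone_el C K U))"
definition zero_cplx :: "'a cplx" where "zero_cplx = \<lparr>cob = (\<lambda>_. []), cdif = (\<lambda>_. azero)\<rparr>"

lemmas embeds_cone_el = embeds_cone1[of C K "fam 0 C K U" for C K U, folded cone_el_def]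
  embeds_cone2[of K C "fam 0 C K U" for C K U, folded cone_el_def]

lemma precomplex_cone_el: "\<lbrakk>precomplex C; precomplex K\<rbrakk> \<Longrightarrow> precomplex (cone_el C K U)"
  unfolding cone_el_def by (intro precomplex_cone fam_families precomplex_graded)

lemma sh_retract: "precomplex C \<Longrightarrow> sh_el' r C * sh_el r C = unit_el C"
  unfolding sh_el_def sh_el'_def by (intro emb_retract[OF embeds_shift] precomplex_graded precomplex_shift)

lemma sh_onto: "precomplex C \<Longrightarrow> sh_el r C * sh_el' r C = unit_el (shift_cplx r C)"
  unfolding sh_el_def sh_el'_def
  by (intro emb_onto[OF embeds_shift] precomplex_graded precomplex_shift) (simp_all add: shift_cplx_def)

lemma tr_retract: "precomplex C \<Longrightarrow> tr_el' C * tr_el C = unit_el C"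
  unfolding tr_el_def tr_el'_def by (intro emb_retract[OF embeds_trans] precomplex_graded precomplex_trans)

lemma tr_onto: "precomplex C \<Longrightarrow> tr_el C * tr_el' C = unit_el (trans_cplx C)"
  unfolding tr_el_def tr_el'_def
  by (intro emb_onto[OF embeds_trans] precomplex_graded precomplex_trans) (simp_all add: trans_cplx_def)

lemma fam_sh_conj:
  assumes "graded A" "graded B" "graded (shift_cplx r A)" "graded (shift_cplx r B)"
  shows "fam k (shift_cplx r A) (shift_cplx r B) (sh_el r B * a * sh_el' r A) = fam k A B a"
  unfolding sh_el_def sh_el'_def fam_def entry_conj[OF embeds_shift embeds_shift assms(1,3,2,4)] by simp

lemma fam_tr_conj:
  assumes "graded A" "graded B" "graded (trans_cplx A)" "graded (trans_cplx B)"
  shows "fam k (trans_cplx A) (trans_cplx B) (tr_el B * a * tr_el' A) = (\<lambda>n. fam k A B a (n + 1))"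
  unfolding tr_el_def tr_el'_def fam_def entry_conj[OF embeds_trans embeds_trans assms(1,3,2,4)] by (simp add: algebra_simps)

lemma dR_shift: assumes C: "precomplex C" shows "dR (shift_cplx r C) = sh_el r C * dR C * sh_el' r C"
proof (rule fam_inj[OF dR_supported[OF precomplex_shift[OF C]]])
  note g = precomplex_graded[OF C] precomplex_graded[OF precomplex_shift[OF C]]
  show "sh_el r C * dR C * sh_el' r C \<in> supported 1 (shift_cplx r C) (shift_cplx r C)"
    using conj_supported[OF embeds_shift embeds_shift dR_supported[OF C]] unfolding sh_el_def sh_el'_def by simp
  show "fam 1 (shift_cplx r C) (shift_cplx r C) (dR (shift_cplx r C)) =
      fam 1 (shift_cplx r C) (shift_cplx r C) (sh_el r C * dR C * sh_el' r C)"
    by (simp add: fam_sh_conj g fam_dR C precomplex_shift) (simp add: shift_cplx_def)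
qed

lemma fam_uminus: "fam k C K (- a) = (\<lambda>n. auminus (fam k C K a n))"
  by (simp add: fam_def auminus_def)

lemma dR_trans: assumes C: "precomplex C" shows "dR (trans_cplx C) = - (tr_el C * dR C * tr_el' C)"
proof (rule fam_inj[OF dR_supported[OF precomplex_trans[OF C]]])
  note g = precomplex_graded[OF C] precomplex_graded[OF precomplex_trans[OF C]]
  show "- (tr_el C * dR C * tr_el' C) \<in> supported 1 (trans_cplx C) (trans_cplx C)"
    using supported_minus[OF conj_supported[OF embeds_trans embeds_trans dR_supported[OF C]]] unfolding tr_el_def tr_el'_def by simp
  show "fam 1 (trans_cplx C) (trans_cplx C) (dR (trans_cplx C)) =
      fam 1 (trans_cplx C) (trans_cplx C) (- (tr_el C * dR C * tr_el' C))"
    by (simp add: fam_uminus fam_tr_conj g fam_dR C precomplex_trans) (simp add: trans_cplx_def)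
qed

lemma dR_cone:
  assumes C: "precomplex C" and K: "precomplex K" and U: "U \<in> supported 0 C K"
  shows "dR (cone_el C K U) = in2 C K U * U * out1 C K U + in2 C K U * dR K * out2 C K U - in1 C K U * dR C * out1 C K U"
    (is "_ = ?a + ?b - ?c")
proof (rule fam_inj[OF dR_supported[OF precomplex_cone_el[OF C K]]])
  let ?V = "cone_el C K U"
  note g = precomplex_graded[OF C] precomplex_graded[OF K] precomplex_graded[OF precomplex_cone_el[OF C K, of U]]
  note d = in1_def out1_def in2_def out2_def
  have "?a \<in> supported 1 ?V ?V" "?b \<in> supported 1 ?V ?V" "?c \<in> supported 1 ?V ?V"
    using conj_supported[OF embeds_cone_el(1) embeds_cone_el(2) U] conj_supported[OF embeds_cone_el(2) embeds_cone_el(2) dR_supported[OF K]]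
      conj_supported[OF embeds_cone_el(1) embeds_cone_el(1) dR_supported[OF C]] unfolding d by simp_all
  then show "?a + ?b - ?c \<in> supported 1 ?V ?V"
    using supported_add[OF supported_add supported_minus, of ?a 1 ?V ?V ?b ?c] by simp
  have dV: "cdif ?V n = ablock (length (cob C (n + 1))) (length (cob C (n + 2)))
    (auminus (cdif C (n + 1))) (fam 0 C K U (n + 1)) azero (cdif K n)" for n
    by (simp add: cone_el_def cone_def)
  \<comment> \<open>In the rows that belong to K the formula for \<open>?a\<close> still mentions U,
    but at an invalid index.\<close>
  have s: "entry U (Idx C (n + 1) i) (Idx K (n + 1) j) = 0" if "i \<ge> length (cob C (n + 1))" for n i j
    using that entry_valid[of U "Idx C (n + 1) i" "Idx K (n + 1) j"] by auto
  show "fam 1 ?V ?V (dR ?V) = fam 1 ?V ?V (?a + ?b - ?c)"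
  proof (intro ext)
    fix n i j
    have a: "entry ?a (Idx ?V n i) (Idx ?V (n + 1) j) =
      (if length (cob C (n + 2)) \<le> j then entry U (Idx C (n + 1) i) (Idx K (n + 1) (j - length (cob C (n + 2)))) else 0)"
      unfolding d entry_conj[OF embeds_cone_el(1) embeds_cone_el(2) g(1) g(3) g(2) g(3)] by (simp add: add.assoc)
    have b: "entry ?b (Idx ?V n i) (Idx ?V (n + 1) j) =
      (if length (cob C (n + 1)) \<le> i \<and> length (cob C (n + 2)) \<le> j then cdif K n (i - length (cob C (n + 1))) (j - length (cob C (n + 2))) else 0)"
      unfolding d entry_conj[OF embeds_cone_el(2) embeds_cone_el(2) g(2) g(3) g(2) g(3)] by (simp add: entry_dR[OF K] add.assoc)
    have c: "entry ?c (Idx ?V n i) (Idx ?V (n + 1) j) = cdif C (n + 1) i j"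
      unfolding d entry_conj[OF embeds_cone_el(1) embeds_cone_el(1) g(1) g(3) g(1) g(3)] by (simp add: entry_dR[OF C])
    have z: "cdif C (n + 1) i j = 0" if "length (cob C (n + 1)) \<le> i \<or> length (cob C (n + 2)) \<le> j"
      using that cdif_supp[OF C, of i "n + 1" j] by (auto simp: add.assoc)
    have "fam 1 ?V ?V (?a + ?b - ?c) n i j = entry ?a (Idx ?V n i) (Idx ?V (n + 1) j) +
        entry ?b (Idx ?V n i) (Idx ?V (n + 1) j) - entry ?c (Idx ?V n i) (Idx ?V (n + 1) j)"
      by (simp add: fam_def)
    also have "\<dots> = cdif ?V n i j"
      unfolding a b c dV using s z by (auto simp: ablock_def auminus_def azero_def fam_def)
    finally show "fam 1 ?V ?V (dR ?V) n i j = fam 1 ?V ?V (?a + ?b - ?c) n i j"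
      by (simp add: fam_dR precomplex_cone_el C K)
  qed
qed

lemma cone_orthogonal: "out1 C K U * in2 C K U = 0" "out2 C K U * in1 C K U = 0"
proof -
  show "out1 C K U * in2 C K U = 0"
  proof (rule rmat_eqI)
    fix x z
    show "entry (out1 C K U * in2 C K U) x z = entry 0 x z"
      unfolding out1_def in2_def entry_emb_simps[OF embeds_cone_el(2)] entry_emb_simps[OF embeds_cone_el(1)]
      by (cases x) (auto simp: emb_def emb'_def Let_def)
  qed
  show "out2 C K U * in1 C K U = 0"
  proof (rule rmat_eqI)
    fix x z
    show "entry (out2 C K U * in1 C K U) x z = entry 0 x z"
      unfolding out2_def in1_def entry_emb_simps[OF embeds_cone_el(2)] entry_emb_simps[OF embeds_cone_el(1)]
      by (cases x) (auto simp: emb_def emb'_def Let_def)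
  qed
qed

lemma cone_retract:
  assumes "precomplex C" "precomplex K"
  shows "out1 C K U * in1 C K U = unit_el C" "out2 C K U * in2 C K U = unit_el K"
  unfolding in1_def out1_def in2_def out2_def using assms
  by (auto intro!: emb_retract[OF embeds_cone_el(1)] emb_retract[OF embeds_cone_el(2)] precomplex_graded precomplex_cone_el)

lemma cone_unit:
  assumes C: "precomplex C" and K: "precomplex K"
  shows "unit_el (cone_el C K U) = in1 C K U * out1 C K U + in2 C K U * out2 C K U"
proof (rule rmat_eqI)
  fix x y
  let ?V = "cone_el C K U"
  note g = precomplex_graded[OF C] precomplex_graded[OF K] precomplex_graded[OF precomplex_cone_el[OF C K, of U]]
  have l: "length (cob ?V n) = length (cob C (n + 1)) + length (cob K n)" for n by (simp add: cone_el_def cone_def)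
  show "entry (unit_el ?V) x y = entry (in1 C K U * out1 C K U + in2 C K U * out2 C K U) x y"
    unfolding entry_plus in1_def out1_def in2_def out2_def entry_emb_range[OF embeds_cone_el(1)]
      entry_emb_range[OF embeds_cone_el(2)] entry_unit_el
    using g by (cases x) (auto simp: emb'_def Let_def l)
qed

lemma conj_square:
  fixes i p d :: "'r :: ring"
  assumes "p * i = u" "d * u = d" "d * d = 0" shows "(i * d * p) * (i * d * p) = 0"
proof -
  have "(i * d * p) * (i * d * p) = i * (d * (p * i)) * d * p" by (simp only: mult.assoc)
  also have "\<dots> = i * (d * d) * p" by (simp add: assms(1,2) mult.assoc)
  finally show ?thesis by (simp add: assms(3))
qed

lemma dR_unit: "precomplex C \<Longrightarrow> dR C * unit_el C = dR C" "precomplex C \<Longrightarrow> unit_el C * dR C = dR C"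
  using unit_el_left unit_el_right dR_supported by blast+

lemma is_cplx_shift: "is_cplx C \<Longrightarrow> is_cplx (shift_cplx r C)"
  unfolding is_cplx_iff dR_shift using precomplex_shift[of C r] conj_square[OF sh_retract dR_unit(1), of C r]
  by (auto simp: dR_shift) (auto simp: shift_cplx_def ashift_def)

lemma is_cplx_trans: "is_cplx C \<Longrightarrow> is_cplx (trans_cplx C)"
proof -
  assume c: "is_cplx C"
  then have p: "precomplex C" and d: "dR C * dR C = 0" by (auto simp: is_cplx_iff)
  from c obtain N where "\<forall>n<N. cob C n = []" by (auto simp: is_cplx_iff)
  then have "\<forall>n<N - 1. cob (trans_cplx C) n = []" by (simp add: trans_cplx_def)
  then show "is_cplx (trans_cplx C)" unfolding is_cplx_iff
    using precomplex_trans[OF p] conj_square[OF tr_retract[OF p] dR_unit(1)[OF p] d] by (auto simp: dR_trans[OF p])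
qed

text \<open>Degrees range over all integers, so translation is reindexing with a sign and has a
  strict inverse. The work lies in showing that the inverse yields complexes.\<close>

lemma trans_cplx_bij: "bij_betw trans_cplx {C. is_cplx C} {C :: 'a cplx. is_cplx C}"
proof -
  let ?inv = "\<lambda>C :: 'a cplx. \<lparr>cob = (\<lambda>n. cob C (n - 1)), cdif = (\<lambda>n. auminus (cdif C (n - 1)))\<rparr>"
  have a: "auminus (auminus F) = F" for F :: "'a amat" by (simp add: auminus_def)
  have l: "?inv (trans_cplx C) = C" for C by (simp add: trans_cplx_def a)
  have r: "trans_cplx (?inv C) = C" for C by (simp add: trans_cplx_def a)
  have "is_cplx (?inv C)" if c: "is_cplx C" for C
  proof -
    let ?X = "?inv C"
    have "cdif C (n - 1) \<in> ahom (cob C (n - 1)) (cob C n)" for n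
      using is_cplx_precomplex[OF c] unfolding precomplex_def families_def mem_Collect_eq
      by (metis diff_add_cancel)
    then have p: "precomplex ?X"
      using is_cplx_graded[OF c] by (simp add: precomplex_def graded_def families_def ahom_auminus)
    \<comment> \<open>Solves \<open>dR_trans\<close> for the differential of the inverse translate,
      whose square is then computed by \<open>conj_square\<close>.\<close>
    have t: "dR ?X = - (tr_el' ?X * dR C * tr_el ?X)"
    proof -
      have "tr_el' ?X * dR C * tr_el ?X = - ((tr_el' ?X * tr_el ?X) * dR ?X * (tr_el' ?X * tr_el ?X))"
        using dR_trans[OF p] unfolding r by (simp add: mult.assoc)
      then show ?thesis by (simp add: tr_retract[OF p] dR_unit[OF p])
    qed
    have "dR ?X * dR ?X = 0"
      unfolding t using conj_square[OF tr_onto[OF p, unfolded r] dR_unit(1)[OF is_cplx_precomplex[OF c]]] c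
      by (simp add: is_cplx_iff)
    moreover from c obtain N where "\<forall>n<N. cob C n = []" by (auto simp: is_cplx_iff)
    then have "\<forall>n<N + 1. cob ?X n = []" by simp
    ultimately show ?thesis using p unfolding is_cplx_iff by blast
  qed
  then show ?thesis by (intro bij_betw_byWitness[where f'="?inv"]) (use l r is_cplx_trans in auto)
qed

lemma is_cplx_cone:
  assumes c: "is_cplx C" "is_cplx K" and U: "U \<in> supported 0 C K" and comm: "dR K * U = U * dR C"
  shows "is_cplx (cone_el C K U)"
proof -
  have C: "precomplex C" and K: "precomplex K" and dd: "dR C * dR C = 0" "dR K * dR K = 0"
    using c by (auto simp: is_cplx_iff)
  let ?i1 = "in1 C K U" let ?i2 = "in2 C K U" let ?p1 = "out1 C K U" let ?p2 = "out2 C K U"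
  note rules = cone_retract[OF C K, THEN reassoc] cone_orthogonal[THEN reassoc] dR_unit[OF C] dR_unit[OF C, THEN reassoc]
    dR_unit[OF K] dR_unit[OF K, THEN reassoc] unit_el_left[OF U, THEN reassoc] unit_el_left[OF U] dd[THEN reassoc]
  \<comment> \<open>The remaining terms vanish by orthogonality of the summands and because both
    differentials square to zero; what is left is the failure of U to be a chain map.\<close>
  have "dR (cone_el C K U) * dR (cone_el C K U) = ?i2 * (dR K * U - U * dR C) * ?p1"
    unfolding dR_cone[OF C K U] by (simp add: algebra_simps rules)
  then have "dR (cone_el C K U) * dR (cone_el C K U) = 0" by (simp add: comm)
  moreover obtain N M where "\<forall>n<N. cob C n = []" "\<forall>n<M. cob K n = []" using c by (auto simp: is_cplx_iff)
  \<comment> \<open>Degree n of the cone contains degree n + 1 of C, which lowers the bound for C by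
    one.\<close>
  then have "\<forall>n<min (N - 1) M. cob (cone_el C K U) n = []" by (simp add: cone_el_def cone_def)
  ultimately show ?thesis using precomplex_cone_el[OF C K] unfolding is_cplx_iff by blast
qed

lemma shift_shift: "shift_cplx r (shift_cplx s C) = shift_cplx (r + s) C"
  by (simp add: shift_cplx_def ashift_ashift)

lemma shift_zero: "shift_cplx 0 C = C" by (simp add: shift_cplx_def ashift_zero)

lemma sh_el_add: "precomplex C \<Longrightarrow> sh_el r (shift_cplx s C) * sh_el s C = sh_el (r + s) C"
proof (rule rmat_eqI)
  fix x z assume C: "precomplex C"
  have g: "graded (shift_cplx r C)" for r using C precomplex_shift precomplex_graded by blast
  have l: "length (cob (shift_cplx r C) n) = length (cob C n)" for r n by (simp add: shift_cplx_def)
  have f: "i < length (cob C n) \<Longrightarrow> fst (cob (shift_cplx r C) n ! i) = fst (cob C n ! i)" for r n i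
    by (simp add: shift_cplx_def nth_ashift)
  show "entry (sh_el r (shift_cplx s C) * sh_el s C) x z = entry (sh_el (r + s) C) x z"
    unfolding sh_el_def shift_shift entry_emb_simps[OF embeds_shift]
      entry_emb_simps[OF embeds_shift[of "shift_cplx s C" r, unfolded shift_shift]]
    by (cases x) (auto simp: emb_def g l f)
qed

interpretation dgc: filtered_dg "{C. is_cplx C}" unit_el dR lev cone_el in1 out1 in2 out2
  trans_cplx tr_el tr_el' shift_cplx sh_el sh_el' "zero_cplx :: 'a cplx"
proof (unfold_locales, unfold mem_Collect_eq)
  fix A B :: "'a cplx" and U :: "'a rmat" assume a: "is_cplx A" "is_cplx B" "U \<in> lev 0 0 A B" "dR B * U = U * dR A"
  then have p: "precomplex A" "precomplex B" "U \<in> supported 0 A B" by (auto simp: is_cplx_iff lev_supported)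
  show "is_cplx (cone_el A B U)" by (rule is_cplx_cone[OF a(1,2) p(3) a(4)])
  show "in1 A B U \<in> lev 0 (-1) A (cone_el A B U)" unfolding in1_def by (rule emb_lev(1)[OF embeds_cone_el(1)])
  show "out1 A B U \<in> lev 0 1 (cone_el A B U) A"
    using emb_lev(2)[OF embeds_cone_el(1)] unfolding out1_def by simp
  show "in2 A B U \<in> lev 0 0 B (cone_el A B U)" unfolding in2_def by (rule emb_lev(1)[OF embeds_cone_el(2)])
  show "out2 A B U \<in> lev 0 0 (cone_el A B U) B"
    using emb_lev(2)[OF embeds_cone_el(2)] unfolding out2_def by simp
  show "out1 A B U * in1 A B U = unit_el A" "out2 A B U * in2 A B U = unit_el B" by (rule cone_retract[OF p(1,2)])+
  show "unit_el (cone_el A B U) = in1 A B U * out1 A B U + in2 A B U * out2 A B U" by (rule cone_unit[OF p(1,2)])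
  show "dR (cone_el A B U) = in2 A B U * U * out1 A B U + in2 A B U * dR B * out2 A B U - in1 A B U * dR A * out1 A B U"
    by (rule dR_cone[OF p])
next
  fix A :: "'a cplx" and r s assume "is_cplx A"
  then have p: "precomplex A" by (rule is_cplx_precomplex)
  show "tr_el A \<in> lev 0 (-1) A (trans_cplx A)" unfolding tr_el_def by (rule emb_lev(1)[OF embeds_trans])
  show "tr_el' A \<in> lev 0 1 (trans_cplx A) A" using emb_lev(2)[OF embeds_trans] unfolding tr_el'_def by simp
  show "sh_el r A \<in> lev r 0 A (shift_cplx r A)" unfolding sh_el_def by (rule emb_lev(1)[OF embeds_shift])
  show "sh_el' r A \<in> lev (- r) 0 (shift_cplx r A) A" using emb_lev(2)[OF embeds_shift] unfolding sh_el'_def by simp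
  show "unit_el A \<in> lev 0 0 A A" unfolding unit_el_def by (rule emb_lev(1)[OF embeds_self])
  show "sh_el 0 A = unit_el A" by (simp add: sh_el_def unit_el_def shift_zero)
  show "sh_el r (shift_cplx s A) * sh_el s A = sh_el (r + s) A" by (rule sh_el_add[OF p])
  show "dR (shift_cplx r A) * sh_el r A = sh_el r A * dR A"
    by (simp add: dR_shift[OF p] mult.assoc sh_retract[OF p] dR_unit[OF p])
next
  show "is_cplx (zero_cplx :: 'a cplx)"
    unfolding is_cplx_def zero_cplx_def using ahom_azero[of "[]" "[]"]
    by (simp add: is_aobj_def acomp_def) (simp add: azero_def)
  show "unit_el zero_cplx = (0 :: 'a rmat)"
  proof (rule rmat_eqI)
    fix x y show "entry (unit_el zero_cplx) x y = entry (0 :: 'a rmat) x y"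
      by (cases x) (auto simp: entry_unit_el zero_cplx_def)
  qed
qed (simp_all add: lev_zero lev_add lev_minus lev_times lev_mono unit_el_left[OF lev_supported] unit_el_right[OF lev_supported]
  is_cplx_shift trans_cplx_bij shift_shift shift_zero cone_orthogonal dR_unit is_cplx_precomplex tr_retract tr_onto sh_retract sh_onto dR_trans,
  auto simp: is_cplx_iff)

section \<open>Chain maps, null homotopies and their classes\<close>

lemma fam_plus: "fam k C K (a + b) = (\<lambda>n. aplus (fam k C K a n) (fam k C K b n))"
  by (simp add: fam_def aplus_def)

lemma ahom_level_ahom: "F \<in> ahom_level P Q r \<Longrightarrow> F \<in> ahom P Q"
  using SC_b_level_SC_b unfolding ahom_level_def ahom_def by blast

lemma Z_supported: "x \<in> dgc.Z r C K \<Longrightarrow> x \<in> supported 0 C K"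
  by (rule lev_supported[OF dgc.Z_L])

lemma fam_chain_map_iff:
  assumes c: "is_cplx C" "is_cplx K" and x: "x \<in> supported 0 C K"
  shows "fam 0 C K x \<in> chain_maps r C K \<longleftrightarrow> x \<in> dgc.Z r C K"
proof -
  note p = is_cplx_precomplex[OF c(1)] is_cplx_precomplex[OF c(2)]
  note g = precomplex_graded[OF p(1)] precomplex_graded[OF p(2)]
  have l: "fam 1 C K (dR K * x) n = acomp (cob C n) (cob K n) (cob K (n + 1)) (cdif K n) (fam 0 C K x n)" for n
    using fam_times[OF x g(2), of 1 K "dR K" n] by (simp add: fam_dR[OF p(2)])
  have r: "fam 1 C K (x * dR C) n = acomp (cob C n) (cob C (n + 1)) (cob K (n + 1)) (fam 0 C K x (n + 1)) (cdif C n)" for n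
    using fam_times[OF dR_supported[OF p(1)] g(1), of 0 K x n] by (simp add: fam_dR[OF p(1)])
  have "dR K * x = x * dR C \<longleftrightarrow> fam 1 C K (dR K * x) = fam 1 C K (x * dR C)"
    using fam_inj[of "dR K * x" 1 C K "x * dR C"] supported_times[OF dR_supported[OF p(2)] x]
      supported_times[OF x dR_supported[OF p(1)]] by auto
  then show ?thesis
    using fam_level_iff[OF g x, of r] unfolding chain_maps_def dgc.Z_def fun_eq_iff[of "fam 1 C K (dR K * x)"] l r
    by auto
qed

lemma chain_map_families: "F \<in> chain_maps r C K \<Longrightarrow> F \<in> families 0 C K"
  unfolding chain_maps_def families_def by (auto intro: ahom_level_ahom)

lemma chain_maps_fam:
  assumes c: "is_cplx C" "is_cplx K"
  shows "chain_maps r C K = fam 0 C K ` dgc.Z r C K"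
proof (intro equalityI subsetI)
  fix F assume F: "F \<in> chain_maps r C K"
  note m = chain_map_families[OF F] and g = is_cplx_graded[OF c(1)] is_cplx_graded[OF c(2)]
  have "mx 0 C K F \<in> dgc.Z r C K"
    using F fam_chain_map_iff[OF c mx_supported[OF g m], of r] by (simp add: fam_mx[OF g m])
  then show "F \<in> fam 0 C K ` dgc.Z r C K" using fam_mx[OF g m] by (metis imageI)
next
  fix F assume "F \<in> fam 0 C K ` dgc.Z r C K"
  then obtain x where x: "x \<in> dgc.Z r C K" "F = fam 0 C K x" by blast
  then show "F \<in> chain_maps r C K" using fam_chain_map_iff[OF c Z_supported[OF x(1)], of r] by simp
qed

lemma fam_boundary:
  assumes c: "is_cplx C" "is_cplx K" and h: "h \<in> supported (-1) C K"
  shows "fam 0 C K (dR K * h + h * dR C) n = aplus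
    (acomp (cob C n) (cob K (n - 1)) (cob K n) (cdif K (n - 1)) (fam (-1) C K h n))
    (acomp (cob C n) (cob C (n + 1)) (cob K n) (fam (-1) C K h (n + 1)) (cdif C n))"
proof -
  note p = is_cplx_precomplex[OF c(1)] is_cplx_precomplex[OF c(2)]
  note g = precomplex_graded[OF p(1)] precomplex_graded[OF p(2)]
  have "fam 0 C K (dR K * h) n = acomp (cob C n) (cob K (n - 1)) (cob K n) (cdif K (n - 1)) (fam (-1) C K h n)"
    using fam_times[OF h g(2), of 1 K "dR K" n] by (simp add: fam_dR[OF p(2)])
  moreover have "fam 0 C K (h * dR C) n = acomp (cob C n) (cob C (n + 1)) (cob K n) (fam (-1) C K h (n + 1)) (cdif C n)"
    using fam_times[OF dR_supported[OF p(1)] g(1), of "-1" K h n] by (simp add: fam_dR[OF p(1)])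
  ultimately show ?thesis by (simp add: fam_plus)
qed

lemma boundary_supported:
  assumes c: "is_cplx C" "is_cplx K" and h: "h \<in> supported (-1) C K"
  shows "dR K * h + h * dR C \<in> supported 0 C K"
  using supported_add[OF supported_times[OF dR_supported[OF is_cplx_precomplex[OF c(2)]] h]]
    supported_times[OF h dR_supported[OF is_cplx_precomplex[OF c(1)]]] by simp

lemma null_homotopic_fam:
  assumes c: "is_cplx C" "is_cplx K"
  shows "null_homotopic r C K = fam 0 C K ` dgc.Bd r C K"
proof (intro equalityI subsetI)
  note g = is_cplx_graded[OF c(1)] is_cplx_graded[OF c(2)]
  fix F assume "F \<in> null_homotopic r C K"
  then obtain H where F: "F \<in> chain_maps r C K" and H: "\<And>n. H n \<in> ahom_level (cob C n) (cob K (n - 1)) r"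
    and FH: "\<And>n. F n = aplus (acomp (cob C n) (cob K (n - 1)) (cob K n) (cdif K (n - 1)) (H n))
        (acomp (cob C n) (cob C (n + 1)) (cob K n) (H (n + 1)) (cdif C n))"
    unfolding null_homotopic_def by blast
  obtain x where x: "x \<in> dgc.Z r C K" "F = fam 0 C K x" using F unfolding chain_maps_fam[OF c] by blast
  have m: "H \<in> families (-1) C K" using ahom_level_ahom[OF H] unfolding families_def by simp
  let ?h = "mx (-1) C K H"
  have s: "?h \<in> supported (-1) C K" by (rule mx_supported[OF g m])
  have h: "?h \<in> lev r (-1) C K" using H unfolding fam_level_iff[OF g s] fam_mx[OF g m] by simp
  have "F = fam 0 C K (dR K * ?h + ?h * dR C)"
    by (rule ext) (simp only: FH fam_boundary[OF c s] fam_mx[OF g m])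
  \<comment> \<open>A matrix supported between two complexes in one degree is determined by its
    family, so the equation of families lifts to the ring.\<close>
  then have "x = dR K * ?h + ?h * dR C"
    using fam_inj[OF Z_supported[OF x(1)] boundary_supported[OF c s]] x(2) by simp
  then show "F \<in> fam 0 C K ` dgc.Bd r C K" using dgc.BdI[OF x(1) h] x(2) by blast
next
  note g = is_cplx_graded[OF c(1)] is_cplx_graded[OF c(2)]
  fix F assume "F \<in> fam 0 C K ` dgc.Bd r C K"
  then obtain x where x: "x \<in> dgc.Bd r C K" "F = fam 0 C K x" by blast
  from x(1) obtain h where h: "h \<in> lev r (-1) C K" "x = dR K * h + h * dR C" by (rule dgc.BdE)
  have "F \<in> chain_maps r C K" using dgc.Bd_Z[OF x(1)] x(2) unfolding chain_maps_fam[OF c] by blast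
  moreover have "fam (-1) C K h n \<in> ahom_level (cob C n) (cob K (n - 1)) r" for n
    using h(1) fam_level_iff[OF g lev_supported[OF h(1)], of r] by simp
  moreover have "F n = aplus (acomp (cob C n) (cob K (n - 1)) (cob K n) (cdif K (n - 1)) (fam (-1) C K h n))
        (acomp (cob C n) (cob C (n + 1)) (cob K n) (fam (-1) C K h (n + 1)) (cdif C n))" for n
    unfolding x(2) h(2) by (rule fam_boundary[OF c lev_supported[OF h(1)]])
  ultimately show "F \<in> null_homotopic r C K" unfolding null_homotopic_def by blast
qed

definition hcl :: "real \<Rightarrow> 'a cplx \<Rightarrow> 'a cplx \<Rightarrow> 'a rmat \<Rightarrow> 'a cmor" where
  "hcl r C K x = hclass r C K (fam 0 C K x)"

lemma hcl_eq:
  assumes "is_cplx C" "is_cplx K"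
  shows "hcl r C K x = fam 0 C K ` (\<lambda>b. b + x) ` dgc.Bd r C K"
  unfolding hcl_def hclass_def r_coset_def null_homotopic_fam[OF assms]
  by (auto simp: chain_map_group_def fam_plus[symmetric])

text \<open>Composition and inclusion of classes are unions over all representatives, so every
  member of a coset has to be seen as coming from a cocycle.\<close>

lemma hcl_mem:
  assumes c: "is_cplx C" "is_cplx K" and x: "x \<in> dgc.Z r C K" and F: "F \<in> hcl r C K x"
  obtains y where "y \<in> dgc.Z r C K" "y - x \<in> dgc.Bd r C K" "F = fam 0 C K y"
proof -
  obtain b where b: "b \<in> dgc.Bd r C K" "F = fam 0 C K (b + x)" using F unfolding hcl_eq[OF c] by blast
  have "b + x \<in> dgc.Z r C K" using dgc.Z_add[OF _ _ dgc.Bd_Z[OF b(1)] x] c by simp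
  then show ?thesis using that[of "b + x"] b by simp
qed

lemma hcl_self: "\<lbrakk>is_cplx C; is_cplx K\<rbrakk> \<Longrightarrow> fam 0 C K x \<in> hcl r C K x"
  unfolding hcl_eq using dgc.Bd_zero[of C K r] by (force intro: rev_image_eqI)

lemma hcl_eq_iff:
  assumes c: "is_cplx C" "is_cplx K" and z: "x \<in> dgc.Z r C K" "y \<in> dgc.Z r C K"
  shows "hcl r C K x = hcl r C K y \<longleftrightarrow> x - y \<in> dgc.Bd r C K"
proof
  assume "hcl r C K x = hcl r C K y"
  then have "fam 0 C K x \<in> hcl r C K y" using hcl_self[OF c] by blast
  from hcl_mem[OF c z(2) this] obtain w where "w \<in> dgc.Z r C K" "w - y \<in> dgc.Bd r C K" "fam 0 C K x = fam 0 C K w" .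
  then show "x - y \<in> dgc.Bd r C K" using fam_inj[OF Z_supported[OF z(1)] Z_supported] by metis
next
  assume b: "x - y \<in> dgc.Bd r C K"
  have sub: "(\<lambda>b. b + u) ` dgc.Bd r C K \<subseteq> (\<lambda>b. b + v) ` dgc.Bd r C K" if "u - v \<in> dgc.Bd r C K" for u v
  proof
    fix w assume "w \<in> (\<lambda>b. b + u) ` dgc.Bd r C K"
    then obtain b where "b \<in> dgc.Bd r C K" "w = b + u" by blast
    then have "b + (u - v) \<in> dgc.Bd r C K" "w = b + (u - v) + v" using dgc.Bd_add[of C K b r "u - v"] that c by simp_all
    then show "w \<in> (\<lambda>b. b + v) ` dgc.Bd r C K" by blast
  qed
  have "y - x \<in> dgc.Bd r C K" using dgc.Bd_minus[of C K "x - y" r] b c by simp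
  then show "hcl r C K x = hcl r C K y" unfolding hcl_eq[OF c] using sub[OF b] sub[of y x] by (metis subset_antisym)
qed

lemma hcl_add:
  assumes c: "is_cplx C" "is_cplx K" and z: "x \<in> dgc.Z r C K" "y \<in> dgc.Z r C K"
  shows "hcl r C K x \<otimes>\<^bsub>Hom_C r C K\<^esub> hcl r C K y = hcl r C K (x + y)"
proof -
  have "hcl r C K x \<otimes>\<^bsub>Hom_C r C K\<^esub> hcl r C K y =
    {fam 0 C K ((b + x) + (b' + y)) |b b'. b \<in> dgc.Bd r C K \<and> b' \<in> dgc.Bd r C K}"
    unfolding Hom_C_def FactGroup_def hcl_eq[OF c]
    by (auto simp: set_mult_def chain_map_group_def fam_plus)
  also have "\<dots> = hcl r C K (x + y)" unfolding hcl_eq[OF c]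
  proof (intro equalityI subsetI)
    fix F assume "F \<in> {fam 0 C K ((b + x) + (b' + y)) |b b'. b \<in> dgc.Bd r C K \<and> b' \<in> dgc.Bd r C K}"
    then obtain b b' where b: "b \<in> dgc.Bd r C K" "b' \<in> dgc.Bd r C K" "F = fam 0 C K ((b + x) + (b' + y))" by blast
    have "b + b' \<in> dgc.Bd r C K" using dgc.Bd_add[of C K b r b'] b c by simp
    moreover have "F = fam 0 C K ((b + b') + (x + y))" unfolding b(3) by (simp add: ac_simps)
    ultimately show "F \<in> fam 0 C K ` (\<lambda>b. b + (x + y)) ` dgc.Bd r C K" by blast
  next
    fix F assume "F \<in> fam 0 C K ` (\<lambda>b. b + (x + y)) ` dgc.Bd r C K"
    then obtain b where b: "b \<in> dgc.Bd r C K" "F = fam 0 C K (b + (x + y))" by blast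
    have "0 \<in> dgc.Bd r C K" using dgc.Bd_zero[of C K r] c by simp
    moreover have "F = fam 0 C K ((b + x) + (0 + y))" unfolding b(2) by (simp add: ac_simps)
    ultimately show "F \<in> {fam 0 C K ((b + x) + (b' + y)) |b b'. b \<in> dgc.Bd r C K \<and> b' \<in> dgc.Bd r C K}"
      using b(1) by blast
  qed
  finally show ?thesis .
qed

lemma hcl_zero: "\<lbrakk>is_cplx C; is_cplx K\<rbrakk> \<Longrightarrow> \<one>\<^bsub>Hom_C r C K\<^esub> = hcl r C K 0"
  unfolding hcl_eq by (simp add: Hom_C_def FactGroup_def null_homotopic_fam)

lemma carrier_Hom_C:
  assumes "is_cplx C" "is_cplx K"
  shows "carrier (Hom_C r C K) = hcl r C K ` dgc.Z r C K"
  unfolding Hom_C_def FactGroup_def RCOSETS_def hcl_def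
  by (auto simp: hclass_def chain_map_group_def chain_maps_fam[OF assms])

text \<open>All sets in the union are equal by \<open>dgc.Bd_cmp\<close>, and the union runs over
  nonempty cosets.\<close>

lemma hcl_comp:
  assumes c: "is_cplx A" "is_cplx B" "is_cplx D" and z: "x \<in> dgc.Z s A B" "y \<in> dgc.Z r B D"
  shows "comp_C r s A B D (hcl r B D y) (hcl s A B x) = hcl (r + s) A D (y * x)"
proof -
  have "hclass (r + s) A D (\<lambda>n. acomp (cob A n) (cob B n) (cob D n) (G n) (F n)) = hcl (r + s) A D (y * x)"
    if G: "G \<in> hcl r B D y" and F: "F \<in> hcl s A B x" for G F
  proof -
    from hcl_mem[OF c(2,3) z(2) G] obtain g where g: "g \<in> dgc.Z r B D" "g - y \<in> dgc.Bd r B D" "G = fam 0 B D g" .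
    from hcl_mem[OF c(1,2) z(1) F] obtain f where f: "f \<in> dgc.Z s A B" "f - x \<in> dgc.Bd s A B" "F = fam 0 A B f" .
    have "(\<lambda>n. acomp (cob A n) (cob B n) (cob D n) (G n) (F n)) = fam 0 A D (g * f)"
      using fam_times[OF Z_supported[OF f(1)] is_cplx_graded[OF c(2)], of 0 D g] by (simp add: g(3) f(3) fun_eq_iff)
    moreover have "hcl (r + s) A D (g * f) = hcl (r + s) A D (y * x)"
      using c z g f dgc.Bd_cmp[of A B D y r g x s f] dgc.Z_mult[of A B D g r f s] dgc.Z_mult[of A B D y r x s]
      by (simp add: hcl_eq_iff)
    ultimately show ?thesis by (simp add: hcl_def)
  qed
  then show ?thesis unfolding comp_C_def using hcl_self[OF c(1,2), of x s] hcl_self[OF c(2,3), of y r] by blast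
qed

lemma hcl_incl:
  assumes c: "is_cplx A" "is_cplx B" and z: "x \<in> dgc.Z r A B" and "r \<le> s"
  shows "incl_C r s A B (hcl r A B x) = hcl s A B x"
proof -
  have "hclass s A B F = hcl s A B x" if F: "F \<in> hcl r A B x" for F
  proof -
    from hcl_mem[OF c z F] obtain f where f: "f \<in> dgc.Z r A B" "f - x \<in> dgc.Bd r A B" "F = fam 0 A B f" .
    have "hcl s A B f = hcl s A B x"
      using c z f \<open>r \<le> s\<close> dgc.Bd_mono[of A B r s "f - x"] dgc.Z_mono[of A B r s] by (simp add: hcl_eq_iff)
    then show ?thesis by (simp add: hcl_def f(3))
  qed
  then show ?thesis unfolding incl_C_def using hcl_self[OF c, of x r] by blast
qed

lemma ahom_level_shift: "ahom_level (ashift r P) (ashift r Q) k = ahom_level P Q k"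
  by (simp add: ahom_level_def amat_supp_def nth_ashift add_diff_eq)

lemma acomp_shift: "acomp (ashift r P) (ashift r Q) (ashift r R) G F = acomp P Q R G F"
  by (auto simp: acomp_def nth_ashift fun_eq_iff intro!: sum.cong)

text \<open>Only differences of weights enter the level conditions, so shifting both objects by r
  leaves the sets of chain maps and null homotopies literally unchanged. This is why shifts can act
  as the identity on classes.\<close>

lemma hclass_shift: "hclass s (shift_cplx r A) (shift_cplx r B) F = hclass s A B F"
proof -
  have "chain_maps s (shift_cplx r A) (shift_cplx r B) = chain_maps s A B"
    by (simp add: chain_maps_def shift_cplx_def ahom_level_shift acomp_shift)
  moreover from this have "null_homotopic s (shift_cplx r A) (shift_cplx r B) = null_homotopic s A B"
    by (simp add: null_homotopic_def) (simp add: shift_cplx_def ahom_level_shift acomp_shift)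
  ultimately show ?thesis by (simp add: hclass_def chain_map_group_def)
qed

lemma hcl_shift:
  assumes "is_cplx A" "is_cplx B"
  shows "hcl s (shift_cplx r A) (shift_cplx r B) (sh_el r B * x * sh_el' r A) = hcl s A B x"
  unfolding hcl_def hclass_shift using assms
  by (simp add: fam_sh_conj is_cplx_graded is_cplx_shift)

lemma id_C_hcl:
  assumes c: "is_cplx C"
  shows "id_C r s C = hcl (s - r) (shift_cplx r C) (shift_cplx s C) (sh_el s C * sh_el' r C)"
proof -
  have g: "graded C" "graded (shift_cplx r C)" for r using c is_cplx_shift is_cplx_graded by blast+
  have "fam 0 (shift_cplx r C) (shift_cplx s C) (sh_el s C * sh_el' r C) = (\<lambda>n. aid (cob C n))"
    unfolding fam_def sh_el'_def entry_emb_simps(2)[OF embeds_shift] unfolding sh_el_def entry_emb_simps(5)[OF embeds_shift]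
    using g by (auto simp: emb_def emb'_def aid_def fun_eq_iff)
  then show ?thesis by (simp add: id_C_def hcl_def)
qed

lemma hcl_unit: assumes "is_cplx C" shows "hclass 0 C C (\<lambda>n. aid (cob C n)) = hcl 0 C C (unit_el C)"
proof -
  have "fam 0 C C (unit_el C) = (\<lambda>n. aid (cob C n))"
    unfolding fam_def entry_unit_el using is_cplx_graded[OF assms] by (auto simp: aid_def fun_eq_iff)
  then show ?thesis by (simp add: hcl_def)
qed

text \<open>\<open>trans_mor\<close> acts on every representative, and the result is a full coset
  because translation maps boundaries onto boundaries.\<close>

lemma hcl_trans:
  assumes c: "is_cplx A" "is_cplx B" and z: "x \<in> dgc.Z r A B"
  shows "trans_mor (hcl r A B x) = hcl r (trans_cplx A) (trans_cplx B) (tr_el B * x * tr_el' A)"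
proof -
  note ct = is_cplx_trans[OF c(1)] is_cplx_trans[OF c(2)]
  have f: "fam 0 (trans_cplx A) (trans_cplx B) (tr_el B * w * tr_el' A) = (\<lambda>n. fam 0 A B w (n + 1))" for w
    using c ct by (simp add: fam_tr_conj is_cplx_graded)
  have "dgc.Bd r (trans_cplx A) (trans_cplx B) = (\<lambda>b. tr_el B * b * tr_el' A) ` dgc.Bd r A B"
  proof (intro equalityI subsetI)
    fix y assume y: "y \<in> dgc.Bd r (trans_cplx A) (trans_cplx B)"
    then show "y \<in> (\<lambda>b. tr_el B * b * tr_el' A) ` dgc.Bd r A B"
      using dgc.t_conj_Bd_iff[of A B y r] dgc.Bd_Z[OF y] c by auto
  next
    fix y assume "y \<in> (\<lambda>b. tr_el B * b * tr_el' A) ` dgc.Bd r A B"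
    then obtain b where b: "b \<in> dgc.Bd r A B" "y = tr_el B * b * tr_el' A" by blast
    have "y \<in> dgc.Z r (trans_cplx A) (trans_cplx B)" using dgc.t_conj_Z[of A B b r] dgc.Bd_Z[OF b(1)] c b(2) by simp
    then show "y \<in> dgc.Bd r (trans_cplx A) (trans_cplx B)" using dgc.t_conj_Bd_iff[of A B y r] b c by auto
  qed
  then have "hcl r (trans_cplx A) (trans_cplx B) (tr_el B * x * tr_el' A) =
      (\<lambda>b. fam 0 (trans_cplx A) (trans_cplx B) (tr_el B * (b + x) * tr_el' A)) ` dgc.Bd r A B"
    unfolding hcl_eq[OF ct] by (simp add: image_image distrib_left distrib_right)
  also have "\<dots> = trans_mor (hcl r A B x)"
    unfolding f hcl_eq[OF c] trans_mor_def by (simp add: image_image)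
  finally show ?thesis by simp
qed

lemma standard_triangle_hcl:
  assumes c: "is_cplx C" "is_cplx K"
  shows "standard_triangle C K (fam 0 C K U) = (C, K, cone_el C K U, hcl 0 C K U, hcl 0 K (cone_el C K U) (in2 C K U),
    hcl 0 (cone_el C K U) (trans_cplx C) (tr_el C * out1 C K U))"
proof -
  let ?V = "cone_el C K U"
  have g: "graded C" "graded K" "graded ?V" "graded (trans_cplx C)"
    using c is_cplx_graded is_cplx_trans precomplex_cone_el[THEN precomplex_graded] is_cplx_precomplex by blast+
  have "fam 0 K ?V (in2 C K U) = cone_in C K"
    unfolding fam_def in2_def entry_emb_simps(5)[OF embeds_cone_el(2)]
    using g by (auto simp: emb_def cone_in_def ablock_def aid_def azero_def fun_eq_iff)
  moreover have "fam 0 ?V (trans_cplx C) (tr_el C * out1 C K U) = cone_out C K"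
    unfolding fam_def out1_def entry_emb_simps(2)[OF embeds_cone_el(1)]
    unfolding tr_el_def entry_emb_simps(5)[OF embeds_trans]
    using g by (auto simp: emb_def emb'_def Let_def cone_out_def ablock_def aid_def azero_def fun_eq_iff)
  ultimately show ?thesis by (simp add: standard_triangle_def hcl_def cone_el_def)
qed

lemma tpc_C_simps:
  "pob tpc_C = {C. is_cplx C}" "pmor tpc_C = Hom_C" "pcmp tpc_C = comp_C"
  "pidt tpc_C = (\<lambda>C. hclass 0 C C (\<lambda>n. aid (cob C n)))" "pinc tpc_C = incl_C"
  "shO tpc_C = shift_cplx" "shM tpc_C = (\<lambda>_ _ _ _ a. a)" "eta tpc_C = id_C"
  "ptrO tpc_C = trans_cplx" "ptrM tpc_C = (\<lambda>_ _. trans_mor)" "pexact tpc_C = exact_C"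
  "level_zero_cat tpc_C = level_zero_cat pers_C"
  by (simp_all add: tpc_C_def pers_C_def pers_cat.extend_def level_zero_cat_def)

lemma exact_C_hcl:
  "exact_C = {tr. is_triangle (level_zero_cat pers_C) trans_cplx tr \<and>
    (\<exists>A B U. is_cplx A \<and> is_cplx B \<and> U \<in> dgc.Z 0 A B \<and>
      isomorphic_triangles (level_zero_cat pers_C) trans_cplx (\<lambda>_ _. trans_mor) tr
        (A, B, cone_el A B U, hcl 0 A B U, hcl 0 B (cone_el A B U) (in2 A B U),
         hcl 0 (cone_el A B U) (trans_cplx A) (tr_el A * out1 A B U)))}" (is "_ = {tr. _ \<and> ?Q tr}")
proof -
  let ?iso = "isomorphic_triangles (level_zero_cat pers_C) trans_cplx (\<lambda>_ _. trans_mor)"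
  have "(\<exists>C K F. is_cplx C \<and> is_cplx K \<and> F \<in> chain_maps 0 C K \<and> ?iso tr (standard_triangle C K F)) \<longleftrightarrow> ?Q tr" for tr
  proof
    assume "\<exists>C K F. is_cplx C \<and> is_cplx K \<and> F \<in> chain_maps 0 C K \<and> ?iso tr (standard_triangle C K F)"
    then obtain C K F where *: "is_cplx C" "is_cplx K" "F \<in> chain_maps 0 C K" "?iso tr (standard_triangle C K F)" by blast
    from *(3) obtain U where U: "U \<in> dgc.Z 0 C K" "F = fam 0 C K U" unfolding chain_maps_fam[OF *(1,2)] by blast
    show "?Q tr" using *(1,2,4) U(1) unfolding U(2) standard_triangle_hcl[OF *(1,2)] by blast
  next
    assume "?Q tr"
    then obtain A B U where *: "is_cplx A" "is_cplx B" "U \<in> dgc.Z 0 A B"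
      "?iso tr (standard_triangle A B (fam 0 A B U))" using standard_triangle_hcl by metis
    then show "\<exists>C K F. is_cplx C \<and> is_cplx K \<and> F \<in> chain_maps 0 C K \<and> ?iso tr (standard_triangle C K F)"
      using chain_maps_fam[OF *(1,2), of 0] by blast
  qed
  then show ?thesis unfolding exact_C_def by simp
qed

interpretation hpc: homotopy_presentation "{C. is_cplx C}" unit_el dR lev cone_el in1 out1 in2 out2
  trans_cplx tr_el tr_el' shift_cplx sh_el sh_el' zero_cplx "tpc_C :: ('a cplx, 'a cmor) tpc" hcl
proof (unfold_locales, unfold tpc_C_simps mem_Collect_eq)
  show "exact_C = {tr. is_triangle (level_zero_cat (pers_C :: ('a cplx, 'a cmor) pers_cat)) trans_cplx tr \<and>
    (\<exists>A B U. is_cplx A \<and> is_cplx B \<and> U \<in> dgc.Z 0 A B \<and>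
      isomorphic_triangles (level_zero_cat pers_C) trans_cplx (\<lambda>_ _. trans_mor) tr
        (A, B, cone_el A B U, hcl 0 A B U, hcl 0 B (cone_el A B U) (in2 A B U),
         hcl 0 (cone_el A B U) (trans_cplx A) (tr_el A * out1 A B U)))}" by (rule exact_C_hcl)
qed (simp_all add: carrier_Hom_C hcl_eq_iff hcl_add hcl_zero hcl_comp hcl_unit hcl_incl hcl_shift id_C_hcl hcl_trans)

theorem theorem12p17:
  shows "triangulated_persistence_category (tpc_C :: ('a cplx, 'a cmor) tpc)"
  by (rule hpc.triangulated_persistence)

end
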